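(* Let $n=2$ and let $g$ be a holomorphic function on $X\cap D$ such that $c_\infty(g)<\infty$. Then there exist a neighborhood $\mathcal{U}$ of $bD$ and an extension $\tilde g\in C^\infty(D\cap\mathcal{U})$ of $g$ such that: (i) for all non-negative integers $N$, $|\rho|^{N+1}\tilde g$ vanishes to order $N$ on $bD$; (ii) for all non-negative integers $\alpha,\beta$, the function $\left|\frac{\partial^{\alpha+\beta}\tilde g}{\partial\overline{\eta_\zeta}^{\alpha}\partial\overline{v_\zeta}^{\beta}}\right||\rho|^{\alpha+\frac\beta2}$ is bounded on $D\cap\mathcal{U}$, up to a uniform multiplicative constant, by $c_\infty(g)$; (iii) for all non-negative integers $\alpha,\beta$ with $\alpha+\beta\geq1$, $\frac{\partial^{\alpha+\beta}\tilde g}{\partial\overline{\eta_\zeta}^{\alpha}\partial\overline{v_\zeta}^{\beta}}=0$ on $X\cap D\cap\mathcal{U}$.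
   Context: $D$ is a bounded strictly convex domain of $\mathbb{C}^2$, $D=\{z:\rho(z)<0\}$, where $\rho$ is a smooth strictly convex function on $\mathbb{C}^2$ whose gradient does not vanish in a neighborhood of the boundary $bD$. $X=\{z: f(z)=0\}$ is an analytic set, where $f$ is a holomorphic function in a neighborhood of $\overline D$, assumed to be a minimal defining function of $X$; $X\cap D\neq\emptyset$ and $X\cap bD$ is transverse in the sense of tangent cones. For $\zeta$ near $bD$, $\eta_\zeta$ is the outer unit normal at $\zeta$ to $\{\rho=\rho(\zeta)\}$ and $v_\zeta$ a smooth field of unit complex tangent vectors to these level sets. The derivative $\frac{\partial^{\alpha+\beta}\tilde g}{\partial\overline{\eta_\zeta}^{\alpha}\partial\overline{v_\zeta}^{\beta}}(\zeta)$ is $\frac{\partial^{\alpha+\beta}}{\partial\overline{\lambda}^{\alpha}\partial\overline{\mu}^{\beta}}\tilde g(\zeta+\lambda\eta_\zeta+\mu v_\zeta)$ at $\lambda=\mu=0$. $\kappa>0$ is a fixed sufficiently small constant. For $z\in D$, $|v|=1$, $\varepsilon>0$: $\tau(z,v,\varepsilon)=\sup\{\tau>0:\ \rho(z+\lambda v)-\rho(z)<\varepsilon\text{ for all }|\lambda|<\tau\}$, and $\Lambda_{z,v}=\{\lambda\in\mathbb{C}:\ |\lambda|<3\kappa\,\tau(z,v,|\rho(z)|),\ z+\lambda v\in X\}$. Put $g_{z,v}[\lambda]=g(z+\lambda v)$ and, for pairwise distinct elements of $\Lambda_{z,v}$, $g_{z,v}[\lambda_1,\ldots,\lambda_{k+1}]=\frac{g_{z,v}[\lambda_1,\ldots,\lambda_k]-g_{z,v}[\lambda_2,\ldots,\lambda_{k+1}]}{\lambda_1-\lambda_{k+1}}$.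 Finally $c_\infty(g)=\sup|g_{z,v}[\lambda_1,\ldots,\lambda_k]|\,\tau(z,v,|\rho(z)|)^{k-1}$, the supremum being over all $z\in D$, all unit vectors $v\in\mathbb{C}^2$, all $k\geq1$ and all pairwise distinct $\lambda_1,\ldots,\lambda_k\in\Lambda_{z,v}$. *)

theory Defs
  imports "HOL-Analysis.Analysis"
begin

section \<open>Smoothness and strict convexity\<close>

(* Meant for open S, where it is the usual notion of a C^k function: the functions
   x |-> f'(x) w, w fixed, are the directional derivatives of f. *)
primrec Ck_on :: "nat \<Rightarrow> 'a::real_normed_vector set \<Rightarrow> ('a \<Rightarrow> 'b::real_normed_vector) \<Rightarrow> bool" where
  "Ck_on 0 S f \<longleftrightarrow> continuous_on S f"
| "Ck_on (Suc k) S f \<longleftrightarrow>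
     (\<forall>x\<in>S. f differentiable (at x)) \<and> (\<forall>w. Ck_on k S (\<lambda>x. frechet_derivative f (at x) w))"

definition smooth_on :: "'a::real_normed_vector set \<Rightarrow> ('a \<Rightarrow> 'b::real_normed_vector) \<Rightarrow> bool" where
  "smooth_on S f \<longleftrightarrow> (\<forall>k. Ck_on k S f)"

primrec iterated_derivative ::
    "'a::real_normed_vector list \<Rightarrow> ('a \<Rightarrow> 'b::real_normed_vector) \<Rightarrow> 'a \<Rightarrow> 'b" where
  "iterated_derivative [] f = f"
| "iterated_derivative (w # ws) f = (\<lambda>x. frechet_derivative (iterated_derivative ws f) (at x) w)"

(* For h smooth on the open set S: all derivatives of h of order at most N tend to 0 at the
   points of B, i.e. h extends by 0 through B as a function of class C^N. *)
definition vanishes_to_order ::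
    "nat \<Rightarrow> 'a::real_normed_vector set \<Rightarrow> 'a set \<Rightarrow> ('a \<Rightarrow> 'b::real_normed_vector) \<Rightarrow> bool" where
  "vanishes_to_order N B S h \<longleftrightarrow>
     (\<forall>ws. length ws \<le> N \<longrightarrow> (\<forall>p\<in>B. (iterated_derivative ws h \<longlongrightarrow> 0) (at p within S)))"

definition strictly_convex_on :: "'a::real_vector set \<Rightarrow> ('a \<Rightarrow> real) \<Rightarrow> bool" where
  "strictly_convex_on S f \<longleftrightarrow> convex S \<and>
     (\<forall>x\<in>S. \<forall>y\<in>S. \<forall>t. x \<noteq> y \<longrightarrow> 0 < t \<longrightarrow> t < 1 \<longrightarrow>
        f ((1 - t) *\<^sub>R x + t *\<^sub>R y) < (1 - t) * f x + t * f y)"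

(* The strict convexity of the domain {rho < 0} needs no separate hypothesis. *)
lemma strictly_convex_sublevel:
  fixes \<rho> :: "'a::euclidean_space \<Rightarrow> real"
  assumes "strictly_convex_on UNIV \<rho>" "continuous_on UNIV \<rho>"
    and xy: "x \<in> closure {z. \<rho> z < 0}" "y \<in> closure {z. \<rho> z < 0}" "x \<noteq> y"
  shows "open_segment x y \<subseteq> {z. \<rho> z < 0}"
proof
  fix z assume "z \<in> open_segment x y"
  then obtain t where t: "0 < t" "t < 1" "z = (1 - t) *\<^sub>R x + t *\<^sub>R y"
    by (auto simp: in_segment)
  have "closed {z. \<rho> z \<le> 0}"
    using assms(2) by (intro closed_Collect_le) auto
  then have "closure {z. \<rho> z < 0} \<subseteq> {z. \<rho> z \<le> 0}"
    by (intro closure_minimal) auto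
  with xy have "\<rho> x \<le> 0" "\<rho> y \<le> 0" by auto
  then have "(1 - t) * \<rho> x + t * \<rho> y \<le> 0"
    using t by (intro add_nonpos_nonpos) (auto simp: mult_nonneg_nonpos)
  moreover have "\<rho> z < (1 - t) * \<rho> x + t * \<rho> y"
    using assms(1) t xy(3) unfolding strictly_convex_on_def by auto
  ultimately show "z \<in> {z. \<rho> z < 0}" by simp
qed


section \<open>Holomorphic functions of several variables and analytic sets\<close>

definition holomorphic_on_Cn :: "(complex ^ 'n::finite \<Rightarrow> complex) \<Rightarrow> (complex ^ 'n) set \<Rightarrow> bool" where
  "holomorphic_on_Cn f S \<longleftrightarrow> open S \<and>
     (\<forall>z\<in>S. \<exists>f'. (f has_derivative f') (at z) \<and> (\<forall>c h. f' (c *s h) = c * f' h))"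

(* A may be singular: g is locally the restriction of a holomorphic function of the ambient space. *)
definition holomorphic_on_analytic_set ::
    "(complex ^ 'n::finite \<Rightarrow> complex) \<Rightarrow> (complex ^ 'n) set \<Rightarrow> bool" where
  "holomorphic_on_analytic_set g A \<longleftrightarrow>
     (\<forall>p\<in>A. \<exists>V G. open V \<and> p \<in> V \<and> holomorphic_on_Cn G V \<and> (\<forall>z\<in>A \<inter> V. g z = G z))"

(* f generates, over every open set, the ideal of the holomorphic functions vanishing on the zero
   set of f (Chirka's definition). *)
definition minimal_defining_function ::
    "(complex ^ 'n::finite \<Rightarrow> complex) \<Rightarrow> (complex ^ 'n) set \<Rightarrow> bool" where
  "minimal_defining_function f \<Omega> \<longleftrightarrow> holomorphic_on_Cn f \<Omega> \<and>
     (\<forall>V h. open V \<longrightarrow> V \<subseteq> \<Omega> \<longrightarrow> holomorphic_on_Cn h V \<longrightarrow> (\<forall>z\<in>V. f z = 0 \<longrightarrow> h z = 0) \<longrightarrow>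
        (\<exists>q. holomorphic_on_Cn q V \<and> (\<forall>z\<in>V. h z = f z * q z)))"

definition tangent_cone :: "'a::real_normed_vector set \<Rightarrow> 'a \<Rightarrow> 'a set" where
  "tangent_cone X p = {w. \<exists>x r. (\<forall>n::nat. x n \<in> X \<and> 0 < r n) \<and> x \<longlonglongrightarrow> p \<and>
                                 (\<lambda>n. r n *\<^sub>R (x n - p)) \<longlonglongrightarrow> w}"


section \<open>Geometry of the level sets of the defining function\<close>

definition gradient :: "('a::real_inner \<Rightarrow> real) \<Rightarrow> 'a \<Rightarrow> 'a" where
  "gradient \<rho> z = (THE d. GDERIV \<rho> z :> d)"

definition outer_normal :: "('a::real_inner \<Rightarrow> real) \<Rightarrow> 'a \<Rightarrow> 'a" where
  "outer_normal \<rho> z = gradient \<rho> z /\<^sub>R norm (gradient \<rho> z)"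

definition tangent_space :: "('a::real_inner \<Rightarrow> real) \<Rightarrow> 'a \<Rightarrow> 'a set" where
  "tangent_space \<rho> z = {w. w \<bullet> gradient \<rho> z = 0}"

definition complex_tangent_space ::
    "(complex ^ 'n::finite \<Rightarrow> real) \<Rightarrow> complex ^ 'n \<Rightarrow> (complex ^ 'n) set" where
  "complex_tangent_space \<rho> z = {w. w \<in> tangent_space \<rho> z \<and> \<i> *s w \<in> tangent_space \<rho> z}"

(* The tangent cone of a curve is a union of complex lines; every one of them has to be transverse
   to the real tangent hyperplane of the boundary. *)
definition transverse_tangent_cones ::
    "(complex ^ 2) set \<Rightarrow> (complex ^ 2 \<Rightarrow> real) \<Rightarrow> bool" where
  "transverse_tangent_cones X \<rho> \<longleftrightarrow>
     (\<forall>p \<in> X \<inter> frontier {z. \<rho> z < 0}. \<forall>w \<in> tangent_cone X p. w \<noteq> 0 \<longrightarrow>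
        {c *s w + u | c u. u \<in> tangent_space \<rho> p} = UNIV)"


section \<open>Anisotropic antiholomorphic derivatives\<close>

definition dbar :: "(complex \<Rightarrow> complex) \<Rightarrow> complex \<Rightarrow> complex" where
  "dbar h z = (frechet_derivative h (at z) 1 + \<i> * frechet_derivative h (at z) \<i>) / 2"

definition dbar_normal_tangential ::
    "(complex ^ 2 \<Rightarrow> real) \<Rightarrow> (complex ^ 2 \<Rightarrow> complex ^ 2) \<Rightarrow> nat \<Rightarrow> nat \<Rightarrow>
     (complex ^ 2 \<Rightarrow> complex) \<Rightarrow> complex ^ 2 \<Rightarrow> complex" where
  "dbar_normal_tangential \<rho> v \<alpha> \<beta> G \<zeta> =
     (dbar ^^ \<alpha>) (\<lambda>l. (dbar ^^ \<beta>) (\<lambda>m. G (\<zeta> + l *s outer_normal \<rho> \<zeta> + m *s v \<zeta>)) 0) 0"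


section \<open>Divided differences along complex lines\<close>

(* For z in the bounded domain {rho < 0} and eps = |rho z|, the case used below, the set is
   nonempty and bounded, so that Sup is a genuine supremum. *)
definition tau :: "(complex ^ 2 \<Rightarrow> real) \<Rightarrow> complex ^ 2 \<Rightarrow> complex ^ 2 \<Rightarrow> real \<Rightarrow> real" where
  "tau \<rho> z u \<epsilon> = Sup {t. 0 < t \<and> (\<forall>l::complex. norm l < t \<longrightarrow> \<rho> (z + l *s u) - \<rho> z < \<epsilon>)}"

definition Lambda ::
    "real \<Rightarrow> (complex ^ 2 \<Rightarrow> real) \<Rightarrow> (complex ^ 2) set \<Rightarrow> complex ^ 2 \<Rightarrow> complex ^ 2 \<Rightarrow> complex set" where
  "Lambda \<kappa> \<rho> X z u = {l. norm l < 3 * \<kappa> * tau \<rho> z u \<bar>\<rho> z\<bar> \<and> z + l *s u \<in> X}"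

(* A list stands for the tuple of nodes; the value at [] is irrelevant. *)
function (sequential) divided_difference :: "(complex \<Rightarrow> complex) \<Rightarrow> complex list \<Rightarrow> complex" where
  "divided_difference h [] = 0"
| "divided_difference h [a] = h a"
| "divided_difference h ls =
     (divided_difference h (butlast ls) - divided_difference h (tl ls)) / (hd ls - last ls)"
  by pat_completeness auto
termination by (relation "Wellfounded.measure (length \<circ> snd)") auto

definition c_infty ::
    "real \<Rightarrow> (complex ^ 2 \<Rightarrow> real) \<Rightarrow> (complex ^ 2) set \<Rightarrow> (complex ^ 2 \<Rightarrow> complex) \<Rightarrow> ennreal" where
  "c_infty \<kappa> \<rho> X g =
     (SUP (z, u, ls) \<in> {(z, u, ls). \<rho> z < 0 \<and> norm u = 1 \<and> ls \<noteq> [] \<and> distinct ls \<and>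
                                     set ls \<subseteq> Lambda \<kappa> \<rho> X z u}.
        ennreal (norm (divided_difference (\<lambda>l. g (z + l *s u)) ls) *
                 tau \<rho> z u \<bar>\<rho> z\<bar> ^ (length ls - 1)))"

end

theory Submission
  imports Defs "HOL-Complex_Analysis.Complex_Analysis"
begin

text \<open>
  Near the boundary the extension is a sum \<open>\<Sum>i. \<chi>\<^sub>i G\<^sub>i\<close>, where the functions \<open>\<chi>\<^sub>i\<close> form a partition
  of unity whose supports, the cells, have diameter comparable with the square root of \<open>\<bar>\<rho>\<bar>\<close>, and
  \<open>G\<^sub>i\<close> is a holomorphic function near the cell \<open>i\<close> that agrees with \<open>g\<close> on \<open>X\<close> and is bounded by a
  multiple of \<open>c_infty\<close>. On \<open>X\<close> the sum is \<open>g (\<Sum>i. \<chi>\<^sub>i) = g\<close>. An antiholomorphic derivative does not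
  see the factors \<open>G\<^sub>i\<close>. The functions \<open>\<chi>\<^sub>i\<close> are composed of \<open>\<rho>\<close> and of coordinates, both divided by
  the scale of the cell; since a displacement by \<open>\<bar>\<rho>\<bar>\<close> in any direction, or by its square root in a
  complex tangential direction, changes \<open>\<rho>\<close> only by a multiple of \<open>\<bar>\<rho>\<bar>\<close>, a derivative of \<open>\<chi>\<^sub>i\<close> costs
  a factor \<open>1 / \<bar>\<rho>\<bar>\<close> in the normal and \<open>1 / sqrt \<bar>\<rho>\<bar>\<close> in the tangential direction. This gives the
  growth estimate, see \<open>dbounded_weighted\<close>, \<open>cell_bump_dbounded\<close> and \<open>dbar_pair_glued_bound\<close>. On \<open>X\<close>
  all \<open>G\<^sub>i\<close> have the same value, so an antiholomorphic derivative of the sum is \<open>g\<close> times that of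
  the constant function \<open>\<Sum>i. \<chi>\<^sub>i = 1\<close>, which is \<open>0\<close>. By Cauchy's estimates for the \<open>G\<^sub>i\<close> all
  derivatives of order \<open>n\<close> of the extension are \<open>O(1 / \<bar>\<rho>\<bar>\<^sup>n)\<close>, and a factor \<open>\<bar>\<rho>\<bar>\<^sup>N\<^sup>+\<^sup>1\<close> compensates
  for them up to order \<open>N\<close>; see \<open>glued_vanishes\<close>.

  The functions \<open>G\<^sub>i\<close> come from Lagrange interpolation along complex lines. Let \<open>z\<close> be the centre of
  the cell and \<open>u = v z\<close>. As \<open>\<rho>\<close> is stationary at \<open>z\<close> in the direction \<open>u\<close>, the lines \<open>\<zeta> + x u\<close>
  through points \<open>\<zeta>\<close> near \<open>z\<close> stay in \<open>D\<close> for \<open>\<bar>x\<bar>\<close> up to a small multiple of \<open>sqrt \<bar>\<rho>\<bar>\<close>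
  (\<open>line_in_domain\<close>), so that \<open>tau\<close> is at least of this size. Such a line meets the sheets of \<open>X\<close>
  that pass near \<open>z\<close> in finitely many points, and \<open>G\<^sub>i \<zeta>\<close> is the value at \<open>x = 0\<close> of the polynomial
  that interpolates \<open>x \<mapsto> g (\<zeta> + x u)\<close> at these points. Newton's form of the polynomial bounds this
  value by \<open>c_infty\<close> times the number of nodes (\<open>lagrange_norm_le\<close>), and if \<open>\<zeta>\<close> lies on \<open>X\<close> then \<open>0\<close>
  is a node and the value is \<open>g \<zeta>\<close>.

  That \<open>G\<^sub>i\<close> is holomorphic requires control of the nodes, that is, of \<open>X\<close> near a boundary point
  \<open>p\<close>. In unitary coordinates \<open>(l, m)\<close> with \<open>l\<close> normal and \<open>m\<close> complex tangential, transversality of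
  the tangent cone says that \<open>\<bar>m\<bar> \<le> N \<bar>l\<bar>\<close> on \<open>X\<close> (\<open>zero_cone\<close>), and convexity puts \<open>D\<close> into the
  half space \<open>Re l < 0\<close>. The power sums of the zeros \<open>m\<close> over \<open>l\<close> are holomorphic by the argument
  principle, hence so is a discriminant, and the number of distinct zeros is the same for all small
  \<open>l \<noteq> 0\<close>. Over a slit disc, which is simply connected, the zeros therefore split into finitely many
  holomorphic sheets \<open>m = \<sigma> l\<close>, and Cauchy's estimate turns \<open>\<bar>\<sigma> l\<bar> \<le> N \<bar>l\<bar>\<close> into a Lipschitz bound
  on \<open>Re l < 0\<close> (\<open>sheets_exist\<close>, \<open>sheet_chart_exists\<close>). A line in a direction close to the \<open>m\<close> axis
  meets such a graph in exactly one point, which depends holomorphically on the line. Because the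
  direction \<open>u\<close> is kept fixed within a cell, \<open>G\<^sub>i\<close> is a polynomial in one affine coordinate whose
  coefficients are holomorphic functions of another one (\<open>sheet_interpolant\<close>); so analysis in one
  complex variable suffices throughout.
\<close>

section \<open>Directional derivatives and smooth functions\<close>

abbreviation pd :: "'a::real_normed_vector \<Rightarrow> ('a \<Rightarrow> 'b::real_normed_vector) \<Rightarrow> 'a \<Rightarrow> 'b" where
  "pd w f \<equiv> (\<lambda>x. frechet_derivative f (at x) w)"

lemma pd_eqI: "(f has_derivative f') (at x) \<Longrightarrow> pd w f x = f' w"
  by (simp add: frechet_derivative_at[symmetric])

lemma differentiable_cong_open:
  assumes "open S" "x \<in> S" "\<And>y. y \<in> S \<Longrightarrow> f y = g y" "f differentiable (at x)"
  shows "g differentiable (at x)" "pd w g x = pd w f x"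
proof -
  obtain f' where f': "(f has_derivative f') (at x)"
    using assms(4) by (auto simp: differentiable_def)
  then have g': "(g has_derivative f') (at x)"
    using assms(1-3) by (rule has_derivative_transform_within_open)
  show "g differentiable (at x)" using g' by (auto simp: differentiable_def)
  show "pd w g x = pd w f x" using pd_eqI[OF f'] pd_eqI[OF g'] by simp
qed

lemma Ck_on_cong:
  assumes "open S" "\<And>y. y \<in> S \<Longrightarrow> f y = g y" "Ck_on k S f"
  shows "Ck_on k S g"
  using assms(2,3)
proof (induction k arbitrary: f g)
  case 0
  then show ?case by (auto cong: continuous_on_cong)
next
  case (Suc k)
  have d: "f differentiable (at x)" if "x \<in> S" for x using Suc.prems(2) that by auto
  have "g differentiable (at x)" if "x \<in> S" for x
    by (rule differentiable_cong_open(1)[OF assms(1) that Suc.prems(1) d[OF that]])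
  moreover have "Ck_on k S (pd w g)" for w
  proof (rule Suc.IH)
    show "pd w f y = pd w g y" if "y \<in> S" for y
      by (rule differentiable_cong_open(2)[OF assms(1) that Suc.prems(1) d[OF that], symmetric])
    show "Ck_on k S (pd w f)" using Suc.prems(2) by simp
  qed
  ultimately show ?case by simp
qed

lemma smooth_on_cong:
  assumes "open S" "\<And>y. y \<in> S \<Longrightarrow> f y = g y" "smooth_on S f"
  shows "smooth_on S g"
  using assms Ck_on_cong unfolding smooth_on_def by blast

lemma Ck_on_subset: "Ck_on k S f \<Longrightarrow> T \<subseteq> S \<Longrightarrow> Ck_on k T f"
  by (induction k arbitrary: f) (auto intro: continuous_on_subset)

lemma smooth_on_subset: "smooth_on S f \<Longrightarrow> T \<subseteq> S \<Longrightarrow> smooth_on T f"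
  unfolding smooth_on_def using Ck_on_subset by blast

lemma Ck_on_SucD: "Ck_on (Suc k) S f \<Longrightarrow> Ck_on k S f"
proof (induction k arbitrary: f)
  case 0
  then have "isCont f x" if "x \<in> S" for x
    using that differentiable_imp_continuous_within by fastforce
  then show ?case by (simp add: continuous_at_imp_continuous_on)
qed auto

text \<open>
  Closure under directional derivatives is the form of smoothness that all later inductions on the
  order of differentiation use.
\<close>

lemma smooth_on_iff:
  "smooth_on S f \<longleftrightarrow> (\<forall>x\<in>S. f differentiable (at x)) \<and> (\<forall>w. smooth_on S (pd w f))"
proof
  assume *: "smooth_on S f"
  then have "Ck_on (Suc k) S f" for k unfolding smooth_on_def by blast
  then show "(\<forall>x\<in>S. f differentiable (at x)) \<and> (\<forall>w. smooth_on S (pd w f))"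
    unfolding smooth_on_def by auto
next
  assume *: "(\<forall>x\<in>S. f differentiable (at x)) \<and> (\<forall>w. smooth_on S (pd w f))"
  then have "Ck_on (Suc k) S f" for k unfolding smooth_on_def by auto
  then show "smooth_on S f" unfolding smooth_on_def using Ck_on_SucD by blast
qed

lemma smooth_on_differentiable: "smooth_on S f \<Longrightarrow> x \<in> S \<Longrightarrow> f differentiable (at x)"
  and smooth_on_pd: "smooth_on S f \<Longrightarrow> smooth_on S (pd w f)"
  using smooth_on_iff by blast+

lemma smooth_on_continuous_on: "smooth_on S f \<Longrightarrow> continuous_on S f"
  unfolding smooth_on_def by (metis Ck_on.simps(1))

lemma Ck_on_open_local:
  assumes "\<And>x. x \<in> S \<Longrightarrow> \<exists>V. open V \<and> x \<in> V \<and> Ck_on k V f"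
  shows "Ck_on k S f"
  using assms
proof (induction k arbitrary: f)
  case 0
  have "isCont f x" if "x \<in> S" for x
    using 0[OF that] continuous_on_eq_continuous_at by fastforce
  then show ?case by (simp add: continuous_at_imp_continuous_on)
next
  case (Suc k)
  have "f differentiable (at x)" if "x \<in> S" for x using Suc.prems[OF that] by auto
  moreover have "Ck_on k S (pd w f)" for w
  proof (rule Suc.IH)
    fix x assume "x \<in> S"
    from Suc.prems[OF this] show "\<exists>V. open V \<and> x \<in> V \<and> Ck_on k V (pd w f)" by auto
  qed
  ultimately show ?case by simp
qed

lemma smooth_on_open_local:
  assumes "\<And>x. x \<in> S \<Longrightarrow> \<exists>V. open V \<and> x \<in> V \<and> smooth_on V f"
  shows "smooth_on S f"
  unfolding smooth_on_def
proof
  fix k show "Ck_on k S f"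
    by (rule Ck_on_open_local) (use assms in \<open>auto simp: smooth_on_def\<close>)
qed

lemma Ck_on_const: "Ck_on k S (\<lambda>x. c)"
  by (induction k arbitrary: c) auto

lemma smooth_on_const [simp]: "smooth_on S (\<lambda>x. c)"
  by (simp add: smooth_on_def Ck_on_const)

lemma pd_add:
  "f differentiable (at x) \<Longrightarrow> g differentiable (at x) \<Longrightarrow> pd w (\<lambda>x. f x + g x) x = pd w f x + pd w g x"
  using pd_eqI[OF has_derivative_add] by (fastforce simp: frechet_derivative_works)

lemma Ck_on_add:
  assumes "open S" "Ck_on k S f" "Ck_on k S g"
  shows "Ck_on k S (\<lambda>x. f x + g x)"
  using assms(2,3)
proof (induction k arbitrary: f g)
  case 0 then show ?case by (simp add: continuous_on_add)
next
  case (Suc k)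
  have "Ck_on k S (pd w (\<lambda>x. f x + g x))" for w
  proof (rule Ck_on_cong[OF assms(1)])
    show "pd w f x + pd w g x = pd w (\<lambda>x. f x + g x) x" if "x \<in> S" for x
      using Suc.prems that by (subst pd_add) auto
    show "Ck_on k S (\<lambda>x. pd w f x + pd w g x)"
      using Suc.prems by (intro Suc.IH) auto
  qed
  then show ?case using Suc.prems by auto
qed

lemma smooth_on_add:
  "open S \<Longrightarrow> smooth_on S f \<Longrightarrow> smooth_on S g \<Longrightarrow> smooth_on S (\<lambda>x. f x + g x)"
  by (simp add: smooth_on_def Ck_on_add)

lemma smooth_on_sum:
  assumes "open S" "\<And>i. i \<in> I \<Longrightarrow> smooth_on S (f i)"
  shows "smooth_on S (\<lambda>x. \<Sum>i\<in>I. f i x)"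
  using assms(2) by (induction I rule: infinite_finite_induct) (auto simp: smooth_on_add assms(1))

lemma pd_bounded_linear:
  assumes "bounded_linear B" "f differentiable (at x)"
  shows "pd w (\<lambda>x. B (f x)) x = B (pd w f x)"
  using pd_eqI[OF bounded_linear.has_derivative[OF assms(1)]] assms(2)
  by (fastforce simp: frechet_derivative_works)

lemma Ck_on_bounded_linear:
  assumes "open S" "bounded_linear B" "Ck_on k S f"
  shows "Ck_on k S (\<lambda>x. B (f x))"
  using assms(3)
proof (induction k arbitrary: f)
  case 0 then show ?case using bounded_linear.continuous_on[OF assms(2)] by simp
next
  case (Suc k)
  have "(\<lambda>x. B (f x)) differentiable (at x)" if "x \<in> S" for x
  proof -
    have "f differentiable (at x)" using Suc.prems that by simp
    then obtain D where "(f has_derivative D) (at x)" unfolding differentiable_def by blast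
    from bounded_linear.has_derivative[OF assms(2) this] show ?thesis by (auto simp: differentiable_def)
  qed
  moreover have "Ck_on k S (pd w (\<lambda>x. B (f x)))" for w
  proof (rule Ck_on_cong[OF assms(1)])
    show "B (pd w f x) = pd w (\<lambda>x. B (f x)) x" if "x \<in> S" for x
      using Suc.prems that by (subst pd_bounded_linear[OF assms(2)]) auto
    show "Ck_on k S (\<lambda>x. B (pd w f x))"
      using Suc.prems by (intro Suc.IH) auto
  qed
  ultimately show ?case by auto
qed

lemma smooth_on_bounded_linear:
  "open S \<Longrightarrow> bounded_linear B \<Longrightarrow> smooth_on S f \<Longrightarrow> smooth_on S (\<lambda>x. B (f x))"
  by (simp add: smooth_on_def Ck_on_bounded_linear)

lemma smooth_on_bounded_linear_id:
  assumes "bounded_linear B"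
  shows "smooth_on S B"
  unfolding smooth_on_def
proof
  fix k
  have d: "(B has_derivative B) (at x)" for x using assms by (rule bounded_linear_imp_has_derivative)
  then have "pd w B = (\<lambda>x. B w)" for w using pd_eqI by blast
  moreover have "B differentiable (at x)" for x using d by (auto simp: differentiable_def)
  ultimately have "Ck_on (Suc k) S B" by (auto simp: Ck_on_const)
  then show "Ck_on k S B" by (rule Ck_on_SucD)
qed

lemma pd_mult:
  fixes f g :: "'a::real_normed_vector \<Rightarrow> 'b::real_normed_algebra"
  shows "f differentiable (at x) \<Longrightarrow> g differentiable (at x) \<Longrightarrow>
    pd w (\<lambda>x. f x * g x) x = f x * pd w g x + pd w f x * g x"
  using pd_eqI[OF has_derivative_mult] by (fastforce simp: frechet_derivative_works)

lemma Ck_on_mult: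
  fixes f g :: "'a::real_normed_vector \<Rightarrow> 'b::real_normed_algebra"
  assumes "open S" "Ck_on k S f" "Ck_on k S g"
  shows "Ck_on k S (\<lambda>x. f x * g x)"
  using assms(2,3)
proof (induction k arbitrary: f g)
  case 0 then show ?case by (simp add: continuous_on_mult)
next
  case (Suc k)
  have "Ck_on k S (pd w (\<lambda>x. f x * g x))" for w
  proof (rule Ck_on_cong[OF assms(1)])
    show "f x * pd w g x + pd w f x * g x = pd w (\<lambda>x. f x * g x) x" if "x \<in> S" for x
      using Suc.prems that by (subst pd_mult) auto
    have "Ck_on k S (pd w f)" "Ck_on k S (pd w g)" "Ck_on k S f" "Ck_on k S g"
      using Suc.prems Ck_on_SucD[of k S f] Ck_on_SucD[of k S g] by auto
    then show "Ck_on k S (\<lambda>x. f x * pd w g x + pd w f x * g x)"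
      by (intro Ck_on_add[OF assms(1)] Suc.IH)
  qed
  then show ?case using Suc.prems by auto
qed

lemma smooth_on_mult:
  fixes f g :: "'a::real_normed_vector \<Rightarrow> 'b::real_normed_algebra"
  shows "open S \<Longrightarrow> smooth_on S f \<Longrightarrow> smooth_on S g \<Longrightarrow> smooth_on S (\<lambda>x. f x * g x)"
  by (simp add: smooth_on_def Ck_on_mult)

lemma smooth_on_prod:
  fixes f :: "'i \<Rightarrow> 'a::real_normed_vector \<Rightarrow> 'b::{real_normed_algebra_1,comm_ring_1}"
  assumes "open S" "\<And>i. i \<in> I \<Longrightarrow> smooth_on S (f i)"
  shows "smooth_on S (\<lambda>x. \<Prod>i\<in>I. f i x)"
  using assms(2) by (induction I rule: infinite_finite_induct) (auto simp: smooth_on_mult assms(1))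

lemma smooth_on_power:
  fixes f :: "'a::real_normed_vector \<Rightarrow> 'b::real_normed_algebra_1"
  assumes "open S" "smooth_on S f"
  shows "smooth_on S (\<lambda>x. f x ^ n)"
  by (induction n) (auto simp: smooth_on_mult assms)

lemma pd_compose:
  fixes h :: "real \<Rightarrow> 'b::real_normed_vector" and f :: "'a::real_normed_vector \<Rightarrow> real"
  assumes "f differentiable (at x)" "h differentiable (at (f x))"
  shows "(\<lambda>x. h (f x)) differentiable (at x)" "pd w (\<lambda>x. h (f x)) x = pd w f x *\<^sub>R pd 1 h (f x)"
proof -
  have "(f has_derivative (\<lambda>w. pd w f x)) (at x)" "(h has_derivative (\<lambda>w. pd w h (f x))) (at (f x))"
    using assms unfolding frechet_derivative_works by auto
  from has_derivative_compose[OF this]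
  have *: "((\<lambda>x. h (f x)) has_derivative (\<lambda>w. pd (pd w f x) h (f x))) (at x)" .
  show "(\<lambda>x. h (f x)) differentiable (at x)" using * by (auto simp: differentiable_def)
  have "linear (\<lambda>w. pd w h (f x))" using assms(2) by (simp add: linear_frechet_derivative)
  then have "pd (r *\<^sub>R 1) h (f x) = r *\<^sub>R pd 1 h (f x)" for r by (rule linear_cmul)
  then show "pd w (\<lambda>x. h (f x)) x = pd w f x *\<^sub>R pd 1 h (f x)"
    using pd_eqI[OF *] by (metis mult.right_neutral real_scaleR_def)
qed

text \<open>
  Only real functions of a real variable are composed on the outside, because the chain rule then
  keeps the inner factor \<open>pd w f\<close> scalar and the product rule finishes the induction.
\<close>

lemma Ck_on_compose:
  fixes h :: "real \<Rightarrow> real" and f :: "'a::real_normed_vector \<Rightarrow> real"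
  assumes "open S" "Ck_on k S f" "Ck_on k T h" "\<And>x. x \<in> S \<Longrightarrow> f x \<in> T"
  shows "Ck_on k S (\<lambda>x. h (f x))"
  using assms(2,3)
proof (induction k arbitrary: h)
  case 0 then show ?case using assms(4) by (simp add: continuous_on_compose2[of T h S f] image_subsetI)
next
  case (Suc k)
  have "Ck_on k S (pd w (\<lambda>x. h (f x)))" for w
  proof (rule Ck_on_cong[OF assms(1), of "\<lambda>x. pd w f x * pd 1 h (f x)"])
    show "pd w f x * pd 1 h (f x) = pd w (\<lambda>x. h (f x)) x" if "x \<in> S" for x
      using pd_compose(2)[of f x h w] Suc.prems that assms(4) by auto
    show "Ck_on k S (\<lambda>x. pd w f x * pd 1 h (f x))"
    proof (rule Ck_on_mult[OF assms(1)])
      show "Ck_on k S (pd w f)" using Suc.prems by simp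
      have "Ck_on k S f" by (rule Ck_on_SucD[OF Suc.prems(1)])
      moreover have "Ck_on k T (pd 1 h)" using Suc.prems by simp
      ultimately show "Ck_on k S (\<lambda>x. pd 1 h (f x))" by (rule Suc.IH)
    qed
  qed
  moreover have "(\<lambda>x. h (f x)) differentiable (at x)" if "x \<in> S" for x
    using pd_compose(1)[of f x h] Suc.prems that assms(4)[OF that] by simp
  ultimately show ?case by simp
qed

lemma smooth_on_compose:
  fixes h :: "real \<Rightarrow> real" and f :: "'a::real_normed_vector \<Rightarrow> real"
  assumes "open S" "smooth_on S f" "smooth_on T h" "\<And>x. x \<in> S \<Longrightarrow> f x \<in> T"
  shows "smooth_on S (\<lambda>x. h (f x))"
  using assms Ck_on_compose unfolding smooth_on_def by blast

text \<open>
  The next two lemmas differentiate \<open>h\<close> along an affine map whose linear part is only real linear;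
  if it is complex linear, the derivative inherits complex linearity from the formula.
\<close>

lemma pd_holomorphic_compose:
  fixes h :: "complex \<Rightarrow> complex" and B :: "'a::real_normed_vector \<Rightarrow> complex"
  assumes "bounded_linear B" "open T" "h holomorphic_on T" "c + B x \<in> T"
  shows "((\<lambda>x. h (c + B x)) has_derivative (\<lambda>w. deriv h (c + B x) * B w)) (at x)"
proof -
  have 1: "((\<lambda>x. c + B x) has_derivative B) (at x)"
    using assms(1) by (auto intro!: derivative_eq_intros bounded_linear_imp_has_derivative)
  have "(h has_field_derivative deriv h (c + B x)) (at (c + B x))"
    using assms holomorphic_derivI by blast
  then have 2: "(h has_derivative (*) (deriv h (c + B x))) (at (c + B x))"
    by (simp add: has_field_derivative_def)
  show ?thesis using has_derivative_compose[OF 1 2] by simp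
qed

lemma smooth_on_holomorphic_compose:
  fixes h :: "complex \<Rightarrow> complex" and B :: "'a::real_normed_vector \<Rightarrow> complex"
  assumes "bounded_linear B" "open S" "open T" "h holomorphic_on T" "\<And>x. x \<in> S \<Longrightarrow> c + B x \<in> T"
  shows "smooth_on S (\<lambda>x. h (c + B x))"
  unfolding smooth_on_def
proof
  fix k show "Ck_on k S (\<lambda>x. h (c + B x))"
    using assms(4)
  proof (induction k arbitrary: h)
    case 0
    have "continuous_on S (\<lambda>x. c + B x)"
      by (rule continuous_on_add[OF continuous_on_const linear_continuous_on[OF assms(1)]])
    from continuous_on_compose2[OF holomorphic_on_imp_continuous_on[OF 0] this] assms(5)
    show ?case by (simp add: image_subset_iff)
  next
    case (Suc k)
    note d = pd_holomorphic_compose[OF assms(1,3) Suc.prems assms(5)]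
    have "Ck_on k S (pd w (\<lambda>x. h (c + B x)))" for w
    proof (rule Ck_on_cong[OF assms(2), of "\<lambda>x. deriv h (c + B x) * B w"])
      show "deriv h (c + B x) * B w = pd w (\<lambda>x. h (c + B x)) x" if "x \<in> S" for x
        using pd_eqI[OF d[OF that]] by simp
      show "Ck_on k S (\<lambda>x. deriv h (c + B x) * B w)"
        by (rule Ck_on_mult[OF assms(2) Suc.IH[OF holomorphic_deriv[OF Suc.prems assms(3)]] Ck_on_const])
    qed
    moreover have "(\<lambda>x. h (c + B x)) differentiable (at x)" if "x \<in> S" for x
      using d[OF that] unfolding differentiable_def by blast
    ultimately show ?case by simp
  qed
qed

section \<open>Weighted bounds for derivatives\<close>

text \<open>
  Mixed derivatives of order at most \<open>n\<close> at the point \<open>x\<close>, each direction \<open>w\<close> weighted with a length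
  \<open>\<sigma>\<close>: for \<open>(w\<^sub>j, \<sigma>\<^sub>j) \<in> E\<close> the derivative along \<open>w\<^sub>1, \<dots>, w\<^sub>k\<close> is at most \<open>A / (\<sigma>\<^sub>1 \<cdots> \<sigma>\<^sub>k)\<close>. With
  the weights \<open>\<bar>\<rho>\<bar>\<close> for normal and \<open>sqrt \<bar>\<rho>\<bar>\<close> for tangential directions this is the anisotropic
  estimate, and with one weight for all directions the isotropic one. The recursion makes the
  predicate stable under sums, products and composition, with constants that do not depend on the
  weights.
\<close>

primrec dbounded :: "nat \<Rightarrow> ('a \<times> real) set \<Rightarrow> real \<Rightarrow>
    ('a::real_normed_vector \<Rightarrow> 'b::real_normed_vector) \<Rightarrow> 'a \<Rightarrow> bool" where
  "dbounded 0 E A f x \<longleftrightarrow> norm (f x) \<le> A"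
| "dbounded (Suc n) E A f x \<longleftrightarrow>
     norm (f x) \<le> A \<and> (\<forall>(w, \<sigma>)\<in>E. dbounded n E (A / \<sigma>) (pd w f) x)"

lemma dbounded_norm: "dbounded n E A f x \<Longrightarrow> norm (f x) \<le> A"
  by (cases n) auto

lemma dbounded_nonneg: "dbounded n E A f x \<Longrightarrow> 0 \<le> A"
  using dbounded_norm norm_ge_zero order_trans by metis

lemma dbounded_pd: "dbounded (Suc n) E A f x \<Longrightarrow> (w, \<sigma>) \<in> E \<Longrightarrow> dbounded n E (A / \<sigma>) (pd w f) x"
  by fastforce

text \<open>
  A bound at a single point says nothing about nearby values, but the derivatives of the two
  functions agree on the open set; smoothness is what makes them exist there at every order.
\<close>

lemma dbounded_cong:
  assumes "open S" "x \<in> S" "smooth_on S f" "\<And>y. y \<in> S \<Longrightarrow> f y = g y" "dbounded n E A f x"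
  shows "dbounded n E A g x"
  using assms(3-5)
proof (induction n arbitrary: f g A)
  case 0
  then show ?case using assms(2) by simp
next
  case (Suc n)
  have "dbounded n E (A / \<sigma>) (pd w g) x" if "(w, \<sigma>) \<in> E" for w \<sigma>
  proof (rule Suc.IH)
    show "smooth_on S (pd w f)" by (rule smooth_on_pd[OF Suc.prems(1)])
    show "pd w f y = pd w g y" if "y \<in> S" for y
      by (rule differentiable_cong_open(2)[OF assms(1) that Suc.prems(2), symmetric])
         (auto intro: smooth_on_differentiable[OF Suc.prems(1) that])
    show "dbounded n E (A / \<sigma>) (pd w f) x" by (rule dbounded_pd[OF Suc.prems(3) that])
  qed
  moreover have "norm (g x) \<le> A" using Suc.prems(2)[OF assms(2)] dbounded_norm[OF Suc.prems(3)] by simp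
  ultimately show ?case by auto
qed

lemma dbounded_mono:
  assumes "\<forall>(w, \<sigma>)\<in>E. \<sigma> > 0" "A \<le> B" "dbounded n E A f x"
  shows "dbounded n E B f x"
  using assms(2,3)
proof (induction n arbitrary: f A B)
  case (Suc n)
  have "dbounded n E (B / \<sigma>) (pd w f) x" if "(w, \<sigma>) \<in> E" for w \<sigma>
    by (rule Suc.IH[OF _ dbounded_pd[OF Suc.prems(2) that]])
       (use assms(1) that Suc.prems(1) in \<open>auto intro!: divide_right_mono\<close>)
  then show ?case using Suc.prems dbounded_norm[OF Suc.prems(2)] by auto
qed auto

lemma dbounded_SucD: "dbounded (Suc n) E A f x \<Longrightarrow> dbounded n E A f x"
proof (induction n arbitrary: A f)
  case (Suc n)
  have "dbounded n E (A / \<sigma>) (pd w f) x" if "(w, \<sigma>) \<in> E" for w \<sigma>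
    by (rule Suc.IH[OF dbounded_pd[OF Suc.prems that]])
  then show ?case using dbounded_norm[OF Suc.prems] by auto
qed auto

lemma dbounded_const:
  assumes "\<forall>(w, \<sigma>)\<in>E. \<sigma> > 0" "norm c \<le> A"
  shows "dbounded n E A (\<lambda>x. c) x"
  using assms(2)
proof (induction n arbitrary: A c)
  case (Suc n)
  have "0 \<le> A" using Suc.prems norm_ge_zero order_trans by blast
  then have "dbounded n E (A / \<sigma>) (pd w (\<lambda>x. c)) x" if "(w, \<sigma>) \<in> E" for w \<sigma>
    using Suc.IH[of 0 "A / \<sigma>"] that assms(1) by fastforce
  then show ?case using Suc.prems by auto
qed auto

lemma dbounded_add:
  assumes "open S" "x \<in> S" "smooth_on S f" "smooth_on S g" "dbounded n E A f x" "dbounded n E B g x"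
  shows "dbounded n E (A + B) (\<lambda>x. f x + g x) x"
  using assms(3-6)
proof (induction n arbitrary: f g A B)
  case 0 then show ?case by (simp add: norm_triangle_le)
next
  case (Suc n)
  have "dbounded n E ((A + B) / \<sigma>) (pd w (\<lambda>x. f x + g x)) x" if "(w, \<sigma>) \<in> E" for w \<sigma>
  proof (rule dbounded_cong[OF assms(1,2)])
    show "smooth_on S (\<lambda>x. pd w f x + pd w g x)"
      by (rule smooth_on_add[OF assms(1) smooth_on_pd[OF Suc.prems(1)] smooth_on_pd[OF Suc.prems(2)]])
    show "pd w f y + pd w g y = pd w (\<lambda>x. f x + g x) y" if "y \<in> S" for y
      using pd_add[OF smooth_on_differentiable[OF Suc.prems(1) that] smooth_on_differentiable[OF Suc.prems(2) that]] by simp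
    show "dbounded n E ((A + B) / \<sigma>) (\<lambda>x. pd w f x + pd w g x) x"
      using Suc.IH[OF smooth_on_pd[OF Suc.prems(1)] smooth_on_pd[OF Suc.prems(2)]
          dbounded_pd[OF Suc.prems(3) that] dbounded_pd[OF Suc.prems(4) that]]
      by (simp add: add_divide_distrib)
  qed
  moreover have "norm (f x + g x) \<le> A + B"
    using dbounded_norm[OF Suc.prems(3)] dbounded_norm[OF Suc.prems(4)] by (rule norm_triangle_mono)
  ultimately show ?case by auto
qed

lemma dbounded_sum:
  assumes "open S" "x \<in> S" "\<forall>(w, \<sigma>)\<in>E. \<sigma> > 0" "finite I" "\<And>i. i \<in> I \<Longrightarrow> smooth_on S (f i)"
    "\<And>i. i \<in> I \<Longrightarrow> dbounded n E (A i) (f i) x"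
  shows "dbounded n E (\<Sum>i\<in>I. A i) (\<lambda>x. \<Sum>i\<in>I. f i x) x"
  using assms(4-6)
proof (induction I)
  case empty
  show ?case using dbounded_const[OF assms(3), of "0::'c" 0] by simp
next
  case (insert i I)
  have "dbounded n E (A i + (\<Sum>i\<in>I. A i)) (\<lambda>x. f i x + (\<Sum>i\<in>I. f i x)) x"
    using insert by (intro dbounded_add[OF assms(1,2)] smooth_on_sum[OF assms(1)]) auto
  then show ?case using insert by simp
qed

lemma dbounded_bounded_linear:
  assumes "open S" "x \<in> S" "bounded_linear L" "\<And>y. norm (L y) \<le> K * norm y" "0 \<le> K"
    "smooth_on S f" "dbounded n E A f x"
  shows "dbounded n E (K * A) (\<lambda>x. L (f x)) x"
  using assms(6,7)
proof (induction n arbitrary: f A)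
  case 0 then show ?case using assms(4)[of "f x"] assms(5) by (simp add: mult_left_mono order_trans)
next
  case (Suc n)
  have "dbounded n E (K * A / \<sigma>) (pd w (\<lambda>x. L (f x))) x" if "(w, \<sigma>) \<in> E" for w \<sigma>
  proof (rule dbounded_cong[OF assms(1,2)])
    show "smooth_on S (\<lambda>x. L (pd w f x))"
      by (rule smooth_on_bounded_linear[OF assms(1,3) smooth_on_pd[OF Suc.prems(1)]])
    show "L (pd w f y) = pd w (\<lambda>x. L (f x)) y" if "y \<in> S" for y
      using pd_bounded_linear[OF assms(3) smooth_on_differentiable[OF Suc.prems(1) that]] by simp
    show "dbounded n E (K * A / \<sigma>) (\<lambda>x. L (pd w f x)) x"
      using Suc.IH[OF smooth_on_pd[OF Suc.prems(1)] dbounded_pd[OF Suc.prems(2) that]] by simp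
  qed
  moreover have "norm (L (f x)) \<le> K * A"
    using assms(4)[of "f x"] dbounded_norm[OF Suc.prems(2)] assms(5) by (meson mult_left_mono order_trans)
  ultimately show ?case by auto
qed

text \<open>
  Leibniz' rule in recursive form: each differentiation produces two terms of the same shape, which
  gives the factor \<open>2 ^ n\<close>.
\<close>

lemma dbounded_mult:
  fixes f g :: "'a::real_normed_vector \<Rightarrow> 'b::real_normed_algebra"
  assumes "open S" "x \<in> S" "smooth_on S f" "smooth_on S g" "dbounded n E A f x" "dbounded n E B g x"
  shows "dbounded n E (2 ^ n * (A * B)) (\<lambda>x. f x * g x) x"
  using assms(3-6)
proof (induction n arbitrary: f g A B)
  case 0
  then have "norm (f x) * norm (g x) \<le> A * B"
    by (intro mult_mono) (auto intro: order_trans[OF norm_ge_zero])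
  then show ?case using norm_mult_ineq[of "f x" "g x"] by simp
next
  case (Suc n)
  note sf = Suc.prems(1) and sg = Suc.prems(2)
  have bf: "dbounded n E A f x" and bg: "dbounded n E B g x"
    using Suc.prems(3,4) dbounded_SucD by blast+
  have "dbounded n E (2 ^ Suc n * (A * B) / \<sigma>) (pd w (\<lambda>x. f x * g x)) x" if "(w, \<sigma>) \<in> E" for w \<sigma>
  proof (rule dbounded_cong[OF assms(1,2)])
    show "smooth_on S (\<lambda>x. f x * pd w g x + pd w f x * g x)"
      by (intro smooth_on_add[OF assms(1)] smooth_on_mult[OF assms(1)] smooth_on_pd[OF sf] smooth_on_pd[OF sg] sf sg)
    show "f y * pd w g y + pd w f y * g y = pd w (\<lambda>x. f x * g x) y" if "y \<in> S" for y
      using pd_mult[OF smooth_on_differentiable[OF sf that] smooth_on_differentiable[OF sg that]] by simp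
    have "dbounded n E (2 ^ n * (A * (B / \<sigma>)) + 2 ^ n * ((A / \<sigma>) * B)) (\<lambda>x. f x * pd w g x + pd w f x * g x) x"
      by (intro dbounded_add[OF assms(1,2)] smooth_on_mult[OF assms(1)] smooth_on_pd[OF sf] smooth_on_pd[OF sg] sf sg
          Suc.IH bf bg dbounded_pd[OF Suc.prems(3) that] dbounded_pd[OF Suc.prems(4) that])
    then show "dbounded n E (2 ^ Suc n * (A * B) / \<sigma>) (\<lambda>x. f x * pd w g x + pd w f x * g x) x"
      by (simp add: field_simps)
  qed
  moreover have "norm (f x * g x) \<le> 2 ^ Suc n * (A * B)"
  proof -
    have "norm (f x) * norm (g x) \<le> A * B"
      using dbounded_norm[OF bf] dbounded_norm[OF bg] by (intro mult_mono) (auto intro: order_trans[OF norm_ge_zero])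
    moreover have "1 * (A * B) \<le> 2 ^ Suc n * (A * B)"
      using dbounded_nonneg[OF bf] dbounded_nonneg[OF bg] by (intro mult_right_mono) (auto simp del: power_Suc)
    ultimately show ?thesis using norm_mult_ineq[of "f x" "g x"] by linarith
  qed
  ultimately show ?case by auto
qed

lemma dbounded_prod:
  fixes f :: "'i \<Rightarrow> 'a::real_normed_vector \<Rightarrow> 'b::{real_normed_algebra_1,comm_ring_1}"
  assumes "open S" "x \<in> S" "\<forall>(w, \<sigma>)\<in>E. \<sigma> > 0" "finite I" "\<And>i. i \<in> I \<Longrightarrow> smooth_on S (f i)"
    "\<And>i. i \<in> I \<Longrightarrow> dbounded n E (A i) (f i) x"
  shows "dbounded n E (\<Prod>i\<in>I. 2 ^ n * A i) (\<lambda>x. \<Prod>i\<in>I. f i x) x"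
  using assms(4-6)
proof (induction I)
  case empty
  show ?case using dbounded_const[OF assms(3), of "1::'b" 1] by simp
next
  case (insert i I)
  have "dbounded n E (2 ^ n * (A i * (\<Prod>i\<in>I. 2 ^ n * A i))) (\<lambda>x. f i x * (\<Prod>i\<in>I. f i x)) x"
    using insert by (intro dbounded_mult[OF assms(1,2)] smooth_on_prod[OF assms(1)]) auto
  then show ?case using insert by (simp add: mult.assoc)
qed

definition bounded_derivs :: "(real \<Rightarrow> real) \<Rightarrow> bool" where
  "bounded_derivs h \<longleftrightarrow> smooth_on UNIV h \<and> (\<forall>k. \<exists>M. \<forall>t. norm ((pd 1 ^^ k) h t) \<le> M)"

lemma bounded_derivs_pd: "bounded_derivs h \<Longrightarrow> bounded_derivs (pd 1 h)"
  unfolding bounded_derivs_def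
proof safe
  fix k assume "\<forall>k. \<exists>M. \<forall>t. norm ((pd 1 ^^ k) h t) \<le> M"
  from spec[OF this, of "Suc k"] show "\<exists>M. \<forall>t. norm ((pd 1 ^^ k) (pd 1 h) t) \<le> M"
    unfolding funpow_Suc_right o_apply .
qed (rule smooth_on_pd)

text \<open>
  By the chain rule a derivative of \<open>h \<circ> f\<close> is a derivative of \<open>f\<close> times \<open>h' \<circ> f\<close>, and the induction
  hypothesis applies to the latter. The bounds concern the derivatives of \<open>f\<close> because \<open>f\<close> is going
  to be a rescaled coordinate, whose values are not uniformly bounded.
\<close>

lemma dbounded_compose:
  fixes h :: "real \<Rightarrow> real"
  assumes "bounded_derivs h" "0 \<le> A"
  shows "\<exists>C. \<forall>S E x. \<forall>f :: 'a::real_normed_vector \<Rightarrow> real.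
     open S \<longrightarrow> x \<in> S \<longrightarrow> smooth_on S f \<longrightarrow>
     (\<forall>(w, \<sigma>)\<in>E. \<sigma> > 0 \<and> dbounded n E (A / \<sigma>) (pd w f) x) \<longrightarrow> dbounded n E C (\<lambda>x. h (f x)) x"
  using assms(1)
proof (induction n arbitrary: h)
  case 0
  then obtain M where "\<forall>t. norm ((pd 1 ^^ 0) h t) \<le> M" unfolding bounded_derivs_def by blast
  then show ?case by auto
next
  case (Suc n)
  obtain M where M: "\<forall>t. norm ((pd 1 ^^ 0) h t) \<le> M" using Suc.prems unfolding bounded_derivs_def by blast
  have sh: "smooth_on UNIV h" using Suc.prems unfolding bounded_derivs_def by blast
  obtain C where C: "\<And>S E x. \<And>f :: 'a \<Rightarrow> real.
     open S \<Longrightarrow> x \<in> S \<Longrightarrow> smooth_on S f \<Longrightarrow>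
     \<forall>(w, \<sigma>)\<in>E. \<sigma> > 0 \<and> dbounded n E (A / \<sigma>) (pd w f) x \<Longrightarrow> dbounded n E C (\<lambda>x. pd 1 h (f x)) x"
    using Suc.IH[OF bounded_derivs_pd[OF Suc.prems]] by blast
  show ?case
  proof (intro exI allI impI)
    fix S E x and f :: "'a \<Rightarrow> real"
    assume S: "open S" "x \<in> S" and f: "smooth_on S f"
      and b: "\<forall>(w, \<sigma>)\<in>E. 0 < \<sigma> \<and> dbounded (Suc n) E (A / \<sigma>) (pd w f) x"
    have pos: "\<forall>(w, \<sigma>)\<in>E. 0 < \<sigma>" using b by auto
    have "\<forall>(w, \<sigma>)\<in>E. 0 < \<sigma> \<and> dbounded n E (A / \<sigma>) (pd w f) x" using b dbounded_SucD by fast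
    from C[OF S f this] have Cb: "dbounded n E C (\<lambda>x. pd 1 h (f x)) x" .
    have "dbounded n E (max M (2 ^ n * (A * C)) / \<sigma>) (pd w (\<lambda>x. h (f x))) x" if w: "(w, \<sigma>) \<in> E" for w \<sigma>
    proof (rule dbounded_cong[OF S])
      show "smooth_on S (\<lambda>x. pd w f x * pd 1 h (f x))"
        by (rule smooth_on_mult[OF S(1) smooth_on_pd[OF f] smooth_on_compose[OF S(1) f smooth_on_pd[OF sh]]]) simp
      show "pd w f y * pd 1 h (f y) = pd w (\<lambda>x. h (f x)) y" if "y \<in> S" for y
        using pd_compose(2)[of f y h w, OF smooth_on_differentiable[OF f that] smooth_on_differentiable[OF sh]] by simp
      have "dbounded n E (A / \<sigma>) (pd w f) x" using b w dbounded_SucD by fast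
      then have *: "dbounded n E (2 ^ n * ((A / \<sigma>) * C)) (\<lambda>x. pd w f x * pd 1 h (f x)) x"
        by (intro dbounded_mult[OF S] smooth_on_pd[OF f] smooth_on_compose[OF S(1) f smooth_on_pd[OF sh]] Cb) auto
      have "\<sigma> > 0" using pos w by auto
      then have "2 ^ n * ((A / \<sigma>) * C) \<le> max M (2 ^ n * (A * C)) / \<sigma>"
        by (simp add: divide_right_mono)
      from dbounded_mono[OF pos this *]
      show "dbounded n E (max M (2 ^ n * (A * C)) / \<sigma>) (\<lambda>x. pd w f x * pd 1 h (f x)) x" .
    qed
    moreover have "norm (h (f x)) \<le> max M (2 ^ n * (A * C))" using M by (auto intro: order_trans[OF _ max.cobounded1])
    ultimately show "dbounded (Suc n) E (max M (2 ^ n * (A * C))) (\<lambda>x. h (f x)) x" by auto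
  qed
qed

lemma iterated_derivative_snoc:
  "iterated_derivative (ws @ [w]) f = iterated_derivative ws (pd w f)"
  by (induction ws) auto

lemma dbounded_iterated_derivative:
  assumes "dbounded n E A f x" "length ws \<le> n" "\<And>w. w \<in> set ws \<Longrightarrow> (w, s) \<in> E"
  shows "norm (iterated_derivative ws f x) \<le> A / s ^ length ws"
  using assms
proof (induction ws arbitrary: n f A rule: rev_induct)
  case Nil
  then show ?case using dbounded_norm by fastforce
next
  case (snoc w ws)
  then obtain m where m: "n = Suc m" by (cases n) auto
  have "norm (iterated_derivative ws (pd w f) x) \<le> (A / s) / s ^ length ws"
    by (rule snoc.IH[of m]) (use snoc.prems m in \<open>auto simp: dbounded_pd\<close>)
  then show ?case by (simp add: iterated_derivative_snoc)
qed

lemma dbounded_coarser: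
  assumes "dbounded n E A f x" "0 \<le> A" "\<forall>(w, \<sigma>)\<in>E'. (w, 1) \<in> E \<and> 0 < \<sigma> \<and> \<sigma> \<le> 1"
  shows "dbounded n E' A f x"
  using assms(1,2)
proof (induction n arbitrary: f A)
  case (Suc n)
  have "dbounded n E' (A / \<sigma>) (pd w f) x" if "(w, \<sigma>) \<in> E'" for w \<sigma>
  proof -
    have *: "(w, 1) \<in> E" "0 < \<sigma>" "\<sigma> \<le> 1" using assms(3) that by auto
    have "dbounded n E (A / 1) (pd w f) x" by (rule dbounded_pd[OF Suc.prems(1) *(1)])
    then have "dbounded n E' A (pd w f) x" using Suc.IH[of A "pd w f"] Suc.prems(2) by simp
    moreover have "A \<le> A / \<sigma>" using * Suc.prems(2) by (simp add: le_divide_eq mult_left_le)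
    ultimately show ?thesis using dbounded_mono assms(3) by (metis (mono_tags, lifting) case_prod_beta)
  qed
  then show ?case using dbounded_norm[OF Suc.prems(1)] by auto
qed auto

lemma pd_linear_expand:
  fixes f :: "'a::euclidean_space \<Rightarrow> 'b::real_normed_vector"
  assumes "f differentiable (at x)"
  shows "pd w f x = (\<Sum>b\<in>Basis. (w \<bullet> b) *\<^sub>R pd b f x)"
proof -
  have l: "linear (\<lambda>w. pd w f x)" using assms by (simp add: linear_frechet_derivative)
  have "pd (\<Sum>b\<in>Basis. (w \<bullet> b) *\<^sub>R b) f x = (\<Sum>b\<in>Basis. (w \<bullet> b) *\<^sub>R pd b f x)"
    by (subst linear_sum[OF l]) (simp only: linear_cmul[OF l])
  then show ?thesis by (simp add: euclidean_representation)
qed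

text \<open>
  A direction is a linear combination of basis vectors, so that continuity of finitely many
  derivatives on a compact set bounds those in all directions of bounded length at once.
\<close>

lemma dbounded_compact:
  fixes f :: "'a::euclidean_space \<Rightarrow> 'b::real_normed_vector"
  assumes "smooth_on UNIV f" "compact K" "0 \<le> R"
  shows "\<exists>A\<ge>0. \<forall>x\<in>K. dbounded n ({w. norm w \<le> R} \<times> {1}) A f x"
  using assms(1)
proof (induction n arbitrary: f)
  case 0
  have "compact (f ` K)"
    using assms(2) smooth_on_continuous_on[OF smooth_on_subset[OF 0 subset_UNIV]] by (rule compact_continuous_image[rotated])
  then obtain A where "\<forall>y\<in>f ` K. norm y \<le> A" using compact_imp_bounded bounded_iff by blast
  then show ?case by (intro exI[of _ "max 0 A"]) (auto simp: le_max_iff_disj)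
next
  case (Suc n)
  let ?E = "{w::'a. norm w \<le> R} \<times> {1::real}"
  have "\<forall>b\<in>Basis. \<exists>A\<ge>0. \<forall>x\<in>K. dbounded n ?E A (pd b f) x"
    using Suc.IH smooth_on_pd[OF Suc.prems] by blast
  then obtain A where A: "\<And>b. b \<in> Basis \<Longrightarrow> A b \<ge> 0" "\<And>b x. b \<in> Basis \<Longrightarrow> x \<in> K \<Longrightarrow> dbounded n ?E (A b) (pd b f) x"
    by metis
  obtain A0 where A0: "A0 \<ge> 0" "\<And>x. x \<in> K \<Longrightarrow> dbounded n ?E A0 f x" using Suc.IH[OF Suc.prems] by blast
  define T where "T = max A0 (\<Sum>b\<in>Basis. R * A b)"
  have pos: "\<forall>(w, \<sigma>)\<in>?E. \<sigma> > 0" by auto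
  have "dbounded (Suc n) ?E T f x" if x: "x \<in> K" for x
  proof -
    have "dbounded n ?E (T / 1) (pd w f) x" if w: "norm w \<le> R" for w
    proof (rule dbounded_cong[OF open_UNIV UNIV_I])
      have sm: "smooth_on UNIV (\<lambda>x. (w \<bullet> b) *\<^sub>R pd b f x)" for b
        by (rule smooth_on_bounded_linear[OF open_UNIV bounded_linear_scaleR_right smooth_on_pd[OF Suc.prems]])
      show "smooth_on UNIV (\<lambda>x. \<Sum>b\<in>Basis. (w \<bullet> b) *\<^sub>R pd b f x)"
        by (rule smooth_on_sum[OF open_UNIV sm])
      show "(\<Sum>b\<in>Basis. (w \<bullet> b) *\<^sub>R pd b f y) = pd w f y" for y
        by (rule pd_linear_expand[OF smooth_on_differentiable[OF Suc.prems UNIV_I], symmetric])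
      have "dbounded n ?E (R * A b) (\<lambda>x. (w \<bullet> b) *\<^sub>R pd b f x) x" if b: "b \<in> Basis" for b
      proof -
        have "dbounded n ?E (\<bar>w \<bullet> b\<bar> * A b) (\<lambda>x. (w \<bullet> b) *\<^sub>R pd b f x) x"
          by (rule dbounded_bounded_linear[OF open_UNIV UNIV_I bounded_linear_scaleR_right _ _ smooth_on_pd[OF Suc.prems] A(2)[OF b x]]) auto
        moreover have "\<bar>w \<bullet> b\<bar> * A b \<le> R * A b"
          using Basis_le_norm[OF b, of w] w A(1)[OF b] by (intro mult_right_mono) auto
        ultimately show ?thesis using dbounded_mono[OF pos] by blast
      qed
      then have "dbounded n ?E (\<Sum>b\<in>Basis. R * A b) (\<lambda>x. \<Sum>b\<in>Basis. (w \<bullet> b) *\<^sub>R pd b f x) x"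
        by (rule dbounded_sum[OF open_UNIV UNIV_I pos finite_Basis sm])
      then show "dbounded n ?E (T / 1) (\<lambda>x. \<Sum>b\<in>Basis. (w \<bullet> b) *\<^sub>R pd b f x) x"
        by (rule dbounded_mono[OF pos, rotated]) (simp add: T_def)
    qed
    moreover have "norm (f x) \<le> T" using dbounded_norm[OF A0(2)[OF x]] by (simp add: T_def)
    ultimately show ?thesis by auto
  qed
  moreover have "T \<ge> 0" using A0 by (simp add: T_def)
  ultimately show ?case by blast
qed

text \<open>
  This is where the anisotropy originates. At a point where \<open>\<bar>f\<bar> \<le> s\<close>, the weighted bound \<open>A s\<close> for
  \<open>f\<close> demands nothing but bounded derivatives in directions of weight \<open>s\<close>. In a direction \<open>w\<close> of
  weight \<open>sqrt s\<close> the first derivative would have to be \<open>O(sqrt s)\<close>; it vanishes at the point by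
  assumption. From the second order on, two weights are multiplied and their product is at most \<open>s\<close>,
  so that bounded derivatives suffice again.
\<close>

lemma dbounded_weighted:
  fixes f :: "'a::euclidean_space \<Rightarrow> real"
  assumes "smooth_on UNIV f" "compact K" "0 \<le> R"
  shows "\<exists>A\<ge>1. \<forall>x\<in>K. \<forall>s E. 0 < s \<longrightarrow> s \<le> 1 \<longrightarrow> \<bar>f x\<bar> \<le> s \<longrightarrow>
     (\<forall>(w, \<sigma>)\<in>E. norm w \<le> R \<and> (\<sigma> = s \<or> (\<sigma> = sqrt s \<and> pd w f x = 0))) \<longrightarrow> dbounded n E (A * s) f x"
proof -
  let ?E = "{w::'a. norm w \<le> R} \<times> {1::real}"
  obtain A where A: "A \<ge> 0" "\<And>x. x \<in> K \<Longrightarrow> dbounded (Suc n) ?E A f x"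
    using dbounded_compact[OF assms] by blast
  show ?thesis
  proof (intro exI[of _ "max 1 A"] conjI ballI allI impI)
    fix x s and E :: "('a \<times> real) set"
    assume x: "x \<in> K" and s: "0 < s" "s \<le> 1" "\<bar>f x\<bar> \<le> s"
      and E: "\<forall>(w, \<sigma>)\<in>E. norm w \<le> R \<and> (\<sigma> = s \<or> (\<sigma> = sqrt s \<and> pd w f x = 0))"
    let ?B = "max 1 A"
    have ss: "s \<le> sqrt s" "0 < sqrt s" "sqrt s \<le> 1" using s by (auto intro: real_le_rsqrt simp: power2_eq_square mult_left_le)
    have pos: "\<forall>(w, \<sigma>)\<in>E. \<sigma> > 0" using E s ss by auto
    have coarse: "\<forall>(w, \<sigma>)\<in>E. (w, 1) \<in> ?E \<and> 0 < \<sigma> \<and> \<sigma> \<le> 1" using E s ss by auto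
    have B: "dbounded (Suc n) ?E ?B f x" by (rule dbounded_mono[OF _ _ A(2)[OF x]]) auto
    have pd1: "dbounded n ?E ?B (pd w f) x" if "norm w \<le> R" for w
      using dbounded_pd[OF B, of w 1] that by simp
    have s1: "\<bar>f x\<bar> \<le> ?B * s"
    proof -
      have "1 * s \<le> ?B * s" using s by (intro mult_right_mono) auto
      then show ?thesis using s by linarith
    qed
    show "dbounded n E (?B * s) f x"
    proof (cases n)
      case 0 then show ?thesis using s1 by simp
    next
      case (Suc m)
      have "dbounded m E (?B * s / \<sigma>) (pd w f) x" if w: "(w, \<sigma>) \<in> E" for w \<sigma>
      proof -
        have nw: "norm w \<le> R" using E w by auto
        have d1: "dbounded (Suc m) ?E ?B (pd w f) x" using pd1[OF nw] Suc by simp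
        have dE: "dbounded m E ?B (pd w f) x"
          by (rule dbounded_coarser[OF dbounded_SucD[OF d1] _ coarse]) auto
        consider "\<sigma> = s" | "\<sigma> = sqrt s" "pd w f x = 0" using E w by auto
        then show ?thesis
        proof cases
          case 1 then show ?thesis using dE s by simp
        next
          case 2
          (* The first derivative along w vanishes at x; its further derivatives only have to beat
             the remaining factor sqrt s. *)
          have e: "?B * s / \<sigma> = ?B * sqrt s" using 2(1) s(1) real_div_sqrt[of s] by (metis times_divide_eq_right less_imp_le)
          show ?thesis
          proof (cases m)
            case 0 then show ?thesis using 2 s by simp
          next
            case (Suc j)
            have "dbounded j E (?B * sqrt s / \<sigma>') (pd w' (pd w f)) x" if w': "(w', \<sigma>') \<in> E" for w' \<sigma>'
            proof -
              have nw': "norm w' \<le> R" and le: "\<sigma>' \<le> sqrt s" "0 < \<sigma>'" using E w' ss s by auto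
              have "dbounded (Suc j) ?E ?B (pd w' (pd w f)) x"
                using dbounded_pd[OF d1, of w' 1] nw' Suc by (simp del: dbounded.simps)
              then have "dbounded j ?E ?B (pd w' (pd w f)) x" by (rule dbounded_SucD)
              then have "dbounded j E ?B (pd w' (pd w f)) x" by (rule dbounded_coarser[OF _ _ coarse]) auto
              moreover have "?B \<le> ?B * sqrt s / \<sigma>'"
                using le by (simp add: le_divide_eq mult_left_mono)
              ultimately show ?thesis using dbounded_mono[OF pos] by blast
            qed
            then show ?thesis unfolding Suc e using 2 s by auto
          qed
        qed
      qed
      then show ?thesis using s1 Suc by auto
    qed
  qed auto
qed

section \<open>Bump functions of one real variable\<close>

text \<open>
  The family \<open>exp (- 1 / x) / x ^ n\<close>, continued by \<open>0\<close>, is closed under differentiation up to linear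
  combinations; this is why the powers of \<open>1 / x\<close> are included.
\<close>

definition flat :: "nat \<Rightarrow> real \<Rightarrow> real" where
  "flat n x = (if x > 0 then exp (- inverse x) * inverse x ^ n else 0)"

text \<open>
  One term of the exponential series dominates \<open>x ^ (n + 2)\<close> at \<open>x = 1 / h\<close>. The quadratic bound
  makes the difference quotient at the origin tend to \<open>0\<close>.
\<close>

lemma flat_quadratic: "\<bar>flat n h\<bar> \<le> fact (n + 2) * h\<^sup>2"
proof (cases "h > 0")
  case True
  let ?m = "n + 2" and ?y = "inverse h"
  have y: "?y > 0" using True by simp
  have e: "(\<lambda>n. ?y ^ n /\<^sub>R fact n) sums exp ?y" by (rule exp_converges)
  have "(\<Sum>n\<in>{?m}. ?y ^ n /\<^sub>R fact n) \<le> exp ?y"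
    unfolding sums_unique[OF e] by (rule sum_le_suminf[OF sums_summable[OF e]]) (use y in auto)
  then have "?y ^ ?m /\<^sub>R fact ?m \<le> exp ?y" by (simp del: fact_Suc)
  moreover have "a /\<^sub>R F \<le> E \<Longrightarrow> F > 0 \<Longrightarrow> a \<le> F * E" for a F E :: real by (simp add: field_simps)
  ultimately have 1: "?y ^ ?m \<le> fact ?m * exp ?y" using fact_gt_zero by blast
  have "exp (- ?y) * ?y ^ n = (?y ^ ?m * h\<^sup>2) * exp (- ?y)"
    using True by (simp add: power_add power2_eq_square field_simps)
  also have "\<dots> \<le> ((fact ?m * exp ?y) * h\<^sup>2) * exp (- ?y)"
    by (intro mult_right_mono 1) auto
  also have "\<dots> = fact ?m * h\<^sup>2 * (exp ?y * exp (- ?y))" by (simp only: mult_ac)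
  also have "\<dots> = fact ?m * h\<^sup>2" by (simp add: exp_minus)
  finally have "exp (- ?y) * ?y ^ n \<le> fact ?m * h\<^sup>2" .
  then show ?thesis using True by (simp add: flat_def del: fact_Suc)
qed (simp add: flat_def)

lemma flat_derivative: "(flat n has_real_derivative (flat (n + 2) x - n * flat (n + 1) x)) (at x)"
proof -
  consider "x > 0" | "x < 0" | "x = 0" by linarith
  then show ?thesis
  proof cases
    case 1
    have "(inverse has_real_derivative - (inverse x ^ 2)) (at x)"
      using DERIV_inverse[of x UNIV] 1 by (simp add: numeral_2_eq_2)
    note d = this
    have "((\<lambda>x. exp (- inverse x)) has_real_derivative exp (- inverse x) * (- (- (inverse x ^ 2)))) (at x)"
      by (rule DERIV_fun_exp[OF DERIV_minus[OF d]])
    from DERIV_mult[OF this DERIV_power[OF d, of n]]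
    have "((\<lambda>x. exp (- inverse x) * inverse x ^ n) has_real_derivative (flat (n + 2) x - n * flat (n + 1) x)) (at x)"
      by (rule DERIV_cong) (use 1 in \<open>cases n, simp_all add: flat_def power_add power2_eq_square algebra_simps\<close>)
    then show ?thesis
      by (rule has_field_derivative_transform_within_open[OF _ open_greaterThan[of 0]]) (use 1 in \<open>auto simp: flat_def\<close>)
  next
    case 2
    have "((\<lambda>x. 0) has_real_derivative (flat (n + 2) x - n * flat (n + 1) x)) (at x)"
      using 2 by (simp add: flat_def)
    then show ?thesis
      by (rule has_field_derivative_transform_within_open[OF _ open_lessThan[of 0]]) (use 2 in \<open>auto simp: flat_def\<close>)
  next
    case 3
    have "((\<lambda>h. flat n h / h) \<longlongrightarrow> 0) (at 0)"
    proof (rule Lim_null_comparison)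
      show "\<forall>\<^sub>F h in at 0. norm (flat n h / h) \<le> fact (n + 2) * \<bar>h\<bar>"
      proof (intro always_eventually allI)
        fix h :: real
        show "norm (flat n h / h) \<le> fact (n + 2) * \<bar>h\<bar>"
        proof (cases "h = 0")
          case False
          have "\<bar>flat n h\<bar> / \<bar>h\<bar> \<le> fact (n + 2) * h\<^sup>2 / \<bar>h\<bar>"
            by (rule divide_right_mono[OF flat_quadratic]) simp
          also have "h\<^sup>2 = \<bar>h\<bar> * \<bar>h\<bar>" by (simp add: power2_eq_square)
          finally show ?thesis using False by (simp del: fact_Suc abs_mult_self_eq)
        qed (simp add: flat_def)
      qed
      show "((\<lambda>h::real. fact (n + 2) * \<bar>h\<bar>) \<longlongrightarrow> 0) (at 0)"
        using tendsto_mult[OF tendsto_const[of "fact (n + 2) :: real"] tendsto_rabs[OF tendsto_ident_at[of "0::real" UNIV]]]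
        by (simp del: fact_Suc)
    qed
    then show ?thesis using 3 by (simp add: has_field_derivative_iff flat_def)
  qed
qed

lemma pd_real: "(f has_real_derivative d) (at x) \<Longrightarrow> f differentiable (at x) \<and> pd w f x = w * d"
  unfolding has_field_derivative_def by (auto simp: differentiable_def pd_eqI)

lemma smooth_flat: "smooth_on UNIV (flat n)"
  unfolding smooth_on_def
proof
  fix k show "Ck_on k UNIV (flat n)"
  proof (induction k arbitrary: n)
    case 0
    show ?case using DERIV_isCont[OF flat_derivative] by (simp add: continuous_at_imp_continuous_on)
  next
    case (Suc k)
    have e: "pd w (flat n) = (\<lambda>x. w * (flat (n + 2) x + (- real n) * flat (n + 1) x))" for w
      using pd_real[OF flat_derivative] by auto
    have "Ck_on k UNIV (pd w (flat n))" for w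
      unfolding e by (rule Ck_on_mult[OF open_UNIV Ck_on_const Ck_on_add[OF open_UNIV Suc.IH
        Ck_on_mult[OF open_UNIV Ck_on_const Suc.IH]]])
    then show ?case using pd_real[OF flat_derivative] by simp
  qed
qed

lemma smooth_inverse: "smooth_on {0<..} (inverse :: real \<Rightarrow> real)"
  unfolding smooth_on_def
proof
  fix k show "Ck_on k {0<..} (inverse :: real \<Rightarrow> real)"
  proof (induction k)
    case 0
    show ?case by (auto intro!: continuous_intros)
  next
    case (Suc k)
    have d: "(inverse has_real_derivative - (inverse x * inverse x)) (at x)" if "x > 0" for x :: real
      using that by (auto intro!: derivative_eq_intros)
    have "Ck_on k {0<..} (pd w (inverse :: real \<Rightarrow> real))" for w
    proof (rule Ck_on_cong)
      show "(- w) * (inverse x * inverse x) = pd w inverse x" if "x \<in> {0<..}" for x :: real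
        using pd_real[OF d, of x w] that by simp
      show "Ck_on k {0<..} (\<lambda>x::real. (- w) * (inverse x * inverse x))"
        by (rule Ck_on_mult[OF open_greaterThan Ck_on_const Ck_on_mult[OF open_greaterThan Suc.IH Suc.IH]])
    qed simp
    moreover have "(inverse :: real \<Rightarrow> real) differentiable (at x)" if "x > 0" for x
      using pd_real[OF d[OF that]] by blast
    ultimately show ?case by simp
  qed
qed

definition smooth_step :: "real \<Rightarrow> real" where
  "smooth_step x = flat 0 x * inverse (flat 0 x + flat 0 (1 - x))"

lemma flat_pos: "x > 0 \<Longrightarrow> flat n x > 0" and flat_zero: "x \<le> 0 \<Longrightarrow> flat n x = 0"
  by (auto simp: flat_def)

lemma flat_sum_pos: "flat 0 x + flat 0 (1 - x) > 0"
  by (cases "x > 0") (auto simp: flat_def add_pos_nonneg)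

lemma smooth_step_0: "x \<le> 0 \<Longrightarrow> smooth_step x = 0" and smooth_step_1: "1 \<le> x \<Longrightarrow> smooth_step x = 1"
  using flat_pos[of x 0] by (auto simp: smooth_step_def flat_zero)

lemma smooth_on_smooth_step: "smooth_on UNIV smooth_step"
proof -
  have "smooth_on UNIV (\<lambda>x::real. 1 + (- x))"
    by (intro smooth_on_add open_UNIV smooth_on_const smooth_on_bounded_linear_id bounded_linear_minus bounded_linear_ident)
  then have l: "smooth_on UNIV (\<lambda>x::real. 1 - x)" by simp
  have s: "smooth_on UNIV (\<lambda>x. flat 0 x + flat 0 (1 - x))"
    by (rule smooth_on_add[OF open_UNIV smooth_flat smooth_on_compose[OF open_UNIV l smooth_flat]]) simp
  have "smooth_on UNIV (\<lambda>x. inverse (flat 0 x + flat 0 (1 - x)))"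
    by (rule smooth_on_compose[OF open_UNIV s smooth_inverse]) (simp add: flat_sum_pos)
  from smooth_on_mult[OF open_UNIV smooth_flat this] have "smooth_on UNIV (\<lambda>x. flat 0 x * inverse (flat 0 x + flat 0 (1 - x)))" .
  then show ?thesis by (simp add: smooth_step_def[abs_def])
qed

lemma funpow_pd_smooth: "smooth_on S f \<Longrightarrow> smooth_on S ((pd w ^^ k) f)"
  by (induction k) (auto intro: smooth_on_pd)

lemma funpow_pd_cong:
  assumes "open S" "smooth_on S f" "\<And>y. y \<in> S \<Longrightarrow> f y = g y" "x \<in> S"
  shows "(pd w ^^ k) f x = (pd w ^^ k) g x"
  using assms(4)
proof (induction k arbitrary: x)
  case 0 then show ?case using assms(3) by simp
next
  case (Suc k)
  have "pd w ((pd w ^^ k) g) x = pd w ((pd w ^^ k) f) x"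
    by (rule differentiable_cong_open(2)[OF assms(1) Suc.prems Suc.IH])
       (auto intro: smooth_on_differentiable[OF funpow_pd_smooth[OF assms(2)] Suc.prems])
  then show ?case by simp
qed

lemma funpow_pd_const: "(pd w ^^ k) (\<lambda>x. c) = (\<lambda>x. if k = 0 then c else 0)"
proof (induction k)
  case (Suc k)
  show ?case unfolding funpow.simps(2) o_apply Suc.IH by (cases "k = 0") simp_all
qed simp

lemma bounded_derivs_const_outside:
  assumes "smooth_on UNIV h" "\<And>x. x < a \<Longrightarrow> h x = c" "\<And>x. x > b \<Longrightarrow> h x = d"
  shows "bounded_derivs h"
  unfolding bounded_derivs_def
proof (intro conjI allI)
  fix k
  have "compact ((pd 1 ^^ k) h ` {a..b})"
    by (intro compact_continuous_image compact_Icc smooth_on_continuous_on[OF smooth_on_subset[OF funpow_pd_smooth[OF assms(1)]]]) simp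
  then obtain M where M: "\<forall>y \<in> (pd 1 ^^ k) h ` {a..b}. norm y \<le> M" using compact_imp_bounded bounded_iff by blast
  have "norm ((pd 1 ^^ k) h t) \<le> max M (max \<bar>c\<bar> \<bar>d\<bar>)" for t
  proof -
    consider "t < a" | "t > b" | "t \<in> {a..b}" by fastforce
    then show ?thesis
    proof cases
      case 1
      have "(pd 1 ^^ k) (\<lambda>x. c) t = (pd 1 ^^ k) h t"
        by (rule funpow_pd_cong[of "{..<a}"]) (use 1 assms(2) in auto)
      then show ?thesis by (auto simp: funpow_pd_const split: if_splits)
    next
      case 2
      have "(pd 1 ^^ k) (\<lambda>x. d) t = (pd 1 ^^ k) h t"
        by (rule funpow_pd_cong[of "{b<..}"]) (use 2 assms(3) in auto)
      then show ?thesis by (auto simp: funpow_pd_const split: if_splits)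
    next
      case 3 then show ?thesis using M by (auto simp: le_max_iff_disj)
    qed
  qed
  then show "\<exists>M. \<forall>t. norm ((pd 1 ^^ k) h t) \<le> M" by blast
qed (rule assms(1))

lemma smooth_affine: "smooth_on UNIV (\<lambda>x::real. c + d * x)"
  by (intro smooth_on_add open_UNIV smooth_on_const smooth_on_bounded_linear_id bounded_linear_mult_right)

text \<open>
  Both bumps are differences of consecutive terms of a sequence of smooth steps, translated by
  integers and rescaled by powers of \<open>4\<close>, respectively; therefore the sums over all translates and
  over all rescalings telescope to \<open>1\<close>.
\<close>

definition lattice_bump :: "real \<Rightarrow> real" where
  "lattice_bump x = smooth_step (x + 1) - smooth_step x"

definition shell_bump :: "real \<Rightarrow> real" where
  "shell_bump x = smooth_step ((4 - x) / 3) - smooth_step ((4 - 4 * x) / 3)"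

lemma smooth_step_diff:
  "smooth_on UNIV (\<lambda>x. smooth_step (a + b * x) - smooth_step (c + d * x))"
proof -
  have "smooth_on UNIV (\<lambda>x. smooth_step (a + b * x) + (- 1) * smooth_step (c + d * x))"
    by (rule smooth_on_add[OF open_UNIV smooth_on_compose[OF open_UNIV smooth_affine smooth_on_smooth_step]
          smooth_on_mult[OF open_UNIV smooth_on_const smooth_on_compose[OF open_UNIV smooth_affine smooth_on_smooth_step]]]) auto
  then show ?thesis by simp
qed

lemma lattice_bump_outside: "\<bar>x\<bar> \<ge> 1 \<Longrightarrow> lattice_bump x = 0"
  by (cases "x \<ge> 0") (auto simp: lattice_bump_def smooth_step_0 smooth_step_1)

lemma shell_bump_outside: "x \<le> 1 / 4 \<or> x \<ge> 4 \<Longrightarrow> shell_bump x = 0"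
  by (auto simp: shell_bump_def smooth_step_0 smooth_step_1)

lemma bounded_derivs_lattice_bump: "bounded_derivs lattice_bump"
proof (rule bounded_derivs_const_outside[where a = "-1" and b = 1])
  show "smooth_on UNIV lattice_bump"
    using smooth_step_diff[of 1 1 0 1] by (simp add: lattice_bump_def[abs_def] add.commute)
qed (auto simp: lattice_bump_outside)

lemma bounded_derivs_shell_bump: "bounded_derivs shell_bump"
proof (rule bounded_derivs_const_outside[where a = "1/4" and b = 4])
  show "smooth_on UNIV shell_bump"
    using smooth_step_diff[of "4/3" "-1/3" "4/3" "-4/3"] by (simp add: shell_bump_def[abs_def] diff_divide_distrib)
qed (auto simp: shell_bump_outside)

lemma lattice_bump_sum:
  assumes "\<bar>x\<bar> \<le> real J"
  shows "(\<Sum>j \<in> {- int J..int J}. lattice_bump (x - of_int j)) = 1"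
proof -
  have tel: "(\<Sum>j \<in> {a..a + int n}. lattice_bump (x - of_int j)) = smooth_step (x - of_int a + 1) - smooth_step (x - of_int (a + int n))" for a n
  proof (induction n)
    case (Suc n)
    have "{a..a + int (Suc n)} = insert (a + int (Suc n)) {a..a + int n}" by auto
    then show ?case using Suc by (simp add: lattice_bump_def algebra_simps)
  qed (simp add: lattice_bump_def)
  have "{- int J..int J} = {- int J..- int J + int (2 * J)}" by simp
  then have "(\<Sum>j \<in> {- int J..int J}. lattice_bump (x - of_int j)) = smooth_step (x + J + 1) - smooth_step (x - J)"
    using tel[of "- int J" "2 * J"] by simp
  also have "\<dots> = 1" using assms by (subst smooth_step_0, simp, subst smooth_step_1) auto
  finally show ?thesis .
qed

lemma shell_bump_sum:
  assumes "t \<le> 1" "t \<ge> 4 powr (- real N)"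
  shows "(\<Sum>k\<le>N. shell_bump (4 ^ k * t)) = 1"
proof -
  have tel: "(\<Sum>k\<le>n. shell_bump (4 ^ k * t)) = smooth_step ((4 - t) / 3) - smooth_step ((4 - 4 ^ Suc n * t) / 3)" for n
    by (induction n) (simp_all add: shell_bump_def mult.assoc)
  have "4 powr real N * t \<ge> 4 powr real N * 4 powr (- real N)" using assms by (intro mult_left_mono) auto
  then have "4 ^ N * t \<ge> 1" by (simp add: powr_realpow powr_minus field_simps)
  then show ?thesis unfolding tel using assms by (subst smooth_step_1, simp, subst smooth_step_0) auto
qed

section \<open>Antiholomorphic derivatives along vectors\<close>

lemma norm_smult_vec: "norm (c *s (w :: complex ^ 'n::finite)) = norm c * norm w"
  by (simp add: norm_vec_def L2_set_def norm_mult power_mult_distrib sum_distrib_left[symmetric] real_sqrt_mult)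

lemma bounded_linear_smult_left: "bounded_linear (\<lambda>c::complex. c *s (w :: complex ^ 'n::finite))"
  by (rule bounded_linear_intro[where K = "norm w"])
     (auto simp: vec_eq_iff algebra_simps norm_smult_vec)

text \<open>
  For the function \<open>\<lambda> \<mapsto> f (x + \<lambda> w)\<close> this is the derivative with respect to the conjugate of \<open>\<lambda>\<close>. As
  an operator on functions of the full variable it can be iterated with the ordinary calculus of
  directional derivatives, while the definition through slices freezes the base point.
\<close>

definition dbar_along :: "complex ^ 'n::finite \<Rightarrow> (complex ^ 'n \<Rightarrow> complex) \<Rightarrow> complex ^ 'n \<Rightarrow> complex" where
  "dbar_along w f x = 1 / 2 * (pd w f x + \<i> * pd (\<i> *s w) f x)"

lemma smooth_dbar_along:
  assumes "open S" "smooth_on S f"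
  shows "smooth_on S (dbar_along w f)"
  unfolding dbar_along_def[abs_def]
  by (intro smooth_on_mult[OF assms(1)] smooth_on_add[OF assms(1)] smooth_on_const smooth_on_pd[OF assms(2)])

lemma smooth_funpow_dbar_along: "open S \<Longrightarrow> smooth_on S f \<Longrightarrow> smooth_on S ((dbar_along w ^^ k) f)"
  by (induction k) (auto intro: smooth_dbar_along)

lemma dbar_along_cong:
  assumes "open S" "smooth_on S f" "\<And>y. y \<in> S \<Longrightarrow> f y = g y" "x \<in> S"
  shows "dbar_along w f x = dbar_along w g x"
  unfolding dbar_along_def
  using differentiable_cong_open(2)[OF assms(1,4,3) smooth_on_differentiable[OF assms(2,4)]] by simp

lemma funpow_dbar_along_cong:
  assumes "open S" "smooth_on S f" "\<And>y. y \<in> S \<Longrightarrow> f y = g y" "x \<in> S"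
  shows "(dbar_along w ^^ k) f x = (dbar_along w ^^ k) g x"
  using assms(4)
proof (induction k arbitrary: x)
  case (Suc k)
  show ?case
    using dbar_along_cong[OF assms(1) smooth_funpow_dbar_along[OF assms(1,2)] Suc.IH Suc.prems] by simp
qed (simp add: assms(3))

lemma dbar_slice:
  assumes "smooth_on S f" "z + m *s w \<in> S"
  shows "dbar (\<lambda>m. f (z + m *s w)) m = dbar_along w f (z + m *s w)"
proof -
  have 1: "((\<lambda>m. z + m *s w) has_derivative (\<lambda>h. h *s w)) (at m)"
    using has_derivative_add[OF has_derivative_const bounded_linear_imp_has_derivative[OF bounded_linear_smult_left]]
    by simp
  have "(f has_derivative (\<lambda>u. pd u f (z + m *s w))) (at (z + m *s w))"
    using smooth_on_differentiable[OF assms] unfolding frechet_derivative_works .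
  from has_derivative_compose[OF 1 this]
  have "((\<lambda>m. f (z + m *s w)) has_derivative (\<lambda>h. pd (h *s w) f (z + m *s w))) (at m)" .
  from pd_eqI[OF this] show ?thesis by (simp add: dbar_def dbar_along_def)
qed

lemma dbar_cong_open:
  assumes "open T" "m \<in> T" "\<And>m. m \<in> T \<Longrightarrow> h m = h' m" "h differentiable (at m)"
  shows "dbar h m = dbar h' m"
  using differentiable_cong_open(2)[OF assms] unfolding dbar_def by simp

lemma differentiable_slice:
  fixes w :: "complex ^ 'n::finite" and f :: "complex ^ 'n \<Rightarrow> 'b::real_normed_vector"
  assumes "smooth_on S f" "z + m *s w \<in> S"
  shows "(\<lambda>m. f (z + m *s w)) differentiable (at m)"
proof -
  have 1: "((\<lambda>m. z + m *s w) has_derivative (\<lambda>h. h *s w)) (at m)"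
    using has_derivative_add[OF has_derivative_const bounded_linear_imp_has_derivative[OF bounded_linear_smult_left]]
    by simp
  have "(f has_derivative (\<lambda>u. pd u f (z + m *s w))) (at (z + m *s w))"
    using smooth_on_differentiable[OF assms] unfolding frechet_derivative_works .
  from has_derivative_compose[OF 1 this] show ?thesis unfolding differentiable_def by blast
qed

lemma open_slice:
  assumes "open S"
  shows "open {m. z + m *s (w :: complex ^ 'n::finite) \<in> S}"
proof -
  have "continuous_on UNIV (\<lambda>m. z + m *s w)"
    by (intro continuous_on_add continuous_on_const linear_continuous_on bounded_linear_smult_left)
  from open_vimage[OF assms this] show ?thesis by (simp add: vimage_def)
qed

lemma funpow_dbar_slice:
  assumes "open S" "smooth_on S f" "z + m *s w \<in> S" "\<And>m. z + m *s w \<in> S \<Longrightarrow> h m = f (z + m *s w)"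
  shows "(dbar ^^ k) h m = (dbar_along w ^^ k) f (z + m *s w)"
  using assms(3)
proof (induction k arbitrary: m)
  case (Suc k)
  note sm = smooth_funpow_dbar_along[OF assms(1,2), where w = w and k = k]
  have "dbar (\<lambda>m. (dbar_along w ^^ k) f (z + m *s w)) m = dbar ((dbar ^^ k) h) m"
    by (rule dbar_cong_open[OF open_slice[OF assms(1)]])
       (use Suc differentiable_slice[OF sm Suc.prems] in auto)
  then show ?case using dbar_slice[OF sm Suc.prems] by simp
qed (simp add: assms(4))

definition dbar_pair :: "complex ^ 'n::finite \<Rightarrow> complex ^ 'n \<Rightarrow> nat \<Rightarrow> nat \<Rightarrow> (complex ^ 'n \<Rightarrow> complex) \<Rightarrow> complex ^ 'n \<Rightarrow> complex" where
  "dbar_pair w u \<alpha> \<beta> f = (dbar_along w ^^ \<alpha>) ((dbar_along u ^^ \<beta>) f)"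

text \<open>
  The directions \<open>outer_normal \<rho> \<zeta>\<close> and \<open>v \<zeta>\<close> are evaluated at the fixed base point, so that the
  mixed slice derivatives are iterated derivatives along two constant vectors.
\<close>

lemma dbar_normal_tangential_eq:
  assumes "open S" "smooth_on S f" "\<zeta> \<in> S"
  shows "dbar_normal_tangential \<rho> v \<alpha> \<beta> f \<zeta> = dbar_pair (outer_normal \<rho> \<zeta>) (v \<zeta>) \<alpha> \<beta> f \<zeta>"
proof -
  let ?n = "outer_normal \<rho> \<zeta>"
  have "(dbar ^^ \<beta>) (\<lambda>m. f (\<zeta> + l *s ?n + m *s v \<zeta>)) 0 = (dbar_along (v \<zeta>) ^^ \<beta>) f (\<zeta> + l *s ?n)"
    if "\<zeta> + l *s ?n \<in> S" for l
    using funpow_dbar_slice[OF assms(1,2), of "\<zeta> + l *s ?n" 0 "v \<zeta>"] that by simp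
  then show ?thesis
    unfolding dbar_normal_tangential_def dbar_pair_def
    using funpow_dbar_slice[OF assms(1) smooth_funpow_dbar_along[OF assms(1,2)], of \<zeta> 0 ?n] assms(3) by simp
qed

lemma dbar_pair_cong:
  assumes "open S" "smooth_on S f" "\<And>y. y \<in> S \<Longrightarrow> f y = g y" "x \<in> S"
  shows "dbar_pair w u \<alpha> \<beta> f x = dbar_pair w u \<alpha> \<beta> g x"
  unfolding dbar_pair_def
  by (rule funpow_dbar_along_cong[OF assms(1) smooth_funpow_dbar_along[OF assms(1,2)] funpow_dbar_along_cong[OF assms(1-3)] assms(4)])

lemma dbar_along_add:
  assumes "smooth_on S f" "smooth_on S g" "x \<in> S"
  shows "dbar_along w (\<lambda>x. f x + g x) x = dbar_along w f x + dbar_along w g x"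
  unfolding dbar_along_def
  using pd_add[OF smooth_on_differentiable[OF assms(1,3)] smooth_on_differentiable[OF assms(2,3)]]
  by (simp add: algebra_simps)

lemma funpow_dbar_along_add:
  assumes "open S" "smooth_on S f" "smooth_on S g" "x \<in> S"
  shows "(dbar_along w ^^ k) (\<lambda>x. f x + g x) x = (dbar_along w ^^ k) f x + (dbar_along w ^^ k) g x"
  using assms(4)
proof (induction k arbitrary: x)
  case (Suc k)
  note sf = smooth_funpow_dbar_along[OF assms(1,2), where w = w and k = k] and sg = smooth_funpow_dbar_along[OF assms(1,3), where w = w and k = k]
  have "dbar_along w (\<lambda>x. (dbar_along w ^^ k) f x + (dbar_along w ^^ k) g x) x = dbar_along w ((dbar_along w ^^ k) (\<lambda>x. f x + g x)) x"
    by (rule dbar_along_cong[OF assms(1) smooth_on_add[OF assms(1) sf sg] Suc.IH[symmetric] Suc.prems])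
  then show ?case using dbar_along_add[OF sf sg Suc.prems] by simp
qed simp

lemma dbar_pair_add:
  assumes "open S" "smooth_on S f" "smooth_on S g" "x \<in> S"
  shows "dbar_pair w u \<alpha> \<beta> (\<lambda>x. f x + g x) x = dbar_pair w u \<alpha> \<beta> f x + dbar_pair w u \<alpha> \<beta> g x"
proof -
  note sf = smooth_funpow_dbar_along[OF assms(1,2), where w = u and k = \<beta>] and sg = smooth_funpow_dbar_along[OF assms(1,3), where w = u and k = \<beta>]
  have "(dbar_along w ^^ \<alpha>) (\<lambda>x. (dbar_along u ^^ \<beta>) f x + (dbar_along u ^^ \<beta>) g x) x = dbar_pair w u \<alpha> \<beta> (\<lambda>x. f x + g x) x"
    unfolding dbar_pair_def
    by (rule funpow_dbar_along_cong[OF assms(1) smooth_on_add[OF assms(1) sf sg] _ assms(4)])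
       (simp add: funpow_dbar_along_add[OF assms(1-3)])
  then show ?thesis using funpow_dbar_along_add[OF assms(1) sf sg assms(4)] by (simp add: dbar_pair_def)
qed

lemma funpow_dbar_along_const: "(dbar_along w ^^ k) (\<lambda>x. c) = (\<lambda>x. if k = 0 then c else 0)"
proof (induction k)
  case (Suc k)
  show ?case unfolding funpow.simps(2) o_apply Suc.IH by (cases "k = 0") (simp_all add: dbar_along_def[abs_def])
qed simp

lemma dbar_pair_const: "dbar_pair w u \<alpha> \<beta> (\<lambda>x. c) x = (if \<alpha> + \<beta> = 0 then c else 0)"
  by (cases "\<beta> = 0") (simp_all add: dbar_pair_def funpow_dbar_along_const)

lemma dbar_pair_sum:
  assumes "open S" "finite I" "\<And>i. i \<in> I \<Longrightarrow> smooth_on S (f i)" "x \<in> S"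
  shows "dbar_pair w u \<alpha> \<beta> (\<lambda>x. \<Sum>i\<in>I. f i x) x = (\<Sum>i\<in>I. dbar_pair w u \<alpha> \<beta> (f i) x)"
  using assms(2,3)
proof (induction I)
  case empty
  then show ?case using dbar_pair_const[of w u \<alpha> \<beta> 0 x] by simp
next
  case (insert i I)
  have "dbar_pair w u \<alpha> \<beta> (\<lambda>x. f i x + (\<Sum>i\<in>I. f i x)) x = dbar_pair w u \<alpha> \<beta> (f i) x + dbar_pair w u \<alpha> \<beta> (\<lambda>x. \<Sum>i\<in>I. f i x) x"
    by (rule dbar_pair_add[OF assms(1) _ smooth_on_sum[OF assms(1)] assms(4)]) (use insert in auto)
  then show ?case using insert by simp
qed

text \<open>
  The Cauchy-Riemann equations. Such factors pass through antiholomorphic derivatives like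
  constants.
\<close>

definition complex_linear_derivs :: "(complex ^ 'n::finite) set \<Rightarrow> (complex ^ 'n \<Rightarrow> complex) \<Rightarrow> bool" where
  "complex_linear_derivs S g \<longleftrightarrow> (\<forall>x\<in>S. \<forall>w. pd (\<i> *s w) g x = \<i> * pd w g x)"

lemma dbar_along_mult_holomorphic:
  assumes "smooth_on S f" "smooth_on S g" "complex_linear_derivs S g" "x \<in> S"
  shows "dbar_along w (\<lambda>x. f x * g x) x = dbar_along w f x * g x"
proof -
  have "pd (\<i> *s w) g x = \<i> * pd w g x" using assms(3,4) by (auto simp: complex_linear_derivs_def)
  then show ?thesis
    unfolding dbar_along_def
    using pd_mult[OF smooth_on_differentiable[OF assms(1,4)] smooth_on_differentiable[OF assms(2,4)]]
    by (simp add: algebra_simps)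
qed

lemma funpow_dbar_along_mult_holomorphic:
  assumes "open S" "smooth_on S f" "smooth_on S g" "complex_linear_derivs S g" "x \<in> S"
  shows "(dbar_along w ^^ k) (\<lambda>x. f x * g x) x = (dbar_along w ^^ k) f x * g x"
  using assms(5)
proof (induction k arbitrary: x)
  case (Suc k)
  note sf = smooth_funpow_dbar_along[OF assms(1,2), where w = w and k = k]
  have "dbar_along w (\<lambda>x. (dbar_along w ^^ k) f x * g x) x = dbar_along w ((dbar_along w ^^ k) (\<lambda>x. f x * g x)) x"
    by (rule dbar_along_cong[OF assms(1) smooth_on_mult[OF assms(1) sf assms(3)] Suc.IH[symmetric] Suc.prems])
  then show ?case using dbar_along_mult_holomorphic[OF sf assms(3,4) Suc.prems] by simp
qed simp

lemma dbar_pair_mult_holomorphic: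
  assumes "open S" "smooth_on S f" "smooth_on S g" "complex_linear_derivs S g" "x \<in> S"
  shows "dbar_pair w u \<alpha> \<beta> (\<lambda>x. f x * g x) x = dbar_pair w u \<alpha> \<beta> f x * g x"
proof -
  note sf = smooth_funpow_dbar_along[OF assms(1,2), where w = u and k = \<beta>]
  have "(dbar_along w ^^ \<alpha>) (\<lambda>x. (dbar_along u ^^ \<beta>) f x * g x) x = dbar_pair w u \<alpha> \<beta> (\<lambda>x. f x * g x) x"
    unfolding dbar_pair_def
    by (rule funpow_dbar_along_cong[OF assms(1) smooth_on_mult[OF assms(1) sf assms(3)] _ assms(5)])
       (simp add: funpow_dbar_along_mult_holomorphic[OF assms(1-4)])
  then show ?thesis using funpow_dbar_along_mult_holomorphic[OF assms(1) sf assms(3-5)] by (simp add: dbar_pair_def)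
qed

text \<open>
  Both real directions \<open>w\<close> and \<open>\<i> w\<close> of the complex line need the same weight; the factor \<open>1 / 2\<close> in
  the definition absorbs the sum of the two terms.
\<close>

lemma dbounded_dbar_along:
  assumes "open S" "x \<in> S" "smooth_on S f" "dbounded (Suc n) E A f x" "(w, \<sigma>) \<in> E" "(\<i> *s w, \<sigma>) \<in> E"
  shows "dbounded n E (A / \<sigma>) (dbar_along w f) x"
proof -
  have s: "smooth_on S (pd w f)" "smooth_on S (pd (\<i> *s w) f)" using smooth_on_pd[OF assms(3)] by auto
  have "dbounded n E (norm (1/2::complex) * (A / \<sigma> + norm \<i> * (A / \<sigma>))) (dbar_along w f) x"
    unfolding dbar_along_def[abs_def]
    by (intro dbounded_bounded_linear[OF assms(1,2) bounded_linear_mult_right] dbounded_add[OF assms(1,2)]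
        smooth_on_add[OF assms(1)] smooth_on_mult[OF assms(1)] smooth_on_const s
        dbounded_pd[OF assms(4,5)] dbounded_pd[OF assms(4,6)]) (auto simp: norm_mult)
  then show ?thesis by (simp add: norm_divide)
qed

lemma dbounded_funpow_dbar_along:
  assumes "open S" "x \<in> S" "smooth_on S f" "dbounded (k + n) E A f x" "(w, \<sigma>) \<in> E" "(\<i> *s w, \<sigma>) \<in> E"
  shows "dbounded n E (A / \<sigma> ^ k) ((dbar_along w ^^ k) f) x"
  using assms(4)
proof (induction k arbitrary: n)
  case (Suc k)
  have "dbounded (Suc n) E (A / \<sigma> ^ k) ((dbar_along w ^^ k) f) x"
    by (rule Suc.IH) (use Suc.prems in \<open>simp only: add_Suc_right add_Suc\<close>)
  from dbounded_dbar_along[OF assms(1,2) smooth_funpow_dbar_along[OF assms(1,3)] this assms(5,6)]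
  show ?case by (simp add: mult.commute)
qed simp

lemma dbounded_dbar_pair:
  assumes "open S" "x \<in> S" "smooth_on S f" "dbounded (\<beta> + \<alpha>) E A f x"
    "(w, \<sigma>) \<in> E" "(\<i> *s w, \<sigma>) \<in> E" "(u, \<tau>) \<in> E" "(\<i> *s u, \<tau>) \<in> E"
  shows "norm (dbar_pair w u \<alpha> \<beta> f x) \<le> A / (\<tau> ^ \<beta> * \<sigma> ^ \<alpha>)"
proof -
  have "dbounded (\<alpha> + 0) E (A / \<tau> ^ \<beta>) ((dbar_along u ^^ \<beta>) f) x"
    using dbounded_funpow_dbar_along[OF assms(1-4,7,8)] by simp
  from dbounded_funpow_dbar_along[OF assms(1,2) smooth_funpow_dbar_along[OF assms(1,3)] this assms(5,6)]
  show ?thesis by (simp add: dbar_pair_def)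
qed

section \<open>Divided differences and Lagrange interpolation\<close>

text \<open>
  The symmetric formula for the divided difference of \<open>h\<close> with node set \<open>A\<close>, which shows that the
  order of the nodes is irrelevant.
\<close>

definition divided_diff_sum :: "('a::field \<Rightarrow> 'a) \<Rightarrow> 'a set \<Rightarrow> 'a" where
  "divided_diff_sum h A = (\<Sum>x\<in>A. h x / (\<Prod>y\<in>A - {x}. x - y))"

lemma divided_diff_sum_insert:
  assumes "finite B" "a \<notin> B"
  shows "divided_diff_sum h (insert a B) = h a / (\<Prod>y\<in>B. a - y) + (\<Sum>x\<in>B. h x / ((x - a) * (\<Prod>y\<in>B - {x}. x - y)))"
proof -
  have "(\<Prod>y\<in>insert a B - {x}. x - y) = (x - a) * (\<Prod>y\<in>B - {x}. x - y)" if "x \<in> B" for x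
  proof -
    have "insert a B - {x} = insert a (B - {x})" using that assms by auto
    then show ?thesis using assms by simp
  qed
  moreover have "insert a B - {a} = B" using assms by auto
  ultimately show ?thesis using assms by (simp add: divided_diff_sum_def)
qed

text \<open>
  The recursion of divided differences holds for the symmetric formula: for a node \<open>x\<close> other than
  \<open>a\<close> and \<open>z\<close>, the terms combine by \<open>1 / (x - a) - 1 / (x - z) = (a - z) / ((x - a) (x - z))\<close>.
\<close>

lemma divided_diff_sum_recursion:
  assumes "finite A" "a \<in> A" "z \<in> A" "a \<noteq> z"
  shows "(divided_diff_sum h (A - {z}) - divided_diff_sum h (A - {a})) / (a - z) = divided_diff_sum h A"
proof -
  define B where "B = A - {a, z}"
  have B: "finite B" "a \<notin> B" "z \<notin> B" and eqs: "A - {z} = insert a B" "A - {a} = insert z B" "A = insert a (insert z B)"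
    using assms by (auto simp: B_def)
  let ?P = "\<lambda>x. \<Prod>y\<in>B - {x}. x - y"
  have 3: "divided_diff_sum h A = h a / ((a - z) * (\<Prod>y\<in>B. a - y)) + (h z / ((z - a) * (\<Prod>y\<in>B. z - y))
      + (\<Sum>x\<in>B. h x / ((x - a) * ((x - z) * ?P x))))"
  proof -
    have "insert z B - {x} = insert z (B - {x})" if "x \<in> B" for x using that B by auto
    then have "(\<Prod>y\<in>insert z B - {x}. x - y) = (x - z) * ?P x" if "x \<in> B" for x using that B by simp
    moreover have "insert z B - {z} = B" using B by auto
    ultimately show ?thesis unfolding eqs(3) using B assms(4) by (subst divided_diff_sum_insert) auto
  qed
  have t: "(h x / ((x - a) * ?P x) - h x / ((x - z) * ?P x)) / (a - z) = h x / ((x - a) * ((x - z) * ?P x))" if "x \<in> B" for x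
  proof -
    have "?P x \<noteq> 0" "x - a \<noteq> 0" "x - z \<noteq> 0" "a - z \<noteq> 0" using B that assms by auto
    then show ?thesis by (simp add: divide_simps) (simp add: algebra_simps)
  qed
  have "(divided_diff_sum h (A - {z}) - divided_diff_sum h (A - {a})) / (a - z)
    = (h a / (\<Prod>y\<in>B. a - y)) / (a - z) - (h z / (\<Prod>y\<in>B. z - y)) / (a - z)
      + (\<Sum>x\<in>B. (h x / ((x - a) * ?P x) - h x / ((x - z) * ?P x)) / (a - z))"
    unfolding eqs(1,2) divided_diff_sum_insert[OF B(1,2)] divided_diff_sum_insert[OF B(1,3)] sum_subtractf sum_divide_distrib[symmetric]
    by (simp add: add_divide_distrib diff_divide_distrib)
  also have "(\<Sum>x\<in>B. (h x / ((x - a) * ?P x) - h x / ((x - z) * ?P x)) / (a - z)) = (\<Sum>x\<in>B. h x / ((x - a) * ((x - z) * ?P x)))"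
    by (rule sum.cong[OF refl t])
  also have "(h z / (\<Prod>y\<in>B. z - y)) / (a - z) = - (h z / ((z - a) * (\<Prod>y\<in>B. z - y)))"
    by (metis (no_types, opaque_lifting) divide_divide_eq_left minus_diff_eq minus_divide_right mult.commute mult_minus_left)
  also have "(h a / (\<Prod>y\<in>B. a - y)) / (a - z) = h a / ((a - z) * (\<Prod>y\<in>B. a - y))"
    by (simp add: mult.commute)
  finally show ?thesis using 3 by simp
qed

lemma divided_difference_eq_divided_diff_sum:
  assumes "distinct ls" "ls \<noteq> []"
  shows "divided_difference h ls = divided_diff_sum h (set ls)"
  using assms
proof (induction h ls rule: divided_difference.induct)
  case (2 h a) then show ?case by (simp add: divided_diff_sum_def)
next
  case (3 h a b r)
  let ?ls = "a # b # r"
  have "set (butlast ?ls) = set ?ls - {last ?ls}"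
  proof -
    have e: "?ls = butlast ?ls @ [last ?ls]" by simp
    then have "last ?ls \<notin> set (butlast ?ls)" using 3(3) by (metis distinct_append disjoint_iff list.set_intros(1))
    then show ?thesis using e by (metis Diff_insert_absorb insert_is_Un set_append sup_commute list.simps(15) list.set(1))
  qed
  moreover have "set (tl ?ls) = set ?ls - {hd ?ls}" using 3(3) by auto
  moreover have "hd ?ls \<noteq> last ?ls" using 3(3) by auto
  moreover have "divided_difference h (butlast ?ls) = divided_diff_sum h (set (butlast ?ls))"
    using 3(1,3) distinct_butlast[of ?ls] by simp
  moreover have "divided_difference h (tl ?ls) = divided_diff_sum h (set (tl ?ls))" using 3(2,3) by simp
  ultimately show ?case
    using divided_diff_sum_recursion[of "set ?ls" "hd ?ls" "last ?ls" h] by (metis divided_difference.simps(3) List.finite_set hd_in_set last_in_set list.distinct(1))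
qed simp

definition lagrange :: "('a::field \<Rightarrow> 'a) \<Rightarrow> 'a set \<Rightarrow> 'a \<Rightarrow> 'a" where
  "lagrange h A y = (\<Sum>x\<in>A. h x * (\<Prod>k\<in>A - {x}. (y - k) / (x - k)))"

text \<open>
  Newton's form of the interpolation polynomial: adding a node adds the divided difference times the
  nodal polynomial of the old nodes.
\<close>

lemma lagrange_insert:
  assumes "finite A" "x \<notin> A"
  shows "lagrange h (insert x A) y = lagrange h A y + divided_diff_sum h (insert x A) * (\<Prod>a\<in>A. y - a)"
proof -
  let ?Q = "\<lambda>a. \<Prod>k\<in>A - {a}. (y - k) / (a - k)"
  have 1: "lagrange h (insert x A) y = h x * (\<Prod>k\<in>A. (y - k) / (x - k)) + (\<Sum>a\<in>A. h a * ((y - x) / (a - x) * ?Q a))"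
  proof -
    have "insert x A - {a} = insert x (A - {a})" if "a \<in> A" for a using that assms by auto
    then have "(\<Prod>k\<in>insert x A - {a}. (y - k) / (a - k)) = (y - x) / (a - x) * ?Q a" if "a \<in> A" for a
      using that assms by simp
    moreover have "insert x A - {x} = A" using assms by auto
    ultimately show ?thesis using assms by (simp add: lagrange_def)
  qed
  have 2: "h a * ((y - x) / (a - x) * ?Q a) = h a * ?Q a + h a / ((a - x) * (\<Prod>k\<in>A - {a}. a - k)) * (\<Prod>a\<in>A. y - a)"
    if a: "a \<in> A" for a
  proof -
    have "(\<Prod>a\<in>A. y - a) = (y - a) * (\<Prod>k\<in>A - {a}. y - k)" using a assms by (simp add: prod.remove)
    moreover have "a - x \<noteq> 0" "(\<Prod>k\<in>A - {a}. a - k) \<noteq> 0" using a assms by auto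
    moreover have "?Q a = (\<Prod>k\<in>A - {a}. y - k) / (\<Prod>k\<in>A - {a}. a - k)" by (rule prod_dividef)
    ultimately show ?thesis by (simp add: divide_simps) (simp add: algebra_simps)
  qed
  have "(\<Sum>a\<in>A. h a * ((y - x) / (a - x) * ?Q a)) = lagrange h A y
      + (\<Sum>a\<in>A. h a / ((a - x) * (\<Prod>k\<in>A - {a}. a - k))) * (\<Prod>a\<in>A. y - a)"
    unfolding lagrange_def sum_distrib_right sum.distrib[symmetric] by (rule sum.cong[OF refl 2])
  then show ?thesis unfolding 1 divided_diff_sum_insert[OF assms] by (simp add: prod_dividef algebra_simps)
qed

lemma lagrange_node:
  assumes "finite A" "y \<in> A"
  shows "lagrange h A y = h y"
proof -
  have "h x * (\<Prod>k\<in>A - {x}. (y - k) / (x - k)) = (if x = y then h y else 0)" if "x \<in> A" for x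
  proof (cases "x = y")
    case False
    then have "(\<Prod>k\<in>A - {x}. (y - k) / (x - k)) = 0" using assms by (auto intro!: prod_zero)
    then show ?thesis using False by simp
  next
    case True
    have "(\<Prod>k\<in>A - {x}. (y - k) / (x - k)) = 1" by (rule prod.neutral) (use True in auto)
    then show ?thesis using True by simp
  qed
  then have "lagrange h A y = (\<Sum>x\<in>A. if x = y then h y else 0)" unfolding lagrange_def by (rule sum.cong[OF refl])
  then show ?thesis using assms by simp
qed

text \<open>
  In Newton's form every node contributes one divided difference of order \<open>k\<close> times a product of \<open>k\<close>
  distances, each at most \<open>t\<close>. The weights \<open>t ^ k\<close> in the hypothesis are exactly those of \<open>c_infty\<close>.
\<close>

lemma lagrange_norm_le:
  fixes h :: "complex \<Rightarrow> complex" and c :: real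
  assumes "finite A" "0 < t" "\<And>x. x \<in> A \<Longrightarrow> norm (y - x) \<le> t"
    and dd: "\<And>ls. ls \<noteq> [] \<Longrightarrow> distinct ls \<Longrightarrow> set ls \<subseteq> A \<Longrightarrow>
        norm (divided_difference h ls) * t ^ (length ls - 1) \<le> c"
  shows "norm (lagrange h A y) \<le> card A * c"
  using assms(1,3,4)
proof (induction A)
  case empty show ?case by (simp add: lagrange_def)
next
  case (insert x A)
  obtain ls where ls: "set ls = insert x A" "distinct ls" using finite_distinct_list insert.hyps(1) by (metis finite_insert)
  have ne: "ls \<noteq> []" using ls by auto
  have len: "length ls - 1 = card A" using ls insert.hyps distinct_card[of ls] by simp
  have 1: "norm (divided_diff_sum h (insert x A)) * t ^ card A \<le> c"
    using insert.prems(2)[OF ne ls(2)] ls divided_difference_eq_divided_diff_sum[OF ls(2) ne, of h] len by simp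
  have 2: "norm (\<Prod>a\<in>A. y - a) \<le> t ^ card A"
  proof -
    have "(\<Prod>a\<in>A. norm (y - a)) \<le> (\<Prod>a\<in>A. t)" by (rule prod_mono) (use insert.prems(1) in auto)
    then show ?thesis by (simp add: prod_norm)
  qed
  have "norm (lagrange h (insert x A) y) \<le> norm (lagrange h A y) + norm (divided_diff_sum h (insert x A)) * norm (\<Prod>a\<in>A. y - a)"
    unfolding lagrange_insert[OF insert.hyps] by (metis norm_mult norm_triangle_ineq)
  also have "\<dots> \<le> card A * c + norm (divided_diff_sum h (insert x A)) * t ^ card A"
    using insert by (intro add_mono mult_left_mono 2) auto
  also have "\<dots> \<le> card (insert x A) * c" using 1 insert.hyps by (simp add: algebra_simps)
  finally show ?case .
qed

section \<open>Circle integrals with parameters\<close>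

lemma circle_integral_eq:
  "contour_integral (circlepath z r) f =
     integral (cbox 0 1) (\<lambda>s. f (circlepath z r s) * (2 * pi * \<i> * r * exp (2 * of_real pi * \<i> * s)))"
  unfolding contour_integral_integral vector_derivative_circlepath by simp

lemma continuous_circle_kernel:
  "continuous_on A (\<lambda>q. 2 * pi * \<i> * r * exp (2 * of_real pi * \<i> * of_real (snd q)))"
  "continuous_on T (\<lambda>s. 2 * pi * \<i> * r * exp (2 * of_real pi * \<i> * of_real s))"
proof -
  have k: "continuous_on UNIV (\<lambda>s. 2 * pi * \<i> * r * exp (2 * of_real pi * \<i> * of_real s))"
    by (intro continuous_intros)
  then show "continuous_on A (\<lambda>q. 2 * pi * \<i> * r * exp (2 * of_real pi * \<i> * of_real (snd q)))"
    by (rule continuous_on_compose2[OF _ continuous_on_snd[OF continuous_on_id]]) simp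
  show "continuous_on T (\<lambda>s. 2 * pi * \<i> * r * exp (2 * of_real pi * \<i> * of_real s))"
    using k by (rule continuous_on_subset) simp
qed

lemma continuous_circle_integral:
  fixes H :: "'a::topological_space \<Rightarrow> complex \<Rightarrow> complex"
  assumes "continuous_on (P \<times> sphere z r) (\<lambda>(p, x). H p x)" "0 \<le> r"
  shows "continuous_on P (\<lambda>p. contour_integral (circlepath z r) (H p))"
  unfolding circle_integral_eq
proof (rule integral_continuous_on_param)
  have c: "continuous_on (P \<times> cbox 0 1) (\<lambda>q. (fst q, circlepath z r (snd q)))"
    unfolding circlepath by (intro continuous_intros)
  have im: "(\<lambda>q. (fst q, circlepath z r (snd q))) ` (P \<times> cbox 0 1) \<subseteq> P \<times> sphere z r"
    using path_image_circlepath_nonneg[OF assms(2), of z] by (auto simp: path_image_def)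
  have "continuous_on (P \<times> cbox 0 1) (\<lambda>q. H (fst q) (circlepath z r (snd q)) * (2 * pi * \<i> * r * exp (2 * of_real pi * \<i> * of_real (snd q))))"
  proof (rule continuous_on_mult)
    show "continuous_on (P \<times> cbox 0 1) (\<lambda>q. H (fst q) (circlepath z r (snd q)))"
      using continuous_on_compose2[OF assms(1) c im] by (simp add: case_prod_beta)
  qed (rule continuous_circle_kernel)
  then show "continuous_on (P \<times> cbox 0 1) (\<lambda>(p, s). H p (circlepath z r s) * (2 * pi * \<i> * r * exp (2 * of_real pi * \<i> * s)))"
    by (simp add: case_prod_beta)
qed

text \<open>
  Cauchy's formula for the derivative exhibits it as a circle integral, which depends continuously
  on the parameter.
\<close>

lemma continuous_deriv_param:
  fixes K :: "complex \<Rightarrow> 'a::t2_space \<Rightarrow> complex"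
  assumes "open U" "continuous_on (U \<times> T) (\<lambda>(l, t). K l t)" "\<And>t. t \<in> T \<Longrightarrow> (\<lambda>l. K l t) holomorphic_on U"
  shows "continuous_on (U \<times> T) (\<lambda>(l, t). deriv (\<lambda>l. K l t) l)"
proof (clarsimp simp: continuous_on_eq_continuous_within)
  fix l0 t0 assume lt: "l0 \<in> U" "t0 \<in> T"
  obtain e where e: "e > 0" "cball l0 e \<subseteq> U" using assms(1) lt open_contains_cball by blast
  let ?J = "\<lambda>p. 1 / (2 * of_real pi * \<i>) * contour_integral (circlepath l0 e) (\<lambda>x. K x (snd p) / (x - fst p)^2)"
  have eq: "?J p = deriv (\<lambda>l. K l (snd p)) (fst p)" if "p \<in> ball l0 e \<times> T" for p
  proof -
    have h: "(\<lambda>l. K l (snd p)) holomorphic_on cball l0 e"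
      using assms(3)[of "snd p"] that e(2) holomorphic_on_subset by auto
    have "((\<lambda>l. K l (snd p)) has_field_derivative ?J p) (at (fst p))"
      using Cauchy_derivative_integral_circlepath(2)[OF holomorphic_on_imp_continuous_on[OF h] holomorphic_on_subset[OF h ball_subset_cball]] that
      by auto
    then show ?thesis by (simp add: DERIV_imp_deriv)
  qed
  have "continuous_on (ball l0 e \<times> T) ?J"
  proof (intro continuous_on_mult continuous_on_const continuous_circle_integral)
    have c: "continuous_on ((ball l0 e \<times> T) \<times> sphere l0 e) (\<lambda>q. (snd q, snd (fst q)))"
      by (intro continuous_intros)
    have im: "(\<lambda>q. (snd q, snd (fst q))) ` ((ball l0 e \<times> T) \<times> sphere l0 e) \<subseteq> U \<times> T"
      using e(2) by auto
    have "continuous_on ((ball l0 e \<times> T) \<times> sphere l0 e) (\<lambda>q. K (snd q) (snd (fst q)) / (snd q - fst (fst q))^2)"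
      using continuous_on_compose2[OF assms(2) c im] by (intro continuous_intros) (auto simp: case_prod_beta)
    then show "continuous_on ((ball l0 e \<times> T) \<times> sphere l0 e) (\<lambda>(p, x). K x (snd p) / (x - fst p)^2)"
      by (simp add: case_prod_beta)
  qed (use e in auto)
  then have "continuous_on (ball l0 e \<times> T) (\<lambda>p. deriv (\<lambda>l. K l (snd p)) (fst p))"
    by (rule continuous_on_eq) (rule eq)
  then have "continuous (at (l0, t0) within ball l0 e \<times> T) (\<lambda>(l, t). deriv (\<lambda>l. K l t) l)"
    using lt e by (simp add: continuous_on_eq_continuous_within case_prod_unfold)
  moreover have "at (l0, t0) within ball l0 e \<times> T = at (l0, t0) within U \<times> T"
  proof (rule at_within_nhd[of _ "ball l0 e \<times> UNIV"])
    show "open (ball l0 e \<times> (UNIV :: 'a set))" by (simp add: open_Times)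
    show "ball l0 e \<times> T \<inter> ball l0 e \<times> UNIV - {(l0, t0)} = U \<times> T \<inter> ball l0 e \<times> UNIV - {(l0, t0)}"
      using e(2) by auto
  qed (use e in auto)
  ultimately show "continuous (at (l0, t0) within U \<times> T) (\<lambda>(l, t). deriv (\<lambda>l. K l t) l)" by simp
qed

text \<open>
  Differentiation under the integral sign is available on convex sets; holomorphy is a local
  property, so that balls suffice for an arbitrary open set.
\<close>

lemma holomorphic_circle_integral:
  assumes "open U" "continuous_on (U \<times> sphere z r) (\<lambda>(p, x). H p x)" "0 \<le> r"
    "\<And>x. x \<in> sphere z r \<Longrightarrow> (\<lambda>p. H p x) holomorphic_on U"
  shows "(\<lambda>p. contour_integral (circlepath z r) (H p)) holomorphic_on U"
proof -
  have loc: "(\<lambda>p. contour_integral (circlepath z r) (H p)) holomorphic_on B"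
    if B: "open B" "convex B" "B \<subseteq> U" for B
    unfolding circle_integral_eq
  proof (rule leibniz_rule_holomorphic)
    let ?k = "\<lambda>s::real. 2 * pi * \<i> * r * exp (2 * of_real pi * \<i> * s)"
    have circ: "circlepath z r s \<in> sphere z r" if "s \<in> cbox 0 1" for s
      using path_image_circlepath_nonneg[OF assms(3), of z] that by (auto simp: path_image_def)
    show "((\<lambda>p. H p (circlepath z r s) * ?k s) has_field_derivative deriv (\<lambda>p. H p (circlepath z r s)) p * ?k s) (at p within B)"
      if "p \<in> B" "s \<in> cbox 0 1" for p s
    proof -
      have "((\<lambda>p. H p (circlepath z r s)) has_field_derivative deriv (\<lambda>p. H p (circlepath z r s)) p) (at p)"
        using holomorphic_derivI[OF assms(4)[OF circ[OF that(2)]] assms(1)] that(1) B(3) by blast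
      then show ?thesis by (intro DERIV_cmult_right) (rule has_field_derivative_at_within)
    qed
    have c: "continuous_on (B \<times> cbox 0 1) (\<lambda>q. (fst q, circlepath z r (snd q)))"
      unfolding circlepath by (intro continuous_intros)
    have im: "(\<lambda>q. (fst q, circlepath z r (snd q))) ` (B \<times> cbox 0 1) \<subseteq> U \<times> sphere z r"
      using circ B by auto
    show "(\<lambda>s. H p (circlepath z r s) * ?k s) integrable_on cbox 0 1" if "p \<in> B" for p
    proof (rule integrable_continuous)
      have c': "continuous_on (cbox 0 1) (\<lambda>s. (p, circlepath z r s))"
        unfolding circlepath by (intro continuous_intros)
      have im': "(\<lambda>s. (p, circlepath z r s)) ` cbox 0 1 \<subseteq> U \<times> sphere z r" using circ B that by auto
      show "continuous_on (cbox 0 1) (\<lambda>s. H p (circlepath z r s) * ?k s)"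
        using continuous_on_compose2[OF assms(2) c' im']
        by (intro continuous_on_mult continuous_circle_kernel) (simp add: case_prod_beta)
    qed
    have "continuous_on (B \<times> cbox 0 1) (\<lambda>q. deriv (\<lambda>p. H p (circlepath z r (snd q))) (fst q) * ?k (snd q))"
      using continuous_on_compose2[OF continuous_deriv_param[OF assms(1,2,4)] c im]
      by (intro continuous_on_mult continuous_circle_kernel) (simp_all add: case_prod_beta)
    then show "continuous_on (B \<times> cbox 0 1) (\<lambda>(p, s). deriv (\<lambda>p. H p (circlepath z r s)) p * ?k s)"
      by (simp add: case_prod_beta)
    show "convex B" by (rule B(2))
  qed
  have "(\<lambda>p. contour_integral (circlepath z r) (H p)) field_differentiable (at x within U)" if x: "x \<in> U" for x
  proof -
    obtain e where e: "e > 0" "ball x e \<subseteq> U" using assms(1) x open_contains_ball by blast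
    show ?thesis
      using holomorphic_on_imp_differentiable_at[OF loc[OF open_ball convex_ball e(2)] open_ball, of x] e(1)
      by (simp add: field_differentiable_at_within)
  qed
  then show ?thesis unfolding holomorphic_on_def by blast
qed

section \<open>Zeros of holomorphic functions that depend on a parameter\<close>

text \<open>
  The argument principle with a weight \<open>h\<close>. It is applied on a slightly larger disc, since the zeros
  are to be finite in an open set that contains the circle.
\<close>

lemma zeros_in_circle:
  assumes f: "f holomorphic_on ball 0 B" and h: "h holomorphic_on ball 0 B"
    and e: "0 < e" "norm x0 + e < B" and nz: "\<And>x. x \<in> sphere x0 e \<Longrightarrow> f x \<noteq> 0"
  shows "finite {x \<in> ball x0 e. f x = 0}"
    "\<And>x. x \<in> ball x0 e \<Longrightarrow> f x = 0 \<Longrightarrow> zorder f x > 0"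
    "contour_integral (circlepath x0 e) (\<lambda>x. deriv f x * h x / f x)
       = 2 * pi * \<i> * (\<Sum>x | x \<in> ball x0 e \<and> f x = 0. h x * of_int (zorder f x))"
proof -
  define e' where "e' = (e + (B - norm x0)) / 2"
  have e': "e < e'" "norm x0 + e' < B" using e by (auto simp: e'_def field_simps)
  have sub: "cball x0 e' \<subseteq> ball 0 B"
  proof
    fix x assume "x \<in> cball x0 e'"
    then have "norm (x - x0) \<le> e'" by (simp add: dist_norm norm_minus_commute)
    then have "norm x < B" using e'(2) norm_triangle_sub[of x x0] by linarith
    then show "x \<in> ball 0 B" by simp
  qed
  have sub': "ball x0 e' \<subseteq> ball 0 B" using sub ball_subset_cball by blast
  have x1: "x0 + of_real e \<in> sphere x0 e" using e by (simp add: dist_norm)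
  have nc: "\<exists>w\<in>ball 0 B. f w \<noteq> 0"
  proof -
    have "x0 + of_real e \<in> cball x0 e'" using e e' by (simp add: dist_norm)
    then have "x0 + of_real e \<in> ball 0 B" using sub by blast
    then show ?thesis using nz[OF x1] by blast
  qed
  have fin: "finite {x \<in> cball x0 e'. f x = 0}"
  proof (cases "f constant_on ball 0 B")
    case True
    then obtain c where c: "\<And>x. x \<in> ball 0 B \<Longrightarrow> f x = c" by (auto simp: constant_on_def)
    with nc have "c \<noteq> 0" by auto
    then have e0: "{x \<in> cball x0 e'. f x = 0} = {}" using c sub by auto
    show ?thesis unfolding e0 by simp
  next
    case False
    show ?thesis by (rule holomorphic_compact_finite_zeros[OF f open_ball connected_ball compact_cball sub False])
  qed
  have b: "ball x0 e \<subseteq> ball x0 e'" using e' by (simp add: subset_ball)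
  then show "finite {x \<in> ball x0 e. f x = 0}"
    by (intro finite_subset[OF _ fin]) (use ball_subset_cball in blast)
  show "zorder f x > 0" if "x \<in> ball x0 e" "f x = 0" for x
  proof -
    have xB: "x \<in> ball 0 B" using that b sub' by blast
    from zorder_exist_zero[OF f open_ball connected_ball xB nc] that(2) show ?thesis by simp
  qed
  let ?pz = "{w \<in> ball x0 e'. f w = 0 \<or> w \<in> {}}"
  let ?g = "circlepath x0 e"
  have pz: "finite ?pz" by (rule finite_subset[OF _ fin]) (use ball_subset_cball in auto)
  have img: "path_image ?g = sphere x0 e" using e by simp
  have w0: "winding_number ?g z = 0" if "z \<notin> cball x0 e" for z
    by (rule winding_number_zero_outside[of _ "cball x0 e"]) (use that e in \<open>auto simp: img\<close>)
  have "contour_integral ?g (\<lambda>x. deriv f x * h x / f x) = 2 * pi * \<i> * (\<Sum>p\<in>?pz. winding_number ?g p * h p * zorder f p)"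
  proof (rule argument_principle)
    show "path_image ?g \<subseteq> ball x0 e' - ?pz" unfolding img using nz e' by auto
    show "\<forall>z. z \<notin> ball x0 e' \<longrightarrow> winding_number ?g z = 0" using w0 e' by auto
    show "f holomorphic_on ball x0 e' - {}" using holomorphic_on_subset[OF f sub'] by simp
    show "h holomorphic_on ball x0 e'" by (rule holomorphic_on_subset[OF h sub'])
  qed (use pz in auto)
  also have "(\<Sum>p\<in>?pz. winding_number ?g p * h p * zorder f p)
      = (\<Sum>x | x \<in> ball x0 e \<and> f x = 0. winding_number ?g x * h x * zorder f x)"
  proof (rule sum.mono_neutral_right[OF pz])
    show "{x. x \<in> ball x0 e \<and> f x = 0} \<subseteq> ?pz" using b by auto
    show "\<forall>p \<in> ?pz - {x. x \<in> ball x0 e \<and> f x = 0}. winding_number ?g p * h p * zorder f p = 0"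
    proof
      fix p assume p: "p \<in> ?pz - {x. x \<in> ball x0 e \<and> f x = 0}"
      then have "p \<notin> sphere x0 e" using nz by auto
      with p have "p \<notin> cball x0 e" by auto
      then show "winding_number ?g p * h p * zorder f p = 0" using w0 by simp
    qed
  qed
  also have "\<dots> = (\<Sum>x | x \<in> ball x0 e \<and> f x = 0. h x * of_int (zorder f x))"
    by (rule sum.cong) (auto simp: winding_number_circlepath dist_norm norm_minus_commute)
  finally show "contour_integral ?g (\<lambda>x. deriv f x * h x / f x)
       = 2 * pi * \<i> * (\<Sum>x | x \<in> ball x0 e \<and> f x = 0. h x * of_int (zorder f x))" .
qed

lemma int_valued_constant:
  fixes f :: "'a::topological_space \<Rightarrow> complex"
  assumes "connected S" "continuous_on S f" "\<And>x. x \<in> S \<Longrightarrow> f x \<in> \<int>" "x \<in> S" "y \<in> S"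
  shows "f x = f y"
proof -
  have "f constant_on S"
  proof (rule continuous_discrete_range_constant[OF assms(1,2)])
    fix x assume x: "x \<in> S"
    have "1 \<le> norm (f y - f x)" if y: "y \<in> S" "f y \<noteq> f x" for y
    proof -
      have "f y - f x \<in> \<int>" using assms(3) x y by (intro Ints_diff) auto
      then obtain k where k: "f y - f x = of_int k" by (auto elim: Ints_cases)
      with y have "k \<noteq> 0" by auto
      then show ?thesis unfolding k by simp
    qed
    then show "\<exists>e>0. \<forall>y. y \<in> S \<and> f y \<noteq> f x \<longrightarrow> e \<le> norm (f y - f x)" by (intro exI[of _ 1]) auto
  qed
  then show ?thesis using assms(4,5) by (auto simp: constant_on_def)
qed

text \<open>
  Holomorphy in two variables, in the form in which the argument principle with a parameter uses it.
\<close>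

definition sep_holomorphic :: "real \<Rightarrow> real \<Rightarrow> (complex \<Rightarrow> complex \<Rightarrow> complex) \<Rightarrow> bool" where
  "sep_holomorphic a B F \<longleftrightarrow> continuous_on (ball 0 a \<times> ball 0 B) (\<lambda>(l, m). F l m) \<and>
     (\<forall>m\<in>ball 0 B. (\<lambda>l. F l m) holomorphic_on ball 0 a) \<and> (\<forall>l\<in>ball 0 a. F l holomorphic_on ball 0 B)"

lemma sep_holomorphic_deriv:
  assumes "sep_holomorphic a B F"
  shows "continuous_on (ball 0 a \<times> ball 0 B) (\<lambda>(l, m). deriv (F l) m)"
    "\<And>m. m \<in> ball 0 B \<Longrightarrow> (\<lambda>l. deriv (F l) m) holomorphic_on ball 0 a"
proof -
  have cF: "continuous_on (ball 0 a \<times> ball 0 B) (\<lambda>(l, m). F l m)"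
    and h1: "\<And>m. m \<in> ball 0 B \<Longrightarrow> (\<lambda>l. F l m) holomorphic_on ball 0 a"
    and h2: "\<And>l. l \<in> ball 0 a \<Longrightarrow> F l holomorphic_on ball 0 B"
    using assms by (auto simp: sep_holomorphic_def)
  have swap: "continuous_on (A \<times> C) (\<lambda>(x, y). g y x)" if "continuous_on (C \<times> A) (\<lambda>(y, x). g y x)"
    for g :: "complex \<Rightarrow> complex \<Rightarrow> complex" and A C
  proof -
    have "prod.swap ` (A \<times> C) \<subseteq> C \<times> A" by auto
    from continuous_on_compose2[OF that continuous_on_swap this] show ?thesis by (simp add: case_prod_beta)
  qed
  have "continuous_on (ball 0 B \<times> ball 0 a) (\<lambda>(m, l). deriv (\<lambda>m. F l m) m)"
    by (rule continuous_deriv_param[OF open_ball swap[OF cF] h2])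
  from swap[OF this] show "continuous_on (ball 0 a \<times> ball 0 B) (\<lambda>(l, m). deriv (F l) m)" by simp
  show "(\<lambda>l. deriv (F l) m) holomorphic_on ball 0 a" if m: "m \<in> ball 0 B" for m
  proof -
    obtain e where e: "e > 0" "cball m e \<subseteq> ball 0 B" using m open_contains_cball open_ball by metis
    have "(\<lambda>l. contour_integral (circlepath m e) (\<lambda>x. F l x / (x - m)^2)) holomorphic_on ball 0 a"
    proof (rule holomorphic_circle_integral[OF open_ball])
      have "continuous_on (ball 0 a \<times> sphere m e) (\<lambda>q. F (fst q) (snd q) / (snd q - m)^2)"
      proof (intro continuous_on_divide continuous_on_power continuous_on_diff continuous_on_const
          continuous_on_snd[OF continuous_on_id])
        have "ball 0 a \<times> sphere m e \<subseteq> ball 0 a \<times> ball 0 B" using e(2) sphere_cball by blast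
        from continuous_on_subset[OF cF this]
        show "continuous_on (ball 0 a \<times> sphere m e) (\<lambda>q. F (fst q) (snd q))" by (simp add: case_prod_unfold)
      qed (use e in auto)
      then show "continuous_on (ball 0 a \<times> sphere m e) (\<lambda>(l, x). F l x / (x - m)^2)" by (simp add: case_prod_beta)
      show "(\<lambda>l. F l x / (x - m)^2) holomorphic_on ball 0 a" if "x \<in> sphere m e" for x
        using h1[of x] that e by (intro holomorphic_intros) auto
    qed (use e in auto)
    then have "(\<lambda>l. 1 / (2 * of_real pi * \<i>) * contour_integral (circlepath m e) (\<lambda>x. F l x / (x - m)^2)) holomorphic_on ball 0 a"
      by (intro holomorphic_intros)
    moreover have "1 / (2 * of_real pi * \<i>) * contour_integral (circlepath m e) (\<lambda>x. F l x / (x - m)^2) = deriv (F l) m"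
      if "l \<in> ball 0 a" for l
    proof -
      have h: "F l holomorphic_on cball m e" using h2[OF that] e(2) by (rule holomorphic_on_subset)
      show ?thesis
        using Cauchy_derivative_integral_circlepath(2)[OF holomorphic_on_imp_continuous_on[OF h] holomorphic_on_subset[OF h ball_subset_cball], of m] e
        by (simp add: DERIV_imp_deriv)
    qed
    ultimately show ?thesis by (rule holomorphic_transform)
  qed
qed

text \<open>
  As long as no zero crosses the circle, the weighted sum of the zeros inside is the circle integral
  of \<open>F' h / F\<close>, in which \<open>l\<close> enters holomorphically.
\<close>

lemma weighted_zero_sum_holomorphic:
  assumes F: "sep_holomorphic a B F" and L: "open L" "L \<subseteq> ball 0 a"
    and e: "0 < e" "norm x0 + e < B" and nz: "\<And>l x. l \<in> L \<Longrightarrow> x \<in> sphere x0 e \<Longrightarrow> F l x \<noteq> 0"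
    and h: "h holomorphic_on ball 0 B"
  shows "(\<lambda>l. \<Sum>x | x \<in> ball x0 e \<and> F l x = 0. h x * of_int (zorder (F l) x)) holomorphic_on L"
proof -
  have cF: "continuous_on (ball 0 a \<times> ball 0 B) (\<lambda>(l, m). F l m)"
    and h1: "\<And>m. m \<in> ball 0 B \<Longrightarrow> (\<lambda>l. F l m) holomorphic_on ball 0 a"
    and h2: "\<And>l. l \<in> ball 0 a \<Longrightarrow> F l holomorphic_on ball 0 B"
    using F by (auto simp: sep_holomorphic_def)
  have sub: "sphere x0 e \<subseteq> ball 0 B"
  proof
    fix x assume "x \<in> sphere x0 e"
    then have "norm (x - x0) = e" by (simp add: dist_norm norm_minus_commute)
    then show "x \<in> ball 0 B" using e(2) norm_triangle_sub[of x x0] by simp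
  qed
  have "(\<lambda>l. contour_integral (circlepath x0 e) (\<lambda>x. deriv (F l) x * h x / F l x)) holomorphic_on L"
  proof (rule holomorphic_circle_integral[OF L(1)])
    have s: "L \<times> sphere x0 e \<subseteq> ball 0 a \<times> ball 0 B" using L sub by auto
    have ch: "continuous_on (L \<times> sphere x0 e) (\<lambda>q. h (snd q))"
      by (rule continuous_on_compose2[OF holomorphic_on_imp_continuous_on[OF h] continuous_on_snd[OF continuous_on_id]])
         (use sub in auto)
    have "continuous_on (L \<times> sphere x0 e) (\<lambda>q. deriv (F (fst q)) (snd q) * h (snd q) / F (fst q) (snd q))"
      using continuous_on_subset[OF cF s] continuous_on_subset[OF sep_holomorphic_deriv(1)[OF F] s] nz
      by (intro continuous_on_divide continuous_on_mult ch) (auto simp: case_prod_beta)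
    then show "continuous_on (L \<times> sphere x0 e) (\<lambda>(l, x). deriv (F l) x * h x / F l x)" by (simp add: case_prod_beta)
    show "(\<lambda>l. deriv (F l) x * h x / F l x) holomorphic_on L" if "x \<in> sphere x0 e" for x
      using holomorphic_on_subset[OF sep_holomorphic_deriv(2)[OF F] L(2), of x]
        holomorphic_on_subset[OF h1 L(2), of x] that sub nz
      by (intro holomorphic_intros) auto
  qed (use e in auto)
  then have "(\<lambda>l. 1 / (2 * pi * \<i>) * contour_integral (circlepath x0 e) (\<lambda>x. deriv (F l) x * h x / F l x)) holomorphic_on L"
    by (intro holomorphic_intros)
  moreover have "1 / (2 * pi * \<i>) * contour_integral (circlepath x0 e) (\<lambda>x. deriv (F l) x * h x / F l x)
      = (\<Sum>x | x \<in> ball x0 e \<and> F l x = 0. h x * of_int (zorder (F l) x))" if "l \<in> L" for l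
    using zeros_in_circle(3)[OF h2 h e nz] that L(2) by auto
  ultimately show ?thesis by (rule holomorphic_transform)
qed

section \<open>Polynomial sums over zeros\<close>

text \<open>
  A polynomial in \<open>x 0, \<dots>, x (r - 1)\<close>, given by a list of coefficients and exponents.
\<close>

definition poly_fun :: "nat \<Rightarrow> ((nat \<Rightarrow> complex) \<Rightarrow> complex) \<Rightarrow> bool" where
  "poly_fun r P \<longleftrightarrow> (\<exists>ts. \<forall>x. P x = (\<Sum>(c, e)\<leftarrow>ts. c * (\<Prod>i<r. x i ^ e i)))"

lemma poly_fun_diff:
  assumes "i < r" "j < r"
  shows "poly_fun r (\<lambda>x. x i - x j)"
proof -
  have "(\<Prod>k<r. x k ^ (if k = i then 1 else 0)) = x i" if "i < r" for i and x :: "nat \<Rightarrow> complex"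
  proof -
    have "(\<Prod>k<r. x k ^ (if k = i then 1 else 0)) = (\<Prod>k<r. if k = i then x k else 1)"
      by (rule prod.cong) auto
    then show ?thesis using that by simp
  qed
  then show ?thesis unfolding poly_fun_def using assms
    by (intro exI[of _ "[(1, \<lambda>k. if k = i then 1 else 0), (-1, \<lambda>k. if k = j then 1 else 0)]"]) simp
qed

lemma poly_fun_one: "poly_fun r (\<lambda>x. 1)"
  unfolding poly_fun_def by (intro exI[of _ "[(1, \<lambda>k. 0)]"]) simp

lemma poly_fun_mult:
  assumes "poly_fun r P" "poly_fun r Q"
  shows "poly_fun r (\<lambda>x. P x * Q x)"
proof -
  let ?m = "\<lambda>x :: nat \<Rightarrow> complex. \<lambda>(c :: complex, e :: nat \<Rightarrow> nat). c * (\<Prod>i<r. x i ^ e i)"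
  let ?p = "\<lambda>(c :: complex, e :: nat \<Rightarrow> nat). \<lambda>(c', e'). (c * c', \<lambda>i. e i + e' i)"
  obtain ts us where t: "\<And>x. P x = (\<Sum>t\<leftarrow>ts. ?m x t)" and u: "\<And>x. Q x = (\<Sum>u\<leftarrow>us. ?m x u)"
    using assms unfolding poly_fun_def by blast
  have m: "?m x (?p t u) = ?m x t * ?m x u" for x t u
    by (simp add: case_prod_beta power_add prod.distrib mult_ac)
  have 1: "(\<Sum>u\<leftarrow>us. ?m x (?p t u)) = ?m x t * (\<Sum>u\<leftarrow>us. ?m x u)" for x t us
    by (induction us) (simp_all only: list.map sum_list.Cons sum_list.Nil m distrib_left mult_zero_right)
  have "(\<Sum>w\<leftarrow>concat (map (\<lambda>t. map (?p t) us) ts). ?m x w) = (\<Sum>t\<leftarrow>ts. ?m x t) * (\<Sum>u\<leftarrow>us. ?m x u)" for x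
  proof (induction ts)
    case (Cons t ts)
    have "(\<Sum>w\<leftarrow>map (?p t) us. ?m x w) = ?m x t * (\<Sum>u\<leftarrow>us. ?m x u)"
      unfolding map_map o_def by (rule 1)
    then show ?case using Cons by (simp only: list.map concat.simps map_append sum_list.append sum_list.Cons distrib_right)
  qed simp
  note * = this
  show ?thesis unfolding poly_fun_def t u by (intro exI allI) (rule *[symmetric])
qed

lemma poly_fun_prod:
  assumes "\<And>i. i \<in> I \<Longrightarrow> poly_fun r (P i)"
  shows "poly_fun r (\<lambda>x. \<Prod>i\<in>I. P i x)"
  using assms by (induction I rule: infinite_finite_induct) (auto simp: poly_fun_one intro: poly_fun_mult)

text \<open>
  Summing a monomial over all tuples of zeros factorizes into a product of power sums. Summing over
  tuples instead of unordered sets avoids symmetric functions and any labelling of the zeros.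
\<close>

lemma symmetric_sum_holomorphic:
  assumes P: "poly_fun r P" and fin: "\<And>l. l \<in> L \<Longrightarrow> finite (Z l)"
    and pw: "\<And>k. (\<lambda>l. \<Sum>x\<in>Z l. x ^ k * \<mu> l x) holomorphic_on L"
  shows "(\<lambda>l. \<Sum>x\<in>PiE {..<r} (\<lambda>_. Z l). (\<Prod>i<r. \<mu> l (x i)) * P x) holomorphic_on L"
proof -
  obtain ts where ts: "\<And>x. P x = (\<Sum>(c, e)\<leftarrow>ts. c * (\<Prod>i<r. x i ^ e i))"
    using P unfolding poly_fun_def by blast
  have hol: "(\<lambda>l. \<Sum>(c, e)\<leftarrow>ts. c * (\<Prod>i<r. \<Sum>x\<in>Z l. x ^ e i * \<mu> l x)) holomorphic_on L"
    by (induction ts) (auto simp: case_prod_beta intro!: holomorphic_intros pw)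
  have eq: "(\<Sum>(c, e)\<leftarrow>ts. c * (\<Prod>i<r. \<Sum>x\<in>Z l. x ^ e i * \<mu> l x))
      = (\<Sum>x\<in>PiE {..<r} (\<lambda>_. Z l). (\<Prod>i<r. \<mu> l (x i)) * (\<Sum>(c, e)\<leftarrow>ts. c * (\<Prod>i<r. x i ^ e i)))"
    if l: "l \<in> L" for l
  proof (induction ts)
    case (Cons t ts)
    obtain c e where t: "t = (c, e)" by (cases t)
    have "(\<Prod>i<r. \<Sum>x\<in>Z l. x ^ e i * \<mu> l x) = (\<Sum>x\<in>PiE {..<r} (\<lambda>_. Z l). (\<Prod>i<r. \<mu> l (x i)) * (\<Prod>i<r. x i ^ e i))"
      by (subst prod_sum_PiE) (auto simp: fin[OF l] prod.distrib mult.commute)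
    then show ?case using Cons by (simp add: t sum_distrib_left sum.distrib algebra_simps)
  qed simp
  show ?thesis unfolding ts by (rule holomorphic_transform[OF hol eq])
qed

section \<open>The number of distinct zeros\<close>

lemma finite_separation:
  fixes A :: "complex set"
  assumes "finite A" "A \<subseteq> ball 0 b"
  shows "\<exists>\<epsilon>>0. (\<forall>x\<in>A. norm x + \<epsilon> < b) \<and> (\<forall>x\<in>A. \<forall>y\<in>A. x \<noteq> y \<longrightarrow> cball x \<epsilon> \<inter> cball y \<epsilon> = {})"
proof -
  define M where "M = insert 1 ((\<lambda>x. b - norm x) ` A \<union> (\<lambda>(x, y). dist x y) ` {p \<in> A \<times> A. fst p \<noteq> snd p})"
  have M: "finite M" "M \<noteq> {}" "\<And>m. m \<in> M \<Longrightarrow> m > 0"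
    using assms by (auto simp: M_def)
  define \<epsilon> where "\<epsilon> = Min M / 3"
  have "Min M > 0" using M by simp
  then have e: "\<epsilon> > 0" "\<And>m. m \<in> M \<Longrightarrow> 3 * \<epsilon> \<le> m" using M(1) by (auto simp: \<epsilon>_def)
  show ?thesis
  proof (intro exI[of _ \<epsilon>] conjI ballI impI)
    fix x assume "x \<in> A"
    then have "3 * \<epsilon> \<le> b - norm x" by (intro e(2)) (auto simp: M_def)
    then show "norm x + \<epsilon> < b" using e(1) by linarith
  next
    fix x y assume "x \<in> A" "y \<in> A" "x \<noteq> y"
    then have "3 * \<epsilon> \<le> dist x y" by (intro e(2)) (force simp: M_def)
    then have "\<not> (dist x z \<le> \<epsilon> \<and> dist y z \<le> \<epsilon>)" for z
      using dist_triangle2[of x y z] e(1) by linarith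
    then show "cball x \<epsilon> \<inter> cball y \<epsilon> = {}" by auto
  qed (rule e(1))
qed

text \<open>
  The zeros of \<open>F l\<close> in a disc, for \<open>l\<close> near \<open>0\<close>, when the zero set is contained in a cone with
  vertex at the origin. The condition \<open>n * a < B / 2\<close> keeps the zeros away from the circle of radius
  \<open>B / 2\<close>, so that none can escape as \<open>l\<close> varies.
\<close>

locale zero_family =
  fixes a B n :: real and F :: "complex \<Rightarrow> complex \<Rightarrow> complex"
  assumes sep: "sep_holomorphic a B F"
    and a: "0 < a" and B: "0 < B" and n: "0 < n" and na: "n * a < B / 2"
    and cone: "\<And>l m. l \<in> ball 0 a \<Longrightarrow> m \<in> ball 0 B \<Longrightarrow> F l m = 0 \<Longrightarrow> norm m \<le> n * norm l"
begin

definition Z where "Z l = {m. m \<in> ball 0 (B / 2) \<and> F l m = 0}"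

definition mult where "mult l m = complex_of_int (zorder (F l) m)"

lemma hol_F: "l \<in> ball 0 a \<Longrightarrow> F l holomorphic_on ball 0 B"
  and cont_F: "continuous_on (ball 0 a \<times> ball 0 B) (\<lambda>(l, m). F l m)"
  using sep by (auto simp: sep_holomorphic_def)

lemma zero_small: "l \<in> ball 0 a \<Longrightarrow> m \<in> ball 0 B \<Longrightarrow> F l m = 0 \<Longrightarrow> norm m < B / 2"
proof -
  assume l: "l \<in> ball 0 a" "m \<in> ball 0 B" "F l m = 0"
  have "n * norm l \<le> n * a" using l n by (intro mult_left_mono) auto
  then show ?thesis using cone[OF l] na by linarith
qed

lemma Z_eq: "l \<in> ball 0 a \<Longrightarrow> m \<in> Z l \<longleftrightarrow> m \<in> ball 0 B \<and> F l m = 0"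
  using zero_small[of l m] B by (auto simp: Z_def)

lemma nz_sphere: "l \<in> ball 0 a \<Longrightarrow> x \<in> sphere 0 (B / 2) \<Longrightarrow> F l x \<noteq> 0"
  using zero_small[of l x] B by auto

lemma finite_Z: "l \<in> ball 0 a \<Longrightarrow> finite (Z l)"
  and zorder_Z: "l \<in> ball 0 a \<Longrightarrow> m \<in> Z l \<Longrightarrow> zorder (F l) m > 0"
  using zeros_in_circle(1,2)[OF hol_F holomorphic_on_const, of l "B / 2" 0] nz_sphere[of l] B by (auto simp: Z_def)

lemma power_sum_holomorphic: "(\<lambda>l. \<Sum>x\<in>Z l. x ^ k * mult l x) holomorphic_on ball 0 a"
  unfolding Z_def mult_def
  by (rule weighted_zero_sum_holomorphic[OF sep open_ball])
     (use B nz_sphere in \<open>auto intro!: holomorphic_intros\<close>)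

lemma card_Z_bounded: "\<exists>d. \<forall>l\<in>ball 0 a. card (Z l) \<le> d"
proof -
  let ?s = "\<lambda>l. \<Sum>x\<in>Z l. mult l x"
  have "?s holomorphic_on ball 0 a" using power_sum_holomorphic[of 0] by simp
  then have c: "continuous_on (ball 0 a) ?s" by (rule holomorphic_on_imp_continuous_on)
  have int: "?s l = of_int (\<Sum>x\<in>Z l. zorder (F l) x)" for l by (simp add: mult_def)
  have "card (Z l) \<le> nat (\<Sum>x\<in>Z 0. zorder (F 0) x)" if l: "l \<in> ball 0 a" for l
  proof -
    have "?s l = ?s 0"
      by (rule int_valued_constant[OF connected_ball c _ l]) (use a in \<open>auto simp: mult_def\<close>)
    then have e: "(\<Sum>x\<in>Z l. zorder (F l) x) = (\<Sum>x\<in>Z 0. zorder (F 0) x)" unfolding int by (simp only: of_int_eq_iff)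
    have "int (card (Z l)) = (\<Sum>x\<in>Z l. 1)" by simp
    also have "\<dots> \<le> (\<Sum>x\<in>Z l. zorder (F l) x)" by (rule sum_mono) (use zorder_Z[OF l] in force)
    finally show ?thesis using e by linarith
  qed
  then show ?thesis by blast
qed

text \<open>
  The generic number of distinct zeros. Where zeros coincide there are fewer.
\<close>

definition sheet_count where "sheet_count = Max ((\<lambda>l. card (Z l)) ` ball 0 a)"

lemma card_Z_le: "l \<in> ball 0 a \<Longrightarrow> card (Z l) \<le> sheet_count" and card_Z_max: "\<exists>l\<in>ball 0 a. card (Z l) = sheet_count"
proof -
  obtain d where "\<forall>l\<in>ball 0 a. card (Z l) \<le> d" using card_Z_bounded by blast
  then have "(\<lambda>l. card (Z l)) ` ball 0 a \<subseteq> {..d}" by auto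
  then have fin: "finite ((\<lambda>l. card (Z l)) ` ball 0 a)" by (rule finite_subset) simp
  then show "l \<in> ball 0 a \<Longrightarrow> card (Z l) \<le> sheet_count" unfolding sheet_count_def by (intro Max_ge) auto
  have "(\<lambda>l. card (Z l)) ` ball 0 a \<noteq> {}" using a by auto
  from Max_in[OF fin this] show "\<exists>l\<in>ball 0 a. card (Z l) = sheet_count" unfolding sheet_count_def by (auto simp: image_iff)
qed

text \<open>
  Up to sign, the nonzero product of the multiplicities and the number of orderings, this is the
  discriminant of the distinct zeros when there are \<open>sheet_count\<close> of them. Formed as a sum over all
  tuples of zeros it is holomorphic in \<open>l\<close>, and it vanishes if there are fewer zeros because every
  tuple then has a repeated entry.
\<close>

definition discriminant where
  "discriminant l = (\<Sum>x\<in>PiE {..<sheet_count} (\<lambda>_. Z l). (\<Prod>i<sheet_count. mult l (x i)) * (\<Prod>i<sheet_count. \<Prod>j\<in>{..<sheet_count} - {i}. x i - x j))"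

lemma discriminant_holomorphic: "discriminant holomorphic_on ball 0 a"
  unfolding discriminant_def[abs_def]
  by (intro symmetric_sum_holomorphic finite_Z power_sum_holomorphic poly_fun_prod poly_fun_diff) auto

lemma discriminant_nonzero_iff:
  assumes l: "l \<in> ball 0 a"
  shows "discriminant l \<noteq> 0 \<longleftrightarrow> card (Z l) = sheet_count"
proof
  have fin: "finite (PiE {..<sheet_count} (\<lambda>_. Z l))" using finite_Z[OF l] by (intro finite_PiE) auto
  have non_inj: "(\<Prod>i<sheet_count. \<Prod>j\<in>{..<sheet_count} - {i}. x i - x j) = 0" if x: "\<not> inj_on x {..<sheet_count}" for x :: "nat \<Rightarrow> complex"
  proof -
    obtain i j where ij: "i < sheet_count" "j < sheet_count" "x i = x j" "i \<noteq> j" using x by (auto simp: inj_on_def)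
    then have "(\<Prod>j\<in>{..<sheet_count} - {i}. x i - x j) = 0" by (intro prod_zero) auto
    then show ?thesis using ij by (intro prod_zero) auto
  qed
  {
    assume ne: "discriminant l \<noteq> 0"
    show "card (Z l) = sheet_count"
    proof (rule ccontr)
      assume "card (Z l) \<noteq> sheet_count"
      then have lt: "card (Z l) < sheet_count" using card_Z_le[OF l] by simp
      have "\<not> inj_on x {..<sheet_count}" if x: "x \<in> PiE {..<sheet_count} (\<lambda>_. Z l)" for x
      proof
        assume "inj_on x {..<sheet_count}"
        then have "card {..<sheet_count} \<le> card (Z l)" by (rule card_inj_on_le) (use x finite_Z[OF l] in auto)
        with lt show False by simp
      qed
      then have "discriminant l = 0" unfolding discriminant_def by (intro sum.neutral) (auto simp: non_inj)
      with ne show False by simp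
    qed
  next
    assume c: "card (Z l) = sheet_count"
    define I where "I = {x \<in> PiE {..<sheet_count} (\<lambda>_. Z l). inj_on x {..<sheet_count}}"
    define q where "q = (\<Prod>z\<in>Z l. mult l z) * (\<Prod>z\<in>Z l. \<Prod>w\<in>Z l - {z}. z - w)"
    have t: "(\<Prod>i<sheet_count. mult l (x i)) * (\<Prod>i<sheet_count. \<Prod>j\<in>{..<sheet_count} - {i}. x i - x j) = q" if x: "x \<in> I" for x
    proof -
      have inj: "inj_on x {..<sheet_count}" using x by (simp add: I_def)
      have "x ` {..<sheet_count} = Z l"
        by (rule card_subset_eq[OF finite_Z[OF l]]) (use x c card_image[OF inj] in \<open>auto simp: I_def\<close>)
      then have bij: "bij_betw x {..<sheet_count} (Z l)" using inj by (simp add: bij_betw_def)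
      have "(\<Prod>j\<in>{..<sheet_count} - {i}. x i - x j) = (\<Prod>w\<in>Z l - {x i}. x i - w)" if "i \<in> {..<sheet_count}" for i
      proof (rule prod.reindex_bij_betw)
        show "bij_betw x ({..<sheet_count} - {i}) (Z l - {x i})"
          using bij that by (auto simp: bij_betw_def inj_on_def)
      qed
      then have "(\<Prod>i<sheet_count. \<Prod>j\<in>{..<sheet_count} - {i}. x i - x j) = (\<Prod>i<sheet_count. \<Prod>w\<in>Z l - {x i}. x i - w)"
        by (intro prod.cong) auto
      also have "\<dots> = (\<Prod>z\<in>Z l. \<Prod>w\<in>Z l - {z}. z - w)"
        by (rule prod.reindex_bij_betw[OF bij])
      finally show ?thesis unfolding q_def using prod.reindex_bij_betw[OF bij, of "mult l"] by simp
    qed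
    have "discriminant l = (\<Sum>x\<in>I. q)"
    proof -
      have "discriminant l = (\<Sum>x\<in>I. (\<Prod>i<sheet_count. mult l (x i)) * (\<Prod>i<sheet_count. \<Prod>j\<in>{..<sheet_count} - {i}. x i - x j))"
        unfolding discriminant_def by (rule sum.mono_neutral_right[OF fin]) (auto simp: I_def non_inj)
      also have "\<dots> = (\<Sum>x\<in>I. q)" by (rule sum.cong[OF refl t])
      finally show ?thesis .
    qed
    moreover have "card I > 0"
    proof -
      obtain x where x: "bij_betw x {..<sheet_count} (Z l)"
        using ex_bij_betw_nat_finite[OF finite_Z[OF l]] c by (auto simp: lessThan_atLeast0)
      then have b: "bij_betw (restrict x {..<sheet_count}) {..<sheet_count} (Z l)" using bij_betw_cong[of "{..<sheet_count}" "restrict x {..<sheet_count}" x] by simp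
      have "restrict x {..<sheet_count} \<in> I" unfolding I_def using b by (auto simp: bij_betw_def)
      then have "I \<noteq> {}" by blast
      moreover have "finite I" by (rule finite_subset[OF _ fin]) (auto simp: I_def)
      ultimately show ?thesis by (simp add: card_gt_0_iff)
    qed
    moreover have "q \<noteq> 0"
      unfolding q_def using finite_Z[OF l] zorder_Z[OF l] by (force simp: mult_def)
    ultimately show "discriminant l \<noteq> 0" by simp
  }
qed

text \<open>
  The zeros of the discriminant are isolated; so at most the centre of a small disc is exceptional.
\<close>

lemma card_Z_punctured: "\<exists>a'>0. a' \<le> a \<and> (\<forall>l\<in>ball 0 a' - {0}. card (Z l) = sheet_count)"
proof (cases "discriminant 0 = 0")
  case True
  obtain l1 where l1: "l1 \<in> ball 0 a" "card (Z l1) = sheet_count" using card_Z_max by blast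
  then have d1: "discriminant l1 \<noteq> 0" using discriminant_nonzero_iff by blast
  have z: "0 \<in> ball 0 a" using a by simp
  have "\<exists>s>0. ball (0::complex) s \<subseteq> ball 0 a \<and> (\<forall>l\<in>ball 0 s - {0}. discriminant l \<noteq> 0)"
  proof (rule isolated_zeros[OF discriminant_holomorphic open_ball connected_ball z True l1(1) d1])
    fix s assume s: "0 < s" "ball (0::complex) s \<subseteq> ball 0 a" "\<And>l. l \<in> ball 0 s - {0} \<Longrightarrow> discriminant l \<noteq> 0"
    show ?thesis by (intro exI[of _ s] conjI ballI s)
  qed
  then obtain s where s: "0 < s" "ball (0::complex) s \<subseteq> ball 0 a" "\<And>l. l \<in> ball 0 s - {0} \<Longrightarrow> discriminant l \<noteq> 0"
    by blast
  show ?thesis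
  proof (intro exI[of _ "min s a"] conjI ballI)
    fix l :: complex assume l: "l \<in> ball 0 (min s a) - {0}"
    then show "card (Z l) = sheet_count" using s(3)[of l] discriminant_nonzero_iff[of l] by auto
  qed (use s a in auto)
next
  case False
  have "open (ball 0 a \<inter> discriminant -` (- {0}))"
    by (rule continuous_open_preimage[OF holomorphic_on_imp_continuous_on[OF discriminant_holomorphic] open_ball open_delete[OF open_UNIV, folded Compl_eq_Diff_UNIV]])
  moreover have "0 \<in> ball 0 a \<inter> discriminant -` (- {0})" using False a by simp
  ultimately obtain s where s: "s > 0" "ball (0::complex) s \<subseteq> ball 0 a \<inter> discriminant -` (- {0})" using open_contains_ball by blast
  show ?thesis
  proof (intro exI[of _ "min s a"] conjI ballI)
    fix l :: complex assume l: "l \<in> ball 0 (min s a) - {0}"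
    then have "l \<in> ball 0 s" by simp
    then have "l \<in> ball 0 a \<inter> discriminant -` (- {0})" using s(2) by blast
    then show "card (Z l) = sheet_count" using discriminant_nonzero_iff[of l] by blast
  qed (use s a in auto)
qed

lemma nonzero_nearby:
  assumes "l0 \<in> ball 0 a" "compact K" "K \<subseteq> ball 0 B" "\<And>x. x \<in> K \<Longrightarrow> F l0 x \<noteq> 0"
  shows "\<exists>\<delta>>0. \<forall>l\<in>ball l0 \<delta>. l \<in> ball 0 a \<and> (\<forall>x\<in>K. F l x \<noteq> 0)"
proof (cases "K = {}")
  case True
  then show ?thesis using assms(1) open_contains_ball open_ball by (metis empty_iff subsetD)
next
  case False
  obtain e where e: "e > 0" "cball l0 e \<subseteq> ball 0 a" using assms(1) open_contains_cball open_ball by metis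
  have c0: "continuous_on K (\<lambda>x. norm (F l0 x))"
    using holomorphic_on_imp_continuous_on[OF hol_F[OF assms(1)]] assms(3) continuous_on_subset
    by (intro continuous_on_norm) blast
  obtain x0 where x0: "x0 \<in> K" "\<And>x. x \<in> K \<Longrightarrow> norm (F l0 x0) \<le> norm (F l0 x)"
    using continuous_attains_inf[OF assms(2) False c0] by blast
  define c where "c = norm (F l0 x0)"
  have c: "c > 0" using assms(4)[OF x0(1)] by (simp add: c_def)
  have sub: "cball l0 e \<times> K \<subseteq> ball 0 a \<times> ball 0 B" using e(2) assms(3) by blast
  have "uniformly_continuous_on (cball l0 e \<times> K) (\<lambda>(l, m). F l m)"
    by (rule compact_uniformly_continuous[OF continuous_on_subset[OF cont_F sub] compact_Times[OF compact_cball assms(2)]])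
  then obtain d where d: "d > 0" "\<And>p q. p \<in> cball l0 e \<times> K \<Longrightarrow> q \<in> cball l0 e \<times> K \<Longrightarrow> dist q p < d \<Longrightarrow>
      dist (case q of (l, m) \<Rightarrow> F l m) (case p of (l, m) \<Rightarrow> F l m) < c"
    using c unfolding uniformly_continuous_on_def by metis
  show ?thesis
  proof (intro exI[of _ "min d e"] conjI ballI)
    fix l assume l: "l \<in> ball l0 (min d e)"
    then have "l \<in> cball l0 e" by simp
    then show "l \<in> ball 0 a" using e(2) by blast
    fix x assume x: "x \<in> K"
    have "dist (F l x) (F l0 x) < c"
      using d(2)[of "(l0, x)" "(l, x)"] l x e by (simp add: dist_Pair_Pair dist_commute)
    moreover have "c \<le> norm (F l0 x)" using x0(2)[OF x] by (simp add: c_def)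
    ultimately show "F l x \<noteq> 0" by (auto simp: dist_norm)
  qed (use d e in auto)
qed

text \<open>
  Over the disc \<open>ball l0 \<delta>\<close> the zero set is a disjoint union of graphs of holomorphic functions
  \<open>\<phi> x\<close>, one for each zero \<open>x\<close> over \<open>l0\<close>.
\<close>

definition local_system where
  "local_system T l0 \<delta> \<epsilon> \<phi> \<longleftrightarrow> 0 < \<delta> \<and> 0 < \<epsilon> \<and> ball l0 \<delta> \<subseteq> T \<and> (\<forall>x\<in>Z l0. \<phi> x holomorphic_on ball l0 \<delta>) \<and>
      (\<forall>l\<in>ball l0 \<delta>. \<forall>x\<in>Z l0. Z l \<inter> ball x \<epsilon> = {\<phi> x l}) \<and>
      (\<forall>l\<in>ball l0 \<delta>. Z l \<subseteq> (\<Union>x\<in>Z l0. ball x \<epsilon>)) \<and>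
      (\<forall>x\<in>Z l0. \<forall>y\<in>Z l0. x \<noteq> y \<longrightarrow> ball x \<epsilon> \<inter> ball y \<epsilon> = {})"

text \<open>
  Small circles around the zeros over \<open>l0\<close> are not crossed for \<open>l\<close> near \<open>l0\<close>. Each of them contains
  a zero, as the number of zeros with multiplicity is constant, and by the count of distinct zeros
  exactly one. The multiplicity of this zero is constant, and so the zero is its weighted sum
  divided by the multiplicity, which is holomorphic.
\<close>

lemma local_sheets:
  assumes T: "open T" "T \<subseteq> ball 0 a" "\<And>l. l \<in> T \<Longrightarrow> card (Z l) = sheet_count" and l0: "l0 \<in> T"
  shows "\<exists>\<delta> \<epsilon> \<phi>. local_system T l0 \<delta> \<epsilon> \<phi>"
proof -
  have l0a: "l0 \<in> ball 0 a" using l0 T(2) by blast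
  obtain \<epsilon> where \<epsilon>: "\<epsilon> > 0" "\<And>x. x \<in> Z l0 \<Longrightarrow> norm x + \<epsilon> < B / 2"
    "\<And>x y. x \<in> Z l0 \<Longrightarrow> y \<in> Z l0 \<Longrightarrow> x \<noteq> y \<Longrightarrow> cball x \<epsilon> \<inter> cball y \<epsilon> = {}"
  proof -
    have "Z l0 \<subseteq> ball 0 (B / 2)" by (auto simp: Z_def)
    from finite_separation[OF finite_Z[OF l0a] this] show ?thesis using that by blast
  qed
  have cb: "cball x \<epsilon> \<subseteq> ball 0 (B / 2)" if "x \<in> Z l0" for x
  proof
    fix y assume "y \<in> cball x \<epsilon>"
    then have "norm (y - x) \<le> \<epsilon>" by (simp add: dist_norm norm_minus_commute)
    then show "y \<in> ball 0 (B / 2)" using \<epsilon>(2)[OF that] norm_triangle_sub[of y x] by simp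
  qed
  define K where "K = (\<Union>x\<in>Z l0. sphere x \<epsilon>)"
  have K: "compact K" "K \<subseteq> ball 0 B"
  proof -
    show "compact K" unfolding K_def using finite_Z[OF l0a] by (intro compact_UN) auto
    have "sphere x \<epsilon> \<subseteq> ball 0 B" if "x \<in> Z l0" for x
      using cb[OF that] B sphere_cball[of x \<epsilon>] subset_ball[of "B / 2" B "0 :: complex"] by force
    then show "K \<subseteq> ball 0 B" unfolding K_def by blast
  qed
  have nz0: "F l0 y \<noteq> 0" if yK: "y \<in> K" for y
  proof
    assume "F l0 y = 0"
    obtain x where x: "x \<in> Z l0" "y \<in> sphere x \<epsilon>" using yK by (auto simp: K_def)
    then have "y \<in> cball x \<epsilon>" by auto
    then have "y \<in> Z l0" using cb[OF x(1)] \<open>F l0 y = 0\<close> by (auto simp: Z_def)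
    moreover have "y \<noteq> x" using x \<epsilon>(1) by auto
    ultimately have "cball x \<epsilon> \<inter> cball y \<epsilon> = {}" using \<epsilon>(3) x(1) by blast
    then show False using \<open>y \<in> cball x \<epsilon>\<close> \<epsilon>(1) by auto
  qed
  obtain \<delta>1 where \<delta>1: "\<delta>1 > 0" "\<And>l. l \<in> ball l0 \<delta>1 \<Longrightarrow> l \<in> ball 0 a" "\<And>l x. l \<in> ball l0 \<delta>1 \<Longrightarrow> x \<in> K \<Longrightarrow> F l x \<noteq> 0"
    using nonzero_nearby[OF l0a K nz0] by blast
  obtain \<delta>2 where \<delta>2: "\<delta>2 > 0" "ball l0 \<delta>2 \<subseteq> T" using T(1) l0 open_contains_ball by blast
  define \<delta> where "\<delta> = min \<delta>1 \<delta>2"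
  have \<delta>: "\<delta> > 0" "ball l0 \<delta> \<subseteq> T" "ball l0 \<delta> \<subseteq> ball 0 a"
    and nz: "\<And>l x y. l \<in> ball l0 \<delta> \<Longrightarrow> x \<in> Z l0 \<Longrightarrow> y \<in> sphere x \<epsilon> \<Longrightarrow> F l y \<noteq> 0"
    using \<delta>1 \<delta>2 by (auto simp: \<delta>_def K_def)
  have loc: "{y. y \<in> ball x \<epsilon> \<and> F l y = 0} = Z l \<inter> ball x \<epsilon>" if "x \<in> Z l0" for x l
    using cb[OF that] ball_subset_cball[of x \<epsilon>] unfolding Z_def by blast
  have wz: "(\<lambda>l. \<Sum>y\<in>Z l \<inter> ball x \<epsilon>. h y * mult l y) holomorphic_on ball l0 \<delta>"
    if x: "x \<in> Z l0" and h: "h holomorphic_on ball 0 B" for x h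
  proof -
    have bd: "norm x + \<epsilon> < B" using \<epsilon>(2)[OF x] B by linarith
    from weighted_zero_sum_holomorphic[OF sep open_ball \<delta>(3) \<epsilon>(1) bd nz[OF _ x] h]
    show ?thesis unfolding loc[OF x] mult_def .
  qed
  define k where "k x = mult l0 x" for x
  have k0: "k x \<noteq> 0" if "x \<in> Z l0" for x
    using zorder_Z[OF l0a that] by (simp add: k_def mult_def)
  have Zl0: "Z l0 \<inter> ball x \<epsilon> = {x}" if x: "x \<in> Z l0" for x
  proof -
    have "y = x" if y: "y \<in> Z l0" "y \<in> ball x \<epsilon>" for y
    proof (rule ccontr)
      assume "y \<noteq> x"
      then have "cball x \<epsilon> \<inter> cball y \<epsilon> = {}" using \<epsilon>(3) x y(1) by blast
      moreover have "y \<in> cball x \<epsilon>" "y \<in> cball y \<epsilon>" using y(2) \<epsilon>(1) by auto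
      ultimately show False by blast
    qed
    then show ?thesis using x \<epsilon>(1) by auto
  qed
  have count: "(\<Sum>y\<in>Z l \<inter> ball x \<epsilon>. mult l y) = k x" if x: "x \<in> Z l0" and l: "l \<in> ball l0 \<delta>" for x l
  proof -
    have "continuous_on (ball l0 \<delta>) (\<lambda>l. \<Sum>y\<in>Z l \<inter> ball x \<epsilon>. mult l y)"
      using holomorphic_on_imp_continuous_on[OF wz[OF x holomorphic_on_const[of 1]]] by simp
    then have "(\<Sum>y\<in>Z l \<inter> ball x \<epsilon>. mult l y) = (\<Sum>y\<in>Z l0 \<inter> ball x \<epsilon>. mult l0 y)"
      by (rule int_valued_constant[OF connected_ball]) (use l \<delta>(1) in \<open>auto simp: mult_def\<close>)
    then show ?thesis using Zl0[OF x] by (simp add: k_def)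
  qed
  have ex: "\<exists>y. y \<in> Z l \<inter> ball x \<epsilon>" if x: "x \<in> Z l0" and l: "l \<in> ball l0 \<delta>" for x l
  proof (rule ccontr)
    assume "\<nexists>y. y \<in> Z l \<inter> ball x \<epsilon>"
    then have "Z l \<inter> ball x \<epsilon> = {}" by blast
    then show False using count[OF x l] k0[OF x] by simp
  qed
  define \<phi> where "\<phi> x l = (SOME y. y \<in> Z l \<inter> ball x \<epsilon>)" for x l
  have \<phi>: "\<phi> x l \<in> Z l" "\<phi> x l \<in> ball x \<epsilon>" if "x \<in> Z l0" "l \<in> ball l0 \<delta>" for x l
    using someI_ex[OF ex[OF that]] unfolding \<phi>_def by auto
  have disj: "ball x \<epsilon> \<inter> ball y \<epsilon> = {}" if "x \<in> Z l0" "y \<in> Z l0" "x \<noteq> y" for x y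
    using \<epsilon>(3)[OF that] ball_subset_cball by blast
  (* One zero from every disc exhausts the zeros over l, because their number does not change. *)
  have Zeq: "Z l = (\<lambda>x. \<phi> x l) ` Z l0" if l: "l \<in> ball l0 \<delta>" for l
  proof -
    have "inj_on (\<lambda>x. \<phi> x l) (Z l0)"
    proof (rule inj_onI)
      fix x y assume xy: "x \<in> Z l0" "y \<in> Z l0" "\<phi> x l = \<phi> y l"
      have "\<phi> x l \<in> ball x \<epsilon> \<inter> ball y \<epsilon>" using \<phi>(2)[OF xy(1) l] \<phi>(2)[OF xy(2) l] xy(3) by simp
      then show "x = y" using disj[OF xy(1,2)] by blast
    qed
    then have "card ((\<lambda>x. \<phi> x l) ` Z l0) = card (Z l)"
      using card_image T(3) \<delta>(2) l l0 by (metis subsetD)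
    moreover have "finite (Z l)" using finite_Z l \<delta>(3) by blast
    moreover have "(\<lambda>x. \<phi> x l) ` Z l0 \<subseteq> Z l" using \<phi>(1) l by blast
    ultimately show ?thesis using card_subset_eq by metis
  qed
  have single: "Z l \<inter> ball x \<epsilon> = {\<phi> x l}" if x: "x \<in> Z l0" and l: "l \<in> ball l0 \<delta>" for x l
  proof -
    have "y = \<phi> x l" if y: "y \<in> Z l" "y \<in> ball x \<epsilon>" for y
    proof -
      obtain x' where x': "x' \<in> Z l0" "y = \<phi> x' l" using y(1) Zeq[OF l] by blast
      have "y \<in> ball x \<epsilon> \<inter> ball x' \<epsilon>" using \<phi>(2)[OF x'(1) l] y(2) x'(2) by simp
      then have "x' = x" using disj[OF x x'(1)] by blast
      then show ?thesis using x' by simp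
    qed
    then show ?thesis using \<phi>[OF x l] by blast
  qed
  have hol: "\<phi> x holomorphic_on ball l0 \<delta>" if x: "x \<in> Z l0" for x
  proof -
    have "(\<lambda>l. (\<Sum>y\<in>Z l \<inter> ball x \<epsilon>. y * mult l y) / k x) holomorphic_on ball l0 \<delta>"
      using wz[OF x holomorphic_on_id] k0[OF x] by (intro holomorphic_intros) (auto simp: id_def)
    moreover have "(\<Sum>y\<in>Z l \<inter> ball x \<epsilon>. y * mult l y) / k x = \<phi> x l" if l: "l \<in> ball l0 \<delta>" for l
      using count[OF x l] k0[OF x] unfolding single[OF x l] by simp
    ultimately show ?thesis by (rule holomorphic_transform)
  qed
  have cover: "Z l \<subseteq> (\<Union>x\<in>Z l0. ball x \<epsilon>)" if l: "l \<in> ball l0 \<delta>" for l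
    unfolding Zeq[OF l] using \<phi>(2)[OF _ l] by blast
  show ?thesis
    unfolding local_system_def
    by (intro exI[of _ \<delta>] exI[of _ \<epsilon>] exI[of _ \<phi>] conjI ballI impI \<delta>(1,2) \<epsilon>(1) hol single cover disj)
qed

end

section \<open>Sheets over a slit disc\<close>

text \<open>
  The slit runs along the positive real axis: the rest of the disc is simply connected and contains
  the half disc \<open>Re l < 0\<close>, in which the first coordinate of the points of \<open>D\<close> lies.
\<close>

definition slit_disc :: "real \<Rightarrow> complex set" where
  "slit_disc b = ball 0 b - complex_of_real ` {0..}"

definition half_disc :: "real \<Rightarrow> complex set" where
  "half_disc b = {l. Re l < 0 \<and> norm l < b}"

lemma open_half_disc: "open (half_disc b)" and convex_half_disc: "convex (half_disc b)"
proof -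
  have e: "half_disc b = {l. Re l < 0} \<inter> ball 0 b" by (auto simp: half_disc_def)
  show "open (half_disc b)" unfolding e by (intro open_Int open_halfspace_Re_lt open_ball)
  show "convex (half_disc b)" unfolding e by (intro convex_Int convex_halfspace_Re_lt convex_ball)
qed

lemma closed_nonneg_ray: "closed (complex_of_real ` {0..})"
proof -
  have "complex_of_real ` {0..} = {z. Im z = 0} \<inter> {z. Re z \<ge> 0}"
    by (auto simp: complex_eq_iff image_iff intro!: bexI[of _ "Re _"])
  then show ?thesis by (simp add: closed_Int closed_halfspace_Re_ge closed_halfspace_Im_eq)
qed

lemma open_slit_disc: "open (slit_disc b)"
  unfolding slit_disc_def by (intro open_Diff open_ball closed_nonneg_ray)

lemma starlike_slit_disc:
  assumes "b > 0"
  shows "starlike (slit_disc b)"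
  unfolding starlike_def
proof (intro bexI ballI subsetI)
  let ?c = "complex_of_real (- b / 2)"
  show c: "?c \<in> slit_disc b" using assms by (auto simp: slit_disc_def norm_divide simp del: of_real_divide)
  fix x y assume x: "x \<in> slit_disc b" and y: "y \<in> closed_segment ?c x"
  have "y \<in> ball 0 b"
    using closed_segment_subset[OF _ _ convex_ball, of ?c 0 b x] x c y by (auto simp: slit_disc_def simp del: of_real_divide)
  moreover have "y \<notin> complex_of_real ` {0..}"
  proof
    assume "y \<in> complex_of_real ` {0..}"
    then obtain s where s: "y = of_real s" "s \<ge> 0" by auto
    obtain t where t: "0 \<le> t" "t \<le> 1" "y = (1 - t) *\<^sub>R ?c + t *\<^sub>R x" using y by (auto simp: closed_segment_def)
    have "t \<noteq> 0" using t(3) s assms by (auto simp: complex_eq_iff)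
    then have t0: "t > 0" using t by simp
    have "Im y = t * Im x" "Re y = (1 - t) * (- b / 2) + t * Re x" using t(3) by auto
    moreover have "0 \<le> (1 - t) * (b / 2)" using t assms by (intro mult_nonneg_nonneg) auto
    moreover have "Im y = 0" "Re y = s" using s by auto
    moreover have "(1 - t) * (- b / 2) = - ((1 - t) * (b / 2))" by simp
    ultimately have "t * Im x = 0" "t * Re x \<ge> 0" using s(2) by linarith+
    then have "Im x = 0" "t * Re x \<ge> 0" using t0 by auto
    then have "x = of_real (Re x)" "Re x \<ge> 0" using t0 by (auto simp: complex_eq_iff zero_le_mult_iff)
    then show False using x by (auto simp: slit_disc_def)
  qed
  ultimately show "y \<in> slit_disc b" by (simp add: slit_disc_def)
qed

text \<open>
  For \<open>Re l < 0\<close> the distance of \<open>l\<close> from the slit is \<open>\<bar>l\<bar>\<close>. Discs of radius \<open>\<bar>l\<bar> / 2\<close> are therefore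
  available for Cauchy's estimate, uniformly up to the vertex.
\<close>

lemma ball_in_slit_disc:
  assumes "Re l < 0" "norm l < b / 2"
  shows "cball l (norm l / 2) \<subseteq> slit_disc b"
proof
  fix x assume "x \<in> cball l (norm l / 2)"
  then have d: "norm (x - l) \<le> norm l / 2" by (simp add: dist_norm norm_minus_commute)
  have l: "norm l > 0" using assms by auto
  have "norm x \<le> norm l + norm (x - l)" using norm_triangle_sub[of x l] by simp
  then have "norm x < b" using d assms l by linarith
  moreover have "x \<noteq> of_real s" if s: "s \<ge> 0" for s
  proof
    assume "x = of_real s"
    then have "(norm (x - l))\<^sup>2 = (s - Re l)\<^sup>2 + (Im l)\<^sup>2" by (simp add: cmod_power2)
    moreover have "(Re l)\<^sup>2 \<le> (s - Re l)\<^sup>2" using s assms(1) by (simp add: abs_le_square_iff[symmetric])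
    moreover have "(norm l)\<^sup>2 = (Re l)\<^sup>2 + (Im l)\<^sup>2" by (rule cmod_power2)
    ultimately have "(norm l)\<^sup>2 \<le> (norm (x - l))\<^sup>2" by linarith
    then have "norm l \<le> norm (x - l)" by (rule power2_le_imp_le) simp
    with d l show False by simp
  qed
  ultimately show "x \<in> slit_disc b" by (auto simp: slit_disc_def)
qed

context zero_family
begin

text \<open>
  The zero set is a finite covering where the number of distinct zeros is constant and positive; the
  evenly covered neighbourhoods are those of \<open>local_sheets\<close>.
\<close>

lemma covering_zeros:
  assumes T: "open T" "T \<subseteq> ball 0 a" "\<And>l. l \<in> T \<Longrightarrow> card (Z l) = sheet_count" and sheet_count: "sheet_count > 0"
  shows "covering_space (SIGMA l:T. Z l) fst T"
proof
  let ?C = "SIGMA l:T. Z l"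
  show "continuous_on ?C fst" by (intro continuous_intros)
  show "fst ` ?C = T"
  proof -
    have "Z l \<noteq> {}" if "l \<in> T" for l using T(3)[OF that] sheet_count by auto
    then show ?thesis by force
  qed
  fix l0 assume l0: "l0 \<in> T"
  obtain \<delta> \<epsilon> \<phi> where ls: "local_system T l0 \<delta> \<epsilon> \<phi>"
    using local_sheets[OF T l0] by blast
  then have pos: "\<delta> > 0" "\<epsilon> > 0" and sub: "ball l0 \<delta> \<subseteq> T"
    and hol: "\<And>x. x \<in> Z l0 \<Longrightarrow> \<phi> x holomorphic_on ball l0 \<delta>"
    and single: "\<And>l x. l \<in> ball l0 \<delta> \<Longrightarrow> x \<in> Z l0 \<Longrightarrow> Z l \<inter> ball x \<epsilon> = {\<phi> x l}"
    and cover: "\<And>l. l \<in> ball l0 \<delta> \<Longrightarrow> Z l \<subseteq> (\<Union>x\<in>Z l0. ball x \<epsilon>)"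
    and disj: "\<And>x y. x \<in> Z l0 \<Longrightarrow> y \<in> Z l0 \<Longrightarrow> x \<noteq> y \<Longrightarrow> ball x \<epsilon> \<inter> ball y \<epsilon> = {}"
    unfolding local_system_def by blast+
  let ?U = "ball l0 \<delta>"
  define u where "u x = ?C \<inter> (?U \<times> ball x \<epsilon>)" for x
  have u_graph: "u x = (\<lambda>l. (l, \<phi> x l)) ` ?U" if x: "x \<in> Z l0" for x
  proof -
    have "(l, m) \<in> u x \<longleftrightarrow> l \<in> ?U \<and> m = \<phi> x l" for l m
    proof -
      have "(l, m) \<in> u x \<longleftrightarrow> l \<in> ?U \<and> m \<in> Z l \<inter> ball x \<epsilon>" using sub by (auto simp: u_def)
      moreover have "m \<in> Z l \<inter> ball x \<epsilon> \<longleftrightarrow> m = \<phi> x l" if "l \<in> ?U"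
        by (simp only: single[OF that x] singleton_iff)
      ultimately show ?thesis by blast
    qed
    then show ?thesis by auto
  qed
  show "\<exists>V. l0 \<in> V \<and> openin (top_of_set T) V \<and>
      (\<exists>v. \<Union> v = ?C \<inter> fst -` V \<and> (\<forall>u\<in>v. openin (top_of_set ?C) u) \<and> pairwise disjnt v \<and>
        (\<forall>u\<in>v. \<exists>q. homeomorphism u V fst q))"
  proof (intro exI[of _ ?U] conjI exI[of _ "u ` Z l0"])
    show "l0 \<in> ?U" using pos by simp
    show "openin (top_of_set T) ?U" using sub T(1) by (simp add: openin_open_eq)
    show "\<Union> (u ` Z l0) = ?C \<inter> fst -` ?U"
    proof
      show "?C \<inter> fst -` ?U \<subseteq> \<Union> (u ` Z l0)"
      proof
        fix p assume p: "p \<in> ?C \<inter> fst -` ?U"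
        then have "fst p \<in> ?U" "snd p \<in> Z (fst p)" by auto
        then have "snd p \<in> (\<Union>x\<in>Z l0. ball x \<epsilon>)" using cover by blast
        then obtain x where "x \<in> Z l0" "snd p \<in> ball x \<epsilon>" by blast
        then show "p \<in> \<Union> (u ` Z l0)" using p by (intro UN_I[of x]) (auto simp: u_def)
      qed
    qed (auto simp: u_def)
    show "\<forall>w\<in>u ` Z l0. openin (top_of_set ?C) w"
      unfolding u_def by (auto intro!: openin_open_Int open_Times)
    show "pairwise disjnt (u ` Z l0)"
    proof (rule pairwiseI)
      fix w w' assume "w \<in> u ` Z l0" "w' \<in> u ` Z l0" "w \<noteq> w'"
      then obtain x y where "w = u x" "w' = u y" "x \<in> Z l0" "y \<in> Z l0" "x \<noteq> y" by blast
      then show "disjnt w w'" using disj[of x y] by (auto simp: u_def disjnt_def)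
    qed
    show "\<forall>w\<in>u ` Z l0. \<exists>q. homeomorphism w ?U fst q"
    proof
      fix w assume "w \<in> u ` Z l0"
      then obtain x where x: "x \<in> Z l0" "w = u x" by blast
      have "homeomorphism (u x) ?U fst (\<lambda>l. (l, \<phi> x l))"
      proof
        show "continuous_on ?U (\<lambda>l. (l, \<phi> x l))"
          by (intro continuous_on_Pair continuous_on_id holomorphic_on_imp_continuous_on[OF hol[OF x(1)]])
      qed (auto simp: u_graph[OF x(1)] intro: continuous_on_fst)
      then show "\<exists>q. homeomorphism w ?U fst q" using x by blast
    qed
  qed
qed

lemma section_holomorphic:
  assumes T: "open T" "T \<subseteq> ball 0 a" "\<And>l. l \<in> T \<Longrightarrow> card (Z l) = sheet_count"
    and s: "continuous_on T s" "\<And>l. l \<in> T \<Longrightarrow> s l \<in> Z l"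
  shows "s holomorphic_on T"
  unfolding holomorphic_on_open[OF T(1)]
proof
  fix l0 assume l0: "l0 \<in> T"
  obtain \<delta> \<epsilon> \<phi> where ls: "local_system T l0 \<delta> \<epsilon> \<phi>"
    using local_sheets[OF T l0] by blast
  then have pos: "\<delta> > 0" "\<epsilon> > 0" and sub: "ball l0 \<delta> \<subseteq> T"
    and hol: "\<And>x. x \<in> Z l0 \<Longrightarrow> \<phi> x holomorphic_on ball l0 \<delta>"
    and single: "\<And>l x. l \<in> ball l0 \<delta> \<Longrightarrow> x \<in> Z l0 \<Longrightarrow> Z l \<inter> ball x \<epsilon> = {\<phi> x l}"
    unfolding local_system_def by blast+
  let ?x = "s l0"
  have x: "?x \<in> Z l0" by (rule s(2)[OF l0])
  have "open (T \<inter> s -` ball ?x \<epsilon>)" using continuous_open_preimage[OF s(1) T(1) open_ball] .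
  then obtain e where e: "e > 0" "ball l0 e \<subseteq> T \<inter> s -` ball ?x \<epsilon>"
  proof -
    have "l0 \<in> T \<inter> s -` ball ?x \<epsilon>" using l0 pos by simp
    from openE[OF \<open>open (T \<inter> s -` ball ?x \<epsilon>)\<close> this] show ?thesis using that by blast
  qed
  have eq: "\<phi> ?x l = s l" if l: "l \<in> ball l0 (min \<delta> e)" for l
  proof -
    have "l \<in> ball l0 e" "l \<in> ball l0 \<delta>" using l by auto
    then have "s l \<in> Z l \<inter> ball ?x \<epsilon>" using e(2) s(2) by blast
    then have "s l \<in> {\<phi> ?x l}" using single[OF \<open>l \<in> ball l0 \<delta>\<close> x] by simp
    then show ?thesis by simp
  qed
  have "(\<phi> ?x has_field_derivative deriv (\<phi> ?x) l0) (at l0)"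
    by (rule holomorphic_derivI[OF hol[OF x] open_ball]) (use pos in simp)
  then have "(s has_field_derivative deriv (\<phi> ?x) l0) (at l0)"
    by (rule has_field_derivative_transform_within_open[OF _ open_ball[of l0 "min \<delta> e"]]) (use pos e eq in auto)
  then show "\<exists>f'. (s has_field_derivative f') (at l0)" by blast
qed

text \<open>
  Finitely many holomorphic sections with pairwise disjoint graphs that exhaust the zero set over
  \<open>S\<close>.
\<close>

definition sheet_system where
  "sheet_system S \<Lambda> \<longleftrightarrow> finite \<Lambda> \<and> (\<forall>\<sigma>\<in>\<Lambda>. \<sigma> holomorphic_on S \<and> (\<forall>l\<in>S. \<sigma> l \<in> Z l)) \<and>
     (\<forall>l\<in>S. \<forall>m\<in>Z l. \<exists>\<sigma>\<in>\<Lambda>. m = \<sigma> l) \<and>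
     (\<forall>\<sigma>\<in>\<Lambda>. \<forall>\<sigma>'\<in>\<Lambda>. \<sigma> \<noteq> \<sigma>' \<longrightarrow> (\<forall>l\<in>S. \<sigma> l \<noteq> \<sigma>' l))"

text \<open>
  Over a simply connected base the covering has a section through every point of a fibre. Sections
  through different points never meet, by uniqueness of lifts.
\<close>

lemma global_sheets_slit:
  assumes b: "0 < b" "b \<le> a" "\<And>l. l \<in> ball 0 b - {0} \<Longrightarrow> card (Z l) = sheet_count"
  shows "\<exists>\<Lambda>. sheet_system (slit_disc b) \<Lambda>"
proof -
  let ?O = "slit_disc b"
  have O: "open ?O" "?O \<subseteq> ball 0 a" "\<And>l. l \<in> ?O \<Longrightarrow> card (Z l) = sheet_count"
  proof -
    have "0 \<in> complex_of_real ` {0..}" by (intro image_eqI[of _ _ 0]) auto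
    then have sub: "?O \<subseteq> ball 0 b - {0}" by (auto simp: slit_disc_def)
    show "open ?O" by (rule open_slit_disc)
    show "?O \<subseteq> ball 0 a" using sub b(2) by auto
    show "card (Z l) = sheet_count" if "l \<in> ?O" for l using b(3) sub that by blast
  qed
  show ?thesis
  proof (cases "sheet_count = 0")
    case True
    then have "Z l = {}" if "l \<in> ?O" for l using O(3)[OF that] finite_Z O(2) that by auto
    then show ?thesis unfolding sheet_system_def by (intro exI[of _ "{}"]) auto
  next
    case False
    then have cov: "covering_space (SIGMA l:?O. Z l) fst ?O" using covering_zeros[OF O] by simp
    have sc: "simply_connected ?O" by (rule starlike_imp_simply_connected[OF starlike_slit_disc[OF b(1)]])
    have lpc: "locally path_connected ?O" by (rule open_imp_locally_path_connected[OF O(1)])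
    have conn: "connected ?O" using sc simply_connected_imp_connected by blast
    obtain z0 where z0: "z0 \<in> ?O" using starlike_slit_disc[OF b(1)] by (auto simp: starlike_def)
    have "\<exists>s. continuous_on ?O s \<and> (\<forall>l\<in>?O. s l \<in> Z l) \<and> s z0 = x" if x: "x \<in> Z z0" for x
    proof -
      obtain g where g: "continuous_on ?O g" "g \<in> ?O \<rightarrow> (SIGMA l:?O. Z l)" "g z0 = (z0, x)" "\<And>y. y \<in> ?O \<Longrightarrow> fst (g y) = y"
        by (rule covering_space_lift_strong[OF cov _ z0 sc lpc continuous_on_id, of "(z0, x)"]) (use x z0 in auto)
      have "snd (g l) \<in> Z l" if "l \<in> ?O" for l using g(2,4) that by (force simp: Pi_iff)
      then show ?thesis using g by (intro exI[of _ "\<lambda>l. snd (g l)"]) (auto intro: continuous_on_snd)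
    qed
    then obtain s where s: "\<And>x. x \<in> Z z0 \<Longrightarrow> continuous_on ?O (s x)" "\<And>x l. x \<in> Z z0 \<Longrightarrow> l \<in> ?O \<Longrightarrow> s x l \<in> Z l"
      "\<And>x. x \<in> Z z0 \<Longrightarrow> s x z0 = x" by metis
    have uniq: "s x l = s y l \<longrightarrow> x = y" if "x \<in> Z z0" "y \<in> Z z0" "l \<in> ?O" for x y l
    proof
      assume e: "s x l = s y l"
      have "(z0, s x z0) = (z0, s y z0)"
        by (rule covering_space_lift_unique[OF cov, of "\<lambda>z. (z, s x z)" l "\<lambda>z. (z, s y z)" ?O "\<lambda>z. z" z0])
           (use e s that z0 conn in \<open>auto intro!: continuous_on_Pair continuous_on_id\<close>)
      then show "x = y" using s(3) that by simp
    qed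
    have all: "Z l = (\<lambda>x. s x l) ` Z z0" if l: "l \<in> ?O" for l
    proof -
      have "inj_on (\<lambda>x. s x l) (Z z0)" using uniq l by (auto simp: inj_on_def)
      then have "card ((\<lambda>x. s x l) ` Z z0) = card (Z l)" using card_image O(3) l z0 by metis
      moreover have "finite (Z l)" using finite_Z O(2) l by blast
      moreover have "(\<lambda>x. s x l) ` Z z0 \<subseteq> Z l" using s(2) l by blast
      ultimately show ?thesis using card_subset_eq by metis
    qed
    show ?thesis
      unfolding sheet_system_def
    proof (intro exI[of _ "s ` Z z0"] conjI)
      show "finite (s ` Z z0)" using finite_Z O(2) z0 by blast
      show "\<forall>\<sigma>\<in>s ` Z z0. \<sigma> holomorphic_on ?O \<and> (\<forall>l\<in>?O. \<sigma> l \<in> Z l)"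
        using section_holomorphic[OF O] s by blast
      show "\<forall>l\<in>?O. \<forall>m\<in>Z l. \<exists>\<sigma>\<in>s ` Z z0. m = \<sigma> l" using all by blast
      show "\<forall>\<sigma>\<in>s ` Z z0. \<forall>\<sigma>'\<in>s ` Z z0. \<sigma> \<noteq> \<sigma>' \<longrightarrow> (\<forall>l\<in>?O. \<sigma> l \<noteq> \<sigma>' l)" using uniq by blast
    qed
  qed
qed

text \<open>
  On the disc of radius \<open>\<bar>z\<bar> / 2\<close> around \<open>z\<close> the cone condition gives \<open>\<bar>\<sigma>\<bar> \<le> n (3 / 2) \<bar>z\<bar>\<close>. Hence
  Cauchy's estimate bounds the derivative by \<open>3 n\<close>, and the half disc is convex.
\<close>

lemma sheet_lipschitz:
  assumes b: "0 < b" "b \<le> a" and hol: "\<sigma> holomorphic_on slit_disc b" and Z: "\<And>l. l \<in> slit_disc b \<Longrightarrow> \<sigma> l \<in> Z l"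
    and l: "l \<in> half_disc (b / 2)" "l' \<in> half_disc (b / 2)"
  shows "norm (\<sigma> l - \<sigma> l') \<le> 3 * n * norm (l - l')"
proof (rule field_differentiable_bound[OF convex_half_disc _ _ l(1) l(2)])
  fix z assume z: "z \<in> half_disc (b / 2)"
  then have z': "Re z < 0" "norm z < b / 2" by (auto simp: half_disc_def)
  then have z0: "norm z > 0" by auto
  note cb = ball_in_slit_disc[OF z']
  have zin: "z \<in> slit_disc b" using cb z0 by (meson centre_in_cball half_gt_zero less_imp_le subsetD)
  show "(\<sigma> has_field_derivative deriv \<sigma> z) (at z within half_disc (b / 2))"
    using holomorphic_derivI[OF hol open_slit_disc zin] by (rule has_field_derivative_at_within)
  have "norm ((deriv ^^ 1) \<sigma> z) \<le> fact 1 * (n * (3 / 2 * norm z)) / (norm z / 2) ^ 1"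
  proof (rule Cauchy_inequality)
    show "\<sigma> holomorphic_on ball z (norm z / 2)" using hol by (rule holomorphic_on_subset) (use cb ball_subset_cball in blast)
    show "continuous_on (cball z (norm z / 2)) \<sigma>" using holomorphic_on_imp_continuous_on[OF hol] cb by (rule continuous_on_subset)
    show "norm (\<sigma> x) \<le> n * (3 / 2 * norm z)" if "norm (z - x) = norm z / 2" for x
    proof -
      have "x \<in> slit_disc b" using cb that by (auto simp: dist_norm)
      moreover have xa: "x \<in> ball 0 a" using \<open>x \<in> slit_disc b\<close> b by (auto simp: slit_disc_def)
      ultimately have "\<sigma> x \<in> ball 0 B \<and> F x (\<sigma> x) = 0" using Z[of x] Z_eq[OF xa] by blast
      then have "norm (\<sigma> x) \<le> n * norm x" using cone[OF xa] by blast
      also have "norm x \<le> 3 / 2 * norm z" using norm_triangle_sub[of x z] that by (simp add: norm_minus_commute)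
      finally show ?thesis using n by simp
    qed
  qed (use z0 in simp)
  also have "\<dots> = 3 * n" using z0 by (simp add: field_simps)
  finally show "norm (deriv \<sigma> z) \<le> 3 * n" by simp
qed

lemma sheets_exist:
  "\<exists>b>0. b \<le> a \<and> (\<exists>\<Lambda>. finite \<Lambda> \<and>
     (\<forall>\<sigma>\<in>\<Lambda>. \<sigma> holomorphic_on half_disc b \<and> (\<forall>l\<in>half_disc b. \<sigma> l \<in> ball 0 B \<and> F l (\<sigma> l) = 0) \<and>
        (\<forall>l\<in>half_disc b. \<forall>l'\<in>half_disc b. norm (\<sigma> l - \<sigma> l') \<le> 3 * n * norm (l - l'))) \<and>
     (\<forall>l\<in>half_disc b. \<forall>m\<in>ball 0 B. F l m = 0 \<longrightarrow> (\<exists>\<sigma>\<in>\<Lambda>. m = \<sigma> l)) \<and>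
     (\<forall>\<sigma>\<in>\<Lambda>. \<forall>\<sigma>'\<in>\<Lambda>. \<sigma> \<noteq> \<sigma>' \<longrightarrow> (\<forall>l\<in>half_disc b. \<sigma> l \<noteq> \<sigma>' l)))"
proof -
  obtain b where b: "0 < b" "b \<le> a" "\<And>l. l \<in> ball 0 b - {0} \<Longrightarrow> card (Z l) = sheet_count" using card_Z_punctured by blast
  obtain \<Lambda> where ls: "sheet_system (slit_disc b) \<Lambda>" using global_sheets_slit[OF b] by blast
  note ls' = ls[unfolded sheet_system_def]
  have fin: "finite \<Lambda>" using ls' by (elim conjE)
  have L1: "\<forall>\<sigma>\<in>\<Lambda>. \<sigma> holomorphic_on slit_disc b \<and> (\<forall>l\<in>slit_disc b. \<sigma> l \<in> Z l)" using ls' by (elim conjE)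
  have L2: "\<forall>l\<in>slit_disc b. \<forall>m\<in>Z l. \<exists>\<sigma>\<in>\<Lambda>. m = \<sigma> l" using ls' by (elim conjE)
  have L3: "\<forall>\<sigma>\<in>\<Lambda>. \<forall>\<sigma>'\<in>\<Lambda>. \<sigma> \<noteq> \<sigma>' \<longrightarrow> (\<forall>l\<in>slit_disc b. \<sigma> l \<noteq> \<sigma>' l)" using ls' by (elim conjE)
  have sub: "half_disc (b / 2) \<subseteq> slit_disc b"
  proof
    fix z assume z: "z \<in> half_disc (b / 2)"
    then have "norm z < b / 2" by (simp add: half_disc_def)
    then have "norm z < b" using norm_ge_zero[of z] by linarith
    then show "z \<in> slit_disc b" using z by (auto simp: half_disc_def slit_disc_def)
  qed
  have Zl: "m \<in> Z l \<longleftrightarrow> m \<in> ball 0 B \<and> F l m = 0" if "l \<in> half_disc (b / 2)" for l m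
  proof (rule Z_eq)
    have "norm l < b / 2" using that by (simp add: half_disc_def)
    then have "norm l < a" using norm_ge_zero[of l] b(2) by linarith
    then show "l \<in> ball 0 a" by simp
  qed
  show ?thesis
  proof (intro exI[of _ "b / 2"] exI[of _ \<Lambda>] conjI ballI impI)
    fix \<sigma> assume l: "\<sigma> \<in> \<Lambda>"
    have hol: "\<sigma> holomorphic_on slit_disc b" and Lz: "\<And>z. z \<in> slit_disc b \<Longrightarrow> \<sigma> z \<in> Z z"
      using bspec[OF L1 l] by simp_all
    show "\<sigma> holomorphic_on half_disc (b / 2)" using hol sub by (rule holomorphic_on_subset)
    fix z assume z: "z \<in> half_disc (b / 2)"
    then have "\<sigma> z \<in> Z z" using Lz sub by blast
    then show "\<sigma> z \<in> ball 0 B" "F z (\<sigma> z) = 0" using Zl[OF z] by simp_all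
    fix z' assume z': "z' \<in> half_disc (b / 2)"
    show "norm (\<sigma> z - \<sigma> z') \<le> 3 * n * norm (z - z')"
      by (rule sheet_lipschitz[OF b(1,2) hol Lz z z'])
  next
    fix z m assume z: "z \<in> half_disc (b / 2)" and m: "m \<in> ball 0 B" "F z m = 0"
    have "m \<in> Z z" using Zl[OF z] m by simp
    then show "\<exists>\<sigma>\<in>\<Lambda>. m = \<sigma> z" using L2 z sub by fast
  next
    fix \<sigma> \<sigma>' z assume "\<sigma> \<in> \<Lambda>" "\<sigma>' \<in> \<Lambda>" "\<sigma> \<noteq> \<sigma>'" and z: "z \<in> half_disc (b / 2)"
    then have "\<forall>l\<in>slit_disc b. \<sigma> l \<noteq> \<sigma>' l" using L3 by simp
    then show "\<sigma> z \<noteq> \<sigma>' z" using z sub by blast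
  qed (use b fin in auto)
qed

end

section \<open>Boundary and gradient of a convex domain\<close>

lemma defining_function_frontier:
  fixes \<rho> :: "'a::topological_space \<Rightarrow> real"
  assumes "continuous_on UNIV \<rho>" "p \<in> frontier {z. \<rho> z < 0}"
  shows "\<rho> p = 0"
proof -
  have "closed {z. \<rho> z \<le> 0}" "open {z. \<rho> z < 0}"
    using assms(1) by (intro closed_Collect_le open_Collect_less; simp)+
  moreover have "{z. \<rho> z < 0} \<subseteq> {z. \<rho> z \<le> 0}" by auto
  ultimately have "closure {z. \<rho> z < 0} \<subseteq> {z. \<rho> z \<le> 0}" "interior {z. \<rho> z < 0} = {z. \<rho> z < 0}"
    using closure_minimal interior_open by blast+
  then show ?thesis using assms(2) by (force simp: frontier_def)
qed

text \<open>
  The gradient is given by a definite description; the vector of the partial derivatives satisfies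
  it.
\<close>

lemma gradient_eq:
  fixes \<rho> :: "'a::euclidean_space \<Rightarrow> real"
  assumes "\<rho> differentiable (at z)"
  shows "pd w \<rho> z = w \<bullet> gradient \<rho> z"
proof -
  let ?D = "\<lambda>w. pd w \<rho> z"
  have l: "linear ?D" using assms by (simp add: linear_frechet_derivative)
  define d where "d = (\<Sum>b\<in>Basis. ?D b *\<^sub>R b)"
  have D: "?D w = w \<bullet> d" for w
  proof -
    have "?D w = (\<Sum>b\<in>Basis. (w \<bullet> b) *\<^sub>R ?D b)" by (rule pd_linear_expand[OF assms])
    also have "\<dots> = w \<bullet> d" by (simp add: d_def inner_sum_right mult.commute)
    finally show ?thesis .
  qed
  have "(\<rho> has_derivative ?D) (at z)" using assms unfolding frechet_derivative_works .
  moreover have e: "?D = (\<lambda>h. h \<bullet> d)" using D by blast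
  ultimately have g: "GDERIV \<rho> z :> d" unfolding gderiv_def by simp
  have "gradient \<rho> z = d"
    unfolding gradient_def
  proof (rule the_equality)
    show "GDERIV \<rho> z :> d" by (rule g)
    fix d' assume "GDERIV \<rho> z :> d'"
    then have "(\<rho> has_derivative (\<lambda>h. h \<bullet> d')) (at z)" unfolding gderiv_def .
    then have "(\<lambda>h. h \<bullet> d') = (\<lambda>h. h \<bullet> d)"
      using g[unfolded gderiv_def] by (rule has_derivative_unique)
    then have "h \<bullet> (d' - d) = 0" for h by (simp add: inner_diff_right fun_eq_iff)
    from this[of "d' - d"] show "d' = d" by simp
  qed
  then show ?thesis using D by simp
qed

text \<open>
  A convex function lies above its tangent at \<open>p\<close>. Hence \<open>D\<close> lies strictly on one side of the real
  tangent hyperplane at every boundary point.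
\<close>

lemma convex_derivative_neg:
  fixes \<rho> :: "'a::euclidean_space \<Rightarrow> real"
  assumes "strictly_convex_on UNIV \<rho>" "\<rho> differentiable (at p)" "\<rho> p = 0" "\<rho> z < 0"
  shows "pd (z - p) \<rho> p < 0"
proof -
  let ?h = "\<lambda>t. \<rho> (p + t *\<^sub>R (z - p))"
  have D: "(\<rho> has_derivative (\<lambda>w. pd w \<rho> p)) (at p)" using assms(2) unfolding frechet_derivative_works .
  have "((\<lambda>t. p + t *\<^sub>R (z - p)) has_derivative (\<lambda>t. t *\<^sub>R (z - p))) (at 0)"
    by (auto intro!: derivative_eq_intros)
  from has_derivative_compose[OF this, of \<rho>] D
  have hd: "(?h has_derivative (\<lambda>t. pd (t *\<^sub>R (z - p)) \<rho> p)) (at 0)" by simp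
  have lin: "linear (\<lambda>w. pd w \<rho> p)" using assms(2) by (simp add: linear_frechet_derivative)
  have e: "(\<lambda>t. pd (t *\<^sub>R (z - p)) \<rho> p) = (*) (pd (z - p) \<rho> p)" using linear_cmul[OF lin] by (auto simp: mult.commute)
  have "(?h has_real_derivative pd (z - p) \<rho> p) (at 0)"
    using hd unfolding e has_field_derivative_def .
  then have lim: "((\<lambda>t. (?h t - ?h 0) / t) \<longlongrightarrow> pd (z - p) \<rho> p) (at 0)"
    by (simp add: has_field_derivative_iff)
  have lim': "((\<lambda>t. (?h t - ?h 0) / t) \<longlongrightarrow> pd (z - p) \<rho> p) (at_right 0)"
    by (rule tendsto_mono[OF _ lim]) (simp add: at_le)
  have ev: "\<forall>\<^sub>F t in at_right (0::real). (?h t - ?h 0) / t \<le> \<rho> z"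
  proof -
    have "\<forall>\<^sub>F t in at_right (0::real). t \<in> {0<..<1}" by (rule eventually_at_right_real) simp
    then show ?thesis
    proof (rule eventually_mono)
      fix t :: real assume t: "t \<in> {0<..<1}"
      have "z \<noteq> p" using assms(3,4) by auto
      then have "\<rho> ((1 - t) *\<^sub>R p + t *\<^sub>R z) < (1 - t) * \<rho> p + t * \<rho> z"
        using assms(1) t unfolding strictly_convex_on_def by auto
      moreover have "(1 - t) *\<^sub>R p + t *\<^sub>R z = p + t *\<^sub>R (z - p)" by (simp add: algebra_simps)
      ultimately have "?h t \<le> t * \<rho> z" using assms(3) by simp
      then show "(?h t - ?h 0) / t \<le> \<rho> z" using t assms(3) by (simp add: divide_le_eq mult.commute)
    qed
  qed
  have "pd (z - p) \<rho> p \<le> \<rho> z" by (rule tendsto_upperbound[OF lim' ev]) simp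
  then show ?thesis using assms(4) by simp
qed

section \<open>Unitary coordinates\<close>

text \<open>
  \<open>L\<close> and \<open>M\<close> are the coordinates with respect to an orthonormal basis \<open>\<eta>\<close>, \<open>w\<close> of \<open>\<complex>\<^sup>2\<close>; everything
  that is needed about them is collected here.
\<close>

definition unitary_coordinates ::
    "complex ^ 2 \<Rightarrow> complex ^ 2 \<Rightarrow> (complex ^ 2 \<Rightarrow> complex) \<Rightarrow> (complex ^ 2 \<Rightarrow> complex) \<Rightarrow> bool" where
  "unitary_coordinates \<eta> w L M \<longleftrightarrow> bounded_linear L \<and> bounded_linear M \<and>
     (\<forall>c z. L (c *s z) = c * L z) \<and> (\<forall>c z. M (c *s z) = c * M z) \<and>
     (\<forall>z. z = L z *s \<eta> + M z *s w) \<and> (\<forall>z. norm (L z) \<le> norm z) \<and> (\<forall>z. norm (M z) \<le> norm z) \<and>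
     (\<forall>z. Re (L z) = z \<bullet> \<eta>) \<and> (\<forall>l m. L (l *s \<eta> + m *s w) = l) \<and> (\<forall>l m. M (l *s \<eta> + m *s w) = m) \<and>
     norm \<eta> = 1 \<and> norm w = 1"

text \<open>
  The Hermitian inner product, whose real part is the Euclidean one.
\<close>

definition hermitian :: "complex ^ 2 \<Rightarrow> complex ^ 2 \<Rightarrow> complex" where
  "hermitian z w = (\<Sum>i\<in>UNIV. z $ i * cnj (w $ i))"

lemma hermitian_smult: "hermitian (c *s z) w = c * hermitian z w"
  by (simp add: hermitian_def sum_distrib_left mult.assoc)

lemma hermitian_add: "hermitian (x + y) w = hermitian x w + hermitian y w"
  by (simp add: hermitian_def algebra_simps sum.distrib)

lemma Re_hermitian: "Re (hermitian z w) = z \<bullet> w"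
  by (simp add: hermitian_def inner_vec_def inner_complex_def)

lemma Im_hermitian: "Im (hermitian z w) = - ((\<i> *s z) \<bullet> w)"
  unfolding Re_hermitian[symmetric] hermitian_smult by simp

lemma norm_hermitian_le: "norm (hermitian z w) \<le> norm z * norm w"
proof (cases "hermitian z w = 0")
  case False
  define c where "c = cnj (hermitian z w) / norm (hermitian z w)"
  have nc: "norm c = 1" using False by (simp add: c_def norm_divide)
  have "c * hermitian z w = norm (hermitian z w)"
    using False by (simp add: c_def complex_norm_square[symmetric] power2_eq_square mult.commute)
  then have "norm (hermitian z w) = Re (hermitian (c *s z) w)" by (simp add: hermitian_smult)
  also have "\<dots> \<le> norm (c *s z) * norm w" unfolding Re_hermitian using norm_cauchy_schwarz by blast
  finally show ?thesis using nc by (simp add: norm_smult_vec)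
qed simp

lemma bounded_linear_hermitian: "bounded_linear (\<lambda>z. hermitian z w)"
proof (rule bounded_linear_intro[where K = "norm w"])
  show "hermitian (r *\<^sub>R x) w = r *\<^sub>R hermitian x w" for r x
    by (simp add: hermitian_def scaleR_sum_right)
qed (use norm_hermitian_le hermitian_add in auto)

lemma hermitian_self: "hermitian z z = (norm z)\<^sup>2"
  by (simp add: complex_eq_iff Re_hermitian Im_hermitian power2_norm_eq_inner)
     (simp add: inner_vec_def inner_complex_def)

lemma unitary_coordinates_exist:
  assumes "norm \<eta> = 1" "norm w = 1" "w \<bullet> \<eta> = 0" "(\<i> *s w) \<bullet> \<eta> = 0"
  shows "\<exists>L M. unitary_coordinates \<eta> w L M"
proof -
  have h: "hermitian \<eta> \<eta> = 1" "hermitian w w = 1" "hermitian w \<eta> = 0"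
    using assms by (simp_all add: hermitian_self complex_eq_iff Re_hermitian Im_hermitian)
  have h': "hermitian \<eta> w = 0"
  proof -
    have "hermitian \<eta> w = cnj (hermitian w \<eta>)" by (simp add: hermitian_def mult.commute)
    then show ?thesis using h by simp
  qed
  define A :: "complex ^ 2 ^ 2" where "A = (\<chi> i j. if i = 1 then cnj (\<eta> $ j) else cnj (w $ j))"
  define B :: "complex ^ 2 ^ 2" where "B = (\<chi> i j. if j = 1 then \<eta> $ i else w $ i)"
  have "A ** B = mat 1"
    using h h' unfolding hermitian_def
    by (simp add: A_def B_def matrix_matrix_mult_def mat_def vec_eq_iff forall_2 sum_2 mult.commute)
  then have BA: "B ** A = mat 1" by (simp add: matrix_left_right_inverse)
  have dec: "z = hermitian z \<eta> *s \<eta> + hermitian z w *s w" for z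
  proof -
    have "z = B *v (A *v z)" by (simp add: matrix_vector_mul_assoc BA)
    also have "\<dots> = hermitian z \<eta> *s \<eta> + hermitian z w *s w"
      by (simp add: A_def B_def matrix_vector_mult_def vec_eq_iff sum_2 hermitian_def mult.commute distrib_left)
    finally show ?thesis .
  qed
  show ?thesis
    unfolding unitary_coordinates_def
  proof (rule exI[of _ "\<lambda>z. hermitian z \<eta>"], rule exI[of _ "\<lambda>z. hermitian z w"], intro conjI allI bounded_linear_hermitian hermitian_smult dec Re_hermitian assms(1,2))
    show "norm (hermitian z \<eta>) \<le> norm z" "norm (hermitian z w) \<le> norm z" for z
      using norm_hermitian_le[of z \<eta>] norm_hermitian_le[of z w] assms by auto
    show "hermitian (l *s \<eta> + m *s w) \<eta> = l" "hermitian (l *s \<eta> + m *s w) w = m" for l m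
      using h h' by (simp_all add: hermitian_add hermitian_smult)
  qed
qed

section \<open>The analytic set near a boundary point\<close>

text \<open>
  The structure of \<open>X\<close> near a boundary point \<open>p\<close>, in coordinates \<open>l = L (z - p)\<close> and
  \<open>m = M (z - p)\<close>: over the half disc, \<open>X\<close> contains the disjoint graphs of the Lipschitz functions
  in \<open>\<Lambda>\<close>, and every point of \<open>X \<inter> D\<close> near \<open>p\<close> lies on one of them. The graphs may leave \<open>D\<close>.
\<close>

definition sheet_chart where
  "sheet_chart D X p \<delta> L M \<eta> w \<Lambda> a K \<longleftrightarrow> 0 < \<delta> \<and> \<delta> \<le> a \<and> 0 \<le> K \<and> unitary_coordinates \<eta> w L M \<and> finite \<Lambda> \<and>
     (\<forall>z\<in>D. Re (L (z - p)) < 0) \<and>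
     (\<forall>\<sigma>\<in>\<Lambda>. \<sigma> holomorphic_on half_disc a \<and> (\<forall>l\<in>half_disc a. p + l *s \<eta> + \<sigma> l *s w \<in> X) \<and>
        (\<forall>l\<in>half_disc a. \<forall>l'\<in>half_disc a. norm (\<sigma> l - \<sigma> l') \<le> K * norm (l - l'))) \<and>
     (\<forall>z\<in>X \<inter> D \<inter> ball p \<delta>. \<exists>\<sigma>\<in>\<Lambda>. M (z - p) = \<sigma> (L (z - p))) \<and>
     (\<forall>\<sigma>\<in>\<Lambda>. \<forall>\<sigma>'\<in>\<Lambda>. \<sigma> \<noteq> \<sigma>' \<longrightarrow> (\<forall>l\<in>half_disc a. \<sigma> l \<noteq> \<sigma>' l))"

lemma tangential_line:
  assumes "w \<in> complex_tangent_space \<rho> p"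
  shows "c *s w \<in> tangent_space \<rho> p"
proof -
  have 1: "w \<bullet> gradient \<rho> p = 0" "(\<i> *s w) \<bullet> gradient \<rho> p = 0"
    using assms by (auto simp: complex_tangent_space_def tangent_space_def)
  have "c *s w = Re c *\<^sub>R w + Im c *\<^sub>R (\<i> *s w)"
    by (simp add: vec_eq_iff complex_eq_iff)
  then show ?thesis using 1 by (simp add: tangent_space_def inner_add_left)
qed

text \<open>
  A complex tangent line lies in the real tangent space together with all its multiples, so that a
  transverse tangent cone cannot contain a nonzero complex tangential vector.
\<close>

lemma tangent_cone_transverse:
  assumes "transverse_tangent_cones X \<rho>" "p \<in> X" "p \<in> frontier {z. \<rho> z < 0}"
    and w: "w \<in> complex_tangent_space \<rho> p" "c *s w \<in> tangent_cone X p" "c *s w \<noteq> 0" and g: "gradient \<rho> p \<noteq> 0"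
  shows False
proof -
  have "{d *s (c *s w) + u | d u. u \<in> tangent_space \<rho> p} = UNIV"
    using assms unfolding transverse_tangent_cones_def by blast
  then obtain d u where du: "gradient \<rho> p = d *s (c *s w) + u" "u \<in> tangent_space \<rho> p" by blast
  have "d *s (c *s w) \<in> tangent_space \<rho> p"
    using tangential_line[OF w(1), of "d * c"] by (simp add: vector_smult_assoc)
  then have "(d *s (c *s w) + u) \<bullet> gradient \<rho> p = 0" using du(2) by (simp add: tangent_space_def inner_add_left)
  then show False using du(1) g by (metis inner_eq_zero_iff)
qed

lemma scaleR_smult_vec: "r *\<^sub>R (c *s (v :: complex ^ 'n::finite)) = (complex_of_real r * c) *s v"
proof (subst vec_eq_iff, intro allI)
  fix i show "(r *\<^sub>R (c *s v)) $ i = ((complex_of_real r * c) *s v) $ i"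
    unfolding vector_scaleR_component vector_smult_component by (simp add: scaleR_conv_of_real)
qed

text \<open>
  Otherwise there are points of \<open>X\<close> converging to \<open>p\<close> with \<open>l / m\<close> tending to \<open>0\<close>. Rescaled by
  \<open>1 / \<bar>m\<bar>\<close> they accumulate at a unit multiple of \<open>w\<close>, which then belongs to the tangent cone
  although \<open>w\<close> is complex tangential.
\<close>

lemma zero_cone:
  assumes tr: "transverse_tangent_cones X \<rho>" "p \<in> X" "p \<in> frontier {z. \<rho> z < 0}"
    and w: "w \<in> complex_tangent_space \<rho> p" "norm w = 1" and g: "gradient \<rho> p \<noteq> 0" and \<eta>: "norm \<eta> = 1"
  shows "\<exists>N::nat. \<forall>l m. norm l < 1 / Suc N \<longrightarrow> norm m < 1 / Suc N \<longrightarrow> p + l *s \<eta> + m *s w \<in> X \<longrightarrow> norm m \<le> Suc N * norm l"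
proof (rule ccontr)
  assume "\<not> ?thesis"
  then have "\<forall>N::nat. \<exists>l m. norm l < 1 / Suc N \<and> norm m < 1 / Suc N \<and> p + l *s \<eta> + m *s w \<in> X \<and> norm m > Suc N * norm l"
    by (meson not_le)
  then obtain l m where lm: "\<And>N::nat. norm (l N) < 1 / Suc N" "\<And>N. norm (m N) < 1 / Suc N"
    "\<And>N. p + l N *s \<eta> + m N *s w \<in> X" "\<And>N. norm (m N) > Suc N * norm (l N)" by metis
  have m0: "norm (m N) > 0" for N
    using lm(4)[of N] norm_ge_zero[of "l N"] by (smt (verit) mult_nonneg_nonneg of_nat_0_le_iff)
  have lim1: "(\<lambda>N. 1 / real (Suc N)) \<longlonglongrightarrow> 0" by (rule LIMSEQ_Suc[OF lim_1_over_n])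
  define y where "y N = m N / norm (m N)" for N
  have y1: "y N \<in> sphere 0 1" for N using m0[of N] by (simp add: y_def norm_divide)
  obtain u s where us: "u \<in> sphere 0 1" "strict_mono (s :: nat \<Rightarrow> nat)" "(y \<circ> s) \<longlonglongrightarrow> u"
    using compact_sphere[of "0::complex" 1] y1 unfolding compact_def by metis
  have ss: "filterlim s sequentially sequentially" using us(2) filterlim_subseq by blast
  define x where "x N = p + l (s N) *s \<eta> + m (s N) *s w" for N
  define r where "r N = inverse (norm (m (s N)))" for N
  have "l \<longlonglongrightarrow> 0" "m \<longlonglongrightarrow> 0"
    using lm(1,2) by (auto intro!: Lim_null_comparison[OF _ lim1] always_eventually less_imp_le)
  then have ls: "(\<lambda>N. l (s N)) \<longlonglongrightarrow> 0" and ms: "(\<lambda>N. m (s N)) \<longlonglongrightarrow> 0"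
    using filterlim_compose[OF _ ss] by blast+
  note bl = bounded_linear.tendsto[OF bounded_linear_smult_left]
  have xp: "x \<longlonglongrightarrow> p"
    unfolding x_def using tendsto_add[OF tendsto_add[OF tendsto_const bl[OF ls]] bl[OF ms], of p \<eta> w] by simp
  have q: "(\<lambda>N. l (s N) / norm (m (s N))) \<longlonglongrightarrow> 0"
  proof (rule Lim_null_comparison)
    show "(\<lambda>N. 1 / real (Suc (s N))) \<longlonglongrightarrow> 0" using filterlim_compose[OF lim1 ss] .
    show "\<forall>\<^sub>F N in sequentially. norm (l (s N) / norm (m (s N))) \<le> 1 / real (Suc (s N))"
    proof (intro always_eventually allI)
      fix N show "norm (l (s N) / norm (m (s N))) \<le> 1 / real (Suc (s N))"
        using lm(4)[of "s N"] m0[of "s N"] by (simp add: norm_divide field_simps)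
    qed
  qed
  have "(\<lambda>N. r N *\<^sub>R (x N - p)) = (\<lambda>N. (l (s N) / norm (m (s N))) *s \<eta> + (y \<circ> s) N *s w)"
  proof
    fix N
    have "x N - p = l (s N) *s \<eta> + m (s N) *s w" by (simp add: x_def)
    then have "r N *\<^sub>R (x N - p) = (complex_of_real (r N) * l (s N)) *s \<eta> + (complex_of_real (r N) * m (s N)) *s w"
      by (simp only: scaleR_add_right scaleR_smult_vec)
    then show "r N *\<^sub>R (x N - p) = (l (s N) / norm (m (s N))) *s \<eta> + (y \<circ> s) N *s w"
      by (simp add: r_def y_def divide_inverse mult.commute)
  qed
  then have "(\<lambda>N. r N *\<^sub>R (x N - p)) \<longlonglongrightarrow> u *s w"
    using tendsto_add[OF bl[OF q] bl[OF us(3)], of \<eta> w] by simp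
  then have "u *s w \<in> tangent_cone X p"
    unfolding tangent_cone_def using xp lm(3) m0 by (auto simp: x_def r_def intro!: exI[of _ x] exI[of _ r])
  moreover have "u *s w \<noteq> 0"
  proof -
    have "norm (u *s w) = 1" using us(1) w(2) by (simp add: norm_smult_vec)
    then show ?thesis by auto
  qed
  ultimately show False using tangent_cone_transverse[OF tr w(1) _ _ g] by blast
qed

lemma holomorphic_on_Cn_curve:
  assumes f: "holomorphic_on_Cn f \<Omega>" and c: "(c has_derivative (\<lambda>h. h *s d)) (at t)" "c t \<in> \<Omega>"
  shows "\<exists>f'. ((\<lambda>t. f (c t)) has_field_derivative f') (at t)"
proof -
  obtain f' where f': "(f has_derivative f') (at (c t))" "\<And>a h. f' (a *s h) = a * f' h"
    using f c(2) unfolding holomorphic_on_Cn_def by blast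
  from has_derivative_compose[OF c(1) f'(1)] have "((\<lambda>t. f (c t)) has_derivative (\<lambda>h. f' (h *s d))) (at t)" .
  then have "((\<lambda>t. f (c t)) has_derivative (\<lambda>h. f' d * h)) (at t)" unfolding f'(2) by (simp add: mult.commute)
  then show ?thesis unfolding has_field_derivative_def by (intro exI[of _ "f' d"])
qed

lemma smult_curve_derivative:
  "((\<lambda>t. p + t *s d + q) has_derivative (\<lambda>h. h *s (d :: complex ^ 'n::finite))) (at t)"
  using has_derivative_add[OF has_derivative_add[OF has_derivative_const
      bounded_linear_imp_has_derivative[OF bounded_linear_smult_left]] has_derivative_const]
  by simp

lemma holomorphic_on_Cn_continuous: "holomorphic_on_Cn f \<Omega> \<Longrightarrow> continuous_on \<Omega> f"
  unfolding holomorphic_on_Cn_def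
  by (auto intro!: continuous_at_imp_continuous_on dest!: bspec has_derivative_continuous)

lemma sep_holomorphic_chart:
  assumes f: "holomorphic_on_Cn f \<Omega>" and sub: "\<And>l m. norm l < a \<Longrightarrow> norm m < B \<Longrightarrow> p + l *s \<eta> + m *s w \<in> \<Omega>"
  shows "sep_holomorphic a B (\<lambda>l m. f (p + l *s \<eta> + m *s w))"
  unfolding sep_holomorphic_def
proof (intro conjI ballI)
  have "continuous_on (ball 0 a \<times> ball 0 B) (\<lambda>q. p + fst q *s \<eta> + snd q *s w)"
    by (intro continuous_on_add continuous_on_const bounded_linear.continuous_on[OF bounded_linear_smult_left]
        continuous_on_fst continuous_on_snd continuous_on_id)
  from continuous_on_compose2[OF holomorphic_on_Cn_continuous[OF f] this]
  have "continuous_on (ball 0 a \<times> ball 0 B) (\<lambda>q. f (p + fst q *s \<eta> + snd q *s w))"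
    using sub by (auto simp: image_subset_iff)
  then show "continuous_on (ball 0 a \<times> ball 0 B) (\<lambda>(l, m). f (p + l *s \<eta> + m *s w))"
    by (simp add: case_prod_unfold)
  show "(\<lambda>l. f (p + l *s \<eta> + m *s w)) holomorphic_on ball 0 a" if "m \<in> ball 0 B" for m
    unfolding holomorphic_on_open[OF open_ball]
    using holomorphic_on_Cn_curve[OF f smult_curve_derivative] sub that by auto
  show "(\<lambda>m. f (p + l *s \<eta> + m *s w)) holomorphic_on ball 0 B" if "l \<in> ball 0 a" for l
    unfolding holomorphic_on_open[OF open_ball]
    using holomorphic_on_Cn_curve[OF f smult_curve_derivative[of "p + l *s \<eta>" w 0, simplified]] sub that by auto
qed

text \<open>
  If \<open>p\<close> is not on \<open>X\<close>, then no sheets are needed. Otherwise the cone condition turns the defining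
  function, written in unitary coordinates, into a \<open>zero_family\<close>.
\<close>

lemma sheet_chart_exists:
  fixes \<rho> :: "complex ^ 2 \<Rightarrow> real"
  assumes rho: "smooth_on UNIV \<rho>" "strictly_convex_on UNIV \<rho>" and D: "D = {z. \<rho> z < 0}"
    and p: "p \<in> frontier D" "gradient \<rho> p \<noteq> 0"
    and w: "norm w = 1" "w \<in> complex_tangent_space \<rho> p"
    and \<Omega>: "open \<Omega>" "p \<in> \<Omega>" and f: "holomorphic_on_Cn f \<Omega>" and X: "X = {z \<in> \<Omega>. f z = 0}"
    and tr: "transverse_tangent_cones X \<rho>"
  shows "\<exists>\<delta> L M \<Lambda> a K. sheet_chart D X p \<delta> L M (outer_normal \<rho> p) w \<Lambda> a K"
proof -
  let ?\<eta> = "outer_normal \<rho> p"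
  have cont: "continuous_on UNIV \<rho>" by (rule smooth_on_continuous_on[OF rho(1)])
  have diff: "\<rho> differentiable (at p)" by (rule smooth_on_differentiable[OF rho(1)]) simp
  have rp: "\<rho> p = 0" by (rule defining_function_frontier[OF cont p(1)[unfolded D]])
  have n\<eta>: "norm ?\<eta> = 1" using p(2) by (simp add: outer_normal_def)
  have orth: "w \<bullet> ?\<eta> = 0" "(\<i> *s w) \<bullet> ?\<eta> = 0"
    using w(2) by (auto simp: outer_normal_def complex_tangent_space_def tangent_space_def)
  obtain L M where LM: "unitary_coordinates ?\<eta> w L M" using unitary_coordinates_exist[OF n\<eta> w(1) orth] by blast
  have neg: "Re (L (z - p)) < 0" if "z \<in> D" for z
  proof -
    have "(z - p) \<bullet> gradient \<rho> p < 0"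
      using convex_derivative_neg[OF rho(2) diff rp] that gradient_eq[OF diff] D by auto
    then have "(z - p) \<bullet> ?\<eta> < 0" using p(2) by (simp add: outer_normal_def divide_neg_pos inverse_eq_divide[symmetric] mult_pos_neg)
    then show ?thesis using LM by (simp add: unitary_coordinates_def)
  qed
  show ?thesis
  proof (cases "p \<in> X")
    case False
    then have "f p \<noteq> 0" using X \<Omega> by auto
    then obtain e where e: "e > 0" "\<And>z. z \<in> ball p e \<Longrightarrow> f z \<noteq> 0"
      using holomorphic_on_Cn_continuous[OF f] \<Omega> continuous_on_eq_continuous_at[OF \<Omega>(1)]
        continuous_at_avoid[of p f 0] by (metis dist_commute mem_ball)
    then have "X \<inter> D \<inter> ball p e = {}" using X by auto
    then have "sheet_chart D X p e L M ?\<eta> w {} e 1"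
      unfolding sheet_chart_def using e(1) LM neg by auto
    then show ?thesis by blast
  next
    case True
    obtain N :: nat where N: "\<And>l m. norm l < 1 / Suc N \<Longrightarrow> norm m < 1 / Suc N \<Longrightarrow> p + l *s ?\<eta> + m *s w \<in> X \<Longrightarrow> norm m \<le> Suc N * norm l"
      using zero_cone[OF tr True p(1)[unfolded D] w(2,1) p(2) n\<eta>] by blast
    obtain e where e: "e > 0" "ball p e \<subseteq> \<Omega>" using \<Omega> open_contains_ball by blast
    define B where "B = min (1 / Suc N) (e / 2)"
    (* With this radius Suc N * a = B / 4, which is less than B / 2. *)
    define a where "a = B / (4 * real (Suc N))"
    have B: "B > 0" "B \<le> 1 / Suc N" "B \<le> e / 2" using e by (auto simp: B_def)
    have a: "a > 0" "a \<le> B"  "real (Suc N) * a < B / 2"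
    proof -
      have N1: "real (Suc N) \<ge> 1" by simp
      have e: "real (Suc N) * a = B / 4" using N1 by (simp add: a_def field_simps del: of_nat_Suc)
      show "a > 0" using B(1) N1 by (simp add: a_def del: of_nat_Suc)
      then have "1 * a \<le> real (Suc N) * a" using N1 by (intro mult_right_mono) auto
      then show "a \<le> B" using e B(1) by linarith
      show "real (Suc N) * a < B / 2" using e B(1) by linarith
    qed
    have in\<Omega>: "p + l *s ?\<eta> + m *s w \<in> \<Omega>" if "norm l < B" "norm m < B" for l m
    proof -
      have "norm (l *s ?\<eta> + m *s w) \<le> norm l + norm m"
        using norm_triangle_ineq[of "l *s ?\<eta>" "m *s w"] n\<eta> w(1) by (simp add: norm_smult_vec)
      also have "\<dots> < e" using that B(3) by linarith
      finally have "norm (l *s ?\<eta> + m *s w) < e" .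
      moreover have "dist p (p + l *s ?\<eta> + m *s w) = norm (l *s ?\<eta> + m *s w)"
        by (metis add.assoc add_diff_cancel_left' dist_commute dist_norm)
      ultimately have "dist p (p + l *s ?\<eta> + m *s w) < e" by simp
      then show ?thesis using e(2) by auto
    qed
    note aB = a(2)
    interpret zero_family a B "real (Suc N)" "\<lambda>l m. f (p + l *s ?\<eta> + m *s w)"
    proof
      show "sep_holomorphic a B (\<lambda>l m. f (p + l *s ?\<eta> + m *s w))"
        by (rule sep_holomorphic_chart[OF f]) (use in\<Omega> a in auto)
      fix l m assume lm: "l \<in> ball 0 a" "m \<in> ball 0 B" "f (p + l *s ?\<eta> + m *s w) = 0"
      show "norm m \<le> real (Suc N) * norm l"
        by (rule N) (use lm a B in\<Omega>[of l m] X in auto)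
    qed (use a B in auto)
    obtain b \<Lambda> where b: "b > 0" "b \<le> a" and fin: "finite \<Lambda>"
      and S1: "\<forall>\<sigma>\<in>\<Lambda>. \<sigma> holomorphic_on half_disc b \<and>
        (\<forall>l\<in>half_disc b. \<sigma> l \<in> ball 0 B \<and> f (p + l *s ?\<eta> + \<sigma> l *s w) = 0) \<and>
        (\<forall>l\<in>half_disc b. \<forall>l'\<in>half_disc b. norm (\<sigma> l - \<sigma> l') \<le> 3 * real (Suc N) * norm (l - l'))"
      and S2: "\<forall>l\<in>half_disc b. \<forall>m\<in>ball 0 B. f (p + l *s ?\<eta> + m *s w) = 0 \<longrightarrow> (\<exists>\<sigma>\<in>\<Lambda>. m = \<sigma> l)"
      and S3: "\<forall>\<sigma>\<in>\<Lambda>. \<forall>\<sigma>'\<in>\<Lambda>. \<sigma> \<noteq> \<sigma>' \<longrightarrow> (\<forall>l\<in>half_disc b. \<sigma> l \<noteq> \<sigma>' l)"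
      using sheets_exist by (elim exE conjE) (rule that)
    have "sheet_chart D X p b L M ?\<eta> w \<Lambda> b (3 * real (Suc N))"
      unfolding sheet_chart_def
    proof (intro conjI LM fin S3)
      show "\<forall>\<sigma>\<in>\<Lambda>. \<sigma> holomorphic_on half_disc b \<and> (\<forall>l\<in>half_disc b. p + l *s ?\<eta> + \<sigma> l *s w \<in> X) \<and>
        (\<forall>l\<in>half_disc b. \<forall>l'\<in>half_disc b. norm (\<sigma> l - \<sigma> l') \<le> 3 * real (Suc N) * norm (l - l'))"
      proof
        fix \<sigma> assume s: "\<sigma> \<in> \<Lambda>"
        have "p + l *s ?\<eta> + \<sigma> l *s w \<in> X" if l: "l \<in> half_disc b" for l
        proof -
          have "\<sigma> l \<in> ball 0 B" "f (p + l *s ?\<eta> + \<sigma> l *s w) = 0" using S1 s l by blast+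
          moreover have "norm l < B" using l b aB by (auto simp: half_disc_def)
          ultimately show ?thesis using in\<Omega> X by auto
        qed
        then show "\<sigma> holomorphic_on half_disc b \<and> (\<forall>l\<in>half_disc b. p + l *s ?\<eta> + \<sigma> l *s w \<in> X) \<and>
          (\<forall>l\<in>half_disc b. \<forall>l'\<in>half_disc b. norm (\<sigma> l - \<sigma> l') \<le> 3 * real (Suc N) * norm (l - l'))"
          using bspec[OF S1 s] by simp
      qed
      show "\<forall>z\<in>X \<inter> D \<inter> ball p b. \<exists>\<sigma>\<in>\<Lambda>. M (z - p) = \<sigma> (L (z - p))"
      proof
        fix z assume z: "z \<in> X \<inter> D \<inter> ball p b"
        have nz: "norm (z - p) < b" using z by (simp add: dist_norm norm_minus_commute)
        have U: "z - p = L (z - p) *s ?\<eta> + M (z - p) *s w" "norm (L (z - p)) \<le> norm (z - p)" "norm (M (z - p)) \<le> norm (z - p)"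
          using LM unfolding unitary_coordinates_def by blast+
        have "L (z - p) \<in> half_disc b" using U(2) nz neg z by (auto simp: half_disc_def)
        moreover have "M (z - p) \<in> ball 0 B" using U(3) nz b aB by simp
        moreover have "p + L (z - p) *s ?\<eta> + M (z - p) *s w = z" by (metis U(1) add.assoc add.commute diff_add_cancel)
        ultimately show "\<exists>\<sigma>\<in>\<Lambda>. M (z - p) = \<sigma> (L (z - p))" using S2 z X by auto
      qed
    qed (use b neg in auto)
    then show ?thesis by blast
  qed
qed

section \<open>Polynomials with holomorphic coefficients\<close>

text \<open>
  Polynomials in \<open>m\<close> whose coefficients are holomorphic functions of \<open>l\<close>. Here \<open>l\<close> and \<open>m\<close> are going
  to be affine functions on \<open>\<complex>\<^sup>n\<close>. The class is closed under directional derivatives and thus allows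
  inductions on the order of differentiation that use no theory of several complex variables.
\<close>

inductive hol_poly :: "complex set \<Rightarrow> (complex ^ 'n::finite \<Rightarrow> complex) \<Rightarrow> (complex ^ 'n \<Rightarrow> complex) \<Rightarrow> (complex ^ 'n \<Rightarrow> complex) \<Rightarrow> bool"
  for U l m where
  hol_poly_coeff: "b holomorphic_on U \<Longrightarrow> hol_poly U l m (\<lambda>z. b (l z))"
| hol_poly_var: "hol_poly U l m m"
| hol_poly_add: "hol_poly U l m f \<Longrightarrow> hol_poly U l m g \<Longrightarrow> hol_poly U l m (\<lambda>z. f z + g z)"
| hol_poly_mult: "hol_poly U l m f \<Longrightarrow> hol_poly U l m g \<Longrightarrow> hol_poly U l m (\<lambda>z. f z * g z)"

lemma hol_poly_const: "hol_poly U l m (\<lambda>z. c)"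
  using hol_poly_coeff[OF holomorphic_on_const] .

lemma hol_poly_sum: "(\<And>i. i \<in> I \<Longrightarrow> hol_poly U l m (f i)) \<Longrightarrow> hol_poly U l m (\<lambda>z. \<Sum>i\<in>I. f i z)"
  by (induction I rule: infinite_finite_induct) (simp_all add: hol_poly_const hol_poly_add)

lemma hol_poly_prod: "(\<And>i. i \<in> I \<Longrightarrow> hol_poly U l m (f i)) \<Longrightarrow> hol_poly U l m (\<lambda>z. \<Prod>i\<in>I. f i z)"
  by (induction I rule: infinite_finite_induct) (simp_all add: hol_poly_const hol_poly_mult)

definition affine_functional :: "(complex ^ 'n::finite \<Rightarrow> complex) \<Rightarrow> (complex ^ 'n \<Rightarrow> complex) \<Rightarrow> bool" where
  "affine_functional l A \<longleftrightarrow> bounded_linear A \<and> (\<forall>c z. A (c *s z) = c * A z) \<and> (\<forall>z. l z = l 0 + A z)"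

text \<open>
  Smoothness, the Cauchy-Riemann equations and closure under derivatives are proved together, since
  the product rule needs differentiability of the factors.
\<close>

lemma hol_poly_calculus:
  assumes "affine_functional l A" "affine_functional m A'" "open P" "open U" "\<And>z. z \<in> P \<Longrightarrow> l z \<in> U" "hol_poly U l m G"
  shows "smooth_on P G \<and> complex_linear_derivs P G \<and> (\<forall>w. \<exists>G'. hol_poly U l m G' \<and> (\<forall>z\<in>P. pd w G z = G' z))"
  using assms(6)
proof (induction rule: hol_poly.induct)
  case (hol_poly_coeff b)
  have A: "bounded_linear A" "\<And>c z. A (c *s z) = c * A z" and l: "\<And>z. l z = l 0 + A z"
    using assms(1) unfolding affine_functional_def by blast+
  have el: "(\<lambda>z. b (l z)) = (\<lambda>z. b (l 0 + A z))" using l by metis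
  have U: "l 0 + A z \<in> U" if "z \<in> P" for z using assms(5)[OF that] l[of z] by metis
  have d: "pd w (\<lambda>z. b (l z)) z = deriv b (l z) * A w" if "z \<in> P" for w z
    using pd_eqI[OF pd_holomorphic_compose[OF A(1) assms(4) hol_poly_coeff U[OF that]]] l[of z] unfolding el by simp
  show ?case
  proof (intro conjI allI)
    show "smooth_on P (\<lambda>z. b (l z))"
      unfolding el by (rule smooth_on_holomorphic_compose[OF A(1) assms(3,4) hol_poly_coeff U])
    show "complex_linear_derivs P (\<lambda>z. b (l z))"
      unfolding complex_linear_derivs_def using d A(2) by simp
    show "\<exists>G'. hol_poly U l m G' \<and> (\<forall>z\<in>P. pd w (\<lambda>z. b (l z)) z = G' z)" for w
      using d hol_poly_mult[OF hol_poly.hol_poly_coeff[OF holomorphic_deriv[OF hol_poly_coeff assms(4)]] hol_poly_const]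
      by (intro exI[of _ "\<lambda>z. deriv b (l z) * A w"]) simp
  qed
next
  case hol_poly_var
  have A: "bounded_linear A'" "\<And>c z. A' (c *s z) = c * A' z" and l: "\<And>z. m z = m 0 + A' z"
    using assms(2) unfolding affine_functional_def by blast+
  have el: "m = (\<lambda>z. m 0 + A' z)" using l by blast
  have "((\<lambda>z. m 0 + A' z) has_derivative A') (at z)" for z
    using has_derivative_add[OF has_derivative_const bounded_linear_imp_has_derivative[OF A(1)]] by simp
  then have d: "pd w m z = A' w" for w z using pd_eqI el by metis
  show ?case
  proof (intro conjI allI)
    show "smooth_on P m"
      by (subst el) (intro smooth_on_add assms(3) smooth_on_const smooth_on_bounded_linear_id A(1))
    show "complex_linear_derivs P m"
      unfolding complex_linear_derivs_def using d A(2) by simp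
    show "\<exists>G'. hol_poly U l m G' \<and> (\<forall>z\<in>P. pd w m z = G' z)" for w
      using d hol_poly_const by (intro exI[of _ "\<lambda>z. A' w"]) simp
  qed
next
  case (hol_poly_add f g)
  then have s: "smooth_on P f" "smooth_on P g" and c: "complex_linear_derivs P f" "complex_linear_derivs P g" by auto
  have d: "pd w (\<lambda>z. f z + g z) z = pd w f z + pd w g z" if "z \<in> P" for w z
    using pd_add[OF smooth_on_differentiable[OF s(1) that] smooth_on_differentiable[OF s(2) that]] .
  show ?case
  proof (intro conjI allI)
    show "smooth_on P (\<lambda>z. f z + g z)" by (rule smooth_on_add[OF assms(3) s])
    show "complex_linear_derivs P (\<lambda>z. f z + g z)"
      using c d unfolding complex_linear_derivs_def by (simp add: distrib_left)
    fix w
    obtain f' g' where "hol_poly U l m f'" "\<forall>z\<in>P. pd w f z = f' z" "hol_poly U l m g'" "\<forall>z\<in>P. pd w g z = g' z"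
      using hol_poly_add.IH by metis
    then show "\<exists>G'. hol_poly U l m G' \<and> (\<forall>z\<in>P. pd w (\<lambda>z. f z + g z) z = G' z)"
      using d hol_poly.hol_poly_add by (intro exI[of _ "\<lambda>z. f' z + g' z"]) simp
  qed
next
  case (hol_poly_mult f g)
  then have s: "smooth_on P f" "smooth_on P g" and c: "complex_linear_derivs P f" "complex_linear_derivs P g" by auto
  have d: "pd w (\<lambda>z. f z * g z) z = f z * pd w g z + pd w f z * g z" if "z \<in> P" for w z
    using pd_mult[OF smooth_on_differentiable[OF s(1) that] smooth_on_differentiable[OF s(2) that]] .
  show ?case
  proof (intro conjI allI)
    show "smooth_on P (\<lambda>z. f z * g z)" by (rule smooth_on_mult[OF assms(3) s])
    show "complex_linear_derivs P (\<lambda>z. f z * g z)"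
      using c d unfolding complex_linear_derivs_def by (simp add: algebra_simps)
    fix w
    obtain f' g' where *: "hol_poly U l m f'" "\<forall>z\<in>P. pd w f z = f' z" "hol_poly U l m g'" "\<forall>z\<in>P. pd w g z = g' z"
      using hol_poly_mult.IH by metis
    have "hol_poly U l m (\<lambda>z. f z * g' z + f' z * g z)"
      by (rule hol_poly.hol_poly_add[OF hol_poly.hol_poly_mult[OF hol_poly_mult.hyps(1) *(3)] hol_poly.hol_poly_mult[OF *(1) hol_poly_mult.hyps(2)]])
    then show "\<exists>G'. hol_poly U l m G' \<and> (\<forall>z\<in>P. pd w (\<lambda>z. f z * g z) z = G' z)"
      using d * by (intro exI[of _ "\<lambda>z. f z * g' z + f' z * g z"]) simp
  qed
qed

definition hol_poly_on :: "(complex ^ 'n::finite) set \<Rightarrow> (complex ^ 'n \<Rightarrow> complex) \<Rightarrow> bool" where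
  "hol_poly_on P G \<longleftrightarrow> open P \<and> (\<exists>U l m A A'. affine_functional l A \<and> affine_functional m A' \<and> open U \<and>
     (\<forall>z\<in>P. l z \<in> U) \<and> hol_poly U l m G)"

lemma hol_poly_on_calculus:
  assumes "hol_poly_on P G"
  shows "smooth_on P G \<and> complex_linear_derivs P G \<and> (\<forall>w. \<exists>G'. hol_poly_on P G' \<and> (\<forall>z\<in>P. pd w G z = G' z))"
proof -
  obtain U l m A A' where h: "affine_functional l A" "affine_functional m A'" "open U" "\<forall>z\<in>P. l z \<in> U"
    "hol_poly U l m G" and P: "open P"
    using assms unfolding hol_poly_on_def by blast
  have lU: "l z \<in> U" if "z \<in> P" for z using h(4) that by blast
  note c = hol_poly_calculus[OF h(1,2) P h(3) lU h(5)]
  have "\<exists>G'. hol_poly_on P G' \<and> (\<forall>z\<in>P. pd w G z = G' z)" for w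
  proof -
    obtain G' where G': "hol_poly U l m G'" "\<forall>z\<in>P. pd w G z = G' z" using c by blast
    have "hol_poly_on P G'" unfolding hol_poly_on_def using h P G'(1) by blast
    then show ?thesis using G'(2) by blast
  qed
  then show ?thesis using c by blast
qed

lemma hol_poly_on_smooth: "hol_poly_on P G \<Longrightarrow> smooth_on P G"
  and hol_poly_on_complex_linear: "hol_poly_on P G \<Longrightarrow> complex_linear_derivs P G"
  and hol_poly_on_pd: "hol_poly_on P G \<Longrightarrow> \<exists>G'. hol_poly_on P G' \<and> (\<forall>z\<in>P. pd w G z = G' z)"
  using hol_poly_on_calculus by blast+

text \<open>
  Cauchy's estimate on the complex line through \<open>\<zeta>\<close> in the direction \<open>w\<close>, on a disc of radius
  \<open>r / (2 \<bar>w\<bar>)\<close>, so that its closure is mapped into the ball.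
\<close>

lemma hol_poly_on_cauchy:
  assumes G: "hol_poly_on P G" and r: "r > 0" "ball \<zeta> r \<subseteq> P" and B: "\<And>z. z \<in> ball \<zeta> r \<Longrightarrow> norm (G z) \<le> B"
  shows "norm (pd w G \<zeta>) \<le> 2 * B * norm w / r"
proof (cases "w = 0")
  case True
  have "\<zeta> \<in> P" using r centre_in_ball by (meson subsetD)
  then have "G differentiable (at \<zeta>)" by (rule smooth_on_differentiable[OF hol_poly_on_smooth[OF G]])
  then have "linear (\<lambda>w. pd w G \<zeta>)" by (simp add: linear_frechet_derivative)
  then show ?thesis using True linear_0 by fastforce
next
  case False
  define R where "R = r / (2 * norm w)"
  have R: "R > 0" "R * norm w < r" using False r by (simp_all add: R_def)
  have inb: "\<zeta> + x *s w \<in> ball \<zeta> r" if "norm x \<le> R" for x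
  proof -
    have "norm (x *s w) \<le> R * norm w" using that by (simp add: norm_smult_vec mult_right_mono)
    then show ?thesis using R(2) by (simp add: dist_norm)
  qed
  have d: "((\<lambda>x. G (\<zeta> + x *s w)) has_field_derivative pd w G (\<zeta> + x *s w)) (at x)" if "norm x \<le> R" for x
  proof -
    let ?z = "\<zeta> + x *s w"
    have zP: "?z \<in> P" using inb[OF that] r by blast
    have df: "G differentiable (at ?z)" by (rule smooth_on_differentiable[OF hol_poly_on_smooth[OF G] zP])
    then have lin: "linear (\<lambda>w. pd w G ?z)" by (simp add: linear_frechet_derivative)
    have c: "pd (h *s w) G ?z = pd w G ?z * h" for h
    proof -
      have "h *s w = Re h *\<^sub>R w + Im h *\<^sub>R (\<i> *s w)" by (simp add: vec_eq_iff complex_eq_iff)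
      then have "pd (h *s w) G ?z = Re h *\<^sub>R pd w G ?z + Im h *\<^sub>R pd (\<i> *s w) G ?z"
        using linear_add[OF lin] linear_cmul[OF lin] by simp
      moreover have "pd (\<i> *s w) G ?z = \<i> * pd w G ?z"
        using hol_poly_on_complex_linear[OF G] zP unfolding complex_linear_derivs_def by blast
      ultimately show ?thesis by (simp add: complex_eq_iff)
    qed
    have "((\<lambda>x. \<zeta> + x *s w) has_derivative (\<lambda>h. h *s w)) (at x)"
      using smult_curve_derivative[of \<zeta> w 0] by simp
    from has_derivative_compose[OF this df[unfolded frechet_derivative_works]]
    show ?thesis unfolding has_field_derivative_def c .
  qed
  have "norm ((deriv ^^ 1) (\<lambda>x. G (\<zeta> + x *s w)) 0) \<le> fact 1 * B / R ^ 1"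
  proof (rule Cauchy_inequality)
    have "(\<lambda>x. G (\<zeta> + x *s w)) field_differentiable (at x within cball 0 R)" if "x \<in> cball 0 R" for x
      using d[of x] that by (auto simp: field_differentiable_def intro: has_field_derivative_at_within)
    then have h: "(\<lambda>x. G (\<zeta> + x *s w)) holomorphic_on cball 0 R" by (simp add: holomorphic_on_def)
    show "(\<lambda>x. G (\<zeta> + x *s w)) holomorphic_on ball 0 R" by (rule holomorphic_on_subset[OF h ball_subset_cball])
    show "continuous_on (cball 0 R) (\<lambda>x. G (\<zeta> + x *s w))" by (rule holomorphic_on_imp_continuous_on[OF h])
    show "norm (G (\<zeta> + x *s w)) \<le> B" if "norm (0 - x) = R" for x
      by (rule B[OF inb]) (use that in simp)
  qed (rule R(1))
  moreover have "deriv (\<lambda>x. G (\<zeta> + x *s w)) 0 = pd w G \<zeta>"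
    using DERIV_imp_deriv[OF d[of 0]] R(1) by simp
  ultimately show ?thesis by (simp add: R_def mult.commute mult.left_commute)
qed

text \<open>
  Every differentiation uses Cauchy's estimate on half the current ball and costs a factor \<open>1 / s\<close>,
  which is the weight.
\<close>

lemma hol_poly_on_dbounded:
  assumes "\<kappa> > 0" "W \<ge> 0"
  shows "\<exists>C\<ge>1. \<forall>P G \<zeta> s B. \<forall>E :: ((complex ^ 'n::finite) \<times> real) set. hol_poly_on P G \<longrightarrow> 0 < s \<longrightarrow> ball \<zeta> (\<kappa> * s) \<subseteq> P \<longrightarrow>
     (\<forall>z\<in>ball \<zeta> (\<kappa> * s). norm (G z) \<le> B) \<longrightarrow> (\<forall>(w, \<sigma>)\<in>E. norm w \<le> W \<and> \<sigma> = s) \<longrightarrow> dbounded n E (C * B) G \<zeta>"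
  using assms(1)
proof (induction n arbitrary: \<kappa>)
  case 0
  show ?case
    by (intro exI[of _ 1]) (auto simp: 0)
next
  case (Suc n)
  have "\<kappa> / 2 > 0" using Suc.prems by simp
  from Suc.IH[OF this] obtain C where C: "C \<ge> 1" "\<And>P G \<zeta> s B. \<And>E :: ((complex ^ 'n) \<times> real) set. hol_poly_on P G \<Longrightarrow> 0 < s \<Longrightarrow> ball \<zeta> (\<kappa> / 2 * s) \<subseteq> P \<Longrightarrow>
     \<forall>z\<in>ball \<zeta> (\<kappa> / 2 * s). norm (G z) \<le> B \<Longrightarrow> \<forall>(w, \<sigma>)\<in>E. norm w \<le> W \<and> \<sigma> = s \<Longrightarrow> dbounded n E (C * B) G \<zeta>"
    by blast
  define C' where "C' = max 1 (C * (4 * W / \<kappa>))"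
  show ?case
  proof (intro exI[of _ C'] conjI allI impI)
    show "C' \<ge> 1" by (simp add: C'_def)
    fix P and G :: "complex ^ 'n \<Rightarrow> complex" and \<zeta> s B and E :: "((complex ^ 'n) \<times> real) set"
    assume G: "hol_poly_on P G" and s: "0 < s" and sub: "ball \<zeta> (\<kappa> * s) \<subseteq> P"
      and B: "\<forall>z\<in>ball \<zeta> (\<kappa> * s). norm (G z) \<le> B" and E: "\<forall>(w, \<sigma>)\<in>E. norm w \<le> W \<and> \<sigma> = s"
    have ks: "\<kappa> * s > 0" using Suc.prems s by simp
    have z: "\<zeta> \<in> ball \<zeta> (\<kappa> * s)" using ks by simp
    have B0: "B \<ge> 0" using B z norm_ge_zero order_trans by blast
    have oP: "open P" using G by (simp add: hol_poly_on_def)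
    have zP: "\<zeta> \<in> P" using z sub by blast
    have pos: "\<forall>(w, \<sigma>)\<in>E. \<sigma> > 0" using E s by auto
    have "dbounded n E (C' * B / \<sigma>) (pd w G) \<zeta>" if w: "(w, \<sigma>) \<in> E" for w \<sigma>
    proof -
      have w': "norm w \<le> W" "\<sigma> = s" using E w by auto
      obtain G' where G': "hol_poly_on P G'" "\<forall>z\<in>P. pd w G z = G' z" using hol_poly_on_pd[OF G] by blast
      have half: "ball \<zeta> (\<kappa> / 2 * s) \<subseteq> ball \<zeta> (\<kappa> * s)" using ks by (intro subset_ball) simp
      have "norm (G' z) \<le> 4 * B * W / (\<kappa> * s)" if zz: "z \<in> ball \<zeta> (\<kappa> / 2 * s)" for z
      proof -
        have sub2: "ball z (\<kappa> / 2 * s) \<subseteq> ball \<zeta> (\<kappa> * s)"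
        proof
          fix y assume y: "y \<in> ball z (\<kappa> / 2 * s)"
          have "dist \<zeta> y < \<kappa> / 2 * s + \<kappa> / 2 * s" using zz y dist_triangle[of \<zeta> y z] by simp
          then show "y \<in> ball \<zeta> (\<kappa> * s)" by simp
        qed
        have "norm (pd w G z) \<le> 2 * B * norm w / (\<kappa> / 2 * s)"
          by (rule hol_poly_on_cauchy[OF G]) (use ks sub2 sub B in auto)
        also have "\<dots> \<le> 2 * B * W / (\<kappa> / 2 * s)"
          using ks B0 w'(1) by (intro divide_right_mono mult_left_mono) auto
        also have "\<dots> = 4 * B * W / (\<kappa> * s)" using ks by (simp add: field_simps)
        finally have "norm (pd w G z) \<le> 4 * B * W / (\<kappa> * s)" .
        moreover have "z \<in> P" using zz half sub by blast
        ultimately show ?thesis using G'(2) by simp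
      qed
      then have "dbounded n E (C * (4 * B * W / (\<kappa> * s))) G' \<zeta>"
        by (intro C(2)[OF G'(1) s _ _ E]) (use half sub in auto)
      then have 1: "dbounded n E (C * (4 * B * W / (\<kappa> * s))) (pd w G) \<zeta>"
        by (rule dbounded_cong[OF oP zP hol_poly_on_smooth[OF G'(1)], rotated]) (use G'(2) in simp)
      have "C * (4 * B * W / (\<kappa> * s)) = (C * (4 * W / \<kappa>)) * (B / s)" by simp
      also have "\<dots> \<le> C' * (B / s)" using B0 s by (intro mult_right_mono) (auto simp: C'_def)
      finally have "C * (4 * B * W / (\<kappa> * s)) \<le> C' * B / \<sigma>" using w'(2) by simp
      from dbounded_mono[OF pos this 1] show ?thesis .
    qed
    moreover have "norm (G \<zeta>) \<le> C' * B"
    proof -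
      have "norm (G \<zeta>) \<le> 1 * B" using B z by simp
      also have "\<dots> \<le> C' * B" using B0 by (intro mult_right_mono) (auto simp: C'_def)
      finally show ?thesis .
    qed
    ultimately show "dbounded (Suc n) E (C' * B) G \<zeta>" by auto
  qed
qed

section \<open>Interpolation along complex lines\<close>

text \<open>
  The intersection of the line with the graph of \<open>\<sigma>\<close> is a fixed point of
  \<open>x \<mapsto> (\<sigma> (l0 + x ul) - m0) / um\<close>. By the assumptions on the direction \<open>(ul, um)\<close> and on the
  Lipschitz constant this map contracts by \<open>1 / 2\<close>, and it maps the disc of radius \<open>R\<close> into itself
  if the graph is close to the base point.
\<close>

lemma line_meets_sheet:
  assumes lip: "\<And>l l'. l \<in> H \<Longrightarrow> l' \<in> H \<Longrightarrow> norm (\<sigma> l - \<sigma> l') \<le> K * norm (l - l')" and K: "0 \<le> K"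
    and u: "1 / 2 \<le> norm um" "K * norm ul \<le> 1 / 4" and R: "0 \<le> R"
    and H: "\<And>x. norm x \<le> R \<Longrightarrow> l0 + x * ul \<in> H" and close: "norm (\<sigma> l0 - m0) \<le> R / 4"
  shows "\<exists>x :: complex. norm x \<le> R \<and> \<sigma> (l0 + x * ul) = m0 + x * um"
proof -
  define T where "T x = (\<sigma> (l0 + x * ul) - m0) / um" for x
  have um: "um \<noteq> 0" using u(1) by auto
  have half: "norm c / norm um \<le> 2 * norm c" for c :: complex
    using frac_le[of "norm c" "norm c" "1 / 2" "norm um"] u(1) by simp
  have T: "dist (T x) (T y) \<le> 1 / 2 * dist x y" if "norm x \<le> R" "norm y \<le> R" for x y
  proof -
    have "T x - T y = (\<sigma> (l0 + x * ul) - \<sigma> (l0 + y * ul)) / um" by (simp add: T_def diff_divide_distrib)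
    then have "norm (T x - T y) \<le> 2 * norm (\<sigma> (l0 + x * ul) - \<sigma> (l0 + y * ul))" using half by (simp add: norm_divide)
    also have "\<dots> \<le> 2 * (K * norm ((l0 + x * ul) - (l0 + y * ul)))" using lip[OF H H] that by simp
    also have "(l0 + x * ul) - (l0 + y * ul) = (x - y) * ul" by (simp add: algebra_simps)
    also have "2 * (K * norm ((x - y) * ul)) = 2 * (K * norm ul) * norm (x - y)" by (simp add: norm_mult)
    also have "\<dots> \<le> 2 * (1 / 4) * norm (x - y)" using u(2) by (intro mult_right_mono mult_left_mono) auto
    finally show ?thesis by (simp add: dist_norm)
  qed
  have "norm (T 0) = norm (\<sigma> l0 - m0) / norm um" by (simp add: T_def norm_divide)
  then have "norm (T 0) \<le> R / 2" using half[of "\<sigma> l0 - m0"] close by linarith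
  then have self: "norm (T x) \<le> R" if "norm x \<le> R" for x
    using T[OF that, of 0] R that norm_triangle_sub[of "T x" "T 0"] by (simp add: dist_norm)
  have "\<exists>!x\<in>cball 0 R. T x = x"
    by (rule Banach_fix[where c = "1 / 2"]) (use R self T in \<open>auto simp: complete_eq_closed\<close>)
  then obtain x where "norm x \<le> R" "T x = x" by auto
  then show ?thesis using um by (intro exI[of _ x]) (simp add: T_def field_simps)
qed

text \<open>
  \<open>l - m (ul / um)\<close> is constant on lines with the direction \<open>(ul, um)\<close> and parametrizes them. On the
  graph of \<open>\<sigma>\<close> it is injective for the same reason that makes lines meet the graph only once; the
  inverse \<open>\<xi>\<close> finds the intersection point of a given line.
\<close>

lemma sheet_projection:
  assumes hol: "\<sigma> holomorphic_on H" and H: "open H"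
    and lip: "\<And>l l'. l \<in> H \<Longrightarrow> l' \<in> H \<Longrightarrow> norm (\<sigma> l - \<sigma> l') \<le> K * norm (l - l')"
    and u: "1 / 2 \<le> norm um" "K * norm ul \<le> 1 / 4"
  shows "\<exists>\<xi>. \<xi> holomorphic_on (\<lambda>l. l - \<sigma> l * (ul / um)) ` H \<and> open ((\<lambda>l. l - \<sigma> l * (ul / um)) ` H) \<and>
     (\<forall>l\<in>H. \<xi> (l - \<sigma> l * (ul / um)) = l)"
proof -
  let ?\<psi> = "\<lambda>l. l - \<sigma> l * (ul / um)"
  have h: "?\<psi> holomorphic_on H" by (intro holomorphic_intros hol)
  have inj: "inj_on ?\<psi> H"
  proof (rule inj_onI)
    fix x y assume xy: "x \<in> H" "y \<in> H" "?\<psi> x = ?\<psi> y"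
    then have "x - y = (\<sigma> x - \<sigma> y) * (ul / um)" by (simp add: algebra_simps)
    then have "norm (x - y) = norm (\<sigma> x - \<sigma> y) * (norm ul / norm um)" by (simp add: norm_mult norm_divide)
    also have "\<dots> \<le> (K * norm (x - y)) * (norm ul / norm um)" by (intro mult_right_mono lip xy) simp
    also have "\<dots> = norm (x - y) * ((K * norm ul) / norm um)" by simp
    also have "\<dots> \<le> norm (x - y) * ((1 / 4) / (1 / 2))"
      using u by (intro mult_left_mono frac_le) auto
    finally show "x = y" by simp
  qed
  obtain \<xi> where "\<xi> holomorphic_on ?\<psi> ` H" "\<And>z. z \<in> H \<Longrightarrow> \<xi> (?\<psi> z) = z"
    using holomorphic_has_inverse[OF h H inj] by metis
  moreover have "open (?\<psi> ` H)" by (rule open_mapping_thm3[OF h H inj])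
  ultimately show ?thesis by blast
qed

lemma curve_composition_holomorphic:
  assumes g: "holomorphic_on_analytic_set g A" and U: "open U" and c: "\<xi> holomorphic_on U" "\<theta> holomorphic_on U"
    and inA: "\<And>x. x \<in> U \<Longrightarrow> p + \<xi> x *s \<eta> + \<theta> x *s w \<in> A"
  shows "(\<lambda>x. g (p + \<xi> x *s \<eta> + \<theta> x *s w)) holomorphic_on U"
  unfolding holomorphic_on_open[OF U]
proof
  fix x0 assume x0: "x0 \<in> U"
  let ?c = "\<lambda>x. p + \<xi> x *s \<eta> + \<theta> x *s w"
  obtain V G where V: "open V" "?c x0 \<in> V" "holomorphic_on_Cn G V" "\<And>z. z \<in> A \<inter> V \<Longrightarrow> g z = G z"
    using g inA[OF x0] unfolding holomorphic_on_analytic_set_def by metis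
  have d: "(?c has_derivative (\<lambda>h. h *s (deriv \<xi> x0 *s \<eta> + deriv \<theta> x0 *s w))) (at x0)"
  proof -
    have "(\<xi> has_derivative (*) (deriv \<xi> x0)) (at x0)" "(\<theta> has_derivative (*) (deriv \<theta> x0)) (at x0)"
      using holomorphic_derivI[OF c(1) U x0] holomorphic_derivI[OF c(2) U x0] by (simp_all add: has_field_derivative_def)
    note this[THEN bounded_linear.has_derivative[OF bounded_linear_smult_left]]
    from has_derivative_add[OF has_derivative_add[OF has_derivative_const[of p] this(1)[of \<eta>]] this(2)[of w]]
    show ?thesis by (simp add: vector_smult_assoc vector_add_ldistrib mult.commute)
  qed
  have cont: "continuous_on U ?c"
    by (intro continuous_on_add continuous_on_const bounded_linear.continuous_on[OF bounded_linear_smult_left]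
        holomorphic_on_imp_continuous_on c)
  have op: "open (U \<inter> ?c -` V)" by (rule continuous_open_preimage[OF cont U V(1)])
  obtain D where "((\<lambda>x. G (?c x)) has_field_derivative D) (at x0)"
    using holomorphic_on_Cn_curve[OF V(3) d V(2)] by blast
  then have "((\<lambda>x. g (?c x)) has_field_derivative D) (at x0)"
    by (rule has_field_derivative_transform_within_open[OF _ op]) (use x0 V inA in auto)
  then show "\<exists>f'. ((\<lambda>x. g (?c x)) has_field_derivative f') (at x0)" by blast
qed

text \<open>
  Lagrange interpolation of \<open>g\<close> along the lines with direction \<open>u\<close>, with the sheets that meet \<open>P\<close> as
  nodes. The condition \<open>4 (1 + K) d \<le> R\<close> ensures that these sheets, which pass at distance at most
  \<open>(1 + K) d\<close> from any point of \<open>P\<close>, are hit by every line at a parameter of modulus at most \<open>R\<close>. In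
  the affine coordinates \<open>l'\<close>, constant along lines, and \<open>m'\<close>, which increases by \<open>x\<close> from \<open>z\<close> to
  \<open>z + x u\<close>, the node on the sheet \<open>\<sigma>\<close> is \<open>\<alpha> \<sigma> (l' z) - m' z\<close>. Differences of nodes and the values
  of \<open>g\<close> at the nodes depend on \<open>l'\<close> alone; hence the interpolated value is a polynomial in \<open>m'\<close>
  with coefficients holomorphic in \<open>l'\<close>.
\<close>

lemma sheet_interpolant:
  assumes chart: "sheet_chart D X p \<delta> L M \<eta> w \<Lambda> a K" and D: "open D"
    and u: "1 / 2 \<le> norm (M u)" "K * norm (L u) \<le> 1 / 4"
    and P: "open P" "\<And>z z'. z \<in> P \<Longrightarrow> z' \<in> P \<Longrightarrow> norm (z - z') \<le> d"
    and R: "4 * (1 + K) * d \<le> R" "0 \<le> R" "\<And>z x. z \<in> P \<Longrightarrow> norm x \<le> R \<Longrightarrow> z + x *s u \<in> D \<inter> ball p \<delta>"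
    and g: "holomorphic_on_analytic_set g (X \<inter> D)"
    and c: "0 \<le> c" "\<And>z ls. z \<in> P \<Longrightarrow> ls \<noteq> [] \<Longrightarrow> distinct ls \<Longrightarrow>
        (\<And>x. x \<in> set ls \<Longrightarrow> norm x \<le> R \<and> z + x *s u \<in> X) \<Longrightarrow>
        norm (divided_difference (\<lambda>x. g (z + x *s u)) ls) * t z ^ (length ls - 1) \<le> c"
    and t: "\<And>z. z \<in> P \<Longrightarrow> 0 < t z \<and> R \<le> t z"
  shows "\<exists>G. hol_poly_on P G \<and> (\<forall>z\<in>P. norm (G z) \<le> real (card \<Lambda>) * c) \<and> (\<forall>z\<in>P \<inter> X. G z = g z)"
proof -
  define H where "H = half_disc a"
  define ul where "ul = L u"
  define um where "um = M u"
  note ch = chart[unfolded sheet_chart_def]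
  have da: "\<delta> \<le> a" and K: "0 \<le> K" and fin: "finite \<Lambda>" and neg: "\<forall>z\<in>D. Re (L (z - p)) < 0"
    and LM: "unitary_coordinates \<eta> w L M" using ch by auto
  have S0: "\<forall>\<sigma>\<in>\<Lambda>. \<sigma> holomorphic_on H \<and> (\<forall>l\<in>H. p + l *s \<eta> + \<sigma> l *s w \<in> X) \<and>
        (\<forall>l\<in>H. \<forall>l'\<in>H. norm (\<sigma> l - \<sigma> l') \<le> K * norm (l - l'))" unfolding H_def using ch by (elim conjE)
  have S1: "\<forall>z\<in>X \<inter> D \<inter> ball p \<delta>. \<exists>\<sigma>\<in>\<Lambda>. M (z - p) = \<sigma> (L (z - p))" using ch by (elim conjE)
  have S2: "\<forall>\<sigma>\<in>\<Lambda>. \<forall>\<sigma>'\<in>\<Lambda>. \<sigma> \<noteq> \<sigma>' \<longrightarrow> (\<forall>l\<in>H. \<sigma> l \<noteq> \<sigma>' l)" unfolding H_def using ch by (elim conjE)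
  have hol: "\<sigma> holomorphic_on H" and inX: "\<And>l. l \<in> H \<Longrightarrow> p + l *s \<eta> + \<sigma> l *s w \<in> X"
    and lip: "\<And>l l'. l \<in> H \<Longrightarrow> l' \<in> H \<Longrightarrow> norm (\<sigma> l - \<sigma> l') \<le> K * norm (l - l')" if "\<sigma> \<in> \<Lambda>" for \<sigma>
    using bspec[OF S0 that] by auto
  have blL: "bounded_linear L" and blM: "bounded_linear M" and cL: "\<And>c z. L (c *s z) = c * L z" and cM: "\<And>c z. M (c *s z) = c * M z"
    and dec: "\<And>z. z = L z *s \<eta> + M z *s w" and nL: "\<And>z. norm (L z) \<le> norm z" and nM: "\<And>z. norm (M z) \<le> norm z"
    using LM unfolding unitary_coordinates_def by blast+
  have oH: "open H" unfolding H_def by (rule open_half_disc)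
  have um: "1 / 2 \<le> norm um" "K * norm ul \<le> 1 / 4" "um \<noteq> 0" using u by (auto simp: um_def ul_def)
  have Ladd: "L (z + x *s u - p) = L (z - p) + x * ul" and Madd: "M (z + x *s u - p) = M (z - p) + x * um" for z x
  proof -
    have e: "z + x *s u - p = (z - p) + x *s u" by simp
    show "L (z + x *s u - p) = L (z - p) + x * ul"
      unfolding e linear_add[OF bounded_linear.linear[OF blL]] cL ul_def ..
    show "M (z + x *s u - p) = M (z - p) + x * um"
      unfolding e linear_add[OF bounded_linear.linear[OF blM]] cM um_def ..
  qed
  have inH: "L (z - p) \<in> H" if "z \<in> D \<inter> ball p \<delta>" for z
  proof -
    have "norm (L (z - p)) < a" using nL[of "z - p"] that da by (simp add: dist_norm norm_minus_commute)
    then show ?thesis using neg that by (simp add: H_def half_disc_def)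
  qed
  have lineH: "L (z - p) + x * ul \<in> H" if "z \<in> P" "norm x \<le> R" for z x
    using inH[OF R(3)[OF that]] unfolding Ladd .
  define \<psi> where "\<psi> \<sigma> l = l - \<sigma> l * (ul / um)" for \<sigma> and l :: complex
  have "\<forall>\<sigma>\<in>\<Lambda>. \<exists>\<xi>. \<xi> holomorphic_on \<psi> \<sigma> ` H \<and> open (\<psi> \<sigma> ` H) \<and> (\<forall>l\<in>H. \<xi> (\<psi> \<sigma> l) = l)"
  proof
    fix \<sigma> assume s: "\<sigma> \<in> \<Lambda>"
    show "\<exists>\<xi>. \<xi> holomorphic_on \<psi> \<sigma> ` H \<and> open (\<psi> \<sigma> ` H) \<and> (\<forall>l\<in>H. \<xi> (\<psi> \<sigma> l) = l)"
      using sheet_projection[OF hol[OF s] oH lip[OF s] um(1,2)] unfolding \<psi>_def by blast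
  qed
  from bchoice[OF this] obtain \<xi> where \<xi>: "\<forall>\<sigma>\<in>\<Lambda>. \<xi> \<sigma> holomorphic_on \<psi> \<sigma> ` H \<and> open (\<psi> \<sigma> ` H) \<and> (\<forall>l\<in>H. \<xi> \<sigma> (\<psi> \<sigma> l) = l)"
    by blast
  (* Sheets that stay away from P are left out: the lines through P need not meet them within radius
     R. *)
  define S where "S = {\<sigma> \<in> \<Lambda>. \<exists>z\<in>P. M (z - p) = \<sigma> (L (z - p))}"
  have SL: "S \<subseteq> \<Lambda>" and finS: "finite S" using fin by (auto simp: S_def)
  have \<xi>hol: "\<xi> \<sigma> holomorphic_on \<psi> \<sigma> ` H" and \<psi>open: "open (\<psi> \<sigma> ` H)" and \<xi>\<psi>: "\<And>l. l \<in> H \<Longrightarrow> \<xi> \<sigma> (\<psi> \<sigma> l) = l" if "\<sigma> \<in> S" for \<sigma>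
    using bspec[OF \<xi> subsetD[OF SL that]] by auto
  have \<xi>H: "\<xi> \<sigma> x \<in> H" "\<psi> \<sigma> (\<xi> \<sigma> x) = x" if "\<sigma> \<in> S" "x \<in> \<psi> \<sigma> ` H" for \<sigma> x
    using that \<xi>\<psi>[OF that(1)] by auto
  define l' where "l' z = L (z - p) - M (z - p) * (ul / um)" for z
  define m' where "m' z = M (z - p) / um" for z
  define \<alpha> where "\<alpha> \<sigma> x = \<sigma> (\<xi> \<sigma> x) / um" for \<sigma> x
  define pt where "pt \<sigma> x = p + \<xi> \<sigma> x *s \<eta> + \<sigma> (\<xi> \<sigma> x) *s w" for \<sigma> x
  define node where "node \<sigma> z = \<alpha> \<sigma> (l' z) - m' z" for \<sigma> z
  (* Intersections are unique: wherever the line meets the graph, the parameter is node sigma z. *)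
  have sol: "l' z \<in> \<psi> \<sigma> ` H \<and> x = node \<sigma> z \<and> \<xi> \<sigma> (l' z) = L (z - p) + x * ul"
    if s: "\<sigma> \<in> S" and x: "L (z - p) + x * ul \<in> H" "\<sigma> (L (z - p) + x * ul) = M (z - p) + x * um" for \<sigma> z x
  proof -
    have "\<psi> \<sigma> (L (z - p) + x * ul) = L (z - p) + x * ul - (M (z - p) + x * um) * (ul / um)"
      unfolding \<psi>_def x(2) ..
    also have "\<dots> = l' z" using um(3) by (simp add: l'_def field_simps)
    finally have e: "\<psi> \<sigma> (L (z - p) + x * ul) = l' z" .
    then have xi: "\<xi> \<sigma> (l' z) = L (z - p) + x * ul" using \<xi>\<psi>[OF s x(1)] by simp
    have "\<alpha> \<sigma> (l' z) = (M (z - p) + x * um) / um" unfolding \<alpha>_def xi x(2) ..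
    then have "x = node \<sigma> z" using um(3) by (simp add: node_def m'_def add_divide_distrib)
    then show ?thesis using e x(1) xi by (metis image_eqI)
  qed
  have node: "norm (node \<sigma> z) \<le> R \<and> l' z \<in> \<psi> \<sigma> ` H \<and> pt \<sigma> (l' z) = z + node \<sigma> z *s u"
    if s: "\<sigma> \<in> S" and z: "z \<in> P" for \<sigma> z
  proof -
    have sL: "\<sigma> \<in> \<Lambda>" using s SL by blast
    obtain z0 where z0: "z0 \<in> P" "M (z0 - p) = \<sigma> (L (z0 - p))" using s by (auto simp: S_def)
    have zH: "L (z - p) \<in> H" "L (z0 - p) \<in> H" using lineH[of _ 0] z z0 R(2) by auto
    have "\<sigma> (L (z - p)) - M (z - p) = (\<sigma> (L (z - p)) - \<sigma> (L (z0 - p))) + M (z0 - z)"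
      using z0(2) linear_diff[OF bounded_linear.linear[OF blM], of "z0 - p" "z - p"] by simp
    then have "norm (\<sigma> (L (z - p)) - M (z - p)) \<le> norm (\<sigma> (L (z - p)) - \<sigma> (L (z0 - p))) + norm (M (z0 - z))"
      by (metis norm_triangle_ineq)
    also have "\<dots> \<le> K * norm (L (z - p) - L (z0 - p)) + norm (z0 - z)" by (intro add_mono lip[OF sL] zH nM)
    also have "L (z - p) - L (z0 - p) = L (z - z0)"
      using linear_diff[OF bounded_linear.linear[OF blL], of "z - p" "z0 - p"] by simp
    also have "K * norm (L (z - z0)) + norm (z0 - z) \<le> K * d + d"
      using K P(2)[OF z z0(1)] P(2)[OF z0(1) z] nL[of "z - z0"] by (intro add_mono mult_left_mono) auto
    also have "\<dots> \<le> R / 4" using R(1) by (simp add: algebra_simps)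
    finally have close: "norm (\<sigma> (L (z - p)) - M (z - p)) \<le> R / 4" .
    obtain x where x: "norm x \<le> R" "\<sigma> (L (z - p) + x * ul) = M (z - p) + x * um"
      using line_meets_sheet[OF lip[OF sL] K um(1,2) R(2) lineH[OF z] close] by blast
    from sol[OF s lineH[OF z x(1)] x(2)]
    have e: "l' z \<in> \<psi> \<sigma> ` H" "x = node \<sigma> z" "\<xi> \<sigma> (l' z) = L (z - p) + x * ul" by auto
    have "pt \<sigma> (l' z) = p + (L (z + x *s u - p) *s \<eta> + M (z + x *s u - p) *s w)"
      unfolding pt_def e(3) x(2) Ladd Madd by (simp add: add.assoc)
    also have "\<dots> = z + x *s u" unfolding dec[of "z + x *s u - p", symmetric] by simp
    finally show ?thesis using e x(1) by simp
  qed
  (* The lines whose intersection points with all sheets of S lie in D, where g is holomorphic along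
     X. *)
  define U where "U = (\<Inter>\<sigma>\<in>S. \<psi> \<sigma> ` H \<inter> pt \<sigma> -` D)"
  have \<theta>hol: "(\<lambda>x. \<sigma> (\<xi> \<sigma> x)) holomorphic_on \<psi> \<sigma> ` H" if s: "\<sigma> \<in> S" for \<sigma>
  proof -
    have "\<sigma> \<circ> \<xi> \<sigma> holomorphic_on \<psi> \<sigma> ` H"
      by (rule holomorphic_on_compose_gen[OF \<xi>hol[OF s] hol[OF subsetD[OF SL s]]]) (use \<xi>H[OF s] in blast)
    then show ?thesis by (simp add: o_def)
  qed
  have oU: "open U"
    unfolding U_def
  proof (rule open_INT[OF finS], rule ballI)
    fix \<sigma> assume s: "\<sigma> \<in> S"
    have "continuous_on (\<psi> \<sigma> ` H) (pt \<sigma>)"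
      unfolding pt_def
      by (intro continuous_on_add continuous_on_const bounded_linear.continuous_on[OF bounded_linear_smult_left]
          holomorphic_on_imp_continuous_on \<xi>hol[OF s] \<theta>hol[OF s])
    then show "open (\<psi> \<sigma> ` H \<inter> pt \<sigma> -` D)" by (rule continuous_open_preimage[OF _ \<psi>open[OF s] D])
  qed
  have PU: "l' z \<in> U" if z: "z \<in> P" for z
    unfolding U_def
  proof
    fix \<sigma> assume s: "\<sigma> \<in> S"
    have "z + node \<sigma> z *s u \<in> D" using R(3)[OF z] node[OF s z] by blast
    then show "l' z \<in> \<psi> \<sigma> ` H \<inter> pt \<sigma> -` D" using node[OF s z] by simp
  qed
  have Usub: "U \<subseteq> \<psi> \<sigma> ` H" if "\<sigma> \<in> S" for \<sigma> using that by (auto simp: U_def)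
  have ptXD: "pt \<sigma> x \<in> X \<inter> D" if s: "\<sigma> \<in> S" and x: "x \<in> U" for \<sigma> x
  proof -
    have "\<xi> \<sigma> x \<in> H" using \<xi>H(1)[OF s] Usub[OF s] x by blast
    then have "pt \<sigma> x \<in> X" unfolding pt_def by (rule inX[OF subsetD[OF SL s]])
    then show ?thesis using s x by (auto simp: U_def)
  qed
  have \<alpha>hol: "\<alpha> \<sigma> holomorphic_on U" if s: "\<sigma> \<in> S" for \<sigma>
    unfolding \<alpha>_def[abs_def] by (intro holomorphic_intros holomorphic_on_subset[OF \<theta>hol[OF s] Usub[OF s]]) (rule um(3))
  have \<gamma>hol: "(\<lambda>x. g (pt \<sigma> x)) holomorphic_on U" if s: "\<sigma> \<in> S" for \<sigma>
    unfolding pt_def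
    by (rule curve_composition_holomorphic[OF g oU holomorphic_on_subset[OF \<xi>hol[OF s] Usub[OF s]]
          holomorphic_on_subset[OF \<theta>hol[OF s] Usub[OF s]] ptXD[OF s, unfolded pt_def]])
  (* Two sheets never meet the same line in the same point, because their graphs are disjoint. *)
  have \<alpha>ne: "\<alpha> \<sigma> x \<noteq> \<alpha> \<tau> x" if s: "\<sigma> \<in> S" "\<tau> \<in> S" "\<sigma> \<noteq> \<tau>" and x: "x \<in> U" for \<sigma> \<tau> x
  proof
    assume "\<alpha> \<sigma> x = \<alpha> \<tau> x"
    then have e: "\<sigma> (\<xi> \<sigma> x) = \<tau> (\<xi> \<tau> x)" using um(3) by (simp add: \<alpha>_def)
    have xs: "x \<in> \<psi> \<sigma> ` H" "x \<in> \<psi> \<tau> ` H" using Usub s(1,2) x by blast+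
    have "\<xi> \<sigma> x = x + \<sigma> (\<xi> \<sigma> x) * (ul / um)" "\<xi> \<tau> x = x + \<tau> (\<xi> \<tau> x) * (ul / um)"
      using \<xi>H(2)[OF s(1) xs(1)] \<xi>H(2)[OF s(2) xs(2)] by (simp_all add: \<psi>_def algebra_simps)
    then have "\<xi> \<sigma> x = \<xi> \<tau> x" using e by simp
    then have "\<sigma> (\<xi> \<sigma> x) = \<tau> (\<xi> \<sigma> x)" using e by simp
    moreover have "\<sigma> (\<xi> \<sigma> x) \<noteq> \<tau> (\<xi> \<sigma> x)" using S2 SL s \<xi>H(1)[OF s(1) xs(1)] by blast
    ultimately show False by simp
  qed
  (* Lagrange formula at x = 0, with the node differences expressed by l' and m'. *)
  define G where "G z = (\<Sum>\<sigma>\<in>S. g (pt \<sigma> (l' z)) * (\<Prod>\<tau>\<in>S - {\<sigma>}. (m' z + - \<alpha> \<tau> (l' z)) * inverse (\<alpha> \<sigma> (l' z) - \<alpha> \<tau> (l' z))))" for z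
  have hp: "hol_poly U l' m' G"
    unfolding G_def[abs_def]
  proof (rule hol_poly_sum, rule hol_poly_mult)
    fix \<sigma> assume s: "\<sigma> \<in> S"
    show "hol_poly U l' m' (\<lambda>z. g (pt \<sigma> (l' z)))" by (rule hol_poly_coeff[OF \<gamma>hol[OF s]])
    show "hol_poly U l' m' (\<lambda>z. \<Prod>\<tau>\<in>S - {\<sigma>}. (m' z + - \<alpha> \<tau> (l' z)) * inverse (\<alpha> \<sigma> (l' z) - \<alpha> \<tau> (l' z)))"
    proof (rule hol_poly_prod, rule hol_poly_mult)
      fix \<tau> assume "\<tau> \<in> S - {\<sigma>}"
      then have t: "\<tau> \<in> S" "\<sigma> \<noteq> \<tau>" by auto
      have "(\<lambda>x. - \<alpha> \<tau> x) holomorphic_on U" by (rule holomorphic_on_minus[OF \<alpha>hol[OF t(1)]])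
      from hol_poly_add[OF hol_poly_var hol_poly_coeff[OF this]]
      show "hol_poly U l' m' (\<lambda>z. m' z + - \<alpha> \<tau> (l' z))" .
      have "(\<lambda>x. inverse (\<alpha> \<sigma> x - \<alpha> \<tau> x)) holomorphic_on U"
        by (rule holomorphic_on_inverse[OF holomorphic_on_diff[OF \<alpha>hol[OF s] \<alpha>hol[OF t(1)]]])
           (use \<alpha>ne[OF s t(1) t(2)] in simp)
      from hol_poly_coeff[OF this]
      show "hol_poly U l' m' (\<lambda>z. inverse (\<alpha> \<sigma> (l' z) - \<alpha> \<tau> (l' z)))" .
    qed
  qed
  have aff: "affine_functional (\<lambda>z. N (z - p)) N" if "bounded_linear N" "\<And>c z. N (c *s z) = c * N z" for N :: "complex ^ 2 \<Rightarrow> complex"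
    unfolding affine_functional_def linear_diff[OF bounded_linear.linear[OF that(1)]]
    using that linear_0[OF bounded_linear.linear[OF that(1)]] by simp
  have "affine_functional l' (\<lambda>z. L z - M z * (ul / um))"
    unfolding l'_def[abs_def]
    by (rule aff[OF bounded_linear_sub[OF blL bounded_linear_compose[OF bounded_linear_mult_left blM]]])
       (simp add: cL cM algebra_simps)
  moreover have "affine_functional m' (\<lambda>z. M z / um)"
    unfolding m'_def[abs_def]
    by (rule aff[OF bounded_linear_compose[OF bounded_linear_divide blM]]) (simp add: cM)
  ultimately have hpo: "hol_poly_on P G"
    unfolding hol_poly_on_def using P(1) oU PU hp by blast
  have lag: "G z = lagrange (\<lambda>x. g (z + x *s u)) ((\<lambda>\<sigma>. node \<sigma> z) ` S) 0" if z: "z \<in> P" for z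
  proof -
    have inj: "inj_on (\<lambda>\<sigma>. node \<sigma> z) S"
      using \<alpha>ne PU[OF z] by (auto simp: inj_on_def node_def)
    have "lagrange (\<lambda>x. g (z + x *s u)) ((\<lambda>\<sigma>. node \<sigma> z) ` S) 0
      = (\<Sum>\<sigma>\<in>S. g (z + node \<sigma> z *s u) * (\<Prod>k\<in>(\<lambda>\<sigma>. node \<sigma> z) ` S - {node \<sigma> z}. (0 - k) / (node \<sigma> z - k)))"
      unfolding lagrange_def by (simp add: sum.reindex[OF inj])
    also have "\<dots> = G z"
      unfolding G_def
    proof (rule sum.cong[OF refl])
      fix \<sigma> assume s: "\<sigma> \<in> S"
      have im: "(\<lambda>\<sigma>. node \<sigma> z) ` S - {node \<sigma> z} = (\<lambda>\<sigma>. node \<sigma> z) ` (S - {\<sigma>})"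
        using inj s by (auto simp: inj_on_def)
      have inj': "inj_on (\<lambda>\<sigma>. node \<sigma> z) (S - {\<sigma>})" using inj by (rule inj_on_subset) blast
      have "(\<Prod>k\<in>(\<lambda>\<sigma>. node \<sigma> z) ` S - {node \<sigma> z}. (0 - k) / (node \<sigma> z - k))
        = (\<Prod>\<tau>\<in>S - {\<sigma>}. (0 - node \<tau> z) / (node \<sigma> z - node \<tau> z))"
        unfolding im by (simp add: prod.reindex[OF inj'])
      also have "\<dots> = (\<Prod>\<tau>\<in>S - {\<sigma>}. (m' z + - \<alpha> \<tau> (l' z)) * inverse (\<alpha> \<sigma> (l' z) - \<alpha> \<tau> (l' z)))"
        by (rule prod.cong) (simp_all add: node_def divide_inverse)
      finally show "g (z + node \<sigma> z *s u) * (\<Prod>k\<in>(\<lambda>\<sigma>. node \<sigma> z) ` S - {node \<sigma> z}. (0 - k) / (node \<sigma> z - k))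
        = g (pt \<sigma> (l' z)) * (\<Prod>\<tau>\<in>S - {\<sigma>}. (m' z + - \<alpha> \<tau> (l' z)) * inverse (\<alpha> \<sigma> (l' z) - \<alpha> \<tau> (l' z)))"
        using node[OF s z] by simp
    qed
    finally show ?thesis by simp
  qed
  have nodeX: "z + node \<sigma> z *s u \<in> X" if "\<sigma> \<in> S" "z \<in> P" for \<sigma> z
    using node[OF that] ptXD[OF that(1) PU[OF that(2)]] by auto
  have "norm (G z) \<le> real (card \<Lambda>) * c" if z: "z \<in> P" for z
  proof -
    let ?A = "(\<lambda>\<sigma>. node \<sigma> z) ` S"
    have "norm (lagrange (\<lambda>x. g (z + x *s u)) ?A 0) \<le> real (card ?A) * c"
    proof (rule lagrange_norm_le[where t = "t z"])
      show "finite ?A" using finS by simp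
      show "0 < t z" using t[OF z] by blast
      show "norm (0 - x) \<le> t z" if "x \<in> ?A" for x
        using that node[OF _ z] t[OF z] by (auto intro: order_trans)
      show "norm (divided_difference (\<lambda>x. g (z + x *s u)) ls) * t z ^ (length ls - 1) \<le> c"
        if "ls \<noteq> []" "distinct ls" "set ls \<subseteq> ?A" for ls
        by (rule c(2)[OF z that(1,2)]) (use that(3) node[OF _ z] nodeX[OF _ z] in blast)
    qed
    also have "real (card ?A) * c \<le> real (card \<Lambda>) * c"
      using card_image_le[OF finS] card_mono[OF fin SL] c(1) by (intro mult_right_mono) (auto intro: order_trans)
    finally show ?thesis using lag[OF z] by simp
  qed
  (* On X the base point itself is a node. *)
  moreover have "G z = g z" if z: "z \<in> P \<inter> X" for z
  proof -
    have zD: "z \<in> D \<inter> ball p \<delta>" using R(3)[of z 0] z R(2) by simp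
    then obtain \<sigma> where s: "\<sigma> \<in> \<Lambda>" "M (z - p) = \<sigma> (L (z - p))" using S1 z by blast
    then have sS: "\<sigma> \<in> S" using z by (auto simp: S_def)
    have "0 = node \<sigma> z" using sol[OF sS, of z 0] inH[OF zD] s(2) by simp
    then have "0 \<in> (\<lambda>\<sigma>. node \<sigma> z) ` S" using sS by blast
    from lagrange_node[OF _ this, of "\<lambda>x. g (z + x *s u)"] show ?thesis using lag[of z] z finS by simp
  qed
  ultimately show ?thesis using hpo by blast
qed

section \<open>Second order estimates for the defining function\<close>

lemma pd_norm_bound:
  fixes f :: "'a::euclidean_space \<Rightarrow> 'b::real_normed_vector"
  assumes "f differentiable (at x)" "\<And>v. norm v \<le> 1 \<Longrightarrow> norm (pd v f x) \<le> A"
  shows "norm (pd v f x) \<le> A * norm v"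
proof (cases "v = 0")
  case False
  have lin: "linear (\<lambda>v. pd v f x)" using assms(1) by (simp add: linear_frechet_derivative)
  define e where "e = v /\<^sub>R norm v"
  have v: "v = norm v *\<^sub>R e" and ne: "norm e \<le> 1" using False by (simp_all add: e_def)
  have "pd v f x = norm v *\<^sub>R pd e f x" by (subst v) (rule linear_cmul[OF lin])
  then show ?thesis using mult_left_mono[OF assms(2)[OF ne] norm_ge_zero[of v]] by (simp add: mult.commute)
next
  case True
  have lin: "linear (\<lambda>v. pd v f x)" using assms(1) by (simp add: linear_frechet_derivative)
  then show ?thesis using True linear_0[OF lin] by simp
qed

lemma smooth_lipschitz_bounds:
  fixes \<rho> :: "'a::euclidean_space \<Rightarrow> real"
  assumes "smooth_on UNIV \<rho>"
  shows "\<exists>C\<ge>1. \<forall>x\<in>cball 0 R. \<forall>y\<in>cball 0 R. \<bar>\<rho> x - \<rho> y\<bar> \<le> C * norm (x - y) \<and>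
      (\<forall>w. \<bar>pd w \<rho> x - pd w \<rho> y\<bar> \<le> C * norm (x - y) * norm w)"
proof -
  obtain A where A: "A \<ge> 0" "\<And>x. x \<in> cball 0 R \<Longrightarrow> dbounded (Suc (Suc 0)) ({w::'a. norm w \<le> 1} \<times> {1}) A \<rho> x"
    using dbounded_compact[OF assms compact_cball, of 1 0 R "Suc (Suc 0)"] by auto
  have d: "\<rho> differentiable (at x)" "pd w \<rho> differentiable (at x)" for x w
    using smooth_on_differentiable[OF assms] smooth_on_differentiable[OF smooth_on_pd[OF assms]] by auto
  have b1: "norm (pd v \<rho> x) \<le> A * norm v" if x: "x \<in> cball 0 R" for x v
  proof (rule pd_norm_bound[OF d(1)])
    fix v :: 'a assume "norm v \<le> 1"
    then have "dbounded (Suc 0) ({w::'a. norm w \<le> 1} \<times> {1}) (A / 1) (pd v \<rho>) x"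
      by (intro dbounded_pd[OF A(2)[OF x]]) auto
    then show "norm (pd v \<rho> x) \<le> A" using dbounded_norm by fastforce
  qed
  have b2: "norm (pd v (pd w \<rho>) x) \<le> A * norm v" if x: "x \<in> cball 0 R" and w: "norm w \<le> 1" for x v w
  proof (rule pd_norm_bound[OF d(2)])
    fix v :: 'a assume v: "norm v \<le> 1"
    have "dbounded (Suc 0) ({w::'a. norm w \<le> 1} \<times> {1}) (A / 1) (pd w \<rho>) x"
      by (rule dbounded_pd[OF A(2)[OF x]]) (use w in auto)
    then have "dbounded 0 ({w::'a. norm w \<le> 1} \<times> {1}) (A / 1 / 1) (pd v (pd w \<rho>)) x"
      by (rule dbounded_pd) (use v in auto)
    then show "norm (pd v (pd w \<rho>) x) \<le> A" by simp
  qed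
  have mvt: "norm (f x - f y) \<le> A * norm (x - y)"
    if f: "\<And>x. f differentiable (at x)" "\<And>x v. x \<in> cball 0 R \<Longrightarrow> norm (pd v f x) \<le> A * norm v"
      and xy: "x \<in> cball 0 R" "y \<in> cball 0 R" for f :: "'a \<Rightarrow> real" and x y
  proof (rule differentiable_bound[OF convex_cball _ _ xy])
    show "(f has_derivative (\<lambda>v. pd v f x)) (at x within cball 0 R)" for x
      using f(1) unfolding frechet_derivative_works by (rule has_derivative_at_withinI)
    show "onorm (\<lambda>v. pd v f x) \<le> A" if "x \<in> cball 0 R" for x
      by (rule onorm_le) (rule f(2)[OF that])
  qed
  show ?thesis
  proof (intro exI[of _ "max 1 A"] conjI ballI allI)
    fix x y :: 'a assume xy: "x \<in> cball 0 R" "y \<in> cball 0 R"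
    have le: "A * t \<le> max 1 A * t" if "t \<ge> 0" for t using that by (intro mult_right_mono) auto
    show "\<bar>\<rho> x - \<rho> y\<bar> \<le> max 1 A * norm (x - y)"
      using mvt[OF d(1) b1 xy] le[of "norm (x - y)"] by simp
    fix w :: 'a
    show "\<bar>pd w \<rho> x - pd w \<rho> y\<bar> \<le> max 1 A * norm (x - y) * norm w"
    proof (cases "w = 0")
      case True
      then show ?thesis using b1[OF xy(1), of w] b1[OF xy(2), of w] by simp
    next
      case False
      define e where "e = w /\<^sub>R norm w"
      have w: "w = norm w *\<^sub>R e" and ne: "norm e \<le> 1" using False by (simp_all add: e_def)
      have e: "pd w \<rho> x = norm w * pd e \<rho> x" for x
        using linear_cmul[OF linear_frechet_derivative[OF d(1)], of x "norm w" e] w by simp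
      have "norm (pd e \<rho> x - pd e \<rho> y) \<le> A * norm (x - y)" by (rule mvt[OF d(2) b2[OF _ ne] xy])
      then have "norm w * \<bar>pd e \<rho> x - pd e \<rho> y\<bar> \<le> norm w * (max 1 A * norm (x - y))"
        using le[of "norm (x - y)"] by (intro mult_left_mono) auto
      moreover have "\<bar>pd w \<rho> x - pd w \<rho> y\<bar> = norm w * \<bar>pd e \<rho> x - pd e \<rho> y\<bar>"
        unfolding e by (simp add: abs_mult right_diff_distrib[symmetric])
      ultimately show ?thesis by (simp add: mult.commute mult.left_commute)
    qed
  qed simp
qed

text \<open>
  Along \<open>h\<close> the function \<open>\<rho>\<close> is stationary at \<open>z\<close>. At points near \<open>z\<close> its derivative along \<open>h\<close> is
  therefore bounded by the distance from \<open>z\<close>, so that a displacement by \<open>h\<close> changes \<open>\<rho>\<close> only to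
  second order.
\<close>

lemma tangential_growth:
  fixes \<rho> :: "'a::euclidean_space \<Rightarrow> real"
  assumes diff: "\<And>x. \<rho> differentiable (at x)"
    and C: "\<And>x y w. x \<in> cball 0 R \<Longrightarrow> y \<in> cball 0 R \<Longrightarrow> \<bar>pd w \<rho> x - pd w \<rho> y\<bar> \<le> C * norm (x - y) * norm w" "0 \<le> C"
    and z: "z \<in> cball 0 R" "pd h \<rho> z = 0" and x: "x \<in> cball 0 R" "x + h \<in> cball 0 R"
  shows "\<rho> (x + h) \<le> \<rho> x + C * (norm (x - z) + norm h) * norm h"
proof -
  have D: "((\<lambda>t. \<rho> (x + t *\<^sub>R h)) has_real_derivative pd h \<rho> (x + t *\<^sub>R h)) (at t)" for t
  proof -
    let ?y = "x + t *\<^sub>R h"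
    have "((\<lambda>t. x + t *\<^sub>R h) has_derivative (\<lambda>t. t *\<^sub>R h)) (at t)" by (auto intro!: derivative_eq_intros)
    from has_derivative_compose[OF this diff[unfolded frechet_derivative_works]]
    have "((\<lambda>t. \<rho> (x + t *\<^sub>R h)) has_derivative (\<lambda>s. pd (s *\<^sub>R h) \<rho> ?y)) (at t)" .
    moreover have "(\<lambda>s. pd (s *\<^sub>R h) \<rho> ?y) = (*) (pd h \<rho> ?y)"
      using linear_cmul[OF linear_frechet_derivative[OF diff[of ?y]]] by (auto simp: mult.commute)
    ultimately show ?thesis by (simp add: has_field_derivative_def)
  qed
  obtain t where t: "0 < t" "t < 1" "\<rho> (x + 1 *\<^sub>R h) - \<rho> (x + 0 *\<^sub>R h) = (1 - 0) * pd h \<rho> (x + t *\<^sub>R h)"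
    using MVT2[of 0 1 "\<lambda>t. \<rho> (x + t *\<^sub>R h)" "\<lambda>t. pd h \<rho> (x + t *\<^sub>R h)"] D by auto
  have "x + t *\<^sub>R h = (1 - t) *\<^sub>R x + t *\<^sub>R (x + h)" by (simp add: algebra_simps)
  then have y: "x + t *\<^sub>R h \<in> cball 0 R"
    using t x convexD[OF convex_cball[of 0 R], of x "x + h" "1 - t" t] by simp
  have "\<bar>pd h \<rho> (x + t *\<^sub>R h)\<bar> \<le> C * norm (x + t *\<^sub>R h - z) * norm h" using C(1)[OF y z(1), of h] z(2) by simp
  also have "\<dots> \<le> C * (norm (x - z) + norm h) * norm h"
  proof (intro mult_right_mono mult_left_mono C(2))
    have "norm (x + t *\<^sub>R h - z) \<le> norm (x - z) + norm (t *\<^sub>R h)"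
      using norm_triangle_ineq[of "x - z" "t *\<^sub>R h"] by (simp add: algebra_simps)
    also have "norm (t *\<^sub>R h) \<le> norm h" using t by (simp add: mult_left_le_one_le)
    finally show "norm (x + t *\<^sub>R h - z) \<le> norm (x - z) + norm h" by simp
  qed simp
  finally show ?thesis using t(3) by simp
qed

text \<open>
  With \<open>\<epsilon> = \<bar>\<rho> z\<bar>\<close> the defining condition of \<open>tau\<close> says that the disc lies in \<open>D\<close>. Boundedness of
  \<open>D\<close> is needed for the supremum to exist.
\<close>

lemma tau_lower_bound:
  fixes \<rho> :: "complex ^ 2 \<Rightarrow> real"
  assumes bd: "bounded {z. \<rho> z < 0}" and z: "\<rho> z < 0" and u: "norm u = 1" and R: "R > 0"
    and line: "\<And>l. norm l \<le> R \<Longrightarrow> \<rho> (z + l *s u) < 0"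
  shows "R \<le> tau \<rho> z u \<bar>\<rho> z\<bar>"
  unfolding tau_def
proof (rule cSup_upper)
  let ?T = "{t. 0 < t \<and> (\<forall>l::complex. norm l < t \<longrightarrow> \<rho> (z + l *s u) - \<rho> z < \<bar>\<rho> z\<bar>)}"
  show "R \<in> ?T" using R line z by auto
  obtain B where B: "\<And>y. \<rho> y < 0 \<Longrightarrow> norm y \<le> B" using bd unfolding bounded_iff by auto
  show "bdd_above ?T"
  proof (rule bdd_aboveI[of _ "2 * B"])
    fix t assume t: "t \<in> ?T"
    show "t \<le> 2 * B"
    proof (rule ccontr)
      assume "\<not> t \<le> 2 * B"
      then obtain s where s: "2 * B < s" "s < t" using dense by (meson not_le)
      have "B \<ge> 0" using B[OF z] norm_ge_zero order_trans by blast
      then have s0: "s > 0" using s by linarith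
      have "norm (complex_of_real s) < t" using s s0 by simp
      then have "\<rho> (z + of_real s *s u) - \<rho> z < \<bar>\<rho> z\<bar>" using t by blast
      then have "\<rho> (z + of_real s *s u) < 0" using z by simp
      then have "norm (z + of_real s *s u) \<le> B" by (rule B)
      moreover have "norm (of_real s *s u) \<le> norm (z + of_real s *s u) + norm z"
        using norm_triangle_ineq4[of "z + of_real s *s u" z] by simp
      ultimately show False using B[OF z] s(1) u s0 by (simp add: norm_smult_vec)
    qed
  qed
qed

section \<open>A partition of unity near the boundary\<close>

text \<open>
  The cell \<open>(k, j)\<close> consists of the points with \<open>\<bar>\<rho>\<bar>\<close> between \<open>1 / 4\<close> and \<open>4\<close> times \<open>1 / 4 ^ k\<close> that
  lie within one mesh width \<open>c / 2 ^ k\<close> of the lattice point \<open>j\<close> in each real coordinate. Its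
  diameter is thus of the order of the square root of \<open>\<bar>\<rho>\<bar>\<close>, which is the natural scale in the
  tangential directions; being larger than \<open>\<bar>\<rho>\<bar>\<close> in the normal direction does no harm.
\<close>

definition cell :: "('a::euclidean_space \<Rightarrow> real) \<Rightarrow> real \<Rightarrow> nat \<times> ('a \<Rightarrow> int) \<Rightarrow> 'a set" where
  "cell \<rho> c i = {z. 1 / 4 \<le> 4 ^ fst i * (- \<rho> z) \<and> 4 ^ fst i * (- \<rho> z) \<le> 4 \<and>
     (\<forall>b\<in>Basis. \<bar>2 ^ fst i / c * (z \<bullet> b) - of_int (snd i b)\<bar> \<le> 1)}"

definition cell_bump :: "('a::euclidean_space \<Rightarrow> real) \<Rightarrow> real \<Rightarrow> nat \<times> ('a \<Rightarrow> int) \<Rightarrow> 'a \<Rightarrow> real" where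
  "cell_bump \<rho> c i z = shell_bump (4 ^ fst i * (- \<rho> z)) *
     (\<Prod>b\<in>Basis. lattice_bump (2 ^ fst i / c * (z \<bullet> b) - of_int (snd i b)))"

text \<open>
  Finitely many indices that suffice away from the boundary. Extensional functions make the indices
  unique.
\<close>

definition cell_box :: "nat \<Rightarrow> nat \<Rightarrow> (nat \<times> ('a::euclidean_space \<Rightarrow> int)) set" where
  "cell_box N J = {..N} \<times> PiE Basis (\<lambda>_. {- int J..int J})"

lemma finite_cell_box: "finite (cell_box N J)"
  unfolding cell_box_def by (intro finite_cartesian_product finite_PiE) auto

lemma cell_bump_outside: "z \<notin> cell \<rho> c i \<Longrightarrow> cell_bump \<rho> c i z = 0"
proof -
  assume z: "z \<notin> cell \<rho> c i"
  consider "4 ^ fst i * (- \<rho> z) \<le> 1 / 4 \<or> 4 ^ fst i * (- \<rho> z) \<ge> 4"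
    | b where "b \<in> Basis" "\<bar>2 ^ fst i / c * (z \<bullet> b) - of_int (snd i b)\<bar> \<ge> 1"
    using z unfolding cell_def by force
  then show ?thesis
  proof cases
    case 1 then show ?thesis unfolding cell_bump_def using shell_bump_outside by simp
  next
    case 2
    then have "(\<Prod>b\<in>Basis. lattice_bump (2 ^ fst i / c * (z \<bullet> b) - of_int (snd i b))) = 0"
      using lattice_bump_outside by (intro prod_zero) auto
    then show ?thesis unfolding cell_bump_def by simp
  qed
qed

lemma cell_bump_sum:
  assumes "- \<rho> z \<le> 1" "- \<rho> z \<ge> 4 powr (- real N)"
    and "\<And>k b. k \<le> N \<Longrightarrow> b \<in> Basis \<Longrightarrow> \<bar>2 ^ k / c * (z \<bullet> b)\<bar> \<le> real J"
  shows "(\<Sum>i\<in>cell_box N J. cell_bump \<rho> c i z) = 1"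
proof -
  have "(\<Sum>j\<in>PiE Basis (\<lambda>_. {- int J..int J}). cell_bump \<rho> c (k, j) z) = shell_bump (4 ^ k * (- \<rho> z))"
    if k: "k \<le> N" for k
  proof -
    have "(\<Sum>j\<in>PiE Basis (\<lambda>_. {- int J..int J}). \<Prod>b\<in>Basis. lattice_bump (2 ^ k / c * (z \<bullet> b) - of_int (j b)))
      = (\<Prod>b\<in>Basis. \<Sum>j\<in>{- int J..int J}. lattice_bump (2 ^ k / c * (z \<bullet> b) - of_int j))"
      by (subst prod_sum_PiE) auto
    also have "\<dots> = 1" using lattice_bump_sum[OF assms(3)[OF k]] by (intro prod.neutral) auto
    finally show ?thesis by (simp add: cell_bump_def sum_distrib_left[symmetric])
  qed
  then show ?thesis
    unfolding cell_box_def using shell_bump_sum[OF assms(1,2)]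
    by (simp add: sum.cartesian_product')
qed

text \<open>
  Three values of \<open>k\<close> are possible at a point, as \<open>4 ^ k \<bar>\<rho>\<bar>\<close> ranges over a factor \<open>16\<close>; in every
  coordinate there are at most three lattice points within distance \<open>1\<close>.
\<close>

lemma card_active_cells:
  fixes \<rho> :: "'a::euclidean_space \<Rightarrow> real"
  assumes "\<rho> z < 0"
  shows "card {i \<in> cell_box N J. z \<in> cell \<rho> c i} \<le> 3 * 3 ^ DIM('a)"
proof (cases "{i \<in> cell_box N J. z \<in> cell \<rho> c i} = {}")
  case False
  let ?A = "{i \<in> cell_box N J. z \<in> cell \<rho> c i}"
  have finA: "finite ?A" by (rule finite_subset[OF _ finite_cell_box]) blast
  define k0 where "k0 = Min (fst ` ?A)"
  have "k0 \<in> fst ` ?A" unfolding k0_def using finA False by (intro Min_in) auto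
  then obtain i0 where i0: "i0 \<in> ?A" "fst i0 = k0" by auto
  have k0: "k0 \<le> fst i" if "i \<in> ?A" for i unfolding k0_def using finA that by (intro Min_le) auto
  define s where "s = - \<rho> z"
  have s: "s > 0" using assms by (simp add: s_def)
  have k2: "fst i \<le> k0 + 2" if i: "i \<in> ?A" for i
  proof (rule ccontr)
    assume "\<not> fst i \<le> k0 + 2"
    then have "k0 + 3 \<le> fst i" by simp
    then have "(4::real) ^ (k0 + 3) \<le> 4 ^ fst i" by (rule power_increasing) simp
    then have "4 ^ (k0 + 3) * s \<le> 4 ^ fst i * s" using s by simp
    also have "\<dots> \<le> 4" using i by (simp add: cell_def s_def)
    finally have "64 * (4 ^ k0 * s) \<le> 4" by (simp add: power_add)
    moreover have "1 / 4 \<le> 4 ^ k0 * s" using i0 by (simp add: cell_def s_def)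
    ultimately show False by linarith
  qed
  let ?y = "\<lambda>k b. 2 ^ k / c * (z \<bullet> b)"
  let ?S = "SIGMA k:{k0..k0 + 2}. PiE Basis (\<lambda>b. {\<lfloor>?y k b\<rfloor> - 1..\<lfloor>?y k b\<rfloor> + 1})"
  have "?A \<subseteq> ?S"
  proof
    fix i assume i: "i \<in> ?A"
    obtain k j where kj: "i = (k, j)" by (cases i)
    have "j b \<in> {\<lfloor>?y k b\<rfloor> - 1..\<lfloor>?y k b\<rfloor> + 1}" if b: "b \<in> Basis" for b
    proof -
      have "\<bar>?y k b - of_int (j b)\<bar> \<le> 1" using i b by (simp add: kj cell_def)
      then show ?thesis unfolding atLeastAtMost_iff by linarith
    qed
    moreover have "j \<in> extensional Basis" using i by (auto simp: kj cell_box_def PiE_def)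
    ultimately show "i \<in> ?S" using k0[OF i] k2[OF i] by (auto simp: kj PiE_def)
  qed
  then have "card ?A \<le> card ?S" by (intro card_mono finite_SigmaI finite_PiE) auto
  also have "card ?S = (\<Sum>k\<in>{k0..k0 + 2}. card (PiE Basis (\<lambda>b. {\<lfloor>?y k b\<rfloor> - 1..\<lfloor>?y k b\<rfloor> + 1})))"
    by (rule card_SigmaI) (auto intro: finite_PiE)
  also have "\<dots> = (\<Sum>k\<in>{k0..k0 + 2}. 3 ^ DIM('a))" by (simp add: card_PiE)
  also have "\<dots> = 3 * 3 ^ DIM('a)" by simp
  finally show ?thesis .
next
  case True
  show ?thesis unfolding True by simp
qed

lemma closed_cell:
  assumes "continuous_on UNIV \<rho>"
  shows "closed (cell \<rho> c i)"
proof -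
  have "cell \<rho> c i = {z. 1 / 4 \<le> 4 ^ fst i * (- \<rho> z)} \<inter> {z. 4 ^ fst i * (- \<rho> z) \<le> 4} \<inter>
     (\<Inter>b\<in>Basis. {z. \<bar>2 ^ fst i / c * (z \<bullet> b) - of_int (snd i b)\<bar> \<le> 1})"
    by (auto simp: cell_def)
  then show ?thesis
    by (simp only:) (intro closed_Int closed_INT ballI closed_Collect_le continuous_intros assms)
qed

lemma smooth_coordinate:
  "smooth_on UNIV (\<lambda>z::'a::euclidean_space. d * (z \<bullet> b) - e)"
proof -
  have "smooth_on UNIV (\<lambda>z::'a. d * (z \<bullet> b) + (- e))"
    by (intro smooth_on_add open_UNIV smooth_on_const smooth_on_bounded_linear_id bounded_linear_mult_right[THEN bounded_linear_compose] bounded_linear_inner_left)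
  then show ?thesis by simp
qed

lemma pd_coordinate: "pd w (\<lambda>z::'a::euclidean_space. d * (z \<bullet> b) - e) = (\<lambda>z. d * (w \<bullet> b))"
proof
  fix z :: 'a
  have "((\<lambda>z::'a. d * (z \<bullet> b) - e) has_derivative (\<lambda>w. d * (w \<bullet> b))) (at z)"
    by (auto intro!: derivative_eq_intros)
  then show "pd w (\<lambda>z. d * (z \<bullet> b) - e) z = d * (w \<bullet> b)" by (rule pd_eqI)
qed

lemma smooth_cell_bump_factors:
  assumes "smooth_on UNIV \<rho>"
  shows "smooth_on UNIV (\<lambda>z::'a::euclidean_space. shell_bump (d * (- \<rho> z)))"
    "smooth_on UNIV (\<lambda>z::'a. lattice_bump (d * (z \<bullet> b) - e))"
proof -
  have "smooth_on UNIV (\<lambda>z. (- d) * \<rho> z)" by (intro smooth_on_mult open_UNIV smooth_on_const assms)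
  then have "smooth_on UNIV (\<lambda>z. d * (- \<rho> z))" by simp
  then show "smooth_on UNIV (\<lambda>z. shell_bump (d * (- \<rho> z)))"
    by (rule smooth_on_compose[OF open_UNIV _ bounded_derivs_shell_bump[unfolded bounded_derivs_def, THEN conjunct1]]) simp
  show "smooth_on UNIV (\<lambda>z::'a. lattice_bump (d * (z \<bullet> b) - e))"
    by (rule smooth_on_compose[OF open_UNIV smooth_coordinate bounded_derivs_lattice_bump[unfolded bounded_derivs_def, THEN conjunct1]]) simp
qed

lemma smooth_cell_bump:
  fixes \<rho> :: "'a::euclidean_space \<Rightarrow> real"
  assumes "smooth_on UNIV \<rho>"
  shows "smooth_on UNIV (cell_bump \<rho> c i)"
  unfolding cell_bump_def[abs_def]
  by (intro smooth_on_mult smooth_on_prod open_UNIV smooth_cell_bump_factors[OF assms])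

text \<open>
  The weighted directions for which the bumps of the cells have uniform bounds at \<open>z\<close>.
\<close>

definition admissible :: "('a::euclidean_space \<Rightarrow> real) \<Rightarrow> real \<Rightarrow> 'a \<Rightarrow> ('a \<times> real) set \<Rightarrow> bool" where
  "admissible \<rho> W z E \<longleftrightarrow> (\<forall>(w, \<sigma>)\<in>E. norm w \<le> W \<and> (\<sigma> = - \<rho> z \<or> (\<sigma> = sqrt (- \<rho> z) \<and> pd w \<rho> z = 0)))"

text \<open>
  On the cell \<open>(k, j)\<close> one has \<open>4 ^ k \<bar>\<rho>\<bar> \<le> 4\<close>. So the weighted bound of \<open>\<rho>\<close> by \<open>A \<bar>\<rho>\<bar>\<close> turns into
  the bound \<open>4 A\<close> for \<open>4 ^ k \<rho>\<close>, independently of \<open>k\<close>; the rescaled coordinates have derivative of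
  order \<open>2 ^ k \<le> 2 / sqrt \<bar>\<rho>\<bar>\<close>, which all weights allow. Composition with the fixed one-dimensional
  bumps preserves such bounds.
\<close>

lemma cell_bump_dbounded:
  fixes \<rho> :: "'a::euclidean_space \<Rightarrow> real"
  assumes rho: "smooth_on UNIV \<rho>" and K: "compact K" and c: "c > 0" and W: "W \<ge> 0"
  shows "\<exists>C. \<forall>i z E. z \<in> K \<longrightarrow> z \<in> cell \<rho> c i \<longrightarrow> - \<rho> z \<le> 1 \<longrightarrow> admissible \<rho> W z E \<longrightarrow> dbounded n E C (cell_bump \<rho> c i) z"
proof -
  obtain A where A: "A \<ge> 1" "\<forall>x\<in>K. \<forall>s E. 0 < s \<longrightarrow> s \<le> 1 \<longrightarrow> \<bar>\<rho> x\<bar> \<le> s \<longrightarrow>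
     (\<forall>(w, \<sigma>)\<in>E. norm w \<le> W \<and> (\<sigma> = s \<or> (\<sigma> = sqrt s \<and> pd w \<rho> x = 0))) \<longrightarrow> dbounded (Suc n) E (A * s) \<rho> x"
    using dbounded_weighted[OF rho K W, of "Suc n"] by blast
  have A40: "0 \<le> 4 * A" and B0: "0 \<le> 2 * W / c" using A(1) W c by auto
  obtain C1 where C1: "\<forall>S E x. \<forall>f :: 'a \<Rightarrow> real. open S \<longrightarrow> x \<in> S \<longrightarrow> smooth_on S f \<longrightarrow>
     (\<forall>(w, \<sigma>)\<in>E. \<sigma> > 0 \<and> dbounded n E (4 * A / \<sigma>) (pd w f) x) \<longrightarrow> dbounded n E C1 (\<lambda>x. shell_bump (f x)) x"
    using dbounded_compose[OF bounded_derivs_shell_bump A40, of n] by blast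
  obtain C2 where C2: "\<forall>S E x. \<forall>f :: 'a \<Rightarrow> real. open S \<longrightarrow> x \<in> S \<longrightarrow> smooth_on S f \<longrightarrow>
     (\<forall>(w, \<sigma>)\<in>E. \<sigma> > 0 \<and> dbounded n E (2 * W / c / \<sigma>) (pd w f) x) \<longrightarrow> dbounded n E C2 (\<lambda>x. lattice_bump (f x)) x"
    using dbounded_compose[OF bounded_derivs_lattice_bump B0, of n] by blast
  show ?thesis
  proof (intro exI[of _ "2 ^ n * (C1 * (\<Prod>b\<in>(Basis::'a set). 2 ^ n * C2))"] allI impI)
    fix i z and E :: "('a \<times> real) set"
    assume z: "z \<in> K" "z \<in> cell \<rho> c i" "- \<rho> z \<le> 1" and E: "admissible \<rho> W z E"
    define s where "s = - \<rho> z"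
    define k where "k = fst i"
    have ks: "1 / 4 \<le> 4 ^ k * s" "4 ^ k * s \<le> 4" using z(2) by (auto simp: cell_def s_def k_def)
    have s: "s > 0"
    proof (rule ccontr)
      assume "\<not> s > 0"
      then have "4 ^ k * s \<le> 0" by (simp add: mult_nonneg_nonpos)
      with ks(1) show False by simp
    qed
    have s1: "s \<le> 1" using z(3) by (simp add: s_def)
    have ss: "s \<le> sqrt s" using s s1 by (auto intro: real_le_rsqrt simp: power2_eq_square mult_left_le)
    have E': "\<forall>(w, \<sigma>)\<in>E. norm w \<le> W \<and> (\<sigma> = s \<or> (\<sigma> = sqrt s \<and> pd w \<rho> z = 0))" using E by (simp add: admissible_def s_def)
    have pos: "\<forall>(w, \<sigma>)\<in>E. \<sigma> > 0" using E' s by auto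
    have rb: "dbounded (Suc n) E (A * s) \<rho> z" proof -
      have "\<bar>\<rho> z\<bar> \<le> s" using s by (simp add: s_def)
      then show ?thesis using A(2) z(1) s s1 E' by blast
    qed
    have "dbounded (Suc n) E (4 ^ k * (A * s)) (\<lambda>z. - (4 ^ k) * \<rho> z) z"
      by (rule dbounded_bounded_linear[OF open_UNIV UNIV_I bounded_linear_mult_right _ _ rho rb]) (auto simp: abs_mult)
    moreover have "4 ^ k * (A * s) \<le> 4 * A" using mult_left_mono[OF ks(2), of A] A(1) by (simp add: mult_ac)
    ultimately have fb: "dbounded (Suc n) E (4 * A) (\<lambda>z. - (4 ^ k) * \<rho> z) z" using dbounded_mono[OF pos] by blast
    have fs: "smooth_on UNIV (\<lambda>z. - (4 ^ k) * \<rho> z)" by (intro smooth_on_mult open_UNIV smooth_on_const rho)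
    have "\<forall>(w, \<sigma>)\<in>E. \<sigma> > 0 \<and> dbounded n E (4 * A / \<sigma>) (pd w (\<lambda>z. - (4 ^ k) * \<rho> z)) z"
      using pos dbounded_pd[OF fb] by auto
    then have "dbounded n E C1 (\<lambda>x. shell_bump (- (4 ^ k) * \<rho> x)) z" using C1 fs open_UNIV UNIV_I by blast
    then have 1: "dbounded n E C1 (\<lambda>x. shell_bump (4 ^ k * (- \<rho> x))) z" by simp
    have 2: "dbounded n E C2 (\<lambda>x. lattice_bump (2 ^ k / c * (x \<bullet> b) - of_int (snd i b))) z" if b: "b \<in> Basis" for b
    proof -
      have "dbounded n E (2 * W / c / \<sigma>) (pd w (\<lambda>x. 2 ^ k / c * (x \<bullet> b) - of_int (snd i b))) z" if w: "(w, \<sigma>) \<in> E" for w \<sigma>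
        unfolding pd_coordinate
      proof (rule dbounded_const[OF pos])
        have w': "norm w \<le> W" "\<sigma> \<le> sqrt s" "\<sigma> > 0" using E' w ss pos by auto
        have "(2 ^ k * sqrt s)\<^sup>2 = 4 ^ k * s" using s by (simp add: power_mult_distrib power_mult[symmetric] mult.commute[of k 2] power_mult)
        then have "(2 ^ k * sqrt s)\<^sup>2 \<le> 2\<^sup>2" using ks(2) by simp
        then have "2 ^ k * sqrt s \<le> 2" by (rule power2_le_imp_le) simp
        moreover have "2 ^ k * \<sigma> \<le> 2 ^ k * sqrt s" using w'(2) by simp
        ultimately have "2 ^ k * \<sigma> \<le> 2" by linarith
        then have "2 ^ k \<le> 2 / \<sigma>" using w'(3) by (simp add: le_divide_eq)
        moreover have "\<bar>w \<bullet> b\<bar> \<le> W" using Basis_le_norm[OF b, of w] w'(1) by simp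
        ultimately have "2 ^ k * \<bar>w \<bullet> b\<bar> \<le> 2 / \<sigma> * W" using w'(3) by (intro mult_mono) auto
        then have "2 ^ k * \<bar>w \<bullet> b\<bar> / c \<le> 2 / \<sigma> * W / c" using c by (intro divide_right_mono) auto
        then show "norm (2 ^ k / c * (w \<bullet> b)) \<le> 2 * W / c / \<sigma>" using c by (simp add: abs_mult mult.commute)
      qed
      then have "\<forall>(w, \<sigma>)\<in>E. \<sigma> > 0 \<and> dbounded n E (2 * W / c / \<sigma>) (pd w (\<lambda>x. 2 ^ k / c * (x \<bullet> b) - of_int (snd i b))) z"
        using pos by auto
      then show ?thesis using C2 smooth_coordinate open_UNIV UNIV_I by blast
    qed
    have 3: "dbounded n E (\<Prod>b\<in>(Basis::'a set). 2 ^ n * C2) (\<lambda>x. \<Prod>b\<in>Basis. lattice_bump (2 ^ k / c * (x \<bullet> b) - of_int (snd i b))) z"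
    proof (rule dbounded_prod[OF open_UNIV UNIV_I pos finite_Basis])
      fix b :: 'a assume b: "b \<in> Basis"
      show "smooth_on UNIV (\<lambda>x. lattice_bump (2 ^ k / c * (x \<bullet> b) - of_int (snd i b)))"
        unfolding k_def by (rule smooth_cell_bump_factors(2)[OF rho])
      show "dbounded n E C2 (\<lambda>x. lattice_bump (2 ^ k / c * (x \<bullet> b) - of_int (snd i b))) z" by (rule 2[OF b])
    qed
    show "dbounded n E (2 ^ n * (C1 * (\<Prod>b\<in>(Basis::'a set). 2 ^ n * C2))) (cell_bump \<rho> c i) z"
      unfolding cell_bump_def[abs_def] k_def[symmetric]
      by (rule dbounded_mult[OF open_UNIV UNIV_I smooth_cell_bump_factors(1)[OF rho] smooth_on_prod[OF open_UNIV smooth_cell_bump_factors(2)[OF rho]] 1 3])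
  qed
qed

section \<open>Charts along the boundary\<close>

text \<open>
  All points of \<open>B\<close> share one chart, in which the directions \<open>v z\<close> are close enough to the \<open>m\<close> axis
  for \<open>line_meets_sheet\<close>.
\<close>

definition good_chart where
  "good_chart D X W v K0 r0 B \<longleftrightarrow> (\<exists>p \<delta> L M \<eta> w \<Lambda> a K. sheet_chart D X p \<delta> L M \<eta> w \<Lambda> a K \<and> K \<le> K0 \<and> card \<Lambda> \<le> r0 \<and>
     B \<subseteq> ball p \<delta> \<inter> W \<and> (\<forall>z\<in>B. 1 / 2 \<le> norm (M (v z)) \<and> K * norm (L (v z)) \<le> 1 / 4))"

lemma good_chart_mono:
  assumes "good_chart D X W v K r B" "K \<le> K0" "r \<le> r0" "B' \<subseteq> B"
  shows "good_chart D X W v K0 r0 B'"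
proof -
  obtain p \<delta> L M \<eta> w \<Lambda> a K' where *: "sheet_chart D X p \<delta> L M \<eta> w \<Lambda> a K'" "K' \<le> K" "card \<Lambda> \<le> r"
     "B \<subseteq> ball p \<delta> \<inter> W" "\<forall>z\<in>B. 1 / 2 \<le> norm (M (v z)) \<and> K' * norm (L (v z)) \<le> 1 / 4"
    using assms(1) unfolding good_chart_def by (elim exE conjE) (rule that)
  show ?thesis
    unfolding good_chart_def
    by (rule exI[of _ p], rule exI[of _ \<delta>], rule exI[of _ L], rule exI[of _ M], rule exI[of _ \<eta>], rule exI[of _ w],
        rule exI[of _ \<Lambda>], rule exI[of _ a], rule exI[of _ K'])
       (use * assms(2-4) in \<open>auto intro: order_trans\<close>)
qed

text \<open>
  At \<open>p\<close> itself \<open>v p\<close> is the \<open>m\<close> axis, and the conditions on the direction are open.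
\<close>

lemma local_good_chart:
  fixes \<rho> :: "complex ^ 2 \<Rightarrow> real"
  assumes rho: "smooth_on UNIV \<rho>" "strictly_convex_on UNIV \<rho>" and D: "D = {z. \<rho> z < 0}"
    and p: "p \<in> frontier D" "gradient \<rho> p \<noteq> 0"
    and W: "open W" "p \<in> W" and v: "smooth_on W v" "\<forall>\<zeta>\<in>W. norm (v \<zeta>) = 1 \<and> v \<zeta> \<in> complex_tangent_space \<rho> \<zeta>"
    and \<Omega>: "open \<Omega>" "p \<in> \<Omega>" and f: "holomorphic_on_Cn f \<Omega>" and X: "X = {z \<in> \<Omega>. f z = 0}"
    and tr: "transverse_tangent_cones X \<rho>"
  shows "\<exists>r>0. \<exists>K n. good_chart D X W v K n (ball p r)"
proof -
  have w: "norm (v p) = 1" "v p \<in> complex_tangent_space \<rho> p" using v(2) W(2) by auto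
  obtain \<delta> L M \<Lambda> a K where ch: "sheet_chart D X p \<delta> L M (outer_normal \<rho> p) (v p) \<Lambda> a K"
    using sheet_chart_exists[OF rho D p w \<Omega> f X tr] by blast
  have d0: "\<delta> > 0" and LM: "unitary_coordinates (outer_normal \<rho> p) (v p) L M"
    using ch by (auto simp: sheet_chart_def)
  have "L (0 *s outer_normal \<rho> p + 1 *s v p) = 0" "M (0 *s outer_normal \<rho> p + 1 *s v p) = 1"
    using LM unfolding unitary_coordinates_def by blast+
  then have LMp: "L (v p) = 0" "M (v p) = 1" by simp_all
  have bl: "bounded_linear L" "bounded_linear M" using LM by (auto simp: unitary_coordinates_def)
  have cv: "continuous_on W v" by (rule smooth_on_continuous_on[OF v(1)])
  have cM: "continuous_on W (\<lambda>z. norm (M (v z)))" and cL: "continuous_on W (\<lambda>z. K * norm (L (v z)))"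
    using bounded_linear.continuous_on[OF bl(2) cv] bounded_linear.continuous_on[OF bl(1) cv]
    by (auto intro!: continuous_on_norm continuous_on_mult continuous_on_const)
  define V where "V = ball p \<delta> \<inter> ((W \<inter> (\<lambda>z. norm (M (v z))) -` {1 / 2<..}) \<inter> (W \<inter> (\<lambda>z. K * norm (L (v z))) -` {..<1 / 4}))"
  have "open V"
    unfolding V_def
    by (intro open_Int open_ball continuous_open_preimage[OF cM W(1)] continuous_open_preimage[OF cL W(1)]) auto
  moreover have "p \<in> V" using d0 W(2) LMp by (simp add: V_def)
  ultimately obtain r where r: "r > 0" "ball p r \<subseteq> V" using open_contains_ball by blast
  have "good_chart D X W v K (card \<Lambda>) (ball p r)"
    unfolding good_chart_def
    by (rule exI[of _ p], rule exI[of _ \<delta>], rule exI[of _ L], rule exI[of _ M], rule exI[of _ "outer_normal \<rho> p"], rule exI[of _ "v p"],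
        rule exI[of _ \<Lambda>], rule exI[of _ a], rule exI[of _ K])
       (use ch r(2) in \<open>auto simp: V_def subset_iff intro: less_imp_le\<close>)
  then show ?thesis using r(1) by blast
qed

text \<open>
  Compactness of the boundary: finitely many charts suffice, and a Lebesgue number of the covering
  makes the radius uniform.
\<close>

lemma uniform_good_charts:
  fixes D :: "(complex ^ 2) set"
  assumes bd: "bounded D" and loc: "\<And>p. p \<in> frontier D \<Longrightarrow> \<exists>r>0. \<exists>K n. good_chart D X W v K n (ball p r)"
  shows "\<exists>e>0. \<exists>K0\<ge>0. \<exists>r0. \<forall>q\<in>frontier D. good_chart D X W v K0 r0 (ball q e)"
proof -
  have comp: "compact (frontier D)" by (rule compact_frontier_bounded[OF bd])
  have "\<forall>p\<in>frontier D. \<exists>t. 0 < fst t \<and> good_chart D X W v (fst (snd t)) (snd (snd t)) (ball p (fst t))"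
    using loc by fastforce
  from bchoice[OF this] obtain t where t: "\<forall>p\<in>frontier D. 0 < fst (t p) \<and> good_chart D X W v (fst (snd (t p))) (snd (snd (t p))) (ball p (fst (t p)))"
    by blast
  have "frontier D \<subseteq> (\<Union>p\<in>frontier D. ball p (fst (t p)))" using t by force
  then obtain F where F: "F \<subseteq> frontier D" "finite F" "frontier D \<subseteq> (\<Union>p\<in>F. ball p (fst (t p)))"
    using compactE_image[OF comp, of "frontier D" "\<lambda>p. ball p (fst (t p))"] by auto
  obtain e where e: "e > 0" "\<And>q. q \<in> frontier D \<Longrightarrow> \<exists>B\<in>(\<lambda>p. ball p (fst (t p))) ` F. ball q e \<subseteq> B"
    using Heine_Borel_lemma[OF comp, of "(\<lambda>p. ball p (fst (t p))) ` F"] F(3) by (metis (no_types, lifting) imageE open_ball)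
  define K0 where "K0 = (\<Sum>p\<in>F. \<bar>fst (snd (t p))\<bar>)"
  define r0 where "r0 = (\<Sum>p\<in>F. snd (snd (t p)))"
  have "good_chart D X W v K0 r0 (ball q e)" if q: "q \<in> frontier D" for q
  proof -
    obtain p where p: "p \<in> F" "ball q e \<subseteq> ball p (fst (t p))" using e(2)[OF q] by blast
    have gc: "good_chart D X W v (fst (snd (t p))) (snd (snd (t p))) (ball p (fst (t p)))" using t F(1) p(1) by blast
    have "fst (snd (t p)) \<le> K0"
      unfolding K0_def using member_le_sum[of p F "\<lambda>p. \<bar>fst (snd (t p))\<bar>"] p(1) F(2) by auto
    moreover have "snd (snd (t p)) \<le> r0"
      unfolding r0_def using member_le_sum[of p F "\<lambda>p. snd (snd (t p))"] p(1) F(2) by auto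
    ultimately show ?thesis by (rule good_chart_mono[OF gc _ _ p(2)])
  qed
  moreover have "K0 \<ge> 0" unfolding K0_def by (simp add: sum_nonneg)
  ultimately show ?thesis using e(1) by blast
qed

section \<open>Interpolants on the cells\<close>

text \<open>
  A radius \<open>e\<close>, a Lipschitz constant \<open>K0\<close> and a number of sheets \<open>r0\<close> that are valid along the whole
  boundary, a Lipschitz constant \<open>CL\<close> for \<open>\<rho>\<close> and its first derivatives, and a radius \<open>RD\<close> of \<open>D\<close>.
  The balls of radius \<open>RD + 2\<close> leave room for short lines that start in \<open>D\<close>.
\<close>

locale extension_data =
  fixes \<rho> :: "complex ^ 2 \<Rightarrow> real" and v :: "complex ^ 2 \<Rightarrow> complex ^ 2" and D X W :: "(complex ^ 2) set"
    and K0 :: real and r0 :: nat and e CL RD \<kappa> :: real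
  assumes rho: "smooth_on UNIV \<rho>" and D: "D = {z. \<rho> z < 0}" and bd: "\<And>z. z \<in> D \<Longrightarrow> norm z \<le> RD"
    and v: "\<And>\<zeta>. \<zeta> \<in> W \<Longrightarrow> norm (v \<zeta>) = 1 \<and> v \<zeta> \<in> complex_tangent_space \<rho> \<zeta>"
    and grad: "\<And>\<zeta>. \<zeta> \<in> W \<Longrightarrow> gradient \<rho> \<zeta> \<noteq> 0"
    and charts: "\<And>q. q \<in> frontier D \<Longrightarrow> good_chart D X W v K0 r0 (ball q e)" and e: "e > 0" and K0: "K0 \<ge> 0"
    and CL: "CL \<ge> 1" "\<And>x y. x \<in> cball 0 (RD + 2) \<Longrightarrow> y \<in> cball 0 (RD + 2) \<Longrightarrow> \<bar>\<rho> x - \<rho> y\<bar> \<le> CL * norm (x - y)"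
      "\<And>x y w. x \<in> cball 0 (RD + 2) \<Longrightarrow> y \<in> cball 0 (RD + 2) \<Longrightarrow> \<bar>pd w \<rho> x - pd w \<rho> y\<bar> \<le> CL * norm (x - y) * norm w"
    and \<kappa>: "0 < \<kappa>" "\<kappa> < 1 / 3"
begin

text \<open>
  The constants are chosen so that, with \<open>h = 1 / 2 ^ k\<close> for a cell of level \<open>k\<close>, lines of length
  \<open>c1 h\<close> through the patch stay in \<open>D\<close>, and the patch, of radius \<open>16 c h\<close>, is so small that the
  sheets meeting it are hit by these lines within radius \<open>\<kappa> c1 h\<close>. As this is less than \<open>3 \<kappa> tau\<close>,
  the nodes are among those over which \<open>c_infty\<close> is a supremum. The patch is a neighbourhood of the
  cell near the boundary; the lower bound \<open>h\<^sup>2 / 64\<close> for \<open>\<bar>\<rho>\<bar>\<close> on it is a fixed fraction of the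
  bound \<open>h\<^sup>2 / 4\<close> on the cell.
\<close>

definition "c1 = min (1 / (16 * CL)) (e / 8)"
definition "c = \<kappa> * c1 / (128 * (1 + K0))"
definition "U = (\<Union>q\<in>frontier D. ball q (e / 4)) \<inter> {z. \<bar>\<rho> z\<bar> < 1}"
definition "centre i = (SOME z. z \<in> cell \<rho> c i \<inter> (D \<inter> U))"
definition "patch i = ball (centre i) (16 * c * (1 / 2 ^ fst i)) \<inter> {\<zeta>. \<rho> \<zeta> < - (1 / 64) * (1 / 2 ^ fst i)\<^sup>2}"

lemma diff: "\<rho> differentiable (at x)"
  using smooth_on_differentiable[OF rho] by simp

lemma cont: "continuous_on UNIV \<rho>"
  by (rule smooth_on_continuous_on[OF rho])

lemma open_D: "open D"
  unfolding D using cont by (intro open_Collect_less) auto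

lemma open_U: "open U"
  unfolding U_def using cont by (intro open_Int open_UN ballI open_ball open_Collect_less continuous_intros) auto

lemma open_DU: "open (D \<inter> U)" by (intro open_Int open_D open_U)

lemma c1_bounds: "0 < c1" "CL * c1 \<le> 1 / 16" "c1 \<le> 1 / 16" "c1 \<le> e / 8"
proof -
  show "0 < c1" "c1 \<le> e / 8" using e CL(1) by (auto simp: c1_def)
  have "c1 \<le> 1 / (16 * CL)" by (simp add: c1_def)
  then show *: "CL * c1 \<le> 1 / 16" using CL(1) by (simp add: field_simps)
  have "1 * c1 \<le> CL * c1" using \<open>0 < c1\<close> CL(1) by (intro mult_right_mono) auto
  then show "c1 \<le> 1 / 16" using * by linarith
qed

lemma c_bounds: "0 < c" "16 * c \<le> c1" "128 * (1 + K0) * c = \<kappa> * c1" "c \<le> 1"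
proof -
  show "0 < c" using \<kappa> c1_bounds K0 by (simp add: c_def)
  show eq: "128 * (1 + K0) * c = \<kappa> * c1" using K0 by (simp add: c_def)
  have "128 * c \<le> 128 * (1 + K0) * c" using K0 \<open>0 < c\<close> by simp
  also have "\<dots> \<le> 1 * c1" unfolding eq using \<kappa> c1_bounds by (intro mult_right_mono) auto
  finally have "128 * c \<le> c1" by simp
  then show "16 * c \<le> c1" "c \<le> 1" using \<open>0 < c\<close> c1_bounds(3) by linarith+
qed

lemma U_subset_W: "U \<subseteq> W"
proof
  fix z assume "z \<in> U"
  then obtain q where q: "q \<in> frontier D" "z \<in> ball q (e / 4)" by (auto simp: U_def)
  have "z \<in> ball q e" using q(2) e by auto
  then show "z \<in> W" using charts[OF q(1)] unfolding good_chart_def by blast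
qed

lemma rho_small: "z \<in> D \<inter> U \<Longrightarrow> \<rho> z < 0 \<and> - 1 < \<rho> z"
proof -
  assume "z \<in> D \<inter> U"
  then have "\<rho> z < 0" "\<bar>\<rho> z\<bar> < 1" unfolding U_def using D by blast+
  then show ?thesis by simp
qed

lemma frontier_subset_U: "frontier D \<subseteq> U"
proof
  fix q assume q: "q \<in> frontier D"
  have "\<rho> q = 0" by (rule defining_function_frontier[OF cont q[unfolded D]])
  then show "q \<in> U" using q e by (auto simp: U_def intro!: bexI[of _ q])
qed

lemma tangential: "\<zeta> \<in> W \<Longrightarrow> pd (x *s v \<zeta>) \<rho> \<zeta> = 0"
  using tangential_line[of "v \<zeta>" \<rho> \<zeta> x] v[of \<zeta>] gradient_eq[OF diff[of \<zeta>], of "x *s v \<zeta>"]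
  by (simp add: tangent_space_def)

definition active where "active i \<longleftrightarrow> cell \<rho> c i \<inter> (D \<inter> U) \<noteq> {}"

lemma centre: "active i \<Longrightarrow> centre i \<in> cell \<rho> c i" "active i \<Longrightarrow> centre i \<in> D" "active i \<Longrightarrow> centre i \<in> U"
proof -
  assume "active i"
  then have "\<exists>z. z \<in> cell \<rho> c i \<inter> (D \<inter> U)" unfolding active_def by blast
  from someI_ex[OF this] show "centre i \<in> cell \<rho> c i" "centre i \<in> D" "centre i \<in> U" unfolding centre_def by auto
qed

lemma open_patch: "open (patch i)"
  unfolding patch_def using cont by (intro open_Int open_ball open_Collect_less continuous_intros) auto

text \<open>
  Both the distance from the centre and the length of the line are at most \<open>c1 h\<close>, so that \<open>\<rho>\<close> grows
  by at most \<open>2 CL (c1 h)\<^sup>2 \<le> h\<^sup>2 / 128\<close> along the line, less than its distance \<open>h\<^sup>2 / 64\<close> from \<open>0\<close>.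
\<close>

lemma line_in_domain:
  assumes i: "active i" and q: "centre i \<in> ball q (e / 4)" and z: "\<zeta> \<in> patch i" and x: "norm x \<le> c1 * (1 / 2 ^ fst i)"
  shows "\<zeta> + x *s v (centre i) \<in> D \<inter> ball q e"
proof -
  define h :: real where "h = 1 / 2 ^ fst i"
  have h: "0 < h" "h \<le> 1" by (auto simp: h_def)
  let ?z = "centre i" and ?y = "x *s v (centre i)"
  have zW: "?z \<in> W" using centre(3)[OF i] U_subset_W by blast
  have ny: "norm ?y \<le> c1 * h" using x v[OF zW] by (simp add: norm_smult_vec h_def)
  have dz: "norm (\<zeta> - ?z) \<le> c1 * h"
  proof -
    have "norm (\<zeta> - ?z) \<le> 16 * c * h" using z by (simp add: patch_def h_def dist_norm norm_minus_commute)
    also have "\<dots> \<le> c1 * h" using c_bounds(2) h by (intro mult_right_mono) auto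
    finally show ?thesis .
  qed
  have ch: "c1 * h \<le> 1 / 16" "c1 * h \<le> e / 8"
  proof -
    have "c1 * h \<le> c1 * 1" using c1_bounds(1) h by (intro mult_left_mono) auto
    then show "c1 * h \<le> 1 / 16" "c1 * h \<le> e / 8" using c1_bounds by linarith+
  qed
  have nz: "norm ?z \<le> RD" using bd centre(2)[OF i] by blast
  have zin: "?z \<in> cball 0 (RD + 2)" using nz by simp
  have n\<zeta>: "norm \<zeta> \<le> RD + 1 / 16" using norm_triangle_sub[of \<zeta> ?z] dz ch nz by linarith
  have \<zeta>in: "\<zeta> \<in> cball 0 (RD + 2)" using n\<zeta> by simp
  have yin: "\<zeta> + ?y \<in> cball 0 (RD + 2)" using norm_triangle_ineq[of \<zeta> ?y] n\<zeta> ny ch by simp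
  have C0: "0 \<le> CL" using CL(1) by simp
  have "\<rho> (\<zeta> + ?y) \<le> \<rho> \<zeta> + CL * (norm (\<zeta> - ?z) + norm ?y) * norm ?y"
    by (rule tangential_growth[OF diff CL(3) C0 zin tangential[OF zW] \<zeta>in yin])
  also have "CL * (norm (\<zeta> - ?z) + norm ?y) * norm ?y \<le> CL * (c1 * h + c1 * h) * (c1 * h)"
    using dz ny C0 c1_bounds(1) h by (intro mult_mono add_mono mult_nonneg_nonneg add_nonneg_nonneg) auto
  also have "\<dots> = (CL * c1) * c1 * (2 * h\<^sup>2)" by (simp add: power2_eq_square)
  also have "\<dots> \<le> (1 / 16) * (1 / 16) * (2 * h\<^sup>2)"
    using c1_bounds C0 by (intro mult_right_mono mult_mono) auto
  also have "\<rho> \<zeta> < - (1 / 64) * h\<^sup>2" using z by (simp add: patch_def h_def)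
  finally have "\<rho> (\<zeta> + ?y) < - (1 / 64) * h\<^sup>2 + (1 / 16) * (1 / 16) * (2 * h\<^sup>2)" by simp
  also have "\<dots> \<le> 0" by simp
  finally have 1: "\<zeta> + ?y \<in> D" unfolding D by simp
  have "dist q (\<zeta> + ?y) \<le> dist q ?z + norm (\<zeta> - ?z) + norm ?y"
  proof -
    have "q - (\<zeta> + ?y) = (q - ?z) - (\<zeta> - ?z) - ?y" by simp
    then have "norm (q - (\<zeta> + ?y)) \<le> norm ((q - ?z) - (\<zeta> - ?z)) + norm ?y" by (metis norm_triangle_ineq4)
    also have "norm ((q - ?z) - (\<zeta> - ?z)) \<le> norm (q - ?z) + norm (\<zeta> - ?z)" by (rule norm_triangle_ineq4)
    finally show ?thesis by (simp add: dist_norm)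
  qed
  also have "\<dots> < e" using q dz ny ch e by simp
  finally show ?thesis using 1 by simp
qed

lemma tau_patch:
  assumes i: "active i" and z: "\<zeta> \<in> patch i"
  shows "c1 * (1 / 2 ^ fst i) \<le> tau \<rho> \<zeta> (v (centre i)) \<bar>\<rho> \<zeta>\<bar>"
proof -
  obtain q where q: "q \<in> frontier D" "centre i \<in> ball q (e / 4)" using centre(3)[OF i] by (auto simp: U_def)
  have nv: "norm (v (centre i)) = 1" using v centre(3)[OF i] U_subset_W by blast
  have bD: "bounded {z. \<rho> z < 0}" using bd unfolding bounded_iff D[symmetric] by blast
  have rz: "\<rho> \<zeta> < 0"
  proof -
    have "\<rho> \<zeta> < - (1 / 64) * (1 / 2 ^ fst i)\<^sup>2" using z by (simp add: patch_def)
    also have "\<dots> \<le> 0" by simp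
    finally show ?thesis .
  qed
  show ?thesis
  proof (rule tau_lower_bound[OF bD rz nv])
    show "0 < c1 * (1 / 2 ^ fst i)" using c1_bounds(1) by simp
    show "\<rho> (\<zeta> + l *s v (centre i)) < 0" if "norm l \<le> c1 * (1 / 2 ^ fst i)" for l
      using line_in_domain[OF i q(2) z that] unfolding D by simp
  qed
qed

text \<open>
  The hypotheses of \<open>sheet_interpolant\<close> with \<open>d = 32 c h\<close>, the diameter of the patch, and
  \<open>R = \<kappa> c1 h\<close>. The choice of \<open>c\<close> makes \<open>4 (1 + K0) d = R\<close>.
\<close>

lemma patch_interpolant:
  assumes i: "active i" and g: "holomorphic_on_analytic_set g (X \<inter> D)" and fin: "c_infty \<kappa> \<rho> X g < \<infinity>"
  shows "\<exists>G. hol_poly_on (patch i) G \<and> (\<forall>z\<in>patch i. norm (G z) \<le> real r0 * enn2real (c_infty \<kappa> \<rho> X g)) \<and>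
     (\<forall>z\<in>patch i \<inter> X. G z = g z)"
proof -
  define h :: real where "h = 1 / 2 ^ fst i"
  have h: "0 < h" by (simp add: h_def)
  define u where "u = v (centre i)"
  define Cg where "Cg = enn2real (c_infty \<kappa> \<rho> X g)"
  have Cg: "ennreal Cg = c_infty \<kappa> \<rho> X g" "0 \<le> Cg" using fin by (auto simp: Cg_def ennreal_enn2real_if)
  obtain q where q: "q \<in> frontier D" "centre i \<in> ball q (e / 4)" using centre(3)[OF i] by (auto simp: U_def)
  have nu: "norm u = 1" using v centre(3)[OF i] U_subset_W unfolding u_def by blast
  obtain p \<delta> L M \<eta> w \<Lambda> a K where ch: "sheet_chart D X p \<delta> L M \<eta> w \<Lambda> a K" and K: "K \<le> K0" and card: "card \<Lambda> \<le> r0"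
     and sub: "ball q e \<subseteq> ball p \<delta> \<inter> W" and dir: "\<forall>z\<in>ball q e. 1 / 2 \<le> norm (M (v z)) \<and> K * norm (L (v z)) \<le> 1 / 4"
    using charts[OF q(1)] unfolding good_chart_def by (elim exE conjE) (rule that)
  have "centre i \<in> ball q e" using q(2) e by auto
  then have u: "1 / 2 \<le> norm (M u)" "K * norm (L u) \<le> 1 / 4" using dir by (auto simp: u_def)
  define d where "d = 32 * c * h"
  define R where "R = \<kappa> * c1 * h"
  have K00: "0 \<le> K" using ch by (simp add: sheet_chart_def)
  have R: "4 * (1 + K) * d \<le> R" "0 \<le> R" "R \<le> c1 * h" "R < 3 * \<kappa> * (c1 * h)"
  proof -
    have "4 * (1 + K) * d \<le> 4 * (1 + K0) * d" using K c_bounds(1) h by (intro mult_right_mono) (auto simp: d_def)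
    also have "\<dots> = R" unfolding d_def R_def using c_bounds(3) by (simp add: algebra_simps)
    finally show "4 * (1 + K) * d \<le> R" .
    have p: "0 < c1 * h" using c1_bounds(1) h by simp
    show "0 \<le> R" using mult_nonneg_nonneg[of \<kappa> "c1 * h"] p \<kappa> by (simp add: R_def mult.assoc)
    have "\<kappa> * (c1 * h) \<le> 1 * (c1 * h)" using p \<kappa> by (intro mult_right_mono) auto
    then show "R \<le> c1 * h" by (simp add: R_def)
    show "R < 3 * \<kappa> * (c1 * h)" using mult_pos_pos[OF \<kappa>(1) p] unfolding R_def mult.assoc by linarith
  qed
  have dd: "norm (z - z') \<le> d" if "z \<in> patch i" "z' \<in> patch i" for z z'
  proof -
    have "norm (z - centre i) \<le> 16 * c * h" "norm (z' - centre i) \<le> 16 * c * h"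
      using that by (auto simp: patch_def h_def dist_norm norm_minus_commute)
    then show ?thesis using norm_triangle_ineq4[of "z - centre i" "z' - centre i"] by (simp add: d_def)
  qed
  have line: "z + x *s u \<in> D \<inter> ball p \<delta>" if "z \<in> patch i" "norm x \<le> R" for z x
  proof -
    have "norm x \<le> c1 * (1 / 2 ^ fst i)" using that(2) R(3) by (simp add: h_def)
    from line_in_domain[OF i q(2) that(1) this] show ?thesis using sub by (auto simp: u_def)
  qed
  define t where "t z = tau \<rho> z u \<bar>\<rho> z\<bar>" for z
  have t: "0 < t z \<and> R \<le> t z \<and> R < 3 * \<kappa> * t z" if "z \<in> patch i" for z
  proof -
    have le: "c1 * h \<le> t z" using tau_patch[OF i that] by (simp add: t_def u_def h_def)
    moreover have "0 < c1 * h" using c1_bounds(1) h by simp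
    moreover have "3 * \<kappa> * (c1 * h) \<le> 3 * \<kappa> * t z" using le \<kappa> by (intro mult_left_mono) auto
    ultimately show ?thesis using R by linarith
  qed
  have div: "norm (divided_difference (\<lambda>x. g (z + x *s u)) ls) * t z ^ (length ls - 1) \<le> Cg"
    if z: "z \<in> patch i" and ls: "ls \<noteq> []" "distinct ls" "\<And>x. x \<in> set ls \<Longrightarrow> norm x \<le> R \<and> z + x *s u \<in> X" for z ls
  proof -
    have "set ls \<subseteq> Lambda \<kappa> \<rho> X z u"
      using ls(3) t[OF z] by (auto simp: Lambda_def t_def intro: le_less_trans)
    moreover have "\<rho> z < 0"
    proof -
      have "z + 0 *s u \<in> D \<inter> ball p \<delta>" by (rule line[OF z]) (use R(2) in simp)
      then show ?thesis unfolding D by simp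
    qed
    ultimately have "(z, u, ls) \<in> {(z, u, ls). \<rho> z < 0 \<and> norm u = 1 \<and> ls \<noteq> [] \<and> distinct ls \<and> set ls \<subseteq> Lambda \<kappa> \<rho> X z u}"
      using nu ls(1,2) by simp
    then have "ennreal (norm (divided_difference (\<lambda>x. g (z + x *s u)) ls) * t z ^ (length ls - 1)) \<le> c_infty \<kappa> \<rho> X g"
      unfolding c_infty_def t_def by (rule SUP_upper2) simp
    then show ?thesis using Cg by (metis ennreal_le_iff)
  qed
  have interp: "\<exists>G. hol_poly_on (patch i) G \<and> (\<forall>z\<in>patch i. norm (G z) \<le> real (card \<Lambda>) * Cg) \<and> (\<forall>z\<in>patch i \<inter> X. G z = g z)"
  proof (rule sheet_interpolant[OF ch open_D u open_patch[of i] _ R(1,2) _ g Cg(2)])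
    fix z z' assume "z \<in> patch i" "z' \<in> patch i"
    then show "norm (z - z') \<le> d" by (rule dd)
  next
    fix z and x :: complex assume "z \<in> patch i" "norm x \<le> R"
    then show "z + x *s u \<in> D \<inter> ball p \<delta>" by (rule line)
  next
    fix z ls assume "z \<in> patch i" "ls \<noteq> []" "distinct ls" "\<And>x. x \<in> set ls \<Longrightarrow> norm x \<le> R \<and> z + x *s u \<in> X"
    then show "norm (divided_difference (\<lambda>x. g (z + x *s u)) ls) * t z ^ (length ls - 1) \<le> Cg" by (rule div)
  next
    fix z assume "z \<in> patch i"
    then show "0 < t z \<and> R \<le> t z" using t by blast
  qed
  obtain G where G: "hol_poly_on (patch i) G" "\<forall>z\<in>patch i. norm (G z) \<le> real (card \<Lambda>) * Cg" "\<forall>z\<in>patch i \<inter> X. G z = g z"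
    using interp by blast
  have "real (card \<Lambda>) * Cg \<le> real r0 * Cg" using card Cg(2) by (intro mult_right_mono) auto
  then show ?thesis using G unfolding Cg_def by (intro exI[of _ G]) (auto intro: order_trans)
qed

text \<open>
  A ball of radius \<open>\<kappa>' \<bar>\<rho> \<zeta>\<bar>\<close> around a point of the cell fits into the patch, which is what Cauchy's
  estimate needs.
\<close>

definition "\<kappa>' = min (4 * c) (1 / (2 * CL))"

lemma \<kappa>'_bounds: "0 < \<kappa>'" "\<kappa>' \<le> 4 * c" "CL * \<kappa>' \<le> 1 / 2" "\<kappa>' \<le> 1 / 2"
proof -
  show "0 < \<kappa>'" "\<kappa>' \<le> 4 * c" using c_bounds(1) CL(1) by (auto simp: \<kappa>'_def)
  have "\<kappa>' \<le> 1 / (2 * CL)" by (simp add: \<kappa>'_def)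
  then show *: "CL * \<kappa>' \<le> 1 / 2" using CL(1) by (simp add: field_simps)
  have "1 * \<kappa>' \<le> CL * \<kappa>'" using \<open>0 < \<kappa>'\<close> CL(1) by (intro mult_right_mono) auto
  then show "\<kappa>' \<le> 1 / 2" using * by linarith
qed

text \<open>
  The cell has width \<open>2 c h\<close> in each of four real coordinates, and the ball adds at most \<open>8 c h\<close>;
  together this is the radius \<open>16 c h\<close>. On the ball \<open>\<rho>\<close> varies by at most half of its value at the
  centre.
\<close>

lemma ball_in_patch:
  assumes z: "\<zeta> \<in> cell \<rho> c i" "\<zeta> \<in> D \<inter> U"
  shows "ball \<zeta> (\<kappa>' * (- \<rho> \<zeta>)) \<subseteq> patch i"
proof
  fix y assume y: "y \<in> ball \<zeta> (\<kappa>' * (- \<rho> \<zeta>))"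
  have i: "active i" using z by (auto simp: active_def)
  define h :: real where "h = 1 / 2 ^ fst i"
  have h: "0 < h" "h * 2 ^ fst i = 1" by (auto simp: h_def)
  have h4: "h\<^sup>2 * 4 ^ fst i = 1"
  proof -
    have "(4::real) ^ fst i = (2 ^ fst i)\<^sup>2" by (simp add: power2_eq_square power_mult_distrib[symmetric])
    then have "h\<^sup>2 * 4 ^ fst i = (h * 2 ^ fst i)\<^sup>2" by (simp add: power_mult_distrib)
    then show ?thesis using h(2) by simp
  qed
  define s where "s = - \<rho> \<zeta>"
  have s: "0 < s" "s < 1" using z(2) rho_small[of \<zeta>] by (auto simp: s_def)
  have ks: "1 / 4 \<le> 4 ^ fst i * s" "4 ^ fst i * s \<le> 4" using z(1) by (auto simp: cell_def s_def)
  have sl: "h\<^sup>2 / 4 \<le> s" "s \<le> 4 * h\<^sup>2"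
  proof -
    have "h\<^sup>2 * (1 / 4) \<le> h\<^sup>2 * (4 ^ fst i * s)" "h\<^sup>2 * (4 ^ fst i * s) \<le> h\<^sup>2 * 4"
      using ks by (intro mult_left_mono; simp)+
    moreover have "h\<^sup>2 * (4 ^ fst i * s) = s" using h4 by (metis mult.assoc mult_1)
    ultimately show "h\<^sup>2 / 4 \<le> s" "s \<le> 4 * h\<^sup>2" by auto
  qed
  have s2h: "s \<le> 2 * h"
  proof -
    have "s\<^sup>2 \<le> s" using s by (simp add: power2_eq_square mult_left_le)
    also have "\<dots> \<le> (2 * h)\<^sup>2" using sl(2) by (simp add: power_mult_distrib)
    finally show ?thesis by (rule power2_le_imp_le) (use h in simp)
  qed
  have dz: "norm (\<zeta> - centre i) \<le> 8 * c * h"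
  proof -
    have "\<bar>(\<zeta> - centre i) \<bullet> b\<bar> \<le> 2 * c * h" if b: "b \<in> Basis" for b
    proof -
      have "\<bar>2 ^ fst i / c * (\<zeta> \<bullet> b) - of_int (snd i b)\<bar> \<le> 1" "\<bar>2 ^ fst i / c * (centre i \<bullet> b) - of_int (snd i b)\<bar> \<le> 1"
        using z(1) centre(1)[OF i] b by (auto simp: cell_def)
      then have "\<bar>2 ^ fst i / c * (\<zeta> \<bullet> b) - 2 ^ fst i / c * (centre i \<bullet> b)\<bar> \<le> 2" by linarith
      also have "2 ^ fst i / c * (\<zeta> \<bullet> b) - 2 ^ fst i / c * (centre i \<bullet> b) = 2 ^ fst i / c * ((\<zeta> - centre i) \<bullet> b)"
        by (simp add: inner_diff_left right_diff_distrib)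
      finally have "2 ^ fst i / c * \<bar>(\<zeta> - centre i) \<bullet> b\<bar> \<le> 2" using c_bounds(1) by (simp add: abs_mult)
      then show ?thesis using c_bounds(1) by (simp add: h_def field_simps)
    qed
    then have "(\<Sum>b\<in>Basis. \<bar>(\<zeta> - centre i) \<bullet> b\<bar>) \<le> (\<Sum>b\<in>(Basis :: (complex ^ 2) set). 2 * c * h)"
      by (rule sum_mono)
    also have "\<dots> = 8 * c * h" by simp
    finally show ?thesis using norm_le_l1[of "\<zeta> - centre i"] by linarith
  qed
  have dy: "norm (y - \<zeta>) < \<kappa>' * s" using y by (simp add: s_def dist_norm norm_minus_commute)
  have "\<kappa>' * s \<le> (4 * c) * (2 * h)" using \<kappa>'_bounds s s2h c_bounds(1) by (intro mult_mono) auto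
  then have "norm (y - centre i) < 16 * c * h"
    using norm_triangle_ineq[of "y - \<zeta>" "\<zeta> - centre i"] dy dz by simp
  then have 1: "y \<in> ball (centre i) (16 * c * h)" by (simp add: dist_norm norm_minus_commute)
  have n\<zeta>: "norm \<zeta> \<le> RD" using bd z(2) by blast
  have "\<kappa>' * s \<le> (1 / 2) * 1" using \<kappa>'_bounds s by (intro mult_mono) auto
  then have "norm y \<le> RD + 2" using norm_triangle_sub[of y \<zeta>] dy n\<zeta> by linarith
  then have "\<bar>\<rho> y - \<rho> \<zeta>\<bar> \<le> CL * norm (y - \<zeta>)" using n\<zeta> by (intro CL(2)) auto
  also have "\<dots> \<le> CL * (\<kappa>' * s)" using dy CL(1) by (intro mult_left_mono) auto
  also have "\<dots> = (CL * \<kappa>') * s" by simp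
  also have "\<dots> \<le> (1 / 2) * s" using \<kappa>'_bounds s by (intro mult_right_mono) auto
  finally have "\<rho> y \<le> - s / 2" by (simp add: s_def)
  also have "\<dots> < - (1 / 64) * h\<^sup>2"
  proof -
    have "h\<^sup>2 > 0" using h by simp
    then show ?thesis using sl(1) by linarith
  qed
  finally show "y \<in> patch i" using 1 by (simp add: patch_def h_def)
qed

lemma in_patch: "\<zeta> \<in> cell \<rho> c i \<Longrightarrow> \<zeta> \<in> D \<inter> U \<Longrightarrow> \<zeta> \<in> patch i"
proof -
  assume z: "\<zeta> \<in> cell \<rho> c i" "\<zeta> \<in> D \<inter> U"
  have "0 < \<kappa>' * (- \<rho> \<zeta>)" using rho_small[OF z(2)] \<kappa>'_bounds(1) by (intro mult_pos_pos) auto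
  then have "\<zeta> \<in> ball \<zeta> (\<kappa>' * (- \<rho> \<zeta>))" by simp
  then show "\<zeta> \<in> patch i" using ball_in_patch[OF z] by blast
qed

section \<open>Gluing the interpolants\<close>

definition cell_family where
  "cell_family g B G \<longleftrightarrow> (\<forall>i. active i \<longrightarrow> hol_poly_on (patch i) (G i) \<and> (\<forall>z\<in>patch i. norm (G i z) \<le> B) \<and>
     (\<forall>z\<in>patch i \<inter> X. G i z = g z))"

definition bump where "bump i z = complex_of_real (cell_bump \<rho> c i z)"

text \<open>
  At every point only finitely many cells contribute. Restricting the sum to them makes the
  definition independent of the boxes, while \<open>glued_eq\<close> gives it as a fixed finite sum on each open
  set \<open>level N\<close>.
\<close>

definition glued where
  "glued G z = (\<Sum>i | snd i \<in> extensional Basis \<and> z \<in> cell \<rho> c i. bump i z * G i z)"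

definition level where "level N = {z \<in> D \<inter> U. - \<rho> z > 4 powr (- real N)}"

definition box where "box N = cell_box N (nat \<lceil>2 ^ N / c * RD\<rceil> + 1)"

lemma open_level: "open (level N)"
proof -
  have "level N = (D \<inter> U) \<inter> {z. - \<rho> z > 4 powr (- real N)}" by (auto simp: level_def)
  then show ?thesis using cont by (simp only:) (intro open_Int open_DU open_Collect_less continuous_intros, auto)
qed

lemma level_exists: "z \<in> D \<inter> U \<Longrightarrow> \<exists>N. z \<in> level N"
proof -
  assume z: "z \<in> D \<inter> U"
  then have "- \<rho> z > 0" by (simp add: D)
  then obtain N where "(1 / 4 :: real) ^ N < - \<rho> z" using real_arch_pow_inv[of "- \<rho> z" "1 / 4"] by auto
  moreover have "4 powr (- real N) = (1 / 4 :: real) ^ N" by (simp add: powr_minus powr_realpow power_divide inverse_eq_divide)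
  ultimately have "z \<in> level N" using z by (simp add: level_def)
  then show ?thesis by blast
qed

lemma coordinate_bound:
  assumes "z \<in> D" "b \<in> Basis" "k \<le> N"
  shows "\<bar>2 ^ k / c * (z \<bullet> b)\<bar> \<le> 2 ^ N / c * RD"
proof -
  have "\<bar>z \<bullet> b\<bar> \<le> RD" using Basis_le_norm[OF assms(2), of z] bd[OF assms(1)] by linarith
  moreover have "(2::real) ^ k / c \<le> 2 ^ N / c" using assms(3) c_bounds(1) by (intro divide_right_mono power_increasing) auto
  ultimately have "2 ^ k / c * \<bar>z \<bullet> b\<bar> \<le> 2 ^ N / c * RD" using c_bounds(1) by (intro mult_mono) auto
  then show ?thesis using c_bounds(1) by (simp add: abs_mult)
qed

lemma active_in_box:
  assumes z: "z \<in> level N" and i: "snd i \<in> extensional Basis" "z \<in> cell \<rho> c i"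
  shows "i \<in> box N"
proof -
  have zD: "z \<in> D" and s: "4 powr (- real N) < - \<rho> z" using z by (auto simp: level_def)
  have k: "fst i \<le> N"
  proof (rule ccontr)
    assume "\<not> fst i \<le> N"
    then have "(4::real) ^ Suc N \<le> 4 ^ fst i" by (intro power_increasing) auto
    moreover have "0 < - \<rho> z" using zD by (simp add: D)
    ultimately have "4 ^ Suc N * (- \<rho> z) \<le> 4 ^ fst i * (- \<rho> z)" by (intro mult_right_mono) auto
    also have "\<dots> \<le> 4" using i(2) by (simp add: cell_def)
    finally have "4 ^ N * (- \<rho> z) \<le> 1" by simp
    moreover have "4 ^ N * 4 powr (- real N) = (1::real)" by (simp add: powr_minus powr_realpow)
    moreover have "4 ^ N * 4 powr (- real N) < 4 ^ N * (- \<rho> z)" using s by (intro mult_strict_left_mono) auto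
    ultimately show False by linarith
  qed
  have "snd i b \<in> {- int (nat \<lceil>2 ^ N / c * RD\<rceil> + 1)..int (nat \<lceil>2 ^ N / c * RD\<rceil> + 1)}" if b: "b \<in> Basis" for b
  proof -
    have "\<bar>2 ^ fst i / c * (z \<bullet> b)\<bar> \<le> 2 ^ N / c * RD" by (rule coordinate_bound[OF zD b k])
    moreover have "\<bar>2 ^ fst i / c * (z \<bullet> b) - of_int (snd i b)\<bar> \<le> 1" using i(2) b by (simp add: cell_def)
    moreover have "2 ^ N / c * RD \<le> of_int (int (nat \<lceil>2 ^ N / c * RD\<rceil>))" by linarith
    ultimately show ?thesis unfolding atLeastAtMost_iff by linarith
  qed
  then show ?thesis using k i(1) by (cases i) (auto simp: box_def cell_box_def PiE_def)
qed

lemma box_extensional: "i \<in> box N \<Longrightarrow> snd i \<in> extensional Basis"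
  by (auto simp: box_def cell_box_def PiE_def)

lemma glued_eq:
  assumes z: "z \<in> level N"
  shows "glued G z = (\<Sum>i\<in>box N. bump i z * G i z)"
  unfolding glued_def
proof (rule sum.mono_neutral_left)
  show "finite (box N)" unfolding box_def by (rule finite_cell_box)
  show "{i. snd i \<in> extensional Basis \<and> z \<in> cell \<rho> c i} \<subseteq> box N" using active_in_box[OF z] by blast
  show "\<forall>i\<in>box N - {i. snd i \<in> extensional Basis \<and> z \<in> cell \<rho> c i}. bump i z * G i z = 0"
  proof
    fix i assume i: "i \<in> box N - {i. snd i \<in> extensional Basis \<and> z \<in> cell \<rho> c i}"
    then have "z \<notin> cell \<rho> c i" using box_extensional[of i N] by auto
    then show "bump i z * G i z = 0" by (simp add: bump_def cell_bump_outside)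
  qed
qed

lemma bump_sum:
  assumes z: "z \<in> level N"
  shows "(\<Sum>i\<in>box N. bump i z) = 1"
proof -
  have "(\<Sum>i\<in>box N. cell_bump \<rho> c i z) = 1"
    unfolding box_def
  proof (rule cell_bump_sum)
    show "- \<rho> z \<le> 1" "4 powr - real N \<le> - \<rho> z" using z by (auto simp: level_def U_def)
    fix k b assume kb: "k \<le> N" "b \<in> (Basis :: (complex ^ 2) set)"
    have "\<bar>2 ^ k / c * (z \<bullet> b)\<bar> \<le> 2 ^ N / c * RD" using z kb by (intro coordinate_bound) (auto simp: level_def)
    then show "\<bar>2 ^ k / c * (z \<bullet> b)\<bar> \<le> real (nat \<lceil>2 ^ N / c * RD\<rceil> + 1)" by linarith
  qed
  then show ?thesis unfolding bump_def of_real_sum[symmetric] by simp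
qed

lemma smooth_bump: "smooth_on S (bump i)"
  unfolding bump_def[abs_def]
  by (rule smooth_on_subset[OF smooth_on_bounded_linear[OF open_UNIV bounded_linear_of_real smooth_cell_bump[OF rho]] subset_UNIV])

lemma bump_zero: "z \<notin> cell \<rho> c i \<Longrightarrow> bump i z = 0"
  by (simp add: bump_def cell_bump_outside)

lemma open_off_cell: "open ((D \<inter> U) - cell \<rho> c i)"
  by (intro open_Diff open_DU closed_cell cont)

lemma family_on_cell:
  assumes "cell_family g B G" "z \<in> D \<inter> U" "z \<in> cell \<rho> c i"
  shows "hol_poly_on (patch i) (G i)" "z \<in> patch i" "\<And>y. y \<in> patch i \<Longrightarrow> norm (G i y) \<le> B" "\<And>y. y \<in> patch i \<inter> X \<Longrightarrow> G i y = g y"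
  using assms in_patch[of z i] unfolding cell_family_def active_def by blast+

text \<open>
  \<open>G i\<close> is smooth on the patch only. Outside of the cell, which is closed, the product vanishes.
\<close>

lemma smooth_term:
  assumes "cell_family g B G"
  shows "smooth_on (D \<inter> U) (\<lambda>z. bump i z * G i z)"
proof (rule smooth_on_open_local)
  fix z assume z: "z \<in> D \<inter> U"
  show "\<exists>V. open V \<and> z \<in> V \<and> smooth_on V (\<lambda>z. bump i z * G i z)"
  proof (cases "z \<in> cell \<rho> c i")
    case True
    note f = family_on_cell[OF assms z True]
    have "smooth_on (patch i) (\<lambda>z. bump i z * G i z)"
      by (rule smooth_on_mult[OF open_patch smooth_bump hol_poly_on_smooth[OF f(1)]])
    then show ?thesis using f(2) open_patch by blast
  next
    case False
    have "smooth_on ((D \<inter> U) - cell \<rho> c i) (\<lambda>z. bump i z * G i z)"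
      by (rule smooth_on_cong[OF open_off_cell _ smooth_on_const[of _ 0]]) (simp add: bump_zero)
    then show ?thesis using open_off_cell False z by blast
  qed
qed

lemma smooth_glued:
  assumes "cell_family g B G"
  shows "smooth_on (D \<inter> U) (glued G)"
proof (rule smooth_on_open_local)
  fix z assume z: "z \<in> D \<inter> U"
  then obtain N where N: "z \<in> level N" using level_exists by blast
  have sub: "level N \<subseteq> D \<inter> U" by (auto simp: level_def)
  have "smooth_on (level N) (\<lambda>z. \<Sum>i\<in>box N. bump i z * G i z)"
    by (rule smooth_on_sum[OF open_level smooth_on_subset[OF smooth_term[OF assms] sub]])
  then have "smooth_on (level N) (glued G)"
    by (rule smooth_on_cong[OF open_level, rotated]) (simp add: glued_eq)
  then show "\<exists>V. open V \<and> z \<in> V \<and> smooth_on V (glued G)" using open_level N by blast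
qed

lemma dbar_pair_bump_off:
  assumes "z \<in> D \<inter> U" "z \<notin> cell \<rho> c i"
  shows "dbar_pair a b \<alpha> \<beta> (bump i) z = 0"
proof -
  have "dbar_pair a b \<alpha> \<beta> (\<lambda>z. 0) z = dbar_pair a b \<alpha> \<beta> (bump i) z"
    by (rule dbar_pair_cong[OF open_off_cell smooth_on_const]) (use assms bump_zero in auto)
  then show ?thesis by (simp add: dbar_pair_const)
qed

lemma dbar_pair_term:
  assumes "cell_family g B G" "z \<in> D \<inter> U"
  shows "dbar_pair a b \<alpha> \<beta> (\<lambda>z. bump i z * G i z) z = (if z \<in> cell \<rho> c i then dbar_pair a b \<alpha> \<beta> (bump i) z * G i z else 0)"
proof (cases "z \<in> cell \<rho> c i")
  case True
  note f = family_on_cell[OF assms True]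
  show ?thesis
    using dbar_pair_mult_holomorphic[OF open_patch smooth_bump hol_poly_on_smooth[OF f(1)] hol_poly_on_complex_linear[OF f(1)] f(2)] True by simp
next
  case False
  have "dbar_pair a b \<alpha> \<beta> (\<lambda>z. 0) z = dbar_pair a b \<alpha> \<beta> (\<lambda>z. bump i z * G i z) z"
    by (rule dbar_pair_cong[OF open_off_cell smooth_on_const]) (use assms(2) False bump_zero in auto)
  then show ?thesis using False by (simp add: dbar_pair_const)
qed

lemma dbar_pair_glued:
  assumes "cell_family g B G" and z: "z \<in> level N"
  shows "dbar_pair a b \<alpha> \<beta> (glued G) z = (\<Sum>i\<in>{i \<in> box N. z \<in> cell \<rho> c i}. dbar_pair a b \<alpha> \<beta> (bump i) z * G i z)"
proof -
  have sub: "level N \<subseteq> D \<inter> U" by (auto simp: level_def)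
  have zDU: "z \<in> D \<inter> U" using z sub by blast
  have fin: "finite (box N)" unfolding box_def by (rule finite_cell_box)
  note sm = smooth_on_subset[OF smooth_term[OF assms(1)] sub]
  have "dbar_pair a b \<alpha> \<beta> (\<lambda>z. \<Sum>i\<in>box N. bump i z * G i z) z = dbar_pair a b \<alpha> \<beta> (glued G) z"
    by (rule dbar_pair_cong[OF open_level smooth_on_sum[OF open_level sm] _ z]) (simp add: glued_eq)
  moreover have "dbar_pair a b \<alpha> \<beta> (\<lambda>z. \<Sum>i\<in>box N. bump i z * G i z) z = (\<Sum>i\<in>box N. dbar_pair a b \<alpha> \<beta> (\<lambda>z. bump i z * G i z) z)"
    by (rule dbar_pair_sum[OF open_level fin sm z])
  moreover have "\<dots> = (\<Sum>i\<in>{i \<in> box N. z \<in> cell \<rho> c i}. dbar_pair a b \<alpha> \<beta> (bump i) z * G i z)"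
    unfolding dbar_pair_term[OF assms(1) zDU] by (rule sum.inter_filter[OF fin, symmetric])
  ultimately show ?thesis by simp
qed

lemma glued_extends:
  assumes "cell_family g B G" and z: "z \<in> X \<inter> D \<inter> U"
  shows "glued G z = g z"
proof -
  obtain N where N: "z \<in> level N" using level_exists z by blast
  have "bump i z * G i z = bump i z * g z" for i
    using family_on_cell[OF assms(1), of z i] bump_zero[of z i] z by (cases "z \<in> cell \<rho> c i") auto
  then have "glued G z = (\<Sum>i\<in>box N. bump i z) * g z" unfolding glued_eq[OF N] sum_distrib_right by (intro sum.cong) auto
  then show ?thesis using bump_sum[OF N] by simp
qed

text \<open>
  On \<open>X\<close> the factors \<open>G i z\<close> can be replaced by \<open>g z\<close>, and what remains is the derivative of the sum
  of the bumps, a constant function.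
\<close>

lemma dbar_pair_glued_zero:
  assumes "cell_family g B G" and z: "z \<in> X \<inter> D \<inter> U" and ab: "1 \<le> \<alpha> + \<beta>"
  shows "dbar_pair a b \<alpha> \<beta> (glued G) z = 0"
proof -
  obtain N where N: "z \<in> level N" using level_exists z by blast
  have zDU: "z \<in> D \<inter> U" using z by blast
  have fin: "finite (box N)" unfolding box_def by (rule finite_cell_box)
  have "dbar_pair a b \<alpha> \<beta> (glued G) z = (\<Sum>i\<in>{i \<in> box N. z \<in> cell \<rho> c i}. dbar_pair a b \<alpha> \<beta> (bump i) z * g z)"
    unfolding dbar_pair_glued[OF assms(1) N]
    by (rule sum.cong) (use family_on_cell[OF assms(1) zDU] z in auto)
  also have "\<dots> = (\<Sum>i\<in>box N. dbar_pair a b \<alpha> \<beta> (bump i) z * g z)"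
    by (rule sum.mono_neutral_left[OF fin]) (use dbar_pair_bump_off[OF zDU] in auto)
  also have "\<dots> = dbar_pair a b \<alpha> \<beta> (\<lambda>z. \<Sum>i\<in>box N. bump i z) z * g z"
    by (simp add: dbar_pair_sum[OF open_level fin smooth_bump N] sum_distrib_right)
  also have "dbar_pair a b \<alpha> \<beta> (\<lambda>z. \<Sum>i\<in>box N. bump i z) z = dbar_pair a b \<alpha> \<beta> (\<lambda>z. 1) z"
    by (rule dbar_pair_cong[OF open_level smooth_on_sum[OF open_level smooth_bump] _ N]) (rule bump_sum)
  also have "\<dots> = 0" using ab unfolding dbar_pair_const by auto
  finally show ?thesis by simp
qed

text \<open>
  \<open>243 = 3 * 3 ^ 4\<close>, for four real coordinates.
\<close>

lemma card_active: "z \<in> D \<Longrightarrow> real (card {i \<in> box N. z \<in> cell \<rho> c i}) \<le> 243"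
proof -
  assume "z \<in> D"
  then have "\<rho> z < 0" by (simp add: D)
  then have "card {i \<in> box N. z \<in> cell \<rho> c i} \<le> 3 * 3 ^ DIM(complex ^ 2)"
    unfolding box_def by (rule card_active_cells)
  then have "card {i \<in> box N. z \<in> cell \<rho> c i} \<le> 243" by simp
  then show ?thesis by linarith
qed

lemma bump_dbounded:
  assumes "0 \<le> Wd"
  shows "\<exists>C\<ge>0. \<forall>i z E. z \<in> D \<inter> U \<longrightarrow> z \<in> cell \<rho> c i \<longrightarrow> admissible \<rho> Wd z E \<longrightarrow> dbounded n E C (bump i) z"
proof -
  obtain C where C: "\<forall>i z E. z \<in> cball 0 RD \<longrightarrow> z \<in> cell \<rho> c i \<longrightarrow> - \<rho> z \<le> 1 \<longrightarrow> admissible \<rho> Wd z E \<longrightarrow> dbounded n E C (cell_bump \<rho> c i) z"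
    using cell_bump_dbounded[OF rho compact_cball c_bounds(1) assms, of 0 RD n] by blast
  show ?thesis
  proof (intro exI[of _ "max 0 C"] conjI allI impI)
    fix i z and E :: "((complex ^ 2) \<times> real) set"
    assume z: "z \<in> D \<inter> U" "z \<in> cell \<rho> c i" and E: "admissible \<rho> Wd z E"
    have "z \<in> cball 0 RD" "- \<rho> z \<le> 1" using z(1) bd by (auto simp: U_def)
    then have "dbounded n E C (cell_bump \<rho> c i) z" using C z(2) E by blast
    then have "dbounded n E (1 * C) (\<lambda>z. complex_of_real (cell_bump \<rho> c i z)) z"
      by (intro dbounded_bounded_linear[OF open_UNIV UNIV_I bounded_linear_of_real _ _ smooth_cell_bump[OF rho]]) auto
    moreover have "\<forall>(w, \<sigma>)\<in>E. \<sigma> > 0" using E z(1) by (auto simp: admissible_def D)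
    ultimately show "dbounded n E (max 0 C) (bump i) z"
      unfolding bump_def[abs_def] by (intro dbounded_mono[of E "1 * C" "max 0 C"]) auto
  qed simp
qed

text \<open>
  The constant depends on the geometry only. At each point the weighted directions are \<open>\<eta>\<close>, \<open>\<i> \<eta>\<close>
  with weight \<open>\<bar>\<rho>\<bar>\<close> and \<open>v\<close>, \<open>\<i> v\<close> with its square root; the latter are admissible because \<open>\<rho>\<close> is
  stationary in complex tangential directions.
\<close>

lemma dbar_pair_glued_bound:
  "\<exists>C\<ge>0. \<forall>g B G z. cell_family g B G \<longrightarrow> z \<in> D \<inter> U \<longrightarrow>
     norm (dbar_pair (outer_normal \<rho> z) (v z) \<alpha> \<beta> (glued G) z) * \<bar>\<rho> z\<bar> powr (real \<alpha> + real \<beta> / 2) \<le> C * B"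
proof -
  obtain C where C: "C \<ge> 0" "\<And>i z E. z \<in> D \<inter> U \<Longrightarrow> z \<in> cell \<rho> c i \<Longrightarrow> admissible \<rho> 1 z E \<Longrightarrow> dbounded (\<beta> + \<alpha>) E C (bump i) z"
    using bump_dbounded[of 1 "\<beta> + \<alpha>"] by auto
  show ?thesis
  proof (intro exI[of _ "243 * C"] conjI allI impI)
    fix g B G z assume fam: "cell_family g B G" and z: "z \<in> D \<inter> U"
    let ?\<eta> = "outer_normal \<rho> z"
    obtain N where N: "z \<in> level N" using level_exists z by blast
    define s where "s = - \<rho> z"
    have s: "s > 0" using z by (simp add: s_def D)
    have zW: "z \<in> W" using z U_subset_W by blast
    have n\<eta>: "norm ?\<eta> = 1" using grad[OF zW] by (simp add: outer_normal_def)
    let ?E = "{(?\<eta>, s), (\<i> *s ?\<eta>, s), (v z, sqrt s), (\<i> *s v z, sqrt s)}"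
    have adm: "admissible \<rho> 1 z ?E"
      using n\<eta> v[OF zW] tangential[OF zW, of 1] tangential[OF zW, of \<i>]
      by (auto simp: admissible_def s_def norm_smult_vec)
    define Q where "Q = sqrt s ^ \<beta> * s ^ \<alpha>"
    have Q: "Q > 0" using s by (simp add: Q_def)
    have bt: "norm (dbar_pair ?\<eta> (v z) \<alpha> \<beta> (bump i) z * G i z) \<le> C / Q * B" if i: "i \<in> {i \<in> box N. z \<in> cell \<rho> c i}" for i
    proof -
      have zc: "z \<in> cell \<rho> c i" using i by blast
      have "norm (dbar_pair ?\<eta> (v z) \<alpha> \<beta> (bump i) z) \<le> C / Q"
        unfolding Q_def by (rule dbounded_dbar_pair[OF open_UNIV UNIV_I smooth_bump C(2)[OF z zc adm]]) auto
      moreover have "norm (G i z) \<le> B" using family_on_cell[OF fam z zc] by blast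
      ultimately show ?thesis unfolding norm_mult using C(1) Q by (intro mult_mono) auto
    qed
    (* B is nonnegative because it bounds a norm: the bumps sum to 1, so some cell contains z. *)
    have B0: "B \<ge> 0 \<or> {i \<in> box N. z \<in> cell \<rho> c i} = {}"
    proof (cases "{i \<in> box N. z \<in> cell \<rho> c i} = {}")
      case False
      then obtain i where "i \<in> box N" "z \<in> cell \<rho> c i" by blast
      then have "norm (G i z) \<le> B" using family_on_cell[OF fam z] by blast
      then show ?thesis using norm_ge_zero order_trans by blast
    qed simp
    have ne: "{i \<in> box N. z \<in> cell \<rho> c i} \<noteq> {}"
    proof
      assume em: "{i \<in> box N. z \<in> cell \<rho> c i} = {}"
      then have "(\<Sum>i\<in>box N. bump i z) = 0" by (intro sum.neutral) (use bump_zero in blast)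
      then show False using bump_sum[OF N] by simp
    qed
    then have B: "B \<ge> 0" using B0 by blast
    have "norm (dbar_pair ?\<eta> (v z) \<alpha> \<beta> (glued G) z) \<le> (\<Sum>i\<in>{i \<in> box N. z \<in> cell \<rho> c i}. C / Q * B)"
      unfolding dbar_pair_glued[OF fam N] by (rule sum_norm_le[OF bt])
    also have "\<dots> = real (card {i \<in> box N. z \<in> cell \<rho> c i}) * (C / Q * B)" by simp
    also have "\<dots> \<le> 243 * (C / Q * B)" using card_active z C(1) Q B by (intro mult_right_mono) auto
    finally have 1: "norm (dbar_pair ?\<eta> (v z) \<alpha> \<beta> (glued G) z) * Q \<le> 243 * (C / Q * B) * Q"
      using Q by (intro mult_right_mono) auto
    have "\<bar>\<rho> z\<bar> powr (real \<alpha> + real \<beta> / 2) = Q"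
    proof -
      have r: "\<bar>\<rho> z\<bar> = s" using s by (simp add: s_def)
      have "s powr (real \<beta> / 2) = sqrt s ^ \<beta>"
        using s by (simp add: powr_half_sqrt[symmetric] powr_realpow[symmetric] powr_powr mult.commute)
      then show ?thesis unfolding r Q_def using s by (simp add: powr_add powr_realpow)
    qed
    then show "norm (dbar_pair ?\<eta> (v z) \<alpha> \<beta> (glued G) z) * \<bar>\<rho> z\<bar> powr (real \<alpha> + real \<beta> / 2) \<le> 243 * C * B"
      using 1 Q by simp
  qed (use C in simp)
qed

text \<open>
  Full derivatives also fall on the factors \<open>G i\<close>. They are controlled by Cauchy's estimate on balls
  of radius \<open>\<kappa>' \<bar>\<rho>\<bar>\<close>, so the weight is now \<open>\<bar>\<rho>\<bar>\<close> in all directions.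
\<close>

lemma glued_dbounded:
  assumes fam: "cell_family g B G" and Wd: "0 \<le> Wd"
  shows "\<exists>C. \<forall>z E. z \<in> D \<inter> U \<longrightarrow> (\<forall>(w, \<sigma>)\<in>E. norm w \<le> Wd \<and> \<sigma> = - \<rho> z) \<longrightarrow> dbounded n E C (glued G) z"
proof -
  obtain Cb where Cb: "Cb \<ge> 0" "\<And>i z E. z \<in> D \<inter> U \<Longrightarrow> z \<in> cell \<rho> c i \<Longrightarrow> admissible \<rho> Wd z E \<Longrightarrow> dbounded n E Cb (bump i) z"
    using bump_dbounded[OF Wd, of n] by blast
  obtain Ch where Ch: "Ch \<ge> 1" "\<And>P G \<zeta> s B. \<And>E :: ((complex ^ 2) \<times> real) set. hol_poly_on P G \<Longrightarrow> 0 < s \<Longrightarrow> ball \<zeta> (\<kappa>' * s) \<subseteq> P \<Longrightarrow>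
     \<forall>z\<in>ball \<zeta> (\<kappa>' * s). norm (G z) \<le> B \<Longrightarrow> \<forall>(w, \<sigma>)\<in>E. norm w \<le> Wd \<and> \<sigma> = s \<Longrightarrow> dbounded n E (Ch * B) G \<zeta>"
    using hol_poly_on_dbounded[OF \<kappa>'_bounds(1) Wd, of n] by blast
  define T where "T = 2 ^ n * (Cb * (Ch * \<bar>B\<bar>))"
  have T: "T \<ge> 0" using Cb(1) Ch(1) by (simp add: T_def)
  show ?thesis
  proof (intro exI[of _ "243 * T"] allI impI)
    fix z and E :: "((complex ^ 2) \<times> real) set"
    assume z: "z \<in> D \<inter> U" and E: "\<forall>(w, \<sigma>)\<in>E. norm w \<le> Wd \<and> \<sigma> = - \<rho> z"
    obtain N where N: "z \<in> level N" using level_exists z by blast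
    have sub: "level N \<subseteq> D \<inter> U" by (auto simp: level_def)
    have fin: "finite (box N)" unfolding box_def by (rule finite_cell_box)
    have s: "- \<rho> z > 0" using z by (simp add: D)
    have pos: "\<forall>(w, \<sigma>)\<in>E. \<sigma> > 0" using E s by auto
    have adm: "admissible \<rho> Wd z E" using E by (auto simp: admissible_def)
    have tb: "dbounded n E (if z \<in> cell \<rho> c i then T else 0) (\<lambda>z. bump i z * G i z) z" for i
    proof (cases "z \<in> cell \<rho> c i")
      case True
      note f = family_on_cell[OF fam z True]
      have "dbounded n E (Ch * \<bar>B\<bar>) (G i) z"
      proof (rule Ch(2)[OF f(1) s ball_in_patch[OF True z] _ E])
        show "\<forall>y\<in>ball z (\<kappa>' * - \<rho> z). norm (G i y) \<le> \<bar>B\<bar>"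
          using f(3) ball_in_patch[OF True z] by (auto intro: order_trans[OF _ abs_ge_self])
      qed
      from dbounded_mult[OF open_patch f(2) smooth_bump hol_poly_on_smooth[OF f(1)] Cb(2)[OF z True adm] this]
      show ?thesis using True by (simp add: T_def)
    next
      case False
      have "dbounded n E 0 (\<lambda>z. bump i z * G i z) z"
        by (rule dbounded_cong[OF open_off_cell[of i] _ smooth_on_const[of _ 0] _ dbounded_const[OF pos]])
           (use False z bump_zero in auto)
      then show ?thesis using False by simp
    qed
    have "dbounded n E (\<Sum>i\<in>box N. if z \<in> cell \<rho> c i then T else 0) (\<lambda>z. \<Sum>i\<in>box N. bump i z * G i z) z"
      by (rule dbounded_sum[OF open_level N pos fin smooth_on_subset[OF smooth_term[OF fam] sub] tb])
    then have 1: "dbounded n E (\<Sum>i\<in>box N. if z \<in> cell \<rho> c i then T else 0) (glued G) z"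
      by (rule dbounded_cong[OF open_level N smooth_on_sum[OF open_level smooth_on_subset[OF smooth_term[OF fam] sub]], rotated])
         (simp add: glued_eq)
    have "(\<Sum>i\<in>box N. if z \<in> cell \<rho> c i then T else 0) = real (card {i \<in> box N. z \<in> cell \<rho> c i}) * T"
      using sum.inter_filter[OF fin, of "\<lambda>_. T" "\<lambda>i. z \<in> cell \<rho> c i"] by simp
    also have "\<dots> \<le> 243 * T" using card_active z T by (intro mult_right_mono) auto
    finally show "dbounded n E (243 * T) (glued G) z" using dbounded_mono[OF pos _ 1] by blast
  qed
qed

text \<open>
  \<open>\<bar>\<rho>\<bar> ^ (N + 1)\<close> is a product of \<open>N + 1\<close> functions with weighted bound \<open>O(\<bar>\<rho>\<bar>)\<close>. A derivative of
  order \<open>n \<le> N\<close> of the product with the extension is therefore \<open>O(\<bar>\<rho>\<bar> ^ (N + 1 - n))\<close>, which tends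
  to \<open>0\<close>.
\<close>

lemma glued_vanishes:
  assumes fam: "cell_family g B G"
  shows "vanishes_to_order N (frontier D) (D \<inter> U) (\<lambda>z. complex_of_real (\<bar>\<rho> z\<bar> ^ (N + 1)) * glued G z)"
  unfolding vanishes_to_order_def
proof (intro allI impI ballI)
  fix ws :: "(complex ^ 2) list" and p assume len: "length ws \<le> N" and p: "p \<in> frontier D"
  let ?h = "\<lambda>z. complex_of_real (\<bar>\<rho> z\<bar> ^ (N + 1)) * glued G z"
  define Wd where "Wd = (\<Sum>w\<leftarrow>ws. norm w)"
  have Wd: "0 \<le> Wd" "\<And>w. w \<in> set ws \<Longrightarrow> norm w \<le> Wd"
    unfolding Wd_def by (auto intro!: sum_list_nonneg member_le_sum_list)
  define n where "n = length ws"
  obtain C where C: "\<And>z E. z \<in> D \<inter> U \<Longrightarrow> \<forall>(w, \<sigma>)\<in>E. norm w \<le> Wd \<and> \<sigma> = - \<rho> z \<Longrightarrow> dbounded n E C (glued G) z"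
    using glued_dbounded[OF fam Wd(1), of n] by blast
  obtain A where A: "A \<ge> 1" "\<forall>x\<in>cball 0 RD. \<forall>s E. 0 < s \<longrightarrow> s \<le> 1 \<longrightarrow> \<bar>\<rho> x\<bar> \<le> s \<longrightarrow>
     (\<forall>(w, \<sigma>)\<in>E. norm w \<le> Wd \<and> (\<sigma> = s \<or> (\<sigma> = sqrt s \<and> pd w \<rho> x = 0))) \<longrightarrow> dbounded n E (A * s) \<rho> x"
    using dbounded_weighted[OF rho compact_cball Wd(1), of 0 RD n] by blast
  define T where "T = 2 ^ n * ((2 ^ n * A) ^ (N + 1) * \<bar>C\<bar>)"
  have T: "T \<ge> 0" using A(1) by (simp add: T_def)
  have bound: "norm (iterated_derivative ws ?h z) \<le> T * \<bar>\<rho> z\<bar>" if z: "z \<in> D \<inter> U" for z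
  proof -
    define s where "s = - \<rho> z"
    have s: "0 < s" "s \<le> 1" "\<bar>\<rho> z\<bar> \<le> s" using rho_small[OF z] by (auto simp: s_def)
    have zR: "z \<in> cball 0 RD" using z bd by auto
    define E where "E = set ws \<times> {s}"
    have E1: "\<forall>(w, \<sigma>)\<in>E. norm w \<le> Wd \<and> \<sigma> = - \<rho> z" using Wd(2) by (auto simp: E_def s_def)
    have E2: "\<forall>(w, \<sigma>)\<in>E. norm w \<le> Wd \<and> (\<sigma> = s \<or> (\<sigma> = sqrt s \<and> pd w \<rho> z = 0))" using E1 by (auto simp: s_def)
    have pos: "\<forall>(w, \<sigma>)\<in>E. \<sigma> > 0" using s by (auto simp: E_def)
    have rb: "dbounded n E (A * s) \<rho> z" using A(2) zR s E2 by blast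
    have "dbounded n E (1 * (A * s)) (\<lambda>z. complex_of_real (- 1 * \<rho> z)) z"
      by (rule dbounded_bounded_linear[OF open_UNIV UNIV_I bounded_linear_compose[OF bounded_linear_of_real bounded_linear_mult_right[of "- 1"]] _ _ rho rb]) auto
    then have nb: "dbounded n E (A * s) (\<lambda>z. complex_of_real (- \<rho> z)) z" by simp
    have ns: "smooth_on UNIV (\<lambda>z. complex_of_real (- \<rho> z))"
    proof -
      have "smooth_on UNIV (\<lambda>z. complex_of_real (- 1 * \<rho> z))"
        by (rule smooth_on_bounded_linear[OF open_UNIV bounded_linear_compose[OF bounded_linear_of_real bounded_linear_mult_right] rho])
      then show ?thesis by simp
    qed
    have ps: "smooth_on S (\<lambda>z. complex_of_real (- \<rho> z) ^ (N + 1))" for S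
      using smooth_on_subset[OF smooth_on_power[OF open_UNIV ns] subset_UNIV] .
    have "dbounded n E (\<Prod>i<N + 1. 2 ^ n * (A * s)) (\<lambda>z. \<Prod>i<N + 1. complex_of_real (- \<rho> z)) z"
      by (rule dbounded_prod[OF open_UNIV UNIV_I pos finite_lessThan ns nb])
    then have pb: "dbounded n E ((2 ^ n * A) ^ (N + 1) * s ^ (N + 1)) (\<lambda>z. complex_of_real (- \<rho> z) ^ (N + 1)) z"
      by (simp only: prod_constant card_lessThan power_mult_distrib mult.assoc)
    have gb: "dbounded n E C (glued G) z" by (rule C[OF z E1])
    have sg: "smooth_on (D \<inter> U) (glued G)" by (rule smooth_glued[OF fam])
    have "dbounded n E (2 ^ n * ((2 ^ n * A) ^ (N + 1) * s ^ (N + 1) * C)) (\<lambda>z. complex_of_real (- \<rho> z) ^ (N + 1) * glued G z) z"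
      by (rule dbounded_mult[OF open_DU z ps sg pb gb])
    then have hb: "dbounded n E (2 ^ n * ((2 ^ n * A) ^ (N + 1) * s ^ (N + 1) * C)) ?h z"
      by (rule dbounded_cong[OF open_DU z smooth_on_mult[OF open_DU ps sg], rotated]) (simp add: D)
    have "norm (iterated_derivative ws ?h z) \<le> 2 ^ n * ((2 ^ n * A) ^ (N + 1) * s ^ (N + 1) * C) / s ^ length ws"
      by (rule dbounded_iterated_derivative[OF hb]) (auto simp: n_def E_def)
    also have "\<dots> \<le> T * s ^ (N + 1) / s ^ n"
    proof -
      have "2 ^ n * ((2 ^ n * A) ^ (N + 1) * s ^ (N + 1) * C) \<le> 2 ^ n * ((2 ^ n * A) ^ (N + 1) * s ^ (N + 1) * \<bar>C\<bar>)"
        using A(1) s by (intro mult_left_mono) auto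
      also have "\<dots> = T * s ^ (N + 1)" by (simp add: T_def mult_ac)
      finally show ?thesis unfolding n_def[symmetric] using s by (intro divide_right_mono) auto
    qed
    also have "\<dots> = T * s ^ (N + 1 - n)" using s len by (simp add: power_diff n_def)
    also have "\<dots> \<le> T * s ^ 1" using s len T by (intro mult_left_mono power_decreasing) (auto simp: n_def)
    finally show ?thesis using s by (simp add: s_def)
  qed
  have rp: "\<rho> p = 0" by (rule defining_function_frontier[OF cont p[unfolded D]])
  show "(iterated_derivative ws ?h \<longlongrightarrow> 0) (at p within D \<inter> U)"
  proof (rule Lim_null_comparison)
    show "\<forall>\<^sub>F z in at p within D \<inter> U. norm (iterated_derivative ws ?h z) \<le> T * \<bar>\<rho> z\<bar>"
      unfolding eventually_at_filter by (rule always_eventually) (use bound in blast)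
    have "(\<rho> \<longlongrightarrow> \<rho> p) (at p within D \<inter> U)"
      using cont continuous_on_eq_continuous_at[OF open_UNIV] by (auto simp: isCont_def intro: tendsto_within_subset)
    then have "((\<lambda>z. T * \<bar>\<rho> z\<bar>) \<longlongrightarrow> T * \<bar>\<rho> p\<bar>) (at p within D \<inter> U)"
      by (intro tendsto_mult tendsto_const tendsto_rabs)
    then show "((\<lambda>z. T * \<bar>\<rho> z\<bar>) \<longlongrightarrow> 0) (at p within D \<inter> U)" using rp by simp
  qed
qed

lemma cell_family_exists:
  assumes "holomorphic_on_analytic_set g (X \<inter> D)" "c_infty \<kappa> \<rho> X g < \<infinity>"
  shows "\<exists>G. cell_family g (real r0 * enn2real (c_infty \<kappa> \<rho> X g)) G"
proof -
  have "\<forall>i. \<exists>G. active i \<longrightarrow> hol_poly_on (patch i) G \<and> (\<forall>z\<in>patch i. norm (G z) \<le> real r0 * enn2real (c_infty \<kappa> \<rho> X g)) \<and>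
     (\<forall>z\<in>patch i \<inter> X. G z = g z)"
    using patch_interpolant[OF _ assms] by blast
  from choice[OF this] show ?thesis unfolding cell_family_def by blast
qed

lemma extension_exists:
  shows "\<exists>C :: nat \<Rightarrow> nat \<Rightarrow> real. \<forall>g. holomorphic_on_analytic_set g (X \<inter> D) \<and> c_infty \<kappa> \<rho> X g < \<infinity> \<longrightarrow>
      (\<exists>U gt. open U \<and> frontier D \<subseteq> U \<and> U \<subseteq> W \<and>
        smooth_on (D \<inter> U) gt \<and> (\<forall>z \<in> X \<inter> D \<inter> U. gt z = g z) \<and>
        (\<forall>N. vanishes_to_order N (frontier D) (D \<inter> U)
               (\<lambda>z. complex_of_real (\<bar>\<rho> z\<bar> ^ (N + 1)) * gt z)) \<and>
        (\<forall>\<alpha> \<beta>. \<forall>\<zeta> \<in> D \<inter> U.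
           ennreal (norm (dbar_normal_tangential \<rho> v \<alpha> \<beta> gt \<zeta>) *
                    \<bar>\<rho> \<zeta>\<bar> powr (real \<alpha> + real \<beta> / 2))
             \<le> ennreal (C \<alpha> \<beta>) * c_infty \<kappa> \<rho> X g) \<and>
        (\<forall>\<alpha> \<beta>. 1 \<le> \<alpha> + \<beta> \<longrightarrow>
           (\<forall>\<zeta> \<in> X \<inter> D \<inter> U. dbar_normal_tangential \<rho> v \<alpha> \<beta> gt \<zeta> = 0)))"
proof -
  have "\<forall>\<alpha> \<beta>. \<exists>C\<ge>0. \<forall>g B G z. cell_family g B G \<longrightarrow> z \<in> D \<inter> U \<longrightarrow>
     norm (dbar_pair (outer_normal \<rho> z) (v z) \<alpha> \<beta> (glued G) z) * \<bar>\<rho> z\<bar> powr (real \<alpha> + real \<beta> / 2) \<le> C * B"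
    using dbar_pair_glued_bound by blast
  then obtain C where C: "\<And>\<alpha> \<beta>. C \<alpha> \<beta> \<ge> 0" "\<And>\<alpha> \<beta> g B G z. cell_family g B G \<Longrightarrow> z \<in> D \<inter> U \<Longrightarrow>
     norm (dbar_pair (outer_normal \<rho> z) (v z) \<alpha> \<beta> (glued G) z) * \<bar>\<rho> z\<bar> powr (real \<alpha> + real \<beta> / 2) \<le> C \<alpha> \<beta> * B"
    by metis
  show ?thesis
  proof (intro exI[of _ "\<lambda>\<alpha> \<beta>. C \<alpha> \<beta> * real r0"] allI impI, elim conjE)
    fix g assume g: "holomorphic_on_analytic_set g (X \<inter> D)" "c_infty \<kappa> \<rho> X g < \<infinity>"
    define Cg where "Cg = enn2real (c_infty \<kappa> \<rho> X g)"
    have Cg: "ennreal Cg = c_infty \<kappa> \<rho> X g" "0 \<le> Cg" using g(2) by (auto simp: Cg_def ennreal_enn2real_if)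
    obtain G where fam: "cell_family g (real r0 * Cg) G" using cell_family_exists[OF g] unfolding Cg_def by blast
    have eq: "dbar_normal_tangential \<rho> v \<alpha> \<beta> (glued G) \<zeta> = dbar_pair (outer_normal \<rho> \<zeta>) (v \<zeta>) \<alpha> \<beta> (glued G) \<zeta>" if "\<zeta> \<in> D \<inter> U" for \<alpha> \<beta> \<zeta>
      by (rule dbar_normal_tangential_eq[OF open_DU smooth_glued[OF fam] that])
    show "\<exists>U gt. open U \<and> frontier D \<subseteq> U \<and> U \<subseteq> W \<and>
        smooth_on (D \<inter> U) gt \<and> (\<forall>z \<in> X \<inter> D \<inter> U. gt z = g z) \<and>
        (\<forall>N. vanishes_to_order N (frontier D) (D \<inter> U)
               (\<lambda>z. complex_of_real (\<bar>\<rho> z\<bar> ^ (N + 1)) * gt z)) \<and>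
        (\<forall>\<alpha> \<beta>. \<forall>\<zeta> \<in> D \<inter> U.
           ennreal (norm (dbar_normal_tangential \<rho> v \<alpha> \<beta> gt \<zeta>) *
                    \<bar>\<rho> \<zeta>\<bar> powr (real \<alpha> + real \<beta> / 2))
             \<le> ennreal (C \<alpha> \<beta> * real r0) * c_infty \<kappa> \<rho> X g) \<and>
        (\<forall>\<alpha> \<beta>. 1 \<le> \<alpha> + \<beta> \<longrightarrow>
           (\<forall>\<zeta> \<in> X \<inter> D \<inter> U. dbar_normal_tangential \<rho> v \<alpha> \<beta> gt \<zeta> = 0))"
    proof (rule exI[of _ U], rule exI[of _ "glued G"], intro conjI allI ballI impI)
      show "ennreal (norm (dbar_normal_tangential \<rho> v \<alpha> \<beta> (glued G) \<zeta>) * \<bar>\<rho> \<zeta>\<bar> powr (real \<alpha> + real \<beta> / 2))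
             \<le> ennreal (C \<alpha> \<beta> * real r0) * c_infty \<kappa> \<rho> X g" if z: "\<zeta> \<in> D \<inter> U" for \<alpha> \<beta> \<zeta>
      proof -
        have "norm (dbar_normal_tangential \<rho> v \<alpha> \<beta> (glued G) \<zeta>) * \<bar>\<rho> \<zeta>\<bar> powr (real \<alpha> + real \<beta> / 2) \<le> (C \<alpha> \<beta> * real r0) * Cg"
          unfolding eq[OF z] using C(2)[OF fam z, of \<alpha> \<beta>] by (simp add: mult.assoc)
        then show ?thesis
          unfolding Cg(1)[symmetric] using C(1)[of \<alpha> \<beta>] Cg(2) by (simp add: ennreal_mult'[symmetric] ennreal_leI)
      qed
      show "dbar_normal_tangential \<rho> v \<alpha> \<beta> (glued G) \<zeta> = 0" if "1 \<le> \<alpha> + \<beta>" "\<zeta> \<in> X \<inter> D \<inter> U" for \<alpha> \<beta> \<zeta>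
        using eq[of \<zeta> \<alpha> \<beta>] dbar_pair_glued_zero[OF fam that(2,1)] that(2) by auto
    qed (use open_U frontier_subset_U U_subset_W smooth_glued[OF fam] glued_extends[OF fam] glued_vanishes[OF fam] in auto)
  qed
qed

end

theorem corollary5p3:
  fixes \<rho> :: "complex ^ 2 \<Rightarrow> real"
    and f :: "complex ^ 2 \<Rightarrow> complex"
    and v :: "complex ^ 2 \<Rightarrow> complex ^ 2"
    and D X \<Omega> W :: "(complex ^ 2) set"
  assumes rho: "smooth_on UNIV \<rho>" "strictly_convex_on UNIV \<rho>"
    and D: "D = {z. \<rho> z < 0}" "bounded D"
    and W: "open W" "frontier D \<subseteq> W" "\<forall>\<zeta>\<in>W. gradient \<rho> \<zeta> \<noteq> 0"
    and v: "smooth_on W v" "\<forall>\<zeta>\<in>W. norm (v \<zeta>) = 1 \<and> v \<zeta> \<in> complex_tangent_space \<rho> \<zeta>"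
    and \<Omega>: "open \<Omega>" "closure D \<subseteq> \<Omega>"
    and f: "holomorphic_on_Cn f \<Omega>" "minimal_defining_function f \<Omega>"
    and X: "X = {z \<in> \<Omega>. f z = 0}" "X \<inter> D \<noteq> {}" "transverse_tangent_cones X \<rho>"
  shows "\<exists>\<kappa>0>0. \<forall>\<kappa>. 0 < \<kappa> \<and> \<kappa> < \<kappa>0 \<longrightarrow>
    (\<exists>C :: nat \<Rightarrow> nat \<Rightarrow> real. \<forall>g.
      holomorphic_on_analytic_set g (X \<inter> D) \<and> c_infty \<kappa> \<rho> X g < \<infinity> \<longrightarrow>
      (\<exists>U gt. open U \<and> frontier D \<subseteq> U \<and> U \<subseteq> W \<and>
        smooth_on (D \<inter> U) gt \<and> (\<forall>z \<in> X \<inter> D \<inter> U. gt z = g z) \<and>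
        (\<forall>N. vanishes_to_order N (frontier D) (D \<inter> U)
               (\<lambda>z. complex_of_real (\<bar>\<rho> z\<bar> ^ (N + 1)) * gt z)) \<and>
        (\<forall>\<alpha> \<beta>. \<forall>\<zeta> \<in> D \<inter> U.
           ennreal (norm (dbar_normal_tangential \<rho> v \<alpha> \<beta> gt \<zeta>) *
                    \<bar>\<rho> \<zeta>\<bar> powr (real \<alpha> + real \<beta> / 2))
             \<le> ennreal (C \<alpha> \<beta>) * c_infty \<kappa> \<rho> X g) \<and>
        (\<forall>\<alpha> \<beta>. 1 \<le> \<alpha> + \<beta> \<longrightarrow>
           (\<forall>\<zeta> \<in> X \<inter> D \<inter> U. dbar_normal_tangential \<rho> v \<alpha> \<beta> gt \<zeta> = 0))))"
proof -
  have "\<exists>r>0. \<exists>K n. good_chart D X W v K n (ball p r)" if p: "p \<in> frontier D" for p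
  proof -
    have pW: "p \<in> W" using p W(2) by blast
    have p\<Omega>: "p \<in> \<Omega>" using p \<Omega>(2) by (auto simp: frontier_def)
    have gp: "gradient \<rho> p \<noteq> 0" using W(3) pW by blast
    show ?thesis by (rule local_good_chart[OF rho D(1) p gp W(1) pW v \<Omega>(1) p\<Omega> f(1) X(1,3)])
  qed
  from uniform_good_charts[OF D(2) this] obtain e K0 r0 where
    charts: "e > 0" "K0 \<ge> 0" "\<forall>q\<in>frontier D. good_chart D X W v K0 r0 (ball q e)" by blast
  obtain RD where RD: "\<And>z. z \<in> D \<Longrightarrow> norm z \<le> RD" using D(2) unfolding bounded_iff by blast
  obtain CL where CL: "CL \<ge> 1" "\<forall>x\<in>cball 0 (RD + 2). \<forall>y\<in>cball 0 (RD + 2). \<bar>\<rho> x - \<rho> y\<bar> \<le> CL * norm (x - y) \<and>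
      (\<forall>w. \<bar>pd w \<rho> x - pd w \<rho> y\<bar> \<le> CL * norm (x - y) * norm w)"
    using smooth_lipschitz_bounds[OF rho(1), of "RD + 2"] by blast
  have "extension_data \<rho> v D X W K0 r0 e CL RD \<kappa>" if "0 < \<kappa> \<and> \<kappa> < 1 / 3" for \<kappa>
    by unfold_locales (use rho D W v charts RD CL that in auto)
  note ext = extension_data.extension_exists[OF this]
  (* For kappa < 1 / 3 the radius 3 kappa tau in Lambda is less than tau, so that all nodes lie in
     D. *)
  show ?thesis
    by (rule exI[of _ "1 / 3 :: real"], rule conjI, simp, intro allI impI, rule ext)
qed

end
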